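(* Let $\Psi$ and $\Sigma$ be bounded sets of positive kernel operators on a Banach function space $L$ and let $\alpha\in[0,1]$. If $r\in\{\rho,\hat\rho\}$, then for all $k\in\mathbb{N}$ $$r \left((\Psi \Sigma)^{\left(\frac{1}{2}\right)} \circ (\Psi \Sigma)^{\left(\frac{1}{2}\right)}\right) ^{\frac{\alpha}{2}} r \left((\Sigma\Psi)^{\left(\frac{1}{2}\right)} \circ ( \Sigma \Psi)^{\left(\frac{1}{2}\right)}\right) ^{\frac{1-\alpha}{2}}$$ $$ \le r \left(((\Psi \Sigma)^k)^{\left(\frac{1}{2}\right)} \circ ((\Psi \Sigma)^k)^{\left(\frac{1}{2}\right)}\right) ^{\frac{\alpha}{2k}} r \left(((\Sigma\Psi)^k)^{\left(\frac{1}{2}\right)} \circ ( (\Sigma \Psi)^k)^{\left(\frac{1}{2}\right)}\right) ^{\frac{1-\alpha}{2k}} \le r (\Psi \Sigma) ^{\frac{1}{2}}.$$ If, in addition, $L$ and its Banach dual $L^*$ have order continuous norms, then these inequalities hold for all $k\in\mathbb{N}$ also for each $r\in\{\rho_{ess},\hat\rho_{ess}\}$.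
   Context: Let $\mu$ be a $\sigma$-finite positive measure on a $\sigma$-algebra of subsets of a non-void set $X$, and let $M(X,\mu)$ be the vector space of equivalence classes (modulo a.e. equality) of complex measurable functions on $X$. A Banach space $L\subseteq M(X,\mu)$ is a Banach function space if $f\in L$, $g\in M(X,\mu)$ and $|g|\le |f|$ imply $g\in L$ and $\|g\|\le\|f\|$. It is assumed throughout that $X$ is the carrier of $L$: there is no subset $Y\subseteq X$ of strictly positive measure such that $f=0$ a.e. on $Y$ for all $f\in L$. A norm is order continuous if $0\le f_n\downarrow 0$ implies $\|f_n\|\to 0$. A (linear) operator $A$ on $L$ is positive if it maps nonnegative functions to nonnegative ones (positive operators are automatically bounded). $A$ is a kernel operator if there is a $\mu\times\mu$-measurable function $a(x,y)$ on $X\times X$ such that for all $f\in L$ and almost all $x\in X$, $\int_X|a(x,y)f(y)|\,d\mu(y)<\infty$ and $(Af)(x)=\int_X a(x,y)f(y)\,d\mu(y)$; such an $A$ is positive iff $a\ge 0$ a.e. If $A_1,\dots,A_m$ are positive kernel operators on $L$ with kernels $a_1,\dots,a_m$ and $\alpha_1,\dots,\alpha_m>0$ with $\sum_j\alpha_j=1$, then the Hadamard weighted geometric mean $A_1^{(\alpha_1)}\circ\cdots\circ A_m^{(\alpha_m)}$ is the positive kernel operator on $L$ with kernel $a_1(x,y)^{\alpha_1}\cdots a_m(x,y)^{\alpha_m}$ (it is defined on all of $L$). For bounded sets $\Psi_1,\dots,\Psi_m$ of positive kernel operators on $L$, $$\Psi_1^{(\alpha_1)}\circ\cdots\circ\Psi_m^{(\alpha_m)}=\{A_1^{(\alpha_1)}\circ\cdots\circ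 A_m^{(\alpha_m)}: A_1\in\Psi_1,\dots,A_m\in\Psi_m\}.$$ For sets of operators, $\Psi\Sigma=\{AB:A\in\Psi,B\in\Sigma\}$ and $\Sigma^m=\{A_1\cdots A_m: A_i\in\Sigma\}$. The Hausdorff measure of noncompactness of a bounded operator $A$ on $L$ is $\beta(A)=\inf\{\delta>0: \text{there is a finite } M\subset L \text{ with } A(D_L)\subset M+\delta D_L\}$, where $D_L$ is the closed unit ball of $L$. For a single operator $A$, $\rho(A)$ is the spectral radius and $\rho_{ess}(A)$ is the essential spectral radius (the spectral radius of the image of $A$ in the Calkin algebra), and $\rho_{ess}(A)=\lim_{j\to\infty}\beta(A^j)^{1/j}$. For a bounded set $\Sigma$ of bounded operators: $\rho(\Sigma)=\limsup_{m\to\infty}[\sup_{A\in\Sigma^m}\rho(A)]^{1/m}$ (generalized spectral radius), $\hat\rho(\Sigma)=\lim_{m\to\infty}[\sup_{A\in\Sigma^m}\|A\|]^{1/m}$ (joint spectral radius), $\rho_{ess}(\Sigma)=\limsup_{m\to\infty}[\sup_{A\in\Sigma^m}\rho_{ess}(A)]^{1/m}$ (generalized essential spectral radius), $\hat\rho_{ess}(\Sigma)=\lim_{m\to\infty}[\sup_{A\in\Sigma^m}\beta(A)]^{1/m}$ (joint essential spectral radius). *)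

theory Defs
  imports "HOL-Analysis.Analysis"
begin

text \<open>
  Elements of \<open>M(X,\<mu>)\<close> are represented by measurable functions on \<open>X = space \<mu>\<close>, two functions
  being identified when they are equal \<open>\<mu>\<close>-a.e.  Accordingly, operators on \<open>L\<close> are maps on
  representatives that respect a.e. equality and are linear up to a.e. equality.
\<close>

type_synonym 'x operator = "('x \<Rightarrow> complex) \<Rightarrow> ('x \<Rightarrow> complex)"

text \<open>Real powers with \<open>0\<^sup>0 = 1\<close> (whereas \<open>0 powr 0 = 0\<close>).\<close>

definition rpow :: "real \<Rightarrow> real \<Rightarrow> real" where
  "rpow x a = (if a = 0 then 1 else x powr a)"


section \<open>Banach function spaces\<close>

text \<open>The last assumption says that \<open>X\<close> is the carrier of \<open>L\<close>. The assumption \<open>ideal\<close> also makes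
  \<open>L\<close> and its norm \<open>N\<close> invariant under a.e. equality.\<close>

locale banach_function_space = sigma_finite_measure \<mu>
  for \<mu> :: "'x measure" +
  fixes L :: "('x \<Rightarrow> complex) set" and N :: "('x \<Rightarrow> complex) \<Rightarrow> real"
  assumes nonvoid: "space \<mu> \<noteq> {}"
    and measurable: "L \<subseteq> borel_measurable \<mu>"
    and zero_closed: "(\<lambda>_. 0) \<in> L"
    and add_closed: "\<lbrakk>f \<in> L; g \<in> L\<rbrakk> \<Longrightarrow> (\<lambda>x. f x + g x) \<in> L"
    and scale_closed: "f \<in> L \<Longrightarrow> (\<lambda>x. c * f x) \<in> L"
    and norm_nonneg: "f \<in> L \<Longrightarrow> N f \<ge> 0"
    and norm_eq_0: "f \<in> L \<Longrightarrow> N f = 0 \<longleftrightarrow> (AE x in \<mu>. f x = 0)"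
    and norm_scale: "f \<in> L \<Longrightarrow> N (\<lambda>x. c * f x) = cmod c * N f"
    and norm_triangle: "\<lbrakk>f \<in> L; g \<in> L\<rbrakk> \<Longrightarrow> N (\<lambda>x. f x + g x) \<le> N f + N g"
    and complete: "\<lbrakk>\<And>n. s n \<in> L;
        \<And>e. e > 0 \<Longrightarrow> \<exists>n0. \<forall>m\<ge>n0. \<forall>n\<ge>n0. N (\<lambda>x. s m x - s n x) < e\<rbrakk>
      \<Longrightarrow> \<exists>f\<in>L. (\<lambda>n. N (\<lambda>x. s n x - f x)) \<longlonglongrightarrow> 0"
    and ideal: "\<lbrakk>f \<in> L; g \<in> borel_measurable \<mu>; AE x in \<mu>. cmod (g x) \<le> cmod (f x)\<rbrakk>
      \<Longrightarrow> g \<in> L \<and> N g \<le> N f"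
    and carrier: "\<lbrakk>Y \<in> sets \<mu>; emeasure \<mu> Y > 0\<rbrakk>
      \<Longrightarrow> \<exists>f\<in>L. \<not> (AE x in \<mu>. x \<in> Y \<longrightarrow> f x = 0)"

definition unit_ball :: "('x \<Rightarrow> complex) set \<Rightarrow> (('x \<Rightarrow> complex) \<Rightarrow> real) \<Rightarrow> ('x \<Rightarrow> complex) set" where
  "unit_ball L N = {f \<in> L. N f \<le> 1}"

definition nonneg_fun :: "'x measure \<Rightarrow> ('x \<Rightarrow> complex) \<Rightarrow> bool" where
  "nonneg_fun \<mu> f \<longleftrightarrow> (AE x in \<mu>. f x \<in> \<real>\<^sub>\<ge>\<^sub>0)"

text \<open>
  The order continuity condition for a space \<open>V\<close> of complex functions, with norm \<open>N\<close> and positive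
  cone \<open>P\<close>; it is used for \<open>L\<close> and for \<open>L\<^sup>*\<close>, whose elements are functions on \<open>L\<close>. The last premise,
  together with positivity of the \<open>f n\<close>, says that \<open>0\<close> is their greatest lower bound in \<open>V\<close>.
\<close>

definition order_continuous_norm ::
  "('a \<Rightarrow> complex) set \<Rightarrow> (('a \<Rightarrow> complex) \<Rightarrow> real) \<Rightarrow> (('a \<Rightarrow> complex) \<Rightarrow> bool) \<Rightarrow> bool" where
  "order_continuous_norm V N P \<longleftrightarrow>
    (\<forall>f. (\<forall>n::nat. f n \<in> V \<and> P (f n)) \<longrightarrow>
         (\<forall>n. P (\<lambda>x. f n x - f (Suc n) x)) \<longrightarrow>
         (\<forall>g\<in>V. (\<forall>n. P (\<lambda>x. f n x - g x)) \<longrightarrow> P (\<lambda>x. - g x)) \<longrightarrow>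
         (\<lambda>n. N (f n)) \<longlonglongrightarrow> 0)"

definition dual :: "('x \<Rightarrow> complex) set \<Rightarrow> (('x \<Rightarrow> complex) \<Rightarrow> real) \<Rightarrow> (('x \<Rightarrow> complex) \<Rightarrow> complex) set" where
  "dual L N = {\<phi>.
    (\<forall>f\<in>L. \<forall>g\<in>L. \<phi> (\<lambda>x. f x + g x) = \<phi> f + \<phi> g) \<and>
    (\<forall>c. \<forall>f\<in>L. \<phi> (\<lambda>x. c * f x) = c * \<phi> f) \<and>
    (\<exists>C. \<forall>f\<in>L. cmod (\<phi> f) \<le> C * N f)}"

definition dual_norm ::
  "('x \<Rightarrow> complex) set \<Rightarrow> (('x \<Rightarrow> complex) \<Rightarrow> real) \<Rightarrow> (('x \<Rightarrow> complex) \<Rightarrow> complex) \<Rightarrow> real" where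
  "dual_norm L N \<phi> = (SUP f \<in> unit_ball L N. cmod (\<phi> f))"

definition nonneg_functional ::
  "'x measure \<Rightarrow> ('x \<Rightarrow> complex) set \<Rightarrow> (('x \<Rightarrow> complex) \<Rightarrow> complex) \<Rightarrow> bool" where
  "nonneg_functional \<mu> L \<phi> \<longleftrightarrow> (\<forall>f\<in>L. nonneg_fun \<mu> f \<longrightarrow> \<phi> f \<in> \<real>\<^sub>\<ge>\<^sub>0)"


section \<open>Operators\<close>

definition linear_operator :: "'x measure \<Rightarrow> ('x \<Rightarrow> complex) set \<Rightarrow> 'x operator \<Rightarrow> bool" where
  "linear_operator \<mu> L A \<longleftrightarrow>
    (\<forall>f\<in>L. A f \<in> L) \<and>
    (\<forall>f\<in>L. \<forall>g\<in>L. (AE x in \<mu>. f x = g x) \<longrightarrow> (AE x in \<mu>. A f x = A g x)) \<and>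
    (\<forall>f\<in>L. \<forall>g\<in>L. AE x in \<mu>. A (\<lambda>y. f y + g y) x = A f x + A g x) \<and>
    (\<forall>c. \<forall>f\<in>L. AE x in \<mu>. A (\<lambda>y. c * f y) x = c * A f x)"

definition bounded_operators ::
  "'x measure \<Rightarrow> ('x \<Rightarrow> complex) set \<Rightarrow> (('x \<Rightarrow> complex) \<Rightarrow> real) \<Rightarrow> 'x operator set" where
  "bounded_operators \<mu> L N = {A. linear_operator \<mu> L A \<and> (\<exists>C. \<forall>f\<in>L. N (A f) \<le> C * N f)}"

definition operator_norm ::
  "('x \<Rightarrow> complex) set \<Rightarrow> (('x \<Rightarrow> complex) \<Rightarrow> real) \<Rightarrow> 'x operator \<Rightarrow> real" where
  "operator_norm L N A = (SUP f \<in> unit_ball L N. N (A f))"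

definition bounded_operator_set ::
  "('x \<Rightarrow> complex) set \<Rightarrow> (('x \<Rightarrow> complex) \<Rightarrow> real) \<Rightarrow> 'x operator set \<Rightarrow> bool" where
  "bounded_operator_set L N \<Psi> \<longleftrightarrow> (\<exists>C. \<forall>A\<in>\<Psi>. \<forall>f\<in>L. N (A f) \<le> C * N f)"

definition positive_operator :: "'x measure \<Rightarrow> ('x \<Rightarrow> complex) set \<Rightarrow> 'x operator \<Rightarrow> bool" where
  "positive_operator \<mu> L A \<longleftrightarrow>
    linear_operator \<mu> L A \<and> (\<forall>f\<in>L. nonneg_fun \<mu> f \<longrightarrow> nonneg_fun \<mu> (A f))"

definition has_kernel ::
  "'x measure \<Rightarrow> ('x \<Rightarrow> complex) set \<Rightarrow> 'x operator \<Rightarrow> ('x \<times> 'x \<Rightarrow> complex) \<Rightarrow> bool" where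
  "has_kernel \<mu> L A a \<longleftrightarrow>
    a \<in> borel_measurable (\<mu> \<Otimes>\<^sub>M \<mu>) \<and>
    (\<forall>f\<in>L. AE x in \<mu>. integrable \<mu> (\<lambda>y. a (x, y) * f y) \<and>
                        A f x = (LINT y|\<mu>. a (x, y) * f y))"

definition positive_kernel_operators :: "'x measure \<Rightarrow> ('x \<Rightarrow> complex) set \<Rightarrow> 'x operator set" where
  "positive_kernel_operators \<mu> L = {A. positive_operator \<mu> L A \<and> (\<exists>a. has_kernel \<mu> L A a)}"

text \<open>The kernel is only determined (and, for a positive operator, only nonnegative) a.e.\<close>

definition kernel ::
  "'x measure \<Rightarrow> ('x \<Rightarrow> complex) set \<Rightarrow> 'x operator \<Rightarrow> 'x \<times> 'x \<Rightarrow> complex" where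
  "kernel \<mu> L A = (SOME a. has_kernel \<mu> L A a)"

definition kernel_operator :: "'x measure \<Rightarrow> ('x \<times> 'x \<Rightarrow> complex) \<Rightarrow> 'x operator" where
  "kernel_operator \<mu> a f = (\<lambda>x. LINT y|\<mu>. a (x, y) * f y)"

text \<open>The mean \<open>A\<^sup>(\<^sup>\<alpha>\<^sup>) \<circ> B\<^sup>(\<^sup>\<beta>\<^sup>)\<close> of positive kernel operators, for \<open>\<alpha>, \<beta> > 0\<close> with \<open>\<alpha> + \<beta> = 1\<close>.
  Since the kernels are nonnegative a.e., \<open>cmod\<close> changes them only on a null set.\<close>

definition hadamard_mean ::
  "'x measure \<Rightarrow> ('x \<Rightarrow> complex) set \<Rightarrow> real \<Rightarrow> 'x operator \<Rightarrow> real \<Rightarrow> 'x operator \<Rightarrow> 'x operator" where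
  "hadamard_mean \<mu> L \<alpha> A \<beta> B = kernel_operator \<mu>
    (\<lambda>p. of_real (cmod (kernel \<mu> L A p) powr \<alpha> * cmod (kernel \<mu> L B p) powr \<beta>))"

definition hadamard_mean_set ::
  "'x measure \<Rightarrow> ('x \<Rightarrow> complex) set \<Rightarrow> real \<Rightarrow> 'x operator set \<Rightarrow> real \<Rightarrow> 'x operator set
    \<Rightarrow> 'x operator set" where
  "hadamard_mean_set \<mu> L \<alpha> \<Psi> \<beta> \<Phi> = {hadamard_mean \<mu> L \<alpha> A \<beta> B | A B. A \<in> \<Psi> \<and> B \<in> \<Phi>}"

definition operator_set_mult :: "'x operator set \<Rightarrow> 'x operator set \<Rightarrow> 'x operator set" where
  "operator_set_mult \<Psi> \<Phi> = {A \<circ> B | A B. A \<in> \<Psi> \<and> B \<in> \<Phi>}"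

primrec operator_set_power :: "'x operator set \<Rightarrow> nat \<Rightarrow> 'x operator set" where
  "operator_set_power \<Phi> 0 = {id}"
| "operator_set_power \<Phi> (Suc m) = operator_set_mult \<Phi> (operator_set_power \<Phi> m)"


section \<open>Spectral radii\<close>

text \<open>\<open>A f \<in> M + \<delta> D\<^sub>L\<close> is expressed as \<open>N (A f - g) \<le> \<delta>\<close> for some \<open>g \<in> M\<close>.\<close>

definition noncompactness ::
  "('x \<Rightarrow> complex) set \<Rightarrow> (('x \<Rightarrow> complex) \<Rightarrow> real) \<Rightarrow> 'x operator \<Rightarrow> real" where
  "noncompactness L N A = Inf {\<delta>. \<delta> > 0 \<and>
    (\<exists>M. finite M \<and> M \<subseteq> L \<and> (\<forall>f\<in>unit_ball L N. \<exists>g\<in>M. N (\<lambda>x. A f x - g x) \<le> \<delta>))}"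

definition null_operators ::
  "'x measure \<Rightarrow> ('x \<Rightarrow> complex) set \<Rightarrow> (('x \<Rightarrow> complex) \<Rightarrow> real) \<Rightarrow> 'x operator set" where
  "null_operators \<mu> L N = {A \<in> bounded_operators \<mu> L N. \<forall>f\<in>L. AE x in \<mu>. A f x = 0}"

definition compact_operators ::
  "'x measure \<Rightarrow> ('x \<Rightarrow> complex) set \<Rightarrow> (('x \<Rightarrow> complex) \<Rightarrow> real) \<Rightarrow> 'x operator set" where
  "compact_operators \<mu> L N = {A \<in> bounded_operators \<mu> L N.
    \<forall>s::nat \<Rightarrow> _. (\<forall>n. s n \<in> unit_ball L N) \<longrightarrow>
      (\<exists>\<phi>::nat \<Rightarrow> nat. strict_mono \<phi> \<and> (\<exists>g\<in>L. (\<lambda>n. N (\<lambda>x. A (s (\<phi> n)) x - g x)) \<longlonglongrightarrow> 0))}"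

text \<open>
  The spectrum of the image of \<open>A\<close> in the quotient of the algebra of bounded operators by the ideal
  \<open>J\<close>. For \<open>J = null_operators\<close> this is the usual spectrum, for \<open>J = compact_operators\<close> the spectrum
  in the Calkin algebra.
\<close>

definition spectrum_mod ::
  "'x measure \<Rightarrow> ('x \<Rightarrow> complex) set \<Rightarrow> (('x \<Rightarrow> complex) \<Rightarrow> real) \<Rightarrow> 'x operator set \<Rightarrow> 'x operator
    \<Rightarrow> complex set" where
  "spectrum_mod \<mu> L N J A = {z. \<not> (\<exists>B \<in> bounded_operators \<mu> L N.
    (\<lambda>f x. B (\<lambda>y. z * f y - A f y) x - f x) \<in> J \<and>
    (\<lambda>f x. z * B f x - A (B f) x - f x) \<in> J)}"

text \<open>The inserted \<open>0\<close> makes suprema of empty sets of nonnegative numbers equal to \<open>0\<close> (the spectrum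
  is empty if the algebra is zero; sets of operators may be empty).\<close>

definition spectral_radius ::
  "'x measure \<Rightarrow> ('x \<Rightarrow> complex) set \<Rightarrow> (('x \<Rightarrow> complex) \<Rightarrow> real) \<Rightarrow> 'x operator \<Rightarrow> real" where
  "spectral_radius \<mu> L N A =
    Sup (insert 0 (cmod ` spectrum_mod \<mu> L N (null_operators \<mu> L N) A))"

definition ess_spectral_radius ::
  "'x measure \<Rightarrow> ('x \<Rightarrow> complex) set \<Rightarrow> (('x \<Rightarrow> complex) \<Rightarrow> real) \<Rightarrow> 'x operator \<Rightarrow> real" where
  "ess_spectral_radius \<mu> L N A =
    Sup (insert 0 (cmod ` spectrum_mod \<mu> L N (compact_operators \<mu> L N) A))"

definition sup_root :: "('x operator \<Rightarrow> real) \<Rightarrow> 'x operator set \<Rightarrow> nat \<Rightarrow> real" where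
  "sup_root q \<Phi> m = root m (Sup (insert 0 (q ` operator_set_power \<Phi> m)))"

definition gen_spectral_radius ::
  "'x measure \<Rightarrow> ('x \<Rightarrow> complex) set \<Rightarrow> (('x \<Rightarrow> complex) \<Rightarrow> real) \<Rightarrow> 'x operator set \<Rightarrow> real" where
  "gen_spectral_radius \<mu> L N \<Phi> =
    real_of_ereal (limsup (\<lambda>m. ereal (sup_root (spectral_radius \<mu> L N) \<Phi> m)))"

definition joint_spectral_radius ::
  "('x \<Rightarrow> complex) set \<Rightarrow> (('x \<Rightarrow> complex) \<Rightarrow> real) \<Rightarrow> 'x operator set \<Rightarrow> real" where
  "joint_spectral_radius L N \<Phi> = lim (sup_root (operator_norm L N) \<Phi>)"

definition gen_ess_spectral_radius ::
  "'x measure \<Rightarrow> ('x \<Rightarrow> complex) set \<Rightarrow> (('x \<Rightarrow> complex) \<Rightarrow> real) \<Rightarrow> 'x operator set \<Rightarrow> real" where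
  "gen_ess_spectral_radius \<mu> L N \<Phi> =
    real_of_ereal (limsup (\<lambda>m. ereal (sup_root (ess_spectral_radius \<mu> L N) \<Phi> m)))"

definition joint_ess_spectral_radius ::
  "('x \<Rightarrow> complex) set \<Rightarrow> (('x \<Rightarrow> complex) \<Rightarrow> real) \<Rightarrow> 'x operator set \<Rightarrow> real" where
  "joint_ess_spectral_radius L N \<Phi> = lim (sup_root (noncompactness L N) \<Phi>)"

abbreviation half_mean :: "'x measure \<Rightarrow> ('x \<Rightarrow> complex) set \<Rightarrow> 'x operator set \<Rightarrow> 'x operator set" where
  "half_mean \<mu> L \<Phi> \<equiv> hadamard_mean_set \<mu> L (1/2) \<Phi> (1/2) \<Phi>"

end

theory Submission
  imports Defs "HOL-Library.Function_Algebras"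
begin

text \<open>
  All four radii come from a seminorm \<open>Q\<close> on the bounded operators (the operator norm, or the measure of
  noncompactness) such that \<open>\<rho>\<close>, resp. \<open>\<rho>\<^sub>e\<^sub>s\<^sub>s\<close>, of \<open>A\<close> is the limit of \<open>Q(A\<^sup>m)\<^sup>1\<^sup>/\<^sup>m\<close>. Cauchy-Schwarz for kernels gives
  \<open>A\<^sub>1\<^sup>(\<^sup>1\<^sup>/\<^sup>2\<^sup>) \<circ> B\<^sub>1\<^sup>(\<^sup>1\<^sup>/\<^sup>2\<^sup>)\<close> times \<open>A\<^sub>2\<^sup>(\<^sup>1\<^sup>/\<^sup>2\<^sup>) \<circ> B\<^sub>2\<^sup>(\<^sup>1\<^sup>/\<^sup>2\<^sup>)\<close> \<open>\<le>\<close> \<open>(A\<^sub>1A\<^sub>2)\<^sup>(\<^sup>1\<^sup>/\<^sup>2\<^sup>) \<circ> (B\<^sub>1B\<^sub>2)\<^sup>(\<^sup>1\<^sup>/\<^sup>2\<^sup>)\<close>, and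
  the mean of \<open>A\<close> and \<open>B\<close> is dominated by \<open>(A + B) / 2\<close>. Hence, writing \<open>H \<Phi>\<close> for the set of means of \<open>\<Phi>\<close>,
  \<open>r (H \<Phi>)\<^sup>k \<le> r (H (\<Phi>\<^sup>k))\<close>, \<open>r (H \<Phi>) \<le> r \<Phi>\<close> and \<open>r (\<Phi>\<^sup>k) \<le> (r \<Phi>)\<^sup>k\<close>; together with \<open>r (\<Sigma>\<Psi>) \<le> r (\<Psi>\<Sigma>)\<close> these give the
  theorem. The measure of noncompactness is monotone on dominated operators only after composition with one
  more kernel operator, which maps order intervals to precompact sets when the norm is order continuous; one extra
  factor does not affect the radii.
\<close>

section \<open>Seminormed spaces and the spectral radius formula\<close>

text \<open>The spectrum only offers inverses modulo an ideal, of operators that are linear up to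
  null functions. Both halves of the formula \<rho>(A) = lim Q(A^m)^(1/m) have to come from this.
  The upper bound averages inverses over roots of unity, so no operator-valued series or integral
  occurs. The lower bound is Riesz theory for a power of small noncompactness, and the operator norm
  is served by the same Fredholm inverse. The mean of products is not the product of means. Words in
  the means are therefore compared through a relation between three operators,
  \<open>mean_dom\<close>, which mentions no kernel and survives composition. Returning from it to
  kernels, in order to bound a word by a genuine mean, rests on uniqueness of kernels. The
  \<sigma>-algebra need not be countably generated, so the exceptional null sets vary with the test
  set, and this is what the approximation by sets with countably many sections overcomes. The
  additional kernel factor of the essential case explains why growth is compared between words of
  length p m + 1 and m.\<close>

locale seminormed_space = vector_space sc
  for sc :: "complex \<Rightarrow> 'v::ab_group_add \<Rightarrow> 'v" +
  fixes n :: "'v \<Rightarrow> real"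
  assumes n_add: "n (x + y) \<le> n x + n y"
    and n_scale: "n (sc c x) = cmod c * n x"
    and n_complete: "(\<And>e. e > 0 \<Longrightarrow> \<exists>i0. \<forall>i\<ge>i0. \<forall>j\<ge>i0. n (s i - s j) < e) \<Longrightarrow>
      \<exists>x. (\<lambda>i::nat. n (s i - x)) \<longlonglongrightarrow> 0"
begin

lemma n_zero [simp]: "n 0 = 0"
  using n_scale[of 0 0] by simp

lemma n_uminus [simp]: "n (- x) = n x"
  using n_scale[of "-1" x] by simp

lemma n_nonneg [simp]: "n x \<ge> 0"
  using n_add[of x "- x"] by simp

lemma n_minus_commute: "n (x - y) = n (y - x)"
  by (metis minus_diff_eq n_uminus)

lemma n_diff: "n (x - y) \<le> n x + n y"
  using n_add[of x "- y"] by simp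

lemma n_triangle: "n (x - z) \<le> n (x - y) + n (y - z)"
  using n_add[of "x - y" "y - z"] by simp

lemma n_eq: "n (x - y) = 0 \<Longrightarrow> n x = n y"
  using n_add[of "x - y" y] n_add[of "y - x" x] n_minus_commute[of x y]
  by (simp only: diff_add_cancel)

text \<open>Linearity is exact although \<open>n\<close> may vanish on nonzero vectors. Boundedness
  forces null vectors to null vectors, so every such map descends to the quotient, a Banach
  space.\<close>

definition bounded_maps :: "('v \<Rightarrow> 'v) set" where
  "bounded_maps = {T. (\<forall>x y. T (x + y) = T x + T y) \<and> (\<forall>c x. T (sc c x) = sc c (T x)) \<and>
    (\<exists>C. \<forall>x. n (T x) \<le> C * n x)}"

lemma bm_add: "T \<in> bounded_maps \<Longrightarrow> T (x + y) = T x + T y"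
  by (simp add: bounded_maps_def)

lemma bm_scale: "T \<in> bounded_maps \<Longrightarrow> T (sc c x) = sc c (T x)"
  by (simp add: bounded_maps_def)

lemma bm_zero: "T \<in> bounded_maps \<Longrightarrow> T 0 = 0"
  using bm_add[of T 0 0] by simp

lemma bm_uminus: "T \<in> bounded_maps \<Longrightarrow> T (- x) = - T x"
  using bm_add[of T x "- x"] bm_zero[of T] by (simp add: eq_neg_iff_add_eq_0 add.commute)

lemma bm_diff: "T \<in> bounded_maps \<Longrightarrow> T (x - y) = T x - T y"
  using bm_add[of T x "- y"] bm_uminus[of T y] by simp

lemma bm_sum: "T \<in> bounded_maps \<Longrightarrow> T (sum f I) = (\<Sum>i\<in>I. T (f i))"
  by (induction I rule: infinite_finite_induct) (auto simp: bm_add bm_zero)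

lemma bm_bound:
  assumes "T \<in> bounded_maps"
  obtains C where "C > 0" "\<And>x. n (T x) \<le> C * n x"
proof -
  obtain C where C: "\<And>x. n (T x) \<le> C * n x"
    using assms by (auto simp: bounded_maps_def)
  have "n (T x) \<le> (\<bar>C\<bar> + 1) * n x" for x
    using C[of x] mult_right_mono[of C "\<bar>C\<bar> + 1" "n x"] by force
  then show ?thesis using that[of "\<bar>C\<bar> + 1"] by force
qed

lemma bm_null:
  assumes "T \<in> bounded_maps" "n x = 0"
  shows "n (T x) = 0"
proof -
  obtain C where "n (T x) \<le> C * n x" using bm_bound[OF assms(1)] by metis
  then show ?thesis using assms(2) n_nonneg[of "T x"] by simp
qed

lemmas bm_simps = bm_add bm_diff bm_uminus bm_zero bm_scale bm_sum

lemma bm_plus: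
  assumes "S \<in> bounded_maps" "T \<in> bounded_maps"
  shows "(\<lambda>x. S x + T x) \<in> bounded_maps"
proof -
  obtain C D where "\<And>x. n (S x) \<le> C * n x" "\<And>x. n (T x) \<le> D * n x"
    using assms bm_bound by metis
  then have "n (S x + T x) \<le> (C + D) * n x" for x
    using n_add[of "S x" "T x"] by (smt (verit) distrib_right)
  then have "\<exists>C. \<forall>x. n (S x + T x) \<le> C * n x" by blast
  then show ?thesis
    using assms unfolding bounded_maps_def by (auto simp: algebra_simps scale_right_distrib)
qed

lemma bm_scaled:
  assumes "T \<in> bounded_maps"
  shows "(\<lambda>x. sc c (T x)) \<in> bounded_maps"
proof -
  obtain D where "\<And>x. n (T x) \<le> D * n x" using assms bm_bound by metis
  then have "n (sc c (T x)) \<le> (cmod c * D) * n x" for x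
    by (simp add: n_scale mult.assoc mult_left_mono)
  then have "\<exists>C. \<forall>x. n (sc c (T x)) \<le> C * n x" by blast
  then show ?thesis
    using assms unfolding bounded_maps_def by (auto simp: scale_right_distrib mult.commute)
qed

lemma bm_minus:
  assumes "S \<in> bounded_maps" "T \<in> bounded_maps"
  shows "(\<lambda>x. S x - T x) \<in> bounded_maps"
  using bm_plus[OF assms(1) bm_scaled[OF assms(2), of "-1"]] by simp

lemma bm_comp:
  assumes "S \<in> bounded_maps" "T \<in> bounded_maps"
  shows "(\<lambda>x. S (T x)) \<in> bounded_maps"
proof -
  obtain C D where "C > 0" "\<And>x. n (S x) \<le> C * n x" "\<And>x. n (T x) \<le> D * n x"
    using assms bm_bound by metis
  then have "n (S (T x)) \<le> (C * D) * n x" for x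
    by (smt (verit, best) mult.assoc mult_left_mono)
  then have "\<exists>C. \<forall>x. n (S (T x)) \<le> C * n x" by blast
  then show ?thesis
    using assms unfolding bounded_maps_def by auto
qed

lemma bm_id: "(\<lambda>x. x) \<in> bounded_maps"
  unfolding bounded_maps_def by (auto intro!: exI[of _ 1])

lemma bm_const_0: "(\<lambda>x. 0) \<in> bounded_maps"
  unfolding bounded_maps_def by (auto intro!: exI[of _ 1])

lemma bm_summed:
  "(\<And>i. i \<in> I \<Longrightarrow> F i \<in> bounded_maps) \<Longrightarrow> (\<lambda>x. \<Sum>i\<in>I. F i x) \<in> bounded_maps"
  by (induction I rule: infinite_finite_induct) (auto intro: bm_plus bm_const_0)

lemma bm_funpow: "T \<in> bounded_maps \<Longrightarrow> T ^^ k \<in> bounded_maps"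
proof (induction k)
  case 0
  then show ?case using bm_id by (simp add: id_def)
next
  case (Suc k)
  then show ?case using bm_comp[of T "T ^^ k"] by (simp add: comp_def)
qed

end

text \<open>\<open>q\<close> is independent of \<open>n\<close>, so that it may be a norm or a
  seminorm that vanishes on compact maps. Inverses are accordingly understood modulo maps on which
  \<open>q\<close> is 0.\<close>

locale operator_seminorm = seminormed_space sc n
  for sc :: "complex \<Rightarrow> 'v::ab_group_add \<Rightarrow> 'v" and n :: "'v \<Rightarrow> real" +
  fixes q :: "('v \<Rightarrow> 'v) \<Rightarrow> real"
  assumes q_add: "\<lbrakk>S \<in> bounded_maps; T \<in> bounded_maps\<rbrakk> \<Longrightarrow> q (\<lambda>x. S x + T x) \<le> q S + q T"
    and q_scale: "T \<in> bounded_maps \<Longrightarrow> q (\<lambda>x. sc c (T x)) = cmod c * q T"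
    and q_comp: "\<lbrakk>S \<in> bounded_maps; T \<in> bounded_maps\<rbrakk> \<Longrightarrow> q (\<lambda>x. S (T x)) \<le> q S * q T"
begin

lemma q_zero: "q (\<lambda>x. 0) = 0"
  using q_scale[OF bm_id, of 0] by simp

lemma q_uminus: "T \<in> bounded_maps \<Longrightarrow> q (\<lambda>x. - T x) = q T"
  using q_scale[of T "-1"] by simp

lemma q_nonneg: "T \<in> bounded_maps \<Longrightarrow> q T \<ge> 0"
  using q_add[of T "\<lambda>x. - T x"] q_uminus[of T] q_zero bm_scaled[of T "-1"] by simp

lemma q_diff: "\<lbrakk>S \<in> bounded_maps; T \<in> bounded_maps\<rbrakk> \<Longrightarrow> q (\<lambda>x. S x - T x) \<le> q S + q T"
  using q_add[of S "\<lambda>x. - T x"] q_uminus[of T] bm_scaled[of T "-1"] by simp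

lemma q_sum: "(\<And>i. i \<in> I \<Longrightarrow> F i \<in> bounded_maps) \<Longrightarrow> q (\<lambda>x. \<Sum>i\<in>I. F i x) \<le> (\<Sum>i\<in>I. q (F i))"
proof (induction I rule: infinite_finite_induct)
  case (insert i I)
  then show ?case
    using q_add[of "F i" "\<lambda>x. \<Sum>i\<in>I. F i x"] bm_summed[of I F] by fastforce
qed (simp_all add: q_zero)

lemma q_funpow_Suc: "T \<in> bounded_maps \<Longrightarrow> q (T ^^ Suc k) \<le> q T * q (T ^^ k)"
  using q_comp[of T "T ^^ k"] bm_funpow[of T k] by (simp add: comp_def)

text \<open>The resolvent identity B - B' = (z - w) B B' up to errors that \<open>q\<close> does not
  see; a left inverse at w and a right inverse at z suffice for it. For z = w it says that the
  inverse is unique up to \<open>q\<close>.\<close>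

lemma resolvent_lipschitz:
  assumes bm: "A \<in> bounded_maps" "B \<in> bounded_maps" "B' \<in> bounded_maps"
    and B: "q (\<lambda>x. B (sc w x - A x) - x) = 0"
    and B': "q (\<lambda>x. sc z (B' x) - A (B' x) - x) = 0"
  shows "q (\<lambda>x. B x - B' x) \<le> cmod (z - w) * q B * q B'"
proof -
  define E where "E = (\<lambda>x. B (sc w x - A x) - x)"
  define E' where "E' = (\<lambda>x. sc z (B' x) - A (B' x) - x)"
  have E: "E \<in> bounded_maps" "E' \<in> bounded_maps"
    unfolding E_def E'_def
    using bm_comp[OF bm(2) bm_minus[OF bm_scaled[OF bm_id, of w] bm(1)]]
      bm_minus[OF bm_scaled[OF bm(3), of z] bm_comp[OF bm(1,3)]] by (auto intro!: bm_minus bm_id)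
  note bms = bm E bm_comp[OF bm(2,3)] bm_comp[OF bm(2) E(2)] bm_comp[OF E(1) bm(3)]
    bm_scaled[OF bm_comp[OF bm(2,3)], of "z - w"]
    bm_minus[OF bm_scaled[OF bm_comp[OF bm(2,3)], of "z - w"] bm_comp[OF bm(2) E(2)]]
  \<comment> \<open>With E = B (w - A) - 1 and E' = (z - A) B' - 1, the terms that contain A cancel
    in B E' - E B'.\<close>
  have eq: "(\<lambda>x. B x - B' x) = (\<lambda>x. (sc (z - w) (B (B' x)) - B (E' x)) + E (B' x))"
    by (rule ext) (simp add: E_def E'_def bm_simps[OF bm(2)] bm_simps[OF bm(1)] bm_simps[OF bm(3)]
        scale_left_diff_distrib algebra_simps)
  have "q (\<lambda>x. B x - B' x) \<le> (q (\<lambda>x. sc (z - w) (B (B' x))) + q (\<lambda>x. B (E' x))) + q (\<lambda>x. E (B' x))"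
    unfolding eq
    by (rule order_trans[OF q_add[OF bms(10,8)]]) (auto intro!: bms q_diff)
  also have "\<dots> \<le> (cmod (z - w) * (q B * q B') + q B * q E') + q E * q B'"
    using q_scale[OF bm_comp[OF bm(2,3)], of "z - w"]
    by (intro add_mono q_comp bm E) (auto intro!: mult_left_mono q_comp bm)
  finally show ?thesis using B B' by (simp add: E_def E'_def)
qed

text \<open>The factorisation z^k - A^k = (z - A) (z^(k-1) + z^(k-2) A + ... + A^(k-1)), applied to
  a right inverse B of z - A. The induction carries the error along, which stays null for
  \<open>q\<close>.\<close>

lemma funpow_resolvent:
  assumes bm: "A \<in> bounded_maps" "B \<in> bounded_maps"
    and B: "q (\<lambda>x. sc z (B x) - A (B x) - x) = 0"
  shows "q (\<lambda>x. (A ^^ k) (B x) - (sc (z ^ k) (B x) - (\<Sum>i<k. sc (z ^ (k - 1 - i)) ((A ^^ i) x)))) = 0"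
proof (induction k)
  case 0
  show ?case using q_zero by simp
next
  case (Suc k)
  define F where "F = (\<lambda>x. (A ^^ k) (B x) - (sc (z ^ k) (B x) - (\<Sum>i<k. sc (z ^ (k - 1 - i)) ((A ^^ i) x))))"
  define E where "E = (\<lambda>x. sc z (B x) - A (B x) - x)"
  have bmE: "E \<in> bounded_maps" unfolding E_def
    by (intro bm_minus bm_id bm_scaled bm_comp[OF bm(1,2)] bm)
  have bmF: "F \<in> bounded_maps" unfolding F_def
    by (intro bm_minus bm_summed bm_scaled bm_funpow bm_comp[OF bm_funpow[OF bm(1)] bm(2)] bm)
  have s: "(\<Sum>i<Suc k. sc (z ^ (Suc k - 1 - i)) ((A ^^ i) x))
      = sc (z ^ k) x + (\<Sum>i<k. sc (z ^ (k - 1 - i)) (A ((A ^^ i) x)))" for x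
    by (subst sum.lessThan_Suc_shift) simp
  have eq: "(\<lambda>x. (A ^^ Suc k) (B x) - (sc (z ^ Suc k) (B x) - (\<Sum>i<Suc k. sc (z ^ (Suc k - 1 - i)) ((A ^^ i) x))))
     = (\<lambda>x. A (F x) - sc (z ^ k) (E x))"
    unfolding s
    by (rule ext) (simp add: F_def E_def bm_simps[OF bm(1)] scale_right_diff_distrib
        algebra_simps mult.commute)
  have "q (\<lambda>x. A (F x) - sc (z ^ k) (E x)) \<le> q A * q F + cmod (z ^ k) * q E"
    using q_diff[OF bm_comp[OF bm(1) bmF] bm_scaled[OF bmE, of "z ^ k"]]
      q_comp[OF bm(1) bmF] q_scale[OF bmE, of "z ^ k"] by simp
  also have "\<dots> = 0" using Suc.IH B by (simp add: F_def E_def)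
  finally have "q (\<lambda>x. A (F x) - sc (z ^ k) (E x)) \<le> 0" .
  moreover have "q (\<lambda>x. A (F x) - sc (z ^ k) (E x)) \<ge> 0"
    by (intro q_nonneg bm_minus bm_scaled bm_comp[OF bm(1) bmF] bmE)
  ultimately show ?case unfolding eq by simp
qed


text \<open>The inverses are chosen independently at each point, so nothing is known about their
  dependence on z. The resolvent estimate yields q(B w) \<le> 2 q(B z) as soon as |z - w| q(B z)
  \<le> 1/2, which the radius d(z) ensures, and finitely many such discs cover K.\<close>

lemma resolvent_bounded:
  assumes A: "A \<in> bounded_maps" and K: "compact K"
    and bm: "\<And>z. z \<in> K \<Longrightarrow> B z \<in> bounded_maps"
    and left: "\<And>z. z \<in> K \<Longrightarrow> q (\<lambda>x. B z (sc z x - A x) - x) = 0"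
    and right: "\<And>z. z \<in> K \<Longrightarrow> q (\<lambda>x. sc z (B z x) - A (B z x) - x) = 0"
  obtains M where "M > 0" "\<And>z. z \<in> K \<Longrightarrow> q (B z) \<le> M"
proof -
  define d where "d z = 1 / (2 * q (B z) + 1)" for z
  have local: "q (B w) \<le> 2 * q (B z)" if "z \<in> K" "w \<in> K" "w \<in> ball z (d z)" for z w
  proof -
    have nn: "q (B z) \<ge> 0" "q (B w) \<ge> 0" using that bm q_nonneg by auto
    have "cmod (z - w) * (2 * q (B z) + 1) < 1"
      using that(3) nn by (simp add: d_def dist_norm pos_less_divide_eq)
    then have h: "cmod (z - w) * q (B z) \<le> 1 / 2"
      using norm_ge_zero[of "z - w"] by (simp add: algebra_simps) (smt (verit) norm_ge_zero)
    have "q (B w) \<le> q (\<lambda>x. B w x - B z x) + q (B z)"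
      using q_add[OF bm_minus[OF bm[OF that(2)] bm[OF that(1)]] bm[OF that(1)]] by simp
    also have "q (\<lambda>x. B w x - B z x) \<le> cmod (z - w) * q (B w) * q (B z)"
      by (rule resolvent_lipschitz[OF A bm[OF that(2)] bm[OF that(1)] left[OF that(2)] right[OF that(1)]])
    also have "\<dots> \<le> q (B w) * (1 / 2)"
      using mult_left_mono[OF h nn(2)] by (simp add: mult_ac)
    finally show ?thesis by simp
  qed
  have "d z > 0" if "z \<in> K" for z
    using q_nonneg[OF bm[OF that]] by (simp add: d_def)
  then have "K \<subseteq> (\<Union>z\<in>K. ball z (d z))" by auto
  then obtain C where C: "C \<subseteq> K" "finite C" "K \<subseteq> (\<Union>z\<in>C. ball z (d z))"
    using compactE_image[OF K, of K "\<lambda>z. ball z (d z)"] by auto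
  show thesis
  proof (rule that)
    have pos: "q (B z) \<ge> 0" if "z \<in> C" for z using that C(1) bm q_nonneg by auto
    \<comment> \<open>The summand 1 keeps the bound positive even if the cover is empty or all
      inverses are null for \<open>q\<close>.\<close>
    then show "1 + (\<Sum>z\<in>C. 2 * q (B z)) > 0"
      by (intro add_pos_nonneg sum_nonneg) auto
    fix w assume w: "w \<in> K"
    then obtain z where z: "z \<in> C" "w \<in> ball z (d z)" using C(3) by auto
    have "q (B w) \<le> 2 * q (B z)" using local[of z w] z w C(1) by auto
    also have "\<dots> \<le> (\<Sum>z\<in>C. 2 * q (B z))"
      by (rule member_le_sum[OF z(1) _ C(2)]) (use pos in auto)
    finally show "q (B w) \<le> 1 + (\<Sum>z\<in>C. 2 * q (B z))" by simp
  qed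
qed

end

section \<open>Averages of the resolvent over circles and the spectral radius formula\<close>

lemma sum_root_of_unity_powers:
  assumes "0 < l" "l < k"
  shows "(\<Sum>j<k. (cis (2 * pi * real j / real k)) ^ l) = 0"
proof -
  define w where "w = cis (2 * pi * real l / real k)"
  have "w \<noteq> cis (2 * pi * real 0 / real k)"
    using inj_onD[OF bij_betw_imp_inj_on[OF bij_betw_roots_unity[of k]], of l 0] assms
    by (auto simp: w_def cis_conv_exp mult_ac)
  then have "w \<noteq> 1" by simp
  have "(cis (2 * pi * real j / real k)) ^ l = w ^ j" for j
    by (simp add: w_def Complex.DeMoivre mult_ac)
  moreover have "w ^ k = 1"
    using assms cis_multiple_2pi[of "real l"] by (simp add: w_def Complex.DeMoivre mult_ac)
  ultimately show ?thesis using \<open>w \<noteq> 1\<close> by (simp add: sum_gp_strict)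
qed

context operator_seminorm
begin

text \<open>Averaging the resolvent over the circle of radius \<open>\<rho>\<close> yields an inverse of \<open>1 - A\<^sup>k / \<rho>\<^sup>k\<close>
  (Rickart's trick), which replaces the vector-valued Cauchy formula.\<close>

lemma resolvent_average:
  assumes A: "A \<in> bounded_maps" and k: "k > 0"
    and Z: "\<And>j. Z j = complex_of_real \<rho> * cis (2 * pi * real j / real k)"
    and bm: "\<And>j. B j \<in> bounded_maps"
    and right: "\<And>j. q (\<lambda>x. sc (Z j) (B j x) - A (B j x) - x) = 0"
    and S: "S = (\<lambda>x. sc (1 / of_nat k) (\<Sum>j<k. sc (Z j) (B j x)))"
  shows "q (\<lambda>x. (A ^^ k) (S x) - sc (of_real \<rho> ^ k) (S x - x)) = 0"
proof -
  define F where "F j = (\<lambda>x. (A ^^ k) (B j x) -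
    (sc (Z j ^ k) (B j x) - (\<Sum>i<k. sc (Z j ^ (k - 1 - i)) ((A ^^ i) x))))" for j
  have q0: "q (F j) = 0" for j
    unfolding F_def by (rule funpow_resolvent[OF A bm right])
  have bmF: "F j \<in> bounded_maps" for j
    unfolding F_def
    by (intro bm_minus bm_summed bm_scaled bm_funpow bm_comp[OF bm_funpow[OF A] bm] bm A)
  have Zk: "Z j ^ k = of_real \<rho> ^ k" for j
    using k cis_multiple_2pi[of "real j"]
    by (simp add: Z power_mult_distrib Complex.DeMoivre mult_ac)
  \<comment> \<open>\<open>Z j ^ (k - i)\<close> is \<rho>^(k-i) times the (k-i)-th power of a k-th
    root of unity, and these powers average to 0 unless k divides k - i, that is, unless i =
    0.\<close>
  have Zsum: "(\<Sum>j<k. Z j * Z j ^ (k - 1 - i)) = (if i = 0 then of_nat k * of_real \<rho> ^ k else 0)"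
    if "i < k" for i
  proof -
    have e: "Z j * Z j ^ (k - 1 - i) = Z j ^ (k - i)" for j
      using that by (metis Suc_diff_Suc diff_Suc_eq_diff_pred power_Suc)
    show ?thesis
    proof (cases "i = 0")
      case True
      then show ?thesis using e Zk by simp
    next
      case False
      have "(\<Sum>j<k. Z j ^ (k - i))
          = of_real \<rho> ^ (k - i) * (\<Sum>j<k. cis (2 * pi * real j / real k) ^ (k - i))"
        by (simp add: Z power_mult_distrib sum_distrib_left)
      then show ?thesis using e sum_root_of_unity_powers[of "k - i" k] that False by simp
    qed
  qed
  have swap: "(\<Sum>j<k. sc (Z j) (\<Sum>i<k. sc (Z j ^ (k - 1 - i)) ((A ^^ i) x)))
      = sc (of_nat k * of_real \<rho> ^ k) x" for x
  proof -
    have "(\<Sum>j<k. sc (Z j) (\<Sum>i<k. sc (Z j ^ (k - 1 - i)) ((A ^^ i) x)))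
        = (\<Sum>j<k. \<Sum>i<k. sc (Z j * Z j ^ (k - 1 - i)) ((A ^^ i) x))"
      by (simp add: scale_sum_right)
    also have "\<dots> = (\<Sum>i<k. sc (\<Sum>j<k. Z j * Z j ^ (k - 1 - i)) ((A ^^ i) x))"
      by (subst sum.swap) (simp add: scale_sum_left)
    also have "\<dots> = (\<Sum>i<k. if i = 0 then sc (of_nat k * of_real \<rho> ^ k) x else 0)"
      by (intro sum.cong refl, subst Zsum) auto
    also have "\<dots> = sc (of_nat k * of_real \<rho> ^ k) x" using k by simp
    finally show ?thesis .
  qed
  have eq: "(\<lambda>x. (A ^^ k) (S x) - sc (of_real \<rho> ^ k) (S x - x))
     = (\<lambda>x. sc (1 / of_nat k) (\<Sum>j<k. sc (Z j) (F j x)))"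
  proof
    fix x
    have "(\<Sum>j<k. sc (Z j) (F j x)) = (\<Sum>j<k. sc (Z j) ((A ^^ k) (B j x)))
        - sc (of_real \<rho> ^ k) (\<Sum>j<k. sc (Z j) (B j x)) + sc (of_nat k * of_real \<rho> ^ k) x"
      unfolding swap[symmetric]
      by (simp add: F_def Zk scale_right_diff_distrib sum_subtractf sum.distrib scale_sum_right mult.commute)
    then show "(A ^^ k) (S x) - sc (of_real \<rho> ^ k) (S x - x) = sc (1 / of_nat k) (\<Sum>j<k. sc (Z j) (F j x))"
      using k unfolding S
      by (simp add: bm_simps[OF bm_funpow[OF A]] scale_right_diff_distrib scale_right_distrib mult.commute)
  qed
  have "q (\<lambda>x. \<Sum>j<k. sc (Z j) (F j x)) \<le> (\<Sum>j<k. q (\<lambda>x. sc (Z j) (F j x)))"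
    by (intro q_sum bm_scaled bmF)
  also have "\<dots> = 0" by (simp add: q_scale[OF bmF] q0)
  finally have "q (\<lambda>x. \<Sum>j<k. sc (Z j) (F j x)) = 0"
    by (intro antisym q_nonneg bm_summed bm_scaled bmF) auto
  then show ?thesis
    unfolding eq by (subst q_scale) (auto intro!: bm_summed bm_scaled bmF)
qed

text \<open>Continuation in the radius, from large circles, where the decay is elementary, down to
  r. Let S be the average of z (z - A)^(-1) over the k points on the circle of radius \<rho>, so
  that \<rho>^k (S - 1) = A^k S modulo \<open>q\<close>. Decay of q(A^k) / \<sigma>^k makes q(S - 1)
  small at radius \<sigma>. Since S is Lipschitz in the radius, uniformly in k, q(S - 1) is at most
  1/2 at a nearby \<tau>, and A^k = \<tau>^k (S - 1) - A^k (S - 1) then gives q(A^k) \<le> \<tau>^k.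
  The step length is independent of k, so finitely many steps reach r.\<close>

theorem gelfand_bound:
  assumes A: "A \<in> bounded_maps" and R: "R > 0" "R < r"
    and inv: "\<And>z. R \<le> cmod z \<Longrightarrow> \<exists>B\<in>bounded_maps.
      q (\<lambda>x. B (sc z x - A x) - x) = 0 \<and> q (\<lambda>x. sc z (B x) - A (B x) - x) = 0"
  shows "(\<lambda>k. q (A ^^ k) / r ^ k) \<longlonglongrightarrow> 0"
proof -
  define P where "P z B \<longleftrightarrow> B \<in> bounded_maps \<and>
    q (\<lambda>x. B (sc z x - A x) - x) = 0 \<and> q (\<lambda>x. sc z (B x) - A (B x) - x) = 0" for z B
  define B where "B z = (SOME B. P z B)" for z
  have "P z (B z)" if "R \<le> cmod z" for z
    using inv[OF that] someI_ex[of "P z"] unfolding B_def P_def by blast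
  then have bm: "\<And>z. R \<le> cmod z \<Longrightarrow> B z \<in> bounded_maps"
    and left: "\<And>z. R \<le> cmod z \<Longrightarrow> q (\<lambda>x. B z (sc z x - A x) - x) = 0"
    and right: "\<And>z. R \<le> cmod z \<Longrightarrow> q (\<lambda>x. sc z (B z x) - A (B z x) - x) = 0"
    by (auto simp: P_def)
  \<comment> \<open>Exceeds r, and also q(A), beyond which a geometric series estimate gives the
    decay that starts the continuation.\<close>
  define R2 where "R2 = r + q A + 1"
  have qA: "q A \<ge> 0" by (rule q_nonneg[OF A])
  have R2: "R2 > R" "R2 > r" "R2 > q A" "R2 > 0" using R qA by (auto simp: R2_def)
  define K where "K = cball (0::complex) R2 - ball 0 R"
  have K: "z \<in> K \<longleftrightarrow> R \<le> cmod z \<and> cmod z \<le> R2" for z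
    by (auto simp: K_def)
  have "compact K" unfolding K_def by (intro compact_diff) auto
  then obtain M where M: "M > 0" "\<And>z. z \<in> K \<Longrightarrow> q (B z) \<le> M"
    using resolvent_bounded[OF A, of K B] bm left right K by blast
  \<comment> \<open>A Lipschitz constant of z (z - A)^(-1) on the annulus: M stems from the factor
    z, and R2 M^2 from the resolvent.\<close>
  define C where "C = M + R2 * M * M"
  have C: "C > 0" using M R2 by (simp add: C_def add_pos_pos)
  have lip: "q (\<lambda>x. sc z (B z x) - sc w (B w x)) \<le> C * cmod (z - w)" if "z \<in> K" "w \<in> K" for z w
  proof -
    have b: "B z \<in> bounded_maps" "B w \<in> bounded_maps" using that K bm by auto
    have qq: "q (B z) \<ge> 0" "q (B w) \<ge> 0" using b q_nonneg by auto
    have eq: "(\<lambda>x. sc z (B z x) - sc w (B w x)) = (\<lambda>x. sc (z - w) (B z x) + sc w (B z x - B w x))"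
      by (rule ext) (simp add: scale_left_diff_distrib scale_right_diff_distrib)
    have "q (\<lambda>x. sc z (B z x) - sc w (B w x))
        \<le> cmod (z - w) * q (B z) + cmod w * q (\<lambda>x. B z x - B w x)"
      unfolding eq
      using q_add[OF bm_scaled[OF b(1), of "z - w"] bm_scaled[OF bm_minus[OF b], of w]]
        q_scale[OF b(1), of "z - w"] q_scale[OF bm_minus[OF b], of w] by simp
    also have "\<dots> \<le> cmod (z - w) * M + R2 * (cmod (w - z) * M * M)"
    proof (intro add_mono mult_mono)
      have "q (\<lambda>x. B z x - B w x) \<le> cmod (w - z) * q (B z) * q (B w)"
        by (rule resolvent_lipschitz[OF A b left right]) (use that K in auto)
      also have "\<dots> \<le> cmod (w - z) * M * M"
        using M that qq by (intro mult_mono) auto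
      finally show "q (\<lambda>x. B z x - B w x) \<le> cmod (w - z) * M * M" .
    qed (use M that K R2 qq q_nonneg[OF bm_minus[OF b]] in auto)
    also have "\<dots> = C * cmod (z - w)" by (simp add: C_def algebra_simps norm_minus_commute)
    finally show ?thesis .
  qed
  define Z where "Z \<rho> k j = complex_of_real \<rho> * cis (2 * pi * real j / real k)" for \<rho> and k j :: nat
  have ZK: "Z \<rho> k j \<in> K" if "\<rho> \<in> {R..R2}" for \<rho> k j
    using that R by (simp add: K Z_def norm_mult)
  define S where "S \<rho> k = (\<lambda>x. sc (1 / of_nat k) (\<Sum>j<k. sc (Z \<rho> k j) (B (Z \<rho> k j) x)))"
    for \<rho> and k :: nat
  have bmS: "S \<rho> k \<in> bounded_maps" if "\<rho> \<in> {R..R2}" for \<rho> k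
    unfolding S_def using ZK[OF that] K by (intro bm_scaled bm_summed bm) auto
  have avg_le: "q (\<lambda>x. sc (1 / of_nat k) (\<Sum>j<k. G j x)) \<le> c"
    if "k > 0" "\<And>j. G j \<in> bounded_maps" "\<And>j. q (G j) \<le> c" for k :: nat and G c
  proof -
    have "q (\<lambda>x. \<Sum>j<k. G j x) \<le> (\<Sum>j<k. q (G j))" by (intro q_sum that)
    also have "\<dots> \<le> real k * c" using sum_bounded_above[of "{..<k}" "\<lambda>j. q (G j)" c] that by simp
    finally show ?thesis
      using that by (simp add: q_scale[OF bm_summed] norm_divide divide_simps mult.commute)
  qed
  have S_le: "q (S \<rho> k) \<le> R2 * M" if "\<rho> \<in> {R..R2}" "k > 0" for \<rho> k
    unfolding S_def
  proof (rule avg_le[OF that(2)])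
    fix j
    have b: "B (Z \<rho> k j) \<in> bounded_maps" using bm ZK[OF that(1)] K by auto
    then show "(\<lambda>x. sc (Z \<rho> k j) (B (Z \<rho> k j) x)) \<in> bounded_maps" by (rule bm_scaled)
    show "q (\<lambda>x. sc (Z \<rho> k j) (B (Z \<rho> k j) x)) \<le> R2 * M"
      unfolding q_scale[OF b] using ZK[OF that(1), of k j] K M R2 q_nonneg[OF b]
      by (intro mult_mono) auto
  qed
  have S_lip: "q (\<lambda>x. S \<rho> k x - S \<sigma> k x) \<le> C * \<bar>\<rho> - \<sigma>\<bar>"
    if "\<rho> \<in> {R..R2}" "\<sigma> \<in> {R..R2}" "k > 0" for \<rho> \<sigma> k
  proof -
    have eq: "(\<lambda>x. S \<rho> k x - S \<sigma> k x) = (\<lambda>x. sc (1 / of_nat k)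
        (\<Sum>j<k. sc (Z \<rho> k j) (B (Z \<rho> k j) x) - sc (Z \<sigma> k j) (B (Z \<sigma> k j) x)))"
      by (rule ext) (simp add: S_def scale_right_diff_distrib sum_subtractf)
    show ?thesis unfolding eq
    proof (rule avg_le[OF that(3)])
      fix j
      have "B (Z \<rho> k j) \<in> bounded_maps" "B (Z \<sigma> k j) \<in> bounded_maps"
        using bm ZK[OF that(1)] ZK[OF that(2)] K by auto
      then show "(\<lambda>x. sc (Z \<rho> k j) (B (Z \<rho> k j) x) - sc (Z \<sigma> k j) (B (Z \<sigma> k j) x)) \<in> bounded_maps"
        by (intro bm_minus bm_scaled)
      have "cmod (Z \<rho> k j - Z \<sigma> k j) = \<bar>\<rho> - \<sigma>\<bar>"
        by (simp add: Z_def left_diff_distrib[symmetric] norm_mult flip: of_real_diff)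
      then show "q (\<lambda>x. sc (Z \<rho> k j) (B (Z \<rho> k j) x) - sc (Z \<sigma> k j) (B (Z \<sigma> k j) x)) \<le> C * \<bar>\<rho> - \<sigma>\<bar>"
        using lip[OF ZK[OF that(1)] ZK[OF that(2)], of k j k j] by simp
    qed
  qed
  have avg: "q (\<lambda>x. (A ^^ k) (S \<rho> k x) - sc (of_real \<rho> ^ k) (S \<rho> k x - x)) = 0"
    if "\<rho> \<in> {R..R2}" "k > 0" for \<rho> k
    by (rule resolvent_average[OF A that(2), where Z = "Z \<rho> k" and B = "\<lambda>j. B (Z \<rho> k j)"])
      (use ZK[OF that(1)] K bm right in \<open>auto simp: Z_def S_def\<close>)
  have bmk: "A ^^ k \<in> bounded_maps" for k by (rule bm_funpow[OF A])
  have near1: "\<rho> ^ k * q (\<lambda>x. S \<rho> k x - x) \<le> q (A ^^ k) * q (S \<rho> k)"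
    and near2: "q (A ^^ k) \<le> \<rho> ^ k * q (\<lambda>x. S \<rho> k x - x) + q (A ^^ k) * q (\<lambda>x. S \<rho> k x - x)"
    if "\<rho> \<in> {R..R2}" "k > 0" for \<rho> k
  proof -
    define E where "E = (\<lambda>x. (A ^^ k) (S \<rho> k x) - sc (of_real \<rho> ^ k) (S \<rho> k x - x))"
    define D where "D = (\<lambda>x. S \<rho> k x - x)"
    have b: "D \<in> bounded_maps" "(\<lambda>x. (A ^^ k) (S \<rho> k x)) \<in> bounded_maps"
      "(\<lambda>x. (A ^^ k) (D x)) \<in> bounded_maps"
      unfolding D_def
      by (intro bm_minus bm_id bmS that bm_comp[OF bmk bmS] bm_comp[OF bmk bm_minus[OF bmS bm_id]])+
    have bE: "E \<in> bounded_maps"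
      using b unfolding E_def D_def by (intro bm_minus[OF b(2)] bm_scaled) auto
    have qE: "q E = 0" unfolding E_def by (rule avg[OF that])
    have \<rho>: "\<rho> > 0" using that R by auto
    have qs: "q (\<lambda>x. sc (of_real \<rho> ^ k) (D x)) = \<rho> ^ k * q D"
      using \<rho> by (simp add: q_scale[OF b(1)] norm_power)
    have "(\<lambda>x. sc (of_real \<rho> ^ k) (D x)) = (\<lambda>x. (A ^^ k) (S \<rho> k x) - E x)"
      by (rule ext) (simp add: E_def D_def)
    then have "\<rho> ^ k * q D \<le> q (\<lambda>x. (A ^^ k) (S \<rho> k x))"
      using q_diff[OF b(2) bE] qE qs by simp
    also have "\<dots> \<le> q (A ^^ k) * q (S \<rho> k)" by (rule q_comp[OF bmk bmS[OF that(1)]])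
    finally show "\<rho> ^ k * q (\<lambda>x. S \<rho> k x - x) \<le> q (A ^^ k) * q (S \<rho> k)" by (simp add: D_def)
    have "A ^^ k = (\<lambda>x. (sc (of_real \<rho> ^ k) (D x) + E x) - (A ^^ k) (D x))"
      by (rule ext) (simp add: E_def D_def bm_simps[OF bmk])
    then have "q (A ^^ k) \<le> q (\<lambda>x. sc (of_real \<rho> ^ k) (D x) + E x) + q (\<lambda>x. (A ^^ k) (D x))"
      using q_diff[OF bm_plus[OF bm_scaled[OF b(1)] bE] b(3)] by metis
    also have "\<dots> \<le> \<rho> ^ k * q D + q (A ^^ k) * q D"
      using q_add[OF bm_scaled[OF b(1)] bE, of "of_real \<rho> ^ k"] qE qs
      by (intro add_mono q_comp[OF bmk b(1)]) simp
    finally show "q (A ^^ k) \<le> \<rho> ^ k * q (\<lambda>x. S \<rho> k x - x) + q (A ^^ k) * q (\<lambda>x. S \<rho> k x - x)"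
      by (simp add: D_def)
  qed
  define tend where "tend \<rho> \<longleftrightarrow> (\<lambda>k. q (A ^^ k) / \<rho> ^ k) \<longlonglongrightarrow> 0" for \<rho>
  \<comment> \<open>From decay at \<sigma> to decay at every \<upsilon> > \<tau>; at \<tau> itself
    the argument yields only q(A^k) \<le> \<tau>^k.\<close>
  have step: "tend \<upsilon>" if "tend \<sigma>" "\<sigma> \<in> {R..R2}" "\<tau> \<in> {R..R2}" "C * \<bar>\<tau> - \<sigma>\<bar> \<le> 1/4" "\<tau> < \<upsilon>"
    for \<sigma> \<tau> \<upsilon>
  proof -
    have pos: "\<sigma> > 0" "\<tau> > 0" "\<upsilon> > 0" using that R by auto
    have "(\<lambda>k. q (A ^^ k) / \<sigma> ^ k * (R2 * M)) \<longlonglongrightarrow> 0"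
      using tendsto_mult_right[OF that(1)[unfolded tend_def], of "R2 * M"] by simp
    then have "\<forall>\<^sub>F k in sequentially. q (A ^^ k) / \<sigma> ^ k * (R2 * M) < 1/4"
      by (rule order_tendstoD) simp
    then have "\<forall>\<^sub>F k in sequentially. q (A ^^ k) \<le> \<tau> ^ k"
      using eventually_gt_at_top[of 0]
    proof eventually_elim
      case (elim k)
      have nn: "q (A ^^ k) \<ge> 0" by (rule q_nonneg[OF bmk])
      have "\<sigma> ^ k * q (\<lambda>x. S \<sigma> k x - x) \<le> q (A ^^ k) * (R2 * M)"
        using near1[OF that(2) elim(2)] mult_left_mono[OF S_le[OF that(2) elim(2)] nn] by simp
      also have "\<dots> = \<sigma> ^ k * (q (A ^^ k) / \<sigma> ^ k * (R2 * M))" using pos by simp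
      also have "\<dots> \<le> \<sigma> ^ k * (1/4)" using elim(1) pos by (intro mult_left_mono) auto
      finally have "q (\<lambda>x. S \<sigma> k x - x) \<le> 1/4"
        using pos by (simp only: mult_le_cancel_left_pos zero_less_power)
      moreover have "q (\<lambda>x. S \<tau> k x - x) \<le> q (\<lambda>x. S \<tau> k x - S \<sigma> k x) + q (\<lambda>x. S \<sigma> k x - x)"
        using q_add[OF bm_minus[OF bmS[OF that(3)] bmS[OF that(2)]] bm_minus[OF bmS[OF that(2)] bm_id], of k k k]
        by simp
      \<comment> \<open>One quarter comes from the decay at \<sigma>, the other from the Lipschitz
        bound. With the value 1/2 the term q(A^k) / 2 is absorbed by the left-hand side
        below.\<close>
      ultimately have d: "q (\<lambda>x. S \<tau> k x - x) \<le> 1/2"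
        using S_lip[OF that(3,2) elim(2)] that(4) by simp
      have "q (A ^^ k) \<le> \<tau> ^ k * (1/2) + q (A ^^ k) * (1/2)"
        by (rule order_trans[OF near2[OF that(3) elim(2)] add_mono[OF mult_left_mono[OF d] mult_left_mono[OF d nn]]])
          (use pos in simp)
      then show ?case by simp
    qed
    then have "\<forall>\<^sub>F k in sequentially. norm (q (A ^^ k) / \<upsilon> ^ k) \<le> (\<tau> / \<upsilon>) ^ k"
      by eventually_elim
        (use q_nonneg[OF bmk] pos in \<open>simp add: power_divide divide_right_mono\<close>)
    moreover have "(\<lambda>k. (\<tau> / \<upsilon>) ^ k) \<longlonglongrightarrow> 0"
      using pos that(5) by (intro LIMSEQ_power_zero) simp
    ultimately show ?thesis unfolding tend_def by (rule Lim_null_comparison)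
  qed
  have tend_R2: "tend R2"
  proof -
    have "q (A ^^ k) \<le> q A ^ k * q (\<lambda>x. x)" for k
    proof (induction k)
      case (Suc k)
      then show ?case
        using order_trans[OF q_funpow_Suc[OF A, of k] mult_left_mono[OF Suc qA]]
        by (simp add: mult_ac del: funpow.simps)
    qed (simp add: id_def)
    then have le: "norm (q (A ^^ k) / R2 ^ k) \<le> (q A / R2) ^ k * q (\<lambda>x. x)" for k
      using R2 q_nonneg[OF bmk] by (simp add: power_divide divide_right_mono)
    have "(\<lambda>k. (q A / R2) ^ k * q (\<lambda>x. x)) \<longlonglongrightarrow> 0"
      using R2 qA by (intro tendsto_mult_left_zero LIMSEQ_power_zero) simp
    then show ?thesis
      unfolding tend_def by (rule Lim_null_comparison[OF always_eventually[OF allI[OF le]]])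
  qed
  \<comment> \<open>Decay at \<tau> + d is transported to a bound at \<tau> - d, both truncated to
    the annulus, over a distance of at most 2 d; strict inequality between \<tau> - d and \<tau>
    turns the bound into decay at \<tau>.\<close>
  define d where "d = 1 / (8 * C)"
  have d: "d > 0" "C * (2 * d) = 1/4" using C by (auto simp: d_def)
  have "\<forall>\<tau>. R < \<tau> \<and> \<tau> \<le> R2 \<and> R2 - real m * d \<le> \<tau> \<longrightarrow> tend \<tau>" for m
  proof (induction m)
    case 0
    then show ?case using tend_R2 by auto
  next
    case (Suc m)
    show ?case
    proof (intro allI impI)
      fix \<tau> assume \<tau>: "R < \<tau> \<and> \<tau> \<le> R2 \<and> R2 - real (Suc m) * d \<le> \<tau>"
      define \<sigma> where "\<sigma> = min R2 (\<tau> + d)"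
      have s: "tend \<sigma>"
        using Suc \<tau> d R2 by (auto simp: \<sigma>_def algebra_simps min_def split: if_splits)
      have "\<bar>max R (\<tau> - d) - \<sigma>\<bar> \<le> 2 * d" using \<tau> d by (auto simp: \<sigma>_def)
      then have "C * \<bar>max R (\<tau> - d) - \<sigma>\<bar> \<le> 1/4"
        using mult_left_mono[of _ "2 * d" C] C d by fastforce
      then show "tend \<tau>"
        using step[OF s, of "max R (\<tau> - d)" \<tau>] \<tau> d R2 by (auto simp: \<sigma>_def)
    qed
  qed
  moreover obtain m :: nat where "R2 - real m * d \<le> r"
    using reals_Archimedean3[OF d(1), rule_format, of "R2 - r"] by (metis diff_le_eq less_imp_le add.commute)
  ultimately have "tend r" using R R2 by auto
  then show ?thesis by (simp add: tend_def)
qed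

end

section \<open>Riesz theory of condensing maps\<close>

context seminormed_space
begin

definition n_tendsto :: "(nat \<Rightarrow> 'v) \<Rightarrow> 'v \<Rightarrow> bool" where
  "n_tendsto s x \<longleftrightarrow> (\<lambda>i. n (s i - x)) \<longlonglongrightarrow> 0"

lemma n_tendsto_subseq: "\<lbrakk>n_tendsto s x; strict_mono \<phi>\<rbrakk> \<Longrightarrow> n_tendsto (\<lambda>i. s (\<phi> i)) x"
  unfolding n_tendsto_def by (drule (1) LIMSEQ_subseq_LIMSEQ) (simp add: o_def)

lemma n_tendsto_map:
  assumes "T \<in> bounded_maps" "n_tendsto s x"
  shows "n_tendsto (\<lambda>i. T (s i)) (T x)"
proof -
  obtain C where C: "C > 0" "\<And>x. n (T x) \<le> C * n x" using bm_bound[OF assms(1)] by metis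
  have "\<forall>\<^sub>F i in sequentially. norm (n (T (s i) - T x)) \<le> n (s i - x) * C"
    using C(2)[of "s _ - x"] by (simp add: bm_simps[OF assms(1)] mult.commute)
  moreover have "(\<lambda>i. n (s i - x) * C) \<longlonglongrightarrow> 0"
    using assms(2) unfolding n_tendsto_def by (rule tendsto_mult_left_zero)
  ultimately show ?thesis unfolding n_tendsto_def by (rule Lim_null_comparison)
qed

lemma n_tendsto_norm: "n_tendsto s x \<Longrightarrow> (\<lambda>i. n (s i)) \<longlonglongrightarrow> n x"
proof -
  assume "n_tendsto s x"
  moreover have "\<bar>n (s i) - n x\<bar> \<le> n (s i - x)" for i
    using n_add[of "s i - x" x] n_add[of "x - s i" "s i"] n_minus_commute[of "s i" x]
    unfolding diff_add_cancel by linarith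
  ultimately have "(\<lambda>i. n (s i) - n x) \<longlonglongrightarrow> 0"
    unfolding n_tendsto_def
    by (intro Lim_null_comparison[OF always_eventually, of "\<lambda>i. n (s i) - n x" "\<lambda>i. n (s i - x)"]) auto
  then show ?thesis by (rule LIM_zero_cancel)
qed

lemma n_tendsto_unique:
  assumes "n_tendsto s x" "n_tendsto s y"
  shows "n (x - y) = 0"
proof -
  have "(\<lambda>i. n (s i - x) + n (s i - y)) \<longlonglongrightarrow> 0 + 0"
    using assms unfolding n_tendsto_def by (rule tendsto_add)
  moreover have "n (x - y) \<le> n (s i - x) + n (s i - y)" for i
    using n_triangle[of x y "s i"] n_minus_commute[of x "s i"] by linarith
  ultimately have "n (x - y) \<le> 0 + 0" by (intro LIMSEQ_le_const) auto
  then show ?thesis using n_nonneg[of "x - y"] by linarith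
qed

lemma n_tendsto_cong:
  assumes "n_tendsto s x" "\<And>i. n (s i - t i) = 0"
  shows "n_tendsto t x"
proof -
  have "n (t i - x) = n (s i - x)" for i
    using assms(2)[of i] n_minus_commute[of "s i" "t i"] by (intro n_eq) simp
  then show ?thesis using assms(1) by (simp add: n_tendsto_def)
qed

lemma n_tendsto_zero: "n_tendsto s 0 \<longleftrightarrow> (\<lambda>i. n (s i)) \<longlonglongrightarrow> 0"
  by (simp add: n_tendsto_def)

text \<open>Diagonal argument: nested infinite index sets on which the sequence oscillates by at
  most 1 / (k + 1), with an increasing choice of one index from each, produce a Cauchy
  sequence.\<close>

lemma subseq_n_convergent:
  fixes s :: "nat \<Rightarrow> 'v"
  assumes "\<And>I e. infinite I \<Longrightarrow> e > 0 \<Longrightarrow> \<exists>J\<subseteq>I. infinite J \<and> (\<forall>i\<in>J. \<forall>j\<in>J. n (s i - s j) \<le> e)"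
  obtains \<phi> :: "nat \<Rightarrow> nat" and x where "strict_mono \<phi>" "n_tendsto (\<lambda>i. s (\<phi> i)) x"
proof -
  define P where "P k p \<longleftrightarrow> infinite (fst p) \<and> snd p \<in> fst p \<and>
    (\<forall>i\<in>fst p. \<forall>j\<in>fst p. n (s i - s j) \<le> 1 / real (Suc k))" for k and p :: "nat set \<times> nat"
  define Q where "Q p p' \<longleftrightarrow> fst p' \<subseteq> fst p \<and> snd p < snd p'" for p p' :: "nat set \<times> nat"
  have "\<exists>f. \<forall>k. P k (f k) \<and> Q (f k) (f (Suc k))"
  proof (rule dependent_nat_choice)
    obtain J where "infinite J" "\<forall>i\<in>J. \<forall>j\<in>J. n (s i - s j) \<le> 1"
      using assms[of UNIV 1] by auto
    moreover from this obtain i where "i \<in> J" by (metis all_not_in_conv infinite_imp_nonempty)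
    ultimately show "\<exists>p. P 0 p" by (intro exI[of _ "(J, i)"]) (auto simp: P_def)
  next
    fix p k assume p: "P k p"
    then obtain J where J: "J \<subseteq> fst p" "infinite J" "\<forall>i\<in>J. \<forall>j\<in>J. n (s i - s j) \<le> 1 / real (Suc (Suc k))"
      using assms[of "fst p" "1 / real (Suc (Suc k))"] by (auto simp: P_def)
    then obtain i where "i \<in> J" "snd p < i" by (meson infinite_nat_iff_unbounded)
    then show "\<exists>p'. P (Suc k) p' \<and> Q p p'"
      using J by (intro exI[of _ "(J, i)"]) (auto simp: P_def Q_def)
  qed
  then obtain f where P: "\<And>k. P k (f k)" and Q: "\<And>k. Q (f k) (f (Suc k))" by blast
  define \<phi> where "\<phi> k = snd (f k)" for k
  have "strict_mono \<phi>"
    using Q by (simp add: strict_mono_Suc_iff \<phi>_def Q_def)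
  moreover have sub: "fst (f j) \<subseteq> fst (f i)" if "i \<le> j" for i j
    using lift_Suc_antimono_le[of "\<lambda>k. fst (f k)", OF _ that] Q by (auto simp: Q_def)
  have small: "n (s (\<phi> i) - s (\<phi> j)) \<le> 1 / real (Suc k)" if "i \<ge> k" "j \<ge> k" for i j k
  proof -
    have "\<phi> i \<in> fst (f k)" "\<phi> j \<in> fst (f k)"
      using P[of i] P[of j] sub[OF that(1)] sub[OF that(2)] by (auto simp: P_def \<phi>_def)
    then show ?thesis using P[of k] by (simp add: P_def)
  qed
  have "\<exists>x. (\<lambda>i. n (s (\<phi> i) - x)) \<longlonglongrightarrow> 0"
  proof (rule n_complete)
    fix e :: real assume "e > 0"
    then obtain k where "1 / real (Suc k) < e" by (metis nat_approx_posE)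
    then show "\<exists>i0. \<forall>i\<ge>i0. \<forall>j\<ge>i0. n (s (\<phi> i) - s (\<phi> j)) < e"
      using small by (meson le_less_trans)
  qed
  ultimately show thesis using that by (auto simp: n_tendsto_def)
qed

text \<open>The centres are arbitrary vectors. What counts later is that two images with the same
  centre are within 2 \<delta> of each other.\<close>

definition covered :: "('v \<Rightarrow> 'v) \<Rightarrow> real \<Rightarrow> bool" where
  "covered T \<delta> \<longleftrightarrow> (\<exists>M. finite M \<and> (\<forall>x. n x \<le> 1 \<longrightarrow> (\<exists>g\<in>M. n (T x - g) \<le> \<delta>)))"

text \<open>Pigeonhole on the finite net, after the vectors have been scaled into the unit ball:
  infinitely many images share a centre.\<close>

lemma covered_infinite_subset:
  assumes "covered T \<delta>" "T \<in> bounded_maps" "infinite I" "d > 0" "\<And>i. i \<in> I \<Longrightarrow> n (s i) \<le> d"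
  obtains J where "J \<subseteq> I" "infinite J" "\<And>i j. i \<in> J \<Longrightarrow> j \<in> J \<Longrightarrow> n (T (s i) - T (s j)) \<le> 2 * \<delta> * d"
proof -
  obtain M where M: "finite M" "\<And>x. n x \<le> 1 \<Longrightarrow> \<exists>g\<in>M. n (T x - g) \<le> \<delta>"
    using assms(1) by (auto simp: covered_def)
  define c where "c = complex_of_real (1 / d)"
  have "\<exists>g\<in>M. n (T (sc c (s i)) - g) \<le> \<delta>" if "i \<in> I" for i
    using assms(4,5) that by (intro M(2)) (auto simp: n_scale c_def norm_divide)
  then obtain g where g: "\<And>i. i \<in> I \<Longrightarrow> g i \<in> M \<and> n (T (sc c (s i)) - g i) \<le> \<delta>" by metis
  have "finite (g ` I)" using g M(1) by (meson finite_subset image_subsetI)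
  then obtain i0 where i0: "i0 \<in> I" "infinite {i \<in> I. g i = g i0}"
    using pigeonhole_infinite[OF assms(3)] by blast
  show thesis
  proof (rule that[of "{i \<in> I. g i = g i0}"])
    fix i j assume ij: "i \<in> {i \<in> I. g i = g i0}" "j \<in> {i \<in> I. g i = g i0}"
    have "n (T (sc c (s i)) - T (sc c (s j))) \<le> n (T (sc c (s i)) - g i) + n (T (sc c (s j)) - g j)"
      using n_triangle[of "T (sc c (s i))" "T (sc c (s j))" "g i"]
        n_minus_commute[of "g j" "T (sc c (s j))"] ij by auto
    also have "\<dots> \<le> 2 * \<delta>" using g[of i] g[of j] ij by simp
    finally have "n (sc c (T (s i) - T (s j))) \<le> 2 * \<delta>"
      unfolding bm_scale[OF assms(2)] scale_right_diff_distrib .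
    then show "n (T (s i) - T (s j)) \<le> 2 * \<delta> * d"
      using assms(4) unfolding n_scale c_def by (simp add: norm_divide field_simps)
  qed (use i0 in auto)
qed

definition closed_subspace :: "'v set \<Rightarrow> bool" where
  "closed_subspace W \<longleftrightarrow> 0 \<in> W \<and> (\<forall>x\<in>W. \<forall>y\<in>W. x + y \<in> W) \<and> (\<forall>c. \<forall>x\<in>W. sc c x \<in> W) \<and>
    (\<forall>s x. (\<forall>i. s i \<in> W) \<longrightarrow> n_tendsto s x \<longrightarrow> x \<in> W)"

text \<open>Riesz's lemma. The distance d from x to W is positive because W is closed; w realises it
  up to a factor less than 2, and x - w is normalised.\<close>

lemma almost_orthogonal:
  assumes W: "closed_subspace W" and x: "x \<notin> W"
  shows "\<exists>c w. w \<in> W \<and> c > 0 \<and> n (sc (complex_of_real c) (x - w)) = 1 \<and>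
    (\<forall>v\<in>W. n (sc (complex_of_real c) (x - w) - v) > 1/2)"
proof -
  have zero: "0 \<in> W" and add: "\<And>x y. x \<in> W \<Longrightarrow> y \<in> W \<Longrightarrow> x + y \<in> W"
    and scale: "\<And>c x. x \<in> W \<Longrightarrow> sc c x \<in> W"
    and closed: "\<And>s x. (\<And>i. s i \<in> W) \<Longrightarrow> n_tendsto s x \<Longrightarrow> x \<in> W"
    using W unfolding closed_subspace_def by blast+
  define d where "d = Inf ((\<lambda>w. n (x - w)) ` W)"
  have bdd: "bdd_below ((\<lambda>w. n (x - w)) ` W)" by (rule bdd_belowI[of _ 0]) auto
  have d_le: "d \<le> n (x - w)" if "w \<in> W" for w
    unfolding d_def by (rule cInf_lower[OF _ bdd]) (use that in auto)
  have "d > 0"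
  proof (rule ccontr)
    assume "\<not> d > 0"
    have "\<exists>w\<in>W. n (x - w) < 1 / real (Suc i)" for i
    proof -
      have "Inf ((\<lambda>w. n (x - w)) ` W) < 1 / real (Suc i)"
        using \<open>\<not> d > 0\<close> unfolding d_def by (smt (verit) divide_pos_pos of_nat_0_less_iff zero_less_Suc)
      then show ?thesis using cInf_lessD[of "(\<lambda>w. n (x - w)) ` W"] zero by blast
    qed
    then obtain s where s: "\<And>i. s i \<in> W" "\<And>i. n (x - s i) < 1 / real (Suc i)" by metis
    have "n_tendsto s x"
      unfolding n_tendsto_def
    proof (rule Lim_null_comparison)
      show "\<forall>\<^sub>F i in sequentially. norm (n (s i - x)) \<le> 1 / real (Suc i)"
        using s(2) n_minus_commute[of x] by (auto simp: less_imp_le)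
      show "(\<lambda>i. 1 / real (Suc i)) \<longlonglongrightarrow> 0"
        using LIMSEQ_inverse_real_of_nat by (simp add: inverse_eq_divide)
    qed
    then show False using closed s(1) x by blast
  qed
  then have "Inf ((\<lambda>w. n (x - w)) ` W) < 2 * d" unfolding d_def by simp
  then obtain w where w: "w \<in> W" "n (x - w) < 2 * d"
    using cInf_lessD[of "(\<lambda>w. n (x - w)) ` W"] zero by blast
  have pos: "n (x - w) > 0" using d_le[OF w(1)] \<open>d > 0\<close> by simp
  define c where "c = 1 / n (x - w)"
  show ?thesis
  proof (intro exI[of _ c] exI[of _ w] conjI ballI)
    show "w \<in> W" by (rule w(1))
    show "c > 0" using pos by (simp add: c_def)
    show "n (sc (complex_of_real c) (x - w)) = 1" using pos by (simp add: n_scale c_def norm_divide)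
    fix v assume v: "v \<in> W"
    have "sc (complex_of_real c) (x - w) - v
        = sc (complex_of_real c) (x - (w + sc (complex_of_real (n (x - w))) v))"
      using pos by (simp add: c_def scale_right_diff_distrib scale_right_distrib algebra_simps flip: of_real_mult)
    then have "n (sc (complex_of_real c) (x - w) - v) = c * n (x - (w + sc (complex_of_real (n (x - w))) v))"
      using pos by (simp add: n_scale c_def norm_divide)
    moreover have "c * n (x - (w + sc (complex_of_real (n (x - w))) v)) \<ge> c * d"
      using pos by (intro mult_left_mono d_le add w v scale) (simp add: c_def)
    moreover have "c * d > 1 / 2" using pos w(2) by (simp add: c_def field_simps)
    ultimately show "n (sc (complex_of_real c) (x - w) - v) > 1/2" by linarith
  qed
qed

end

section \<open>Ascent, descent and a Fredholm inverse of 1 - T\<close>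

lemma funpow_commute: "(\<And>x. f (g x) = g (f x)) \<Longrightarrow> f ((g ^^ k) x) = (g ^^ k) (f x)"
  by (induction k) auto

text \<open>With the constant 1/4, T^m halves the oscillation on some infinite subset of any bounded
  sequence. It also contradicts sequences in the unit ball whose images are more than 1/2 apart, and
  1/2 is the separation that Riesz's lemma provides.\<close>

locale condensing_map = seminormed_space sc n
  for sc :: "complex \<Rightarrow> 'v::ab_group_add \<Rightarrow> 'v" and n :: "'v \<Rightarrow> real" +
  fixes T :: "'v \<Rightarrow> 'v" and m :: nat
  assumes T: "T \<in> bounded_maps" and condensing: "covered (T ^^ m) (1/4)"
begin

definition U :: "'v \<Rightarrow> 'v" where "U x = x - T x"

text \<open>The geometric sum, which inverts \<open>U\<close> modulo T^m.\<close>

definition G :: "'v \<Rightarrow> 'v" where "G x = (\<Sum>l<m. (T ^^ l) x)"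

lemma U: "U \<in> bounded_maps"
proof -
  have "U = (\<lambda>x. x - T x)" by (rule ext) (simp add: U_def)
  then show ?thesis using bm_minus[OF bm_id T] by simp
qed

lemma G: "G \<in> bounded_maps"
proof -
  have "G = (\<lambda>x. \<Sum>l<m. (T ^^ l) x)" by (rule ext) (simp add: G_def)
  then show ?thesis using bm_summed[of "{..<m}" "\<lambda>l. T ^^ l"] bm_funpow[OF T] by simp
qed

lemmas Tm = bm_funpow[OF T, of m]
lemmas Uk = bm_funpow[OF U]

lemma U_T_commute: "U (T x) = T (U x)"
  by (simp add: U_def bm_simps[OF T])

lemma U_G: "U (G x) = x - (T ^^ m) x"
proof -
  have "U (G x) = (\<Sum>l<m. (T ^^ l) x - (T ^^ Suc l) x)"
    by (simp add: U_def G_def bm_simps[OF T] sum_subtractf)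
  also have "\<dots> = x - (T ^^ m) x" by (induction m) simp_all
  finally show ?thesis .
qed

lemma G_U: "G (U x) = x - (T ^^ m) x"
proof -
  have "(T ^^ l) (U x) = U ((T ^^ l) x)" for l
    using funpow_commute[of U T l x, OF U_T_commute] by simp
  then show ?thesis using U_G by (simp add: G_def bm_simps[OF U])
qed

text \<open>Since x = G U x + T^m x, a difference of two terms of the sequence is the sum of a part
  that tends to 0, because U s converges, and a part that the net for T^m halves on an infinite
  subset. Every infinite index set thus contains another on which the oscillation has shrunk by the
  factor 3/4.\<close>

lemma proper:
  assumes bdd: "\<And>i. n (s i) \<le> C" and conv: "n_tendsto (\<lambda>i. U (s i)) y"
  obtains \<phi> x where "strict_mono \<phi>" "n_tendsto (\<lambda>i. s (\<phi> i)) x"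
proof -
  define D where "D = max C 1"
  have D: "D > 0" "\<And>i. n (s i) \<le> D" using bdd by (auto simp: D_def le_max_iff_disj)
  have GU: "n_tendsto (\<lambda>i. G (U (s i))) (G y)" by (rule n_tendsto_map[OF G conv])
  have shrink: "\<exists>J\<subseteq>I. infinite J \<and> (\<forall>i\<in>J. \<forall>j\<in>J. n (s i - s j) \<le> 3/4 * d)"
    if I: "infinite I" "d > 0" "\<forall>i\<in>I. \<forall>j\<in>I. n (s i - s j) \<le> d" for I d
  proof -
    \<comment> \<open>Subtracting a fixed term turns the bound d on the oscillation into a bound on
      norms, to which the covering applies.\<close>
    obtain i0 where i0: "i0 \<in> I" using I(1) by (metis all_not_in_conv infinite_imp_nonempty)
    obtain J where J: "J \<subseteq> I" "infinite J"
      "\<And>i j. i \<in> J \<Longrightarrow> j \<in> J \<Longrightarrow> n ((T ^^ m) (s i - s i0) - (T ^^ m) (s j - s i0)) \<le> 2 * (1/4) * d"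
      using covered_infinite_subset[OF condensing Tm I(1,2), of "\<lambda>i. s i - s i0"] I(3) i0 by blast
    obtain i1 where i1: "\<And>i. i \<ge> i1 \<Longrightarrow> n (G (U (s i)) - G y) < d / 8"
      using order_tendstoD(2)[OF GU[unfolded n_tendsto_def], of "d / 8"] I(2)
      by (auto simp: eventually_sequentially)
    show ?thesis
    proof (intro exI[of _ "J - {..<i1}"] conjI ballI)
      show "infinite (J - {..<i1})" using J(2) by simp
      fix i j assume ij: "i \<in> J - {..<i1}" "j \<in> J - {..<i1}"
      have eq: "s i - s j = (G (U (s i)) - G (U (s j)))
          + ((T ^^ m) (s i - s i0) - (T ^^ m) (s j - s i0))"
        by (simp add: G_U bm_simps[OF Tm])
      have "n (G (U (s i)) - G (U (s j))) \<le> n (G (U (s i)) - G y) + n (G (U (s j)) - G y)"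
        using n_triangle[of "G (U (s i))" "G (U (s j))" "G y"] n_minus_commute[of "G y" "G (U (s j))"] by linarith
      also have "\<dots> \<le> d / 4" using i1[of i] i1[of j] ij by auto
      finally have "n (G (U (s i)) - G (U (s j))) \<le> d / 4" .
      moreover have "n ((T ^^ m) (s i - s i0) - (T ^^ m) (s j - s i0)) \<le> d / 2"
        using J(3)[of i j] ij by simp
      ultimately show "n (s i - s j) \<le> 3/4 * d"
        unfolding eq by (intro order_trans[OF n_add]) simp
    qed (use J in auto)
  qed
  show thesis
  proof (rule subseq_n_convergent[of s, OF _ that])
    fix I :: "nat set" and e :: real assume Ie: "infinite I" "e > 0"
    have iter: "\<exists>J\<subseteq>I. infinite J \<and> (\<forall>i\<in>J. \<forall>j\<in>J. n (s i - s j) \<le> (3/4) ^ k * (2 * D))" for k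
    proof (induction k)
      case 0
      have "n (s i - s j) \<le> 2 * D" for i j
        using n_diff[of "s i" "s j"] D(2)[of i] D(2)[of j] by linarith
      then show ?case using Ie by auto
    next
      case (Suc k)
      then obtain J where J: "J \<subseteq> I" "infinite J" "\<forall>i\<in>J. \<forall>j\<in>J. n (s i - s j) \<le> (3/4) ^ k * (2 * D)"
        by blast
      show ?case using shrink[OF J(2) _ J(3)] D J(1) by (fastforce simp: mult.assoc)
    qed
    have "(\<lambda>k. (3/4::real) ^ k * (2 * D)) \<longlonglongrightarrow> 0"
      by (intro tendsto_mult_left_zero LIMSEQ_power_zero) simp
    then obtain k where "(3/4) ^ k * (2 * D) < e"
      using order_tendstoD(2)[of _ 0 sequentially e] Ie(2) by (fastforce simp: eventually_sequentially)
    then show "\<exists>J\<subseteq>I. infinite J \<and> (\<forall>i\<in>J. \<forall>j\<in>J. n (s i - s j) \<le> e)"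
      using iter[of k] by (meson less_imp_le order_trans)
  qed auto
qed

lemma proper_power:
  assumes "\<And>i. n (s i) \<le> C" "n_tendsto (\<lambda>i. (U ^^ k) (s i)) y"
  shows "\<exists>\<phi> x. strict_mono \<phi> \<and> n_tendsto (\<lambda>i. s (\<phi> i)) x"
  using assms
proof (induction k arbitrary: s y)
  case 0
  then show ?case by (intro exI[of _ id] exI[of _ y]) (auto simp: strict_mono_def)
next
  case (Suc k)
  obtain D where D: "D > 0" "\<And>x. n ((U ^^ k) x) \<le> D * n x" using bm_bound[OF Uk] by metis
  have "n ((U ^^ k) (s i)) \<le> D * C" for i
    using D(2)[of "s i"] mult_left_mono[OF Suc.prems(1)[of i], of D] D(1) by (metis order_trans less_imp_le)
  then obtain \<phi> x where \<phi>: "strict_mono \<phi>" "n_tendsto (\<lambda>i. (U ^^ k) (s (\<phi> i))) x"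
    using proper[of "\<lambda>i. (U ^^ k) (s i)" "D * C" y] Suc.prems(2) by auto
  obtain \<psi> z where "strict_mono \<psi>" "n_tendsto (\<lambda>i. s (\<phi> (\<psi> i))) z"
    using Suc.IH[of "\<lambda>i. s (\<phi> i)" x] Suc.prems(1) \<phi>(2) by blast
  then show ?case
    using \<phi>(1) by (intro exI[of _ "\<lambda>i. \<phi> (\<psi> i)"] exI[of _ z]) (auto simp: strict_mono_def)
qed

definition Ker :: "nat \<Rightarrow> 'v set" where "Ker k = {x. n ((U ^^ k) x) = 0}"

text \<open>Limits are unique only up to null vectors, so a set closed under limits contains all
  null vectors once it contains 0; the range is enlarged accordingly.\<close>

definition Ran :: "nat \<Rightarrow> 'v set" where "Ran k = {x. \<exists>y. n (x - (U ^^ k) y) = 0}"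

lemma n_eq_0_trans: "n (x - y) = 0 \<Longrightarrow> n (y - z) = 0 \<Longrightarrow> n (x - z) = 0"
  using n_triangle[of x z y] n_nonneg[of "x - z"] by linarith

lemma Ker_zero: "0 \<in> Ker k" by (simp add: Ker_def bm_zero[OF Uk])

lemma Ker_add: "x \<in> Ker k \<Longrightarrow> y \<in> Ker k \<Longrightarrow> x + y \<in> Ker k"
  using n_add[of "(U ^^ k) x" "(U ^^ k) y"] n_nonneg[of "(U ^^ k) x + (U ^^ k) y"]
  by (simp add: Ker_def bm_add[OF Uk])

lemma Ker_scale: "x \<in> Ker k \<Longrightarrow> sc c x \<in> Ker k"
  by (simp add: Ker_def bm_scale[OF Uk] n_scale)

lemma Ker_diff: "x \<in> Ker k \<Longrightarrow> y \<in> Ker k \<Longrightarrow> x - y \<in> Ker k"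
  using Ker_add[of x k "sc (-1) y"] Ker_scale[of y k "-1"] by simp

lemma Ker_closed: "(\<And>i. s i \<in> Ker k) \<Longrightarrow> n_tendsto s x \<Longrightarrow> x \<in> Ker k"
proof -
  assume s: "\<And>i. s i \<in> Ker k" and x: "n_tendsto s x"
  have "n_tendsto (\<lambda>i. (U ^^ k) (s i)) 0" using s by (simp add: n_tendsto_def Ker_def)
  then have "n ((U ^^ k) x - 0) = 0" by (rule n_tendsto_unique[OF n_tendsto_map[OF Uk x]])
  then show ?thesis by (simp add: Ker_def)
qed

lemma Ker_subspace: "closed_subspace (Ker k)"
  unfolding closed_subspace_def by (auto intro: Ker_zero Ker_add Ker_scale Ker_closed)

lemma Ker_Suc: "x \<in> Ker k \<Longrightarrow> x \<in> Ker (Suc k)"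
  by (simp add: Ker_def bm_null[OF U])

lemma Ker_mono: "i \<le> j \<Longrightarrow> Ker i \<subseteq> Ker j"
  by (rule lift_Suc_mono_le) (use Ker_Suc in auto)

lemma Ran_zero: "0 \<in> Ran k"
  unfolding Ran_def using bm_zero[OF Uk, of k] by (auto intro!: exI[of _ 0])

lemma Ran_add: assumes "x \<in> Ran k" "y \<in> Ran k" shows "x + y \<in> Ran k"
proof -
  obtain a b where "n (x - (U ^^ k) a) = 0" "n (y - (U ^^ k) b) = 0" using assms by (auto simp: Ran_def)
  then have "n (x + y - (U ^^ k) (a + b)) \<le> 0"
    using n_add[of "x - (U ^^ k) a" "y - (U ^^ k) b"] by (simp add: bm_add[OF Uk] algebra_simps)
  then show ?thesis using n_nonneg[of "x + y - (U ^^ k) (a + b)"] by (auto simp: Ran_def)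
qed

lemma Ran_scale: assumes "x \<in> Ran k" shows "sc c x \<in> Ran k"
proof -
  obtain a where "n (x - (U ^^ k) a) = 0" using assms by (auto simp: Ran_def)
  then have "n (sc c x - (U ^^ k) (sc c a)) = 0"
    by (simp add: bm_scale[OF Uk] n_scale flip: scale_right_diff_distrib)
  then show ?thesis by (auto simp: Ran_def)
qed

lemma Ran_diff: "x \<in> Ran k \<Longrightarrow> y \<in> Ran k \<Longrightarrow> x - y \<in> Ran k"
  using Ran_add[of x k "sc (-1) y"] Ran_scale[of y k "-1"] by simp

lemma U_Ran: "x \<in> Ran k \<Longrightarrow> U x \<in> Ran (Suc k)"
proof -
  assume "x \<in> Ran k"
  then obtain a where "n (x - (U ^^ k) a) = 0" by (auto simp: Ran_def)
  then have "n (U x - (U ^^ Suc k) a) = 0" using bm_null[OF U] by (simp flip: bm_diff[OF U])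
  then show ?thesis unfolding Ran_def by blast
qed

lemma Ran_Suc: "x \<in> Ran (Suc k) \<Longrightarrow> x \<in> Ran k"
  by (auto simp: Ran_def funpow_Suc_right simp del: funpow.simps)

lemma Ran_mono: "i \<le> j \<Longrightarrow> Ran j \<subseteq> Ran i"
  by (rule lift_Suc_antimono_le) (use Ran_Suc in auto)

lemma Ran_commuting:
  assumes "x \<in> Ran k" "S \<in> bounded_maps" "\<And>x. S (U x) = U (S x)"
  shows "S x \<in> Ran k"
proof -
  obtain a where "n (x - (U ^^ k) a) = 0" using assms by (auto simp: Ran_def)
  then have "n (S x - S ((U ^^ k) a)) = 0"
    using bm_null[OF assms(2)] by (simp flip: bm_diff[OF assms(2)])
  then show ?thesis
    using funpow_commute[of S U k a, OF assms(3)] unfolding Ran_def by force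
qed

lemma Ker_commuting:
  assumes "x \<in> Ker k" "S \<in> bounded_maps" "\<And>x. S (U x) = U (S x)"
  shows "S x \<in> Ker k"
  using funpow_commute[of S U k x, OF assms(3)] bm_null[OF assms(2), of "(U ^^ k) x"] assms(1)
  by (simp add: Ker_def)

lemma Tm_commute: "(T ^^ m) (U x) = U ((T ^^ m) x)"
  using funpow_commute[of U T m x, OF U_T_commute] by simp

text \<open>Otherwise there are unit vectors z_i at distance more than 1/2 from the kernel with U^k
  z_i tending to 0. Properness supplies a convergent subsequence; its limit lies in the kernel and
  contradicts the distance.\<close>

lemma bounded_below:
  obtains C where "\<And>x. \<exists>w\<in>Ker k. n (x - w) \<le> C * n ((U ^^ k) x)"
proof (rule ccontr)
  assume "\<not> thesis"
  then have "\<exists>x. \<forall>w\<in>Ker k. n (x - w) > real i * n ((U ^^ k) x)" for i :: nat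
    using that[of "real i"] by (metis not_le)
  then obtain x where x: "\<And>i w. w \<in> Ker k \<Longrightarrow> n (x i - w) > real i * n ((U ^^ k) (x i))" by metis
  have "\<exists>z. n z = 1 \<and> (\<forall>v\<in>Ker k. n (z - v) > 1/2) \<and> real i * n ((U ^^ k) z) \<le> 1" for i
  proof -
    have "x i \<notin> Ker k" using x[of "x i" i] by (auto simp: Ker_def)
    then obtain c w where cw: "w \<in> Ker k" "c > 0" "n (sc (complex_of_real c) (x i - w)) = 1"
      "\<And>v. v \<in> Ker k \<Longrightarrow> n (sc (complex_of_real c) (x i - w) - v) > 1/2"
      using almost_orthogonal[OF Ker_subspace \<open>x i \<notin> Ker k\<close>] by blast
    have "n ((U ^^ k) (x i - w)) = n ((U ^^ k) (x i))"
      using cw(1) by (intro n_eq) (simp add: Ker_def bm_diff[OF Uk])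
    then have "real i * n ((U ^^ k) (sc (complex_of_real c) (x i - w))) = c * (real i * n ((U ^^ k) (x i)))"
      using cw(2) by (simp add: bm_scale[OF Uk] n_scale)
    also have "\<dots> \<le> c * n (x i - w)" using cw(2) x[OF cw(1), of i] by simp
    also have "\<dots> = 1" using cw(2,3) by (simp add: n_scale)
    finally show ?thesis using cw by blast
  qed
  then obtain z where z: "\<And>i. n (z i) = 1" "\<And>i v. v \<in> Ker k \<Longrightarrow> n (z i - v) > 1/2"
    "\<And>i::nat. real i * n ((U ^^ k) (z i)) \<le> 1" by metis
  have lim: "n_tendsto (\<lambda>i. (U ^^ k) (z i)) 0"
    unfolding n_tendsto_zero
  proof (rule Lim_null_comparison[OF _ lim_inverse_n'])
    show "\<forall>\<^sub>F i in sequentially. norm (n ((U ^^ k) (z i))) \<le> 1 / real i"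
      using eventually_gt_at_top[of 0]
      by eventually_elim (use z(3) in \<open>simp add: field_simps\<close>)
  qed
  then obtain \<phi> y where \<phi>: "strict_mono \<phi>" "n_tendsto (\<lambda>i. z (\<phi> i)) y"
    using proper_power[of z 1 k 0] z(1) by auto
  have "n ((U ^^ k) y - 0) = 0"
    using n_tendsto_unique[OF n_tendsto_map[OF Uk \<phi>(2)] n_tendsto_subseq[OF lim \<phi>(1)]] .
  then have "n (z (\<phi> i) - y) > 1/2" for i using z(2)[of y "\<phi> i"] by (simp add: Ker_def)
  moreover have "\<forall>\<^sub>F i in sequentially. n (z (\<phi> i) - y) < 1/2"
    using \<phi>(2) unfolding n_tendsto_def by (rule order_tendstoD) simp
  ultimately show False by (auto simp: eventually_sequentially dest: less_asym)
qed

text \<open>Preimages of a convergent sequence become bounded after a shift by elements of the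
  kernel, and properness then extracts a convergent subsequence of preimages.\<close>

lemma Ran_closed:
  assumes y: "\<And>i. y i \<in> Ran k" "n_tendsto y y'"
  shows "y' \<in> Ran k"
proof -
  obtain x where x: "\<And>i. n (y i - (U ^^ k) (x i)) = 0" using y(1) unfolding Ran_def by auto metis
  obtain C where C: "\<And>x. \<exists>w\<in>Ker k. n (x - w) \<le> C * n ((U ^^ k) x)" using bounded_below by blast
  then have "\<forall>i. \<exists>w. w \<in> Ker k \<and> n (x i - w) \<le> C * n ((U ^^ k) (x i))" by blast
  then obtain w where w: "\<And>i. w i \<in> Ker k" "\<And>i. n (x i - w i) \<le> C * n ((U ^^ k) (x i))" by metis
  have "Bseq (\<lambda>i. n (y i))" using n_tendsto_norm[OF y(2)] by (intro convergent_imp_Bseq convergentI)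
  then obtain D where D: "\<And>i. n (y i) \<le> D" unfolding Bseq_def by auto
  have "n (x i - w i) \<le> \<bar>C\<bar> * D" for i
  proof -
    have "n (x i - w i) \<le> C * n (y i)" using w(2)[of i] n_eq[OF x[of i]] by simp
    also have "\<dots> \<le> \<bar>C\<bar> * D" using D[of i] by (intro mult_mono) auto
    finally show ?thesis .
  qed
  moreover have "n_tendsto (\<lambda>i. (U ^^ k) (x i - w i)) y'"
  proof (rule n_tendsto_cong[OF y(2)])
    fix i
    have "n ((U ^^ k) (x i) - (U ^^ k) (x i - w i)) = 0" using w(1)[of i] by (simp add: Ker_def bm_diff[OF Uk])
    then show "n (y i - (U ^^ k) (x i - w i)) = 0" using x[of i] n_eq_0_trans by blast
  qed
  ultimately obtain \<phi> z where \<phi>: "strict_mono \<phi>" "n_tendsto (\<lambda>i. x (\<phi> i) - w (\<phi> i)) z"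
    using proper_power[of "\<lambda>i. x i - w i"] by blast
  have "n (y' - (U ^^ k) z) = 0"
    using n_tendsto_unique[OF n_tendsto_subseq[OF \<open>n_tendsto (\<lambda>i. (U ^^ k) (x i - w i)) y'\<close> \<phi>(1)]
        n_tendsto_map[OF Uk \<phi>(2)]] .
  then show ?thesis by (auto simp: Ran_def)
qed

lemma Ran_subspace: "closed_subspace (Ran k)"
  unfolding closed_subspace_def by (auto intro: Ran_zero Ran_add Ran_scale Ran_closed)

lemma not_separated:
  assumes "\<And>i. n (z i) \<le> 1" "\<And>i j::nat. i < j \<Longrightarrow> n ((T ^^ m) (z i) - (T ^^ m) (z j)) > 1/2"
  shows False
proof -
  obtain J where J: "infinite J" "\<And>i j. i \<in> J \<Longrightarrow> j \<in> J \<Longrightarrow> n ((T ^^ m) (z i) - (T ^^ m) (z j)) \<le> 2 * (1/4) * 1"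
    using covered_infinite_subset[OF condensing Tm, of UNIV 1 z] assms(1) by auto
  obtain i where "i \<in> J" using J(1) by (metis all_not_in_conv infinite_imp_nonempty)
  moreover obtain j where "j \<in> J" "i < j" using J(1) by (meson infinite_nat_iff_unbounded)
  ultimately show False using J(2)[of i j] assms(2)[of i j] by simp
qed

text \<open>If the kernels grew forever, Riesz's lemma would give unit vectors z_k in
  \<open>Ker (Suc k)\<close> far from \<open>Ker k\<close>. For i < j one has T^m z_j = z_j - G U
  z_j, where G U z_j as well as T^m z_i lie in \<open>Ker j\<close>; so T^m z_i and T^m z_j would be
  more than 1/2 apart.\<close>

lemma ascent: "\<exists>a. Ker (Suc a) \<subseteq> Ker a"
proof (rule ccontr)
  assume a: "\<not> ?thesis"
  have "\<exists>z. n z = 1 \<and> z \<in> Ker (Suc k) \<and> (\<forall>v\<in>Ker k. n (z - v) > 1/2)" for k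
  proof -
    obtain x where x: "x \<in> Ker (Suc k)" "x \<notin> Ker k" using a by blast
    then obtain c w where "w \<in> Ker k" "n (sc (complex_of_real c) (x - w)) = 1"
      "\<And>v. v \<in> Ker k \<Longrightarrow> n (sc (complex_of_real c) (x - w) - v) > 1/2"
      using almost_orthogonal[OF Ker_subspace x(2)] by blast
    then show ?thesis
      using Ker_scale[OF Ker_diff[OF x(1) Ker_Suc]] by blast
  qed
  then obtain z where z: "\<And>k. n (z k) = 1" "\<And>k. z k \<in> Ker (Suc k)" "\<And>k v. v \<in> Ker k \<Longrightarrow> n (z k - v) > 1/2"
    by metis
  show False
  proof (rule not_separated[of z])
    fix i j :: nat assume "i < j"
    then have "z i \<in> Ker j" using z(2)[of i] Ker_mono[of "Suc i" j] by auto
    then have "(T ^^ m) (z i) \<in> Ker j" by (rule Ker_commuting[OF _ Tm Tm_commute])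
    moreover have "U (z j) \<in> Ker j" using z(2)[of j] by (simp add: Ker_def funpow_swap1)
    then have "G (U (z j)) \<in> Ker j" by (rule Ker_commuting[OF _ G]) (simp add: U_G G_U)
    ultimately have "n (z j - (G (U (z j)) + (T ^^ m) (z i))) > 1/2" by (intro z(3) Ker_add)
    then show "n ((T ^^ m) (z i) - (T ^^ m) (z j)) > 1/2"
      using n_minus_commute[of "(T ^^ m) (z j)" "(T ^^ m) (z i)"] by (simp add: G_U)
  qed (simp add: z(1))
qed

text \<open>The mirror image of the ascent. For i < j now T^m z_i = z_i - G U z_i is used, and G U
  z_i and T^m z_j lie in \<open>Ran (Suc i)\<close>. Riesz's lemma applies because the ranges are
  closed.\<close>

lemma descent: "\<exists>d. Ran d \<subseteq> Ran (Suc d)"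
proof (rule ccontr)
  assume a: "\<not> ?thesis"
  have "\<exists>z. n z = 1 \<and> z \<in> Ran k \<and> (\<forall>v\<in>Ran (Suc k). n (z - v) > 1/2)" for k
  proof -
    obtain x where x: "x \<in> Ran k" "x \<notin> Ran (Suc k)" using a by blast
    then obtain c w where "w \<in> Ran (Suc k)" "n (sc (complex_of_real c) (x - w)) = 1"
      "\<And>v. v \<in> Ran (Suc k) \<Longrightarrow> n (sc (complex_of_real c) (x - w) - v) > 1/2"
      using almost_orthogonal[OF Ran_subspace x(2)] by blast
    then show ?thesis
      using Ran_scale[OF Ran_diff[OF x(1) Ran_Suc]] by blast
  qed
  then obtain z where z: "\<And>k. n (z k) = 1" "\<And>k. z k \<in> Ran k" "\<And>k v. v \<in> Ran (Suc k) \<Longrightarrow> n (z k - v) > 1/2"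
    by metis
  show False
  proof (rule not_separated[of z])
    fix i j :: nat assume "i < j"
    then have "z j \<in> Ran (Suc i)" using z(2)[of j] Ran_mono[of "Suc i" j] by auto
    then have "(T ^^ m) (z j) \<in> Ran (Suc i)" by (rule Ran_commuting[OF _ Tm Tm_commute])
    moreover have "G (U (z i)) \<in> Ran (Suc i)"
      by (rule Ran_commuting[OF U_Ran[OF z(2)] G]) (simp add: U_G G_U)
    ultimately have "n (z i - (G (U (z i)) + (T ^^ m) (z j))) > 1/2" by (intro z(3) Ran_add)
    then show "n ((T ^^ m) (z i) - (T ^^ m) (z j)) > 1/2"
      by (simp add: G_U)
  qed (simp add: z(1))
qed

lemma Ker_Ran_stable: "\<exists>p. \<forall>k\<ge>p. Ker k \<subseteq> Ker p \<and> Ran p \<subseteq> Ran k"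
proof -
  obtain a where a: "Ker (Suc a) \<subseteq> Ker a" using ascent by blast
  obtain d where d: "Ran d \<subseteq> Ran (Suc d)" using descent by blast
  have K: "Ker (a + k) \<subseteq> Ker a" for k
  proof (induction k)
    case (Suc k)
    show ?case
    proof
      fix x assume "x \<in> Ker (a + Suc k)"
      then have "U x \<in> Ker (a + k)" by (simp add: Ker_def funpow_swap1)
      then have "U x \<in> Ker a" using Suc by auto
      then have "x \<in> Ker (Suc a)" by (simp add: Ker_def funpow_swap1)
      then show "x \<in> Ker a" using a by auto
    qed
  qed simp
  have R: "Ran d \<subseteq> Ran (d + k)" for k
  proof (induction k)
    case (Suc k)
    show ?case
    proof
      fix x assume "x \<in> Ran d"
      then have "x \<in> Ran (Suc d)" using d by auto
      then obtain y where y: "n (x - U ((U ^^ d) y)) = 0" by (auto simp: Ran_def)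
      have "(U ^^ d) y \<in> Ran d" by (auto simp: Ran_def intro!: exI[of _ y])
      then have "(U ^^ d) y \<in> Ran (d + k)" using Suc by auto
      then have "U ((U ^^ d) y) \<in> Ran (d + Suc k)" using U_Ran by simp
      then show "x \<in> Ran (d + Suc k)" using y n_eq_0_trans unfolding Ran_def by blast
    qed
  qed simp
  show ?thesis
  proof (intro exI[of _ "max a d"] allI impI conjI)
    fix k assume k: "k \<ge> max a d"
    have "Ker k \<subseteq> Ker a" using K[of "k - a"] k by simp
    then show "Ker k \<subseteq> Ker (max a d)" using Ker_mono[of a "max a d"] by auto
    have "Ran d \<subseteq> Ran k" using R[of "k - d"] k by simp
    then show "Ran (max a d) \<subseteq> Ran k" using Ran_mono[of d "max a d"] by auto
  qed
qed

text \<open>\<open>B\<close> inverts \<open>U\<close> on the range of \<open>U\<^sup>p\<close> and kills its complement, the kernel of \<open>U\<^sup>p\<close>. It is chosen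
  pointwise and hence linear only up to the kernel of the seminorm.\<close>

theorem fredholm_inverse:
  obtains B p C where
    "\<And>x. n (B x) \<le> C * n x"
    "\<And>x y. n (B (x + y) - (B x + B y)) = 0"
    "\<And>c x. n (B (sc c x) - sc c (B x)) = 0"
    "\<And>x. n ((U ^^ p) (U (B x) - x)) = 0"
    "\<And>x. n ((U ^^ p) (B (U x) - x)) = 0"
proof -
  obtain p where K: "\<And>k. k \<ge> p \<Longrightarrow> Ker k \<subseteq> Ker p" and R: "\<And>k. k \<ge> p \<Longrightarrow> Ran p \<subseteq> Ran k"
    using Ker_Ran_stable by blast
  \<comment> \<open>Up to null vectors x = U^p y, hence U^(2p) y = 0, and stability of the kernels
    turns this into U^p y = 0.\<close>
  have KR: "n x = 0" if x: "x \<in> Ker p" "x \<in> Ran p" for x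
  proof -
    obtain y where y: "n (x - (U ^^ p) y) = 0" using x(2) by (auto simp: Ran_def)
    have "n ((U ^^ p) (x - (U ^^ p) y)) = 0" using bm_null[OF Uk y] .
    then have "n ((U ^^ p) ((U ^^ p) y)) = 0"
      using x(1) n_eq[of "(U ^^ p) x" "(U ^^ p) ((U ^^ p) y)"] by (simp add: Ker_def bm_diff[OF Uk])
    then have "y \<in> Ker (p + p)" by (simp add: Ker_def funpow_add)
    then have "y \<in> Ker p" using K[of "p + p"] by auto
    then show ?thesis using n_eq[OF y] by (simp add: Ker_def)
  qed
  \<comment> \<open>Stability of the ranges allows U^p x to be written as U^(2p+1) y; then g = U^p y
    solves x = U g modulo \<open>Ker p\<close>.\<close>
  have ex: "\<exists>g\<in>Ran p. n ((U ^^ p) (x - U g)) = 0" for x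
  proof -
    have "(U ^^ p) x \<in> Ran p" by (auto simp: Ran_def intro!: exI[of _ x])
    then have "(U ^^ p) x \<in> Ran (Suc p + p)" using R[of "Suc p + p"] by auto
    then obtain y where y: "n ((U ^^ p) x - (U ^^ (Suc p + p)) y) = 0" by (auto simp only: Ran_def mem_Collect_eq)
    have "(U ^^ (Suc p + p)) y = (U ^^ p) (U ((U ^^ p) y))"
      by (simp add: funpow_add funpow_swap1)
    then have "n ((U ^^ p) (x - U ((U ^^ p) y))) = 0"
      using y by (simp add: bm_diff[OF Uk])
    moreover have "(U ^^ p) y \<in> Ran p" by (auto simp: Ran_def intro!: exI[of _ y])
    ultimately show ?thesis by blast
  qed
  \<comment> \<open>A substitute for the open mapping theorem. If no bound existed, normalised h_i
    in \<open>Ran p\<close> would satisfy U^(p+1) h_i -> 0, and the limit of a subsequence would be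
    a unit vector in both \<open>Ker p\<close> and \<open>Ran p\<close>.\<close>
  have "\<exists>C. \<forall>g\<in>Ran p. \<forall>x. n ((U ^^ p) (x - U g)) = 0 \<longrightarrow> n g \<le> C * n x"
  proof (rule ccontr)
    assume "\<not> ?thesis"
    then have "\<forall>i::nat. \<exists>g x. g \<in> Ran p \<and> n ((U ^^ p) (x - U g)) = 0 \<and> n g > real i * n x"
      by (meson not_le)
    then obtain g x where gx: "\<And>i. g i \<in> Ran p" "\<And>i. n ((U ^^ p) (x i - U (g i))) = 0"
      "\<And>i::nat. n (g i) > real i * n (x i)" by metis
    have pos: "n (g i) > 0" for i
      using gx(3)[of i] n_nonneg[of "x i"] mult_nonneg_nonneg[of "real i" "n (x i)"] by linarith
    define c where "c i = complex_of_real (1 / n (g i))" for i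
    define h where "h i = sc (c i) (g i)" for i
    have h: "n (h i) = 1" "h i \<in> Ran p" for i
      using pos[of i] gx(1)[of i] by (auto simp: h_def n_scale c_def norm_divide intro: Ran_scale)
    obtain D where D: "D > 0" "\<And>x. n ((U ^^ p) x) \<le> D * n x" using bm_bound[OF Uk] by metis
    have "n ((U ^^ Suc p) (h i)) \<le> D / real i" if "i > 0" for i
    proof -
      have "n ((U ^^ p) (U (h i))) = n ((U ^^ p) (sc (c i) (x i)))"
      proof (rule n_eq)
        have "(U ^^ p) (U (h i)) - (U ^^ p) (sc (c i) (x i)) = sc (- c i) ((U ^^ p) (x i - U (g i)))"
          by (simp add: h_def bm_simps[OF U] bm_simps[OF Uk] scale_right_diff_distrib)
        then show "n ((U ^^ p) (U (h i)) - (U ^^ p) (sc (c i) (x i))) = 0"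
          using gx(2)[of i] by (simp add: n_scale)
      qed
      also have "\<dots> \<le> D * (n (x i) / n (g i))"
        using D(2)[of "sc (c i) (x i)"] pos[of i] by (simp add: n_scale c_def norm_divide)
      also have "\<dots> \<le> D * (1 / real i)"
        using D(1) gx(3)[of i] pos[of i] that by (intro mult_left_mono) (auto simp: field_simps)
      finally show ?thesis by (simp add: funpow_swap1)
    qed
    then have lim: "n_tendsto (\<lambda>i. (U ^^ Suc p) (h i)) 0"
      unfolding n_tendsto_zero
      by (intro Lim_null_comparison[OF _ lim_const_over_n[of D]] eventually_mono[OF eventually_gt_at_top[of 0]])
        auto
    then obtain \<phi> y where \<phi>: "strict_mono \<phi>" "n_tendsto (\<lambda>i. h (\<phi> i)) y"
      using proper_power[of h 1 "Suc p" 0] h(1) by auto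
    have "n ((U ^^ Suc p) y - 0) = 0"
      using n_tendsto_unique[OF n_tendsto_map[OF Uk \<phi>(2)] n_tendsto_subseq[OF lim \<phi>(1)]] .
    then have "y \<in> Ker (Suc p)" by (simp add: Ker_def)
    then have "y \<in> Ker p" using K[of "Suc p"] by auto
    moreover have "y \<in> Ran p" by (rule Ran_closed[OF _ \<phi>(2)]) (rule h(2))
    ultimately have "n y = 0" by (rule KR)
    then show False using n_tendsto_norm[OF \<phi>(2)] h(1) by (simp add: LIMSEQ_const_iff)
  qed
  then obtain C where C: "\<And>g x. g \<in> Ran p \<Longrightarrow> n ((U ^^ p) (x - U g)) = 0 \<Longrightarrow> n g \<le> C * n x" by blast
  obtain B where B: "\<And>x. B x \<in> Ran p" "\<And>x. n ((U ^^ p) (x - U (B x))) = 0" using ex by metis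
  \<comment> \<open>The bound for x = 0 shows that the solution in \<open>Ran p\<close> is
    determined up to null vectors; this is where the linearity of B comes from.\<close>
  have unique: "n (B x - g) = 0" if g: "g \<in> Ran p" "n ((U ^^ p) (x - U g)) = 0" for x g
  proof -
    have "(U ^^ p) (0 - U (B x - g)) = (U ^^ p) (x - U (B x)) - (U ^^ p) (x - U g)"
      by (simp add: bm_simps[OF U] bm_simps[OF Uk])
    then have "n ((U ^^ p) (0 - U (B x - g))) = 0"
      using n_diff[of "(U ^^ p) (x - U (B x))" "(U ^^ p) (x - U g)"] B(2)[of x] g(2)
        n_nonneg[of "(U ^^ p) (x - U (B x)) - (U ^^ p) (x - U g)"] by simp
    then have "n (B x - g) \<le> C * n 0" by (intro C Ran_diff B(1) g(1))
    then show ?thesis using n_nonneg[of "B x - g"] by simp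
  qed
  show thesis
  proof (rule that)
    show "n (B x) \<le> C * n x" for x by (rule C[OF B])
    show "n (B (x + y) - (B x + B y)) = 0" for x y
    proof (rule unique[OF Ran_add[OF B(1) B(1)]])
      have "(U ^^ p) (x + y - U (B x + B y)) = (U ^^ p) (x - U (B x)) + (U ^^ p) (y - U (B y))"
        by (simp add: bm_simps[OF U] bm_simps[OF Uk])
      then show "n ((U ^^ p) (x + y - U (B x + B y))) = 0"
        using n_add[of "(U ^^ p) (x - U (B x))" "(U ^^ p) (y - U (B y))"] B(2)[of x] B(2)[of y]
          n_nonneg[of "(U ^^ p) (x - U (B x)) + (U ^^ p) (y - U (B y))"] by simp
    qed
    show "n (B (sc c x) - sc c (B x)) = 0" for c x
    proof (rule unique[OF Ran_scale[OF B(1)]])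
      have "(U ^^ p) (sc c x - U (sc c (B x))) = sc c ((U ^^ p) (x - U (B x)))"
        by (simp add: bm_simps[OF U] bm_simps[OF Uk] scale_right_diff_distrib)
      then show "n ((U ^^ p) (sc c x - U (sc c (B x)))) = 0" using B(2)[of x] by (simp add: n_scale)
    qed
    show "n ((U ^^ p) (U (B x) - x)) = 0" for x
      using B(2)[of x] by (simp add: bm_diff[OF Uk] n_minus_commute)
    show "n ((U ^^ p) (B (U x) - x)) = 0" for x
    proof -
      have "n ((U ^^ Suc p) (B (U x) - x)) = 0"
        using B(2)[of "U x"] by (simp add: funpow_swap1 bm_diff[OF U] bm_diff[OF Uk] n_minus_commute)
      then have "B (U x) - x \<in> Ker (Suc p)" by (simp add: Ker_def)
      then show ?thesis using K[of "Suc p"] by (auto simp: Ker_def)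
    qed
  qed
qed

end

section \<open>Bounded operators on Banach function spaces\<close>

text \<open>A basis of B is extended to a basis of A. The projection kills the former and fixes the
  added vectors, and it extends to the whole space with values in their span. It picks
  representatives modulo B linearly.\<close>

lemma (in vector_space) exists_projection:
  assumes A: "subspace A" and B: "subspace B" "B \<subseteq> A"
  obtains \<pi> where "\<And>x y. \<pi> (x + y) = \<pi> x + \<pi> y" "\<And>c x. \<pi> (scale c x) = scale c (\<pi> x)"
    "\<And>x. \<pi> x \<in> A" "\<And>x. x \<in> A \<Longrightarrow> x - \<pi> x \<in> B" "\<And>x. x \<in> B \<Longrightarrow> \<pi> x = 0" "\<And>x. \<pi> (\<pi> x) = \<pi> x"
proof -
  obtain B0 where B0: "B0 \<subseteq> B" "independent B0" "B \<subseteq> span B0"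
    by (rule maximal_independent_subset)
  have "B0 \<subseteq> A" using B0(1) B(2) by auto
  then obtain B1 where B1: "B0 \<subseteq> B1" "B1 \<subseteq> A" "independent B1" "A \<subseteq> span B1"
    using maximal_independent_subset_extend[OF _ B0(2)] by metis
  interpret vp: vector_space_pair scale scale by unfold_locales
  define f where "f b = (if b \<in> B0 then 0 else b)" for b
  obtain \<pi> where \<pi>: "Vector_Spaces.linear scale scale \<pi>" "\<And>b. b \<in> B1 \<Longrightarrow> \<pi> b = f b" "range \<pi> = span (f ` B1)"
    using vp.linear_independent_extend_subspace[OF B1(3), of f] by blast
  interpret l: Vector_Spaces.linear scale scale \<pi> by (rule \<pi>(1))
  show thesis
  proof (rule that)
    show "\<pi> (x + y) = \<pi> x + \<pi> y" for x y by (rule l.add)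
    show "\<pi> (scale c x) = scale c (\<pi> x)" for c x by (rule l.scale)
    show "\<pi> x \<in> A" for x
    proof -
      have "f ` B1 \<subseteq> A" using B1(2) subspace_0[OF A] by (auto simp: f_def)
      then have "span (f ` B1) \<subseteq> A" by (rule span_minimal[OF _ A])
      then show ?thesis using \<pi>(3) by blast
    qed
    show "x - \<pi> x \<in> B" if "x \<in> A" for x
    proof -
      have "x \<in> span B1" using that B1(4) by auto
      then show ?thesis
      proof (induction rule: span_induct_alt)
        case base
        then show ?case using subspace_0[OF B(1)] by simp
      next
        case (step c b y)
        have "b - \<pi> b \<in> B" using step(1) B0(1) subspace_0[OF B(1)] by (auto simp: \<pi>(2) f_def)
        then have "scale c (b - \<pi> b) + (y - \<pi> y) \<in> B"
          by (intro subspace_add[OF B(1)] subspace_scale[OF B(1)] step)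
        then show ?case by (simp add: l.add l.scale scale_right_diff_distrib algebra_simps)
      qed
    qed
    show "\<pi> x = 0" if "x \<in> B" for x
    proof -
      have "x \<in> span B0" using that B0(3) by auto
      then show ?thesis
        by (induction rule: span_induct_alt) (use \<pi>(2) B1(1) in \<open>auto simp: l.add l.scale f_def\<close>)
    qed
    show "\<pi> (\<pi> x) = \<pi> x" for x
    proof -
      have "\<pi> x \<in> span (f ` B1)" using \<pi>(3) by blast
      then show ?thesis
        by (induction rule: span_induct_alt) (use \<pi>(2) in \<open>auto simp: l.add l.scale f_def\<close>)
    qed
  qed
qed

lemma vector_space_fun: "vector_space (\<lambda>(c::complex) f (x::'x). c * f x :: complex)"
  by unfold_locales (auto simp: fun_eq_iff algebra_simps)

section \<open>Linear representatives of functions and operators\<close>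

context banach_function_space
begin

lemma L_measurable [measurable_dest]: "f \<in> L \<Longrightarrow> f \<in> borel_measurable \<mu>"
  using measurable by auto

lemma diff_closed: "f \<in> L \<Longrightarrow> g \<in> L \<Longrightarrow> (\<lambda>x. f x - g x) \<in> L"
  using add_closed[OF _ scale_closed[of g "-1"], of f] by simp

lemma norm_mono: "\<lbrakk>f \<in> L; g \<in> borel_measurable \<mu>; AE x in \<mu>. cmod (g x) \<le> cmod (f x)\<rbrakk> \<Longrightarrow> N g \<le> N f"
  using ideal by blast

lemma norm_cong:
  assumes "f \<in> L" "g \<in> L" "AE x in \<mu>. f x = g x"
  shows "N f = N g"
proof (rule antisym)
  show "N f \<le> N g"
    by (rule norm_mono[OF assms(2) L_measurable[OF assms(1)] eventually_mono[OF assms(3)]]) simp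
  show "N g \<le> N f"
    by (rule norm_mono[OF assms(1) L_measurable[OF assms(2)] eventually_mono[OF assms(3)]]) simp
qed

lemma norm_zero [simp]: "N (\<lambda>_. 0) = 0"
  using norm_eq_0[OF zero_closed] by simp

lemma norm_minus_commute: "f \<in> L \<Longrightarrow> g \<in> L \<Longrightarrow> N (\<lambda>x. f x - g x) = N (\<lambda>x. g x - f x)"
  using norm_scale[OF diff_closed[of g f], of "-1"] by simp

lemma norm_triangle_diff: "f \<in> L \<Longrightarrow> g \<in> L \<Longrightarrow> N (\<lambda>x. f x - g x) \<le> N f + N g"
  using norm_triangle[OF _ scale_closed[of g "-1"], of f] norm_scale[of g "-1"] by simp

lemma norm_diff_eq_0: "f \<in> L \<Longrightarrow> g \<in> L \<Longrightarrow> N (\<lambda>x. f x - g x) = 0 \<longleftrightarrow> (AE x in \<mu>. f x = g x)"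
  using norm_eq_0[OF diff_closed[of f g]] by simp

text \<open>A linear choice of representatives: operators that are linear up to a.e. equality become
  linear maps on all functions when conjugated with it.\<close>

definition is_rep :: "(('x \<Rightarrow> complex) \<Rightarrow> ('x \<Rightarrow> complex)) \<Rightarrow> bool" where
  "is_rep \<pi> \<longleftrightarrow> (\<forall>f g. \<pi> (f + g) = \<pi> f + \<pi> g) \<and> (\<forall>c f. \<pi> (\<lambda>x. c * f x) = (\<lambda>x. c * \<pi> f x)) \<and>
    (\<forall>f. \<pi> f \<in> L) \<and> (\<forall>f\<in>L. AE x in \<mu>. \<pi> f x = f x) \<and> (\<forall>f\<in>L. (AE x in \<mu>. f x = 0) \<longrightarrow> \<pi> f = 0) \<and>
    (\<forall>f. \<pi> (\<pi> f) = \<pi> f)"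

definition rep :: "('x \<Rightarrow> complex) \<Rightarrow> ('x \<Rightarrow> complex)" where
  "rep = (SOME \<pi>. is_rep \<pi>)"

lemma is_rep_rep: "is_rep rep"
proof -
  interpret V: vector_space "\<lambda>(c::complex) f (x::'x). c * f x :: complex" by (rule vector_space_fun)
  define Z where "Z = {f \<in> L. AE x in \<mu>. f x = 0}"
  have L: "V.subspace L"
    using zero_closed add_closed scale_closed
    by (auto simp: V.subspace_def plus_fun_def zero_fun_def)
  have Z: "V.subspace Z" "Z \<subseteq> L"
    using zero_closed add_closed scale_closed
    by (auto simp: Z_def V.subspace_def plus_fun_def zero_fun_def)
  obtain \<pi> where \<pi>: "\<And>f g. \<pi> (f + g) = \<pi> f + \<pi> g" "\<And>c f. \<pi> (\<lambda>x. c * f x) = (\<lambda>x. c * \<pi> f x)"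
    "\<And>f. \<pi> f \<in> L" "\<And>f. f \<in> L \<Longrightarrow> f - \<pi> f \<in> Z" "\<And>f. f \<in> Z \<Longrightarrow> \<pi> f = 0" "\<And>f. \<pi> (\<pi> f) = \<pi> f"
    by (rule V.exists_projection[OF L Z]) blast
  have "AE x in \<mu>. \<pi> f x = f x" if "f \<in> L" for f
    using \<pi>(4)[OF that] by (auto simp: Z_def elim: AE_mp)
  then have "is_rep \<pi>" using \<pi> by (auto simp: is_rep_def Z_def)
  then show ?thesis unfolding rep_def by (rule someI[of is_rep])
qed

lemma rep_add: "rep (f + g) = rep f + rep g"
  and rep_scale: "rep (\<lambda>x. c * f x) = (\<lambda>x. c * rep f x)"
  and rep_L [simp, intro]: "rep f \<in> L"
  and rep_AE: "f \<in> L \<Longrightarrow> AE x in \<mu>. rep f x = f x"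
  and rep_null: "f \<in> L \<Longrightarrow> AE x in \<mu>. f x = 0 \<Longrightarrow> rep f = 0"
  and rep_rep [simp]: "rep (rep f) = rep f"
  using is_rep_rep by (auto simp: is_rep_def)

lemma rep_diff: "rep (f - g) = rep f - rep g"
  using rep_add[of "f - g" g] by simp

lemma rep_plus: "rep (\<lambda>x. f x + g x) = (\<lambda>x. rep f x + rep g x)"
  and rep_minus: "rep (\<lambda>x. f x - g x) = (\<lambda>x. rep f x - rep g x)"
  using rep_add[of f g] rep_diff[of f g] by (simp_all add: plus_fun_def fun_diff_def)

lemma rep_cong:
  assumes "f \<in> L" "g \<in> L" "AE x in \<mu>. f x = g x"
  shows "rep f = rep g"
proof -
  have "rep (f - g) = 0"
    using assms diff_closed[OF assms(1,2)] by (intro rep_null) (auto simp: fun_diff_def)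
  then show ?thesis by (simp add: rep_diff)
qed

lemma norm_rep: "f \<in> L \<Longrightarrow> N (rep f) = N f"
  by (intro norm_cong rep_AE) auto

text \<open>The abstract theory lives on a whole type, so every function, inside or outside
  \<open>L\<close>, receives the norm of its image under \<open>rep\<close>; completeness is
  inherited from \<open>L\<close>.\<close>

sublocale sem: seminormed_space "\<lambda>c f (x::'x). c * f x" "\<lambda>f. N (rep f)"
proof -
  interpret V: vector_space "\<lambda>(c::complex) f (x::'x). c * f x :: complex" by (rule vector_space_fun)
  show "seminormed_space (\<lambda>c f (x::'x). c * f x) (\<lambda>f. N (rep f))"
  proof
    show "N (rep (f + g)) \<le> N (rep f) + N (rep g)" for f g
      using norm_triangle[of "rep f" "rep g"] by (simp add: rep_plus plus_fun_def)
    show "N (rep (\<lambda>x. c * f x)) = cmod c * N (rep f)" for c f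
      by (simp add: rep_scale norm_scale)
    fix s :: "nat \<Rightarrow> 'x \<Rightarrow> complex"
    assume c: "\<And>e. e > 0 \<Longrightarrow> \<exists>i0. \<forall>i\<ge>i0. \<forall>j\<ge>i0. N (rep (s i - s j)) < e"
    obtain f where f: "f \<in> L" "(\<lambda>i. N (\<lambda>x. rep (s i) x - f x)) \<longlonglongrightarrow> 0"
      using complete[of "\<lambda>i. rep (s i)"] c by (auto simp: rep_minus fun_diff_def)
    have "N (rep (s i - f)) = N (\<lambda>x. rep (s i) x - f x)" for i
      unfolding fun_diff_def rep_minus
      by (rule norm_cong[OF diff_closed diff_closed eventually_mono[OF rep_AE[OF f(1)]]]) (use f(1) in auto)
    then show "\<exists>f. (\<lambda>i. N (rep (s i - f))) \<longlonglongrightarrow> 0"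
      using f(2) by (intro exI[of _ f]) simp
  qed
qed

abbreviation BO :: "'x operator set" where "BO \<equiv> bounded_operators \<mu> L N"

lemma bo_L: "A \<in> BO \<Longrightarrow> f \<in> L \<Longrightarrow> A f \<in> L"
  and bo_cong: "\<lbrakk>A \<in> BO; f \<in> L; g \<in> L; AE x in \<mu>. f x = g x\<rbrakk> \<Longrightarrow> AE x in \<mu>. A f x = A g x"
  and bo_add: "\<lbrakk>A \<in> BO; f \<in> L; g \<in> L\<rbrakk> \<Longrightarrow> AE x in \<mu>. A (\<lambda>y. f y + g y) x = A f x + A g x"
  and bo_scale: "\<lbrakk>A \<in> BO; f \<in> L\<rbrakk> \<Longrightarrow> AE x in \<mu>. A (\<lambda>y. c * f y) x = c * A f x"
  unfolding bounded_operators_def linear_operator_def by blast+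

lemma bo_bound:
  assumes "A \<in> BO"
  obtains C where "C > 0" "\<And>f. f \<in> L \<Longrightarrow> N (A f) \<le> C * N f"
proof -
  obtain C where C: "\<And>f. f \<in> L \<Longrightarrow> N (A f) \<le> C * N f"
    using assms by (auto simp: bounded_operators_def)
  have "N (A f) \<le> (\<bar>C\<bar> + 1) * N f" if "f \<in> L" for f
    using C[OF that] mult_right_mono[of C "\<bar>C\<bar> + 1" "N f"] norm_nonneg[OF that] by force
  then show ?thesis using that[of "\<bar>C\<bar> + 1"] by force
qed

lemma BO_I:
  assumes "\<And>f. f \<in> L \<Longrightarrow> A f \<in> L"
    and "\<And>f g. \<lbrakk>f \<in> L; g \<in> L; AE x in \<mu>. f x = g x\<rbrakk> \<Longrightarrow> AE x in \<mu>. A f x = A g x"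
    and "\<And>f g. \<lbrakk>f \<in> L; g \<in> L\<rbrakk> \<Longrightarrow> AE x in \<mu>. A (\<lambda>y. f y + g y) x = A f x + A g x"
    and "\<And>c f. f \<in> L \<Longrightarrow> AE x in \<mu>. A (\<lambda>y. c * f y) x = c * A f x"
    and "\<And>f. f \<in> L \<Longrightarrow> N (A f) \<le> C * N f"
  shows "A \<in> BO"
  using assms unfolding bounded_operators_def linear_operator_def by blast

lemma bo_id: "id \<in> BO" "(\<lambda>f. f) \<in> BO"
  by (rule BO_I[where C = 1]; simp; fail)+

lemma bo_comp:
  assumes "A \<in> BO" "B \<in> BO"
  shows "(\<lambda>f. A (B f)) \<in> BO"
proof -
  obtain C D where C: "C > 0" "\<And>f. f \<in> L \<Longrightarrow> N (A f) \<le> C * N f" and D: "\<And>f. f \<in> L \<Longrightarrow> N (B f) \<le> D * N f"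
    using assms bo_bound by metis
  note BL = bo_L[OF assms(2)]
  show ?thesis
  proof (rule BO_I[where C = "C * D"])
    fix f g assume f: "f \<in> L" and g: "g \<in> L"
    show "AE x in \<mu>. A (B (\<lambda>y. f y + g y)) x = A (B f) x + A (B g) x"
      using bo_cong[OF assms(1) BL[OF add_closed[OF f g]] add_closed[OF BL[OF f] BL[OF g]] bo_add[OF assms(2) f g]]
        bo_add[OF assms(1) BL[OF f] BL[OF g]] by eventually_elim simp
  next
    fix c f assume f: "f \<in> L"
    show "AE x in \<mu>. A (B (\<lambda>y. c * f y)) x = c * A (B f) x"
      using bo_cong[OF assms(1) BL[OF scale_closed[OF f]] scale_closed[OF BL[OF f]] bo_scale[OF assms(2) f, of c]]
        bo_scale[OF assms(1) BL[OF f], of c] by eventually_elim simp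
    show "N (A (B f)) \<le> C * D * N f"
      using order_trans[OF C(2)[OF BL[OF f]] mult_left_mono[OF D[OF f], of C]] C(1) by (simp add: mult.assoc)
    show "A (B f) \<in> L" by (rule bo_L[OF assms(1) BL[OF f]])
  next
    fix f g assume "f \<in> L" "g \<in> L" "AE x in \<mu>. f x = g x"
    then show "AE x in \<mu>. A (B f) x = A (B g) x"
      by (intro bo_cong[OF assms(1)] bo_cong[OF assms(2)] BL)
  qed
qed

lemma bo_o: "A \<in> BO \<Longrightarrow> B \<in> BO \<Longrightarrow> A \<circ> B \<in> BO"
  using bo_comp[of A B] by (simp add: comp_def)

lemma bo_pow: "A \<in> BO \<Longrightarrow> A ^^ k \<in> BO"
  by (induction k) (simp_all add: bo_id bo_o)

lemma bo_plus:
  assumes "A \<in> BO" "B \<in> BO"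
  shows "(\<lambda>f x. A f x + B f x) \<in> BO"
proof -
  obtain C D where C: "\<And>f. f \<in> L \<Longrightarrow> N (A f) \<le> C * N f" and D: "\<And>f. f \<in> L \<Longrightarrow> N (B f) \<le> D * N f"
    using assms bo_bound by metis
  show ?thesis
  proof (rule BO_I[where C = "C + D"])
    fix f g assume fg: "f \<in> L" "g \<in> L"
    show "AE x in \<mu>. A (\<lambda>y. f y + g y) x + B (\<lambda>y. f y + g y) x = A f x + B f x + (A g x + B g x)"
      using bo_add[OF assms(1) fg] bo_add[OF assms(2) fg] by eventually_elim simp
    assume "AE x in \<mu>. f x = g x"
    then show "AE x in \<mu>. A f x + B f x = A g x + B g x"
      using bo_cong[OF assms(1) fg] bo_cong[OF assms(2) fg] by (auto elim: AE_mp)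
  next
    fix c f assume f: "f \<in> L"
    show "AE x in \<mu>. A (\<lambda>y. c * f y) x + B (\<lambda>y. c * f y) x = c * (A f x + B f x)"
      using bo_scale[OF assms(1) f, of c] bo_scale[OF assms(2) f, of c] by eventually_elim (simp add: algebra_simps)
    show "(\<lambda>x. A f x + B f x) \<in> L" by (intro add_closed bo_L[OF assms(1) f] bo_L[OF assms(2) f])
    show "N (\<lambda>x. A f x + B f x) \<le> (C + D) * N f"
      using norm_triangle[OF bo_L[OF assms(1) f] bo_L[OF assms(2) f]] C[OF f] D[OF f] by (simp add: algebra_simps)
  qed
qed

lemma bo_scaled:
  assumes "A \<in> BO"
  shows "(\<lambda>f x. c * A f x) \<in> BO"
proof -
  obtain C where C: "\<And>f. f \<in> L \<Longrightarrow> N (A f) \<le> C * N f" using assms bo_bound by metis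
  show ?thesis
  proof (rule BO_I[where C = "cmod c * C"])
    fix f g assume fg: "f \<in> L" "g \<in> L"
    show "AE x in \<mu>. c * A (\<lambda>y. f y + g y) x = c * A f x + c * A g x"
      using bo_add[OF assms fg] by eventually_elim (simp add: algebra_simps)
    assume "AE x in \<mu>. f x = g x"
    then show "AE x in \<mu>. c * A f x = c * A g x"
      using bo_cong[OF assms fg] by (auto elim: AE_mp)
  next
    fix d f assume f: "f \<in> L"
    show "AE x in \<mu>. c * A (\<lambda>y. d * f y) x = d * (c * A f x)"
      using bo_scale[OF assms f, of d] by eventually_elim (simp add: algebra_simps)
    show "(\<lambda>x. c * A f x) \<in> L" by (intro scale_closed bo_L[OF assms f])
    show "N (\<lambda>x. c * A f x) \<le> cmod c * C * N f"
      using norm_scale[OF bo_L[OF assms f], of c] mult_left_mono[OF C[OF f], of "cmod c"] by (simp add: mult.assoc)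
  qed
qed

lemma bo_minus:
  assumes "A \<in> BO" "B \<in> BO"
  shows "(\<lambda>f x. A f x - B f x) \<in> BO"
  using bo_plus[OF assms(1) bo_scaled[OF assms(2), of "-1"]] by simp

lemma bo_resolvent: "A \<in> BO \<Longrightarrow> (\<lambda>f y. z * f y - A f y) \<in> BO"
  using bo_minus[OF bo_scaled[OF bo_id(2), of z]] by simp

text \<open>The inner \<open>rep\<close> brings every argument into \<open>L\<close> and identifies
  functions that agree a.e.; the outer one turns linearity up to null functions into exact
  linearity.\<close>

definition lift :: "'x operator \<Rightarrow> 'x operator" where
  "lift A f = rep (A (rep f))"

lemma lift_bounded_map:
  assumes "A \<in> BO"
  shows "lift A \<in> sem.bounded_maps"
proof -
  obtain C where C: "\<And>f. f \<in> L \<Longrightarrow> N (A f) \<le> C * N f" using assms bo_bound by metis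
  note AL = bo_L[OF assms]
  have "lift A (f + g) = lift A f + lift A g" for f g
  proof -
    have "rep (A (rep (f + g))) = rep (A (rep f) + A (rep g))"
    proof (rule rep_cong)
      show "A (rep f) + A (rep g) \<in> L" using add_closed[OF AL AL, of "rep f" "rep g"] by (simp add: plus_fun_def)
      show "AE x in \<mu>. A (rep (f + g)) x = (A (rep f) + A (rep g)) x"
        using bo_add[OF assms, of "rep f" "rep g"] by (simp add: rep_plus plus_fun_def)
    qed (simp add: AL)
    then show ?thesis by (simp add: lift_def rep_add)
  qed
  moreover have "lift A (\<lambda>x. c * f x) = (\<lambda>x. c * lift A f x)" for c f
  proof -
    have "rep (A (rep (\<lambda>x. c * f x))) = rep (\<lambda>x. c * A (rep f) x)"
      using bo_scale[OF assms, of "rep f" c] AL scale_closed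
      by (intro rep_cong) (simp_all add: rep_scale)
    then show ?thesis by (simp add: lift_def rep_scale)
  qed
  moreover have "N (rep (lift A f)) \<le> C * N (rep f)" for f
    using C[of "rep f"] by (simp add: lift_def norm_rep AL)
  ultimately show ?thesis unfolding sem.bounded_maps_def by blast
qed

lemma lift_AE:
  assumes "A \<in> BO" "f \<in> L"
  shows "AE x in \<mu>. lift A f x = A f x"
  using rep_AE[OF bo_L[OF assms(1) rep_L[of f]]] bo_cong[OF assms(1) rep_L assms(2) rep_AE[OF assms(2)]]
  unfolding lift_def by eventually_elim simp

lemma lift_pow: "A \<in> BO \<Longrightarrow> rep ((lift A ^^ k) f) = rep ((A ^^ k) (rep f))"
proof (induction k)
  case (Suc k)
  have L: "(A ^^ k) (rep f) \<in> L" using bo_L[OF bo_pow[OF Suc.prems]] by simp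
  have "rep ((lift A ^^ Suc k) f) = rep (A (rep ((A ^^ k) (rep f))))"
    using Suc by (simp add: lift_def[of A "(lift A ^^ k) f"])
  also have "\<dots> = rep (A ((A ^^ k) (rep f)))"
    using L rep_AE[OF L] by (intro rep_cong bo_L[OF Suc.prems] bo_cong[OF Suc.prems]) auto
  finally show ?case by simp
qed simp

text \<open>The passage back from maps to operators. Boundedness for the seminorm is what makes the
  result respect a.e. equality.\<close>

lemma rep_operator:
  assumes "T \<in> sem.bounded_maps"
  shows "(\<lambda>f. rep (T f)) \<in> BO"
proof -
  obtain C where C: "\<And>f. N (rep (T f)) \<le> C * N (rep f)" using sem.bm_bound[OF assms] by metis
  have add: "T (f + g) = T f + T g" and scale: "T (\<lambda>x. c * f x) = (\<lambda>x. c * T f x)" for f g c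
    using assms by (auto simp: sem.bounded_maps_def)
  show ?thesis
  proof (rule BO_I[where C = C])
    fix f g assume fg: "f \<in> L" "g \<in> L"
    show "AE x in \<mu>. rep (T (\<lambda>y. f y + g y)) x = rep (T f) x + rep (T g) x"
      using add[of f g] by (simp add: rep_plus plus_fun_def)
    assume "AE x in \<mu>. f x = g x"
    then have "rep (f - g) = 0" using fg rep_cong[of f g] by (simp add: rep_diff)
    then have "N (rep (T (f - g))) \<le> C * N 0" using C[of "f - g"] by simp
    then have "N (rep (T (f - g))) = 0" using norm_nonneg[OF rep_L, of "T (f - g)"] by (simp add: zero_fun_def)
    then show "AE x in \<mu>. rep (T f) x = rep (T g) x"
      using norm_diff_eq_0[of "rep (T f)" "rep (T g)"] sem.bm_diff[OF assms, of f g]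
      by (simp add: rep_minus fun_diff_def)
  next
    show "N (rep (T f)) \<le> C * N f" if "f \<in> L" for f using C[of f] norm_rep[OF that] by simp
  qed (simp_all add: scale rep_scale)
qed

end

text \<open>The common features of the operator norm (with the null operators) and of the measure of
  noncompactness (with the compact operators).\<close>

locale operator_gauge = banach_function_space \<mu> L N
  for \<mu> :: "'x measure" and L N +
  fixes Q :: "'x operator \<Rightarrow> real" and J :: "'x operator set"
  assumes Q_add: "\<lbrakk>A \<in> BO; B \<in> BO\<rbrakk> \<Longrightarrow> Q (\<lambda>f x. A f x + B f x) \<le> Q A + Q B"
    and Q_scale: "A \<in> BO \<Longrightarrow> Q (\<lambda>f x. c * A f x) = cmod c * Q A"
    and Q_comp: "\<lbrakk>A \<in> BO; B \<in> BO\<rbrakk> \<Longrightarrow> Q (\<lambda>f. A (B f)) \<le> Q A * Q B"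
    and Q_cong: "\<lbrakk>A \<in> BO; B \<in> BO; \<And>f. f \<in> L \<Longrightarrow> AE x in \<mu>. A f x = B f x\<rbrakk> \<Longrightarrow> Q A = Q B"
    and Q_nonneg: "A \<in> BO \<Longrightarrow> Q A \<ge> 0"
    and Q_ideal: "K \<in> J \<Longrightarrow> Q K = 0"
    and J_BO: "J \<subseteq> BO"
    and small_not_spectrum: "\<lbrakk>A \<in> BO; m \<ge> 1; Q (A ^^ m) < cmod z ^ m\<rbrakk> \<Longrightarrow> z \<notin> spectrum_mod \<mu> L N J A"
begin

text \<open>With the null operators for \<open>J\<close> this is the spectral radius, with the
  compact operators the essential spectral radius.\<close>

definition radius :: "'x operator \<Rightarrow> real" where
  "radius A = Sup (insert 0 (cmod ` spectrum_mod \<mu> L N J A))"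

lemma Q_o: "\<lbrakk>A \<in> BO; B \<in> BO\<rbrakk> \<Longrightarrow> Q (A \<circ> B) \<le> Q A * Q B"
  using Q_comp[of A B] by (simp add: comp_def)

text \<open>\<open>Q\<close> is carried over to maps on all functions by applying \<open>rep\<close>
  to the values. It stays submultiplicative because inserting \<open>rep\<close> between two factors
  does not change the class of the result.\<close>

sublocale gauge: operator_seminorm "\<lambda>c f (x::'x). c * f x" "\<lambda>f. N (rep f)" "\<lambda>T. Q (\<lambda>f. rep (T f))"
proof
  fix S T assume ST: "S \<in> sem.bounded_maps" "T \<in> sem.bounded_maps"
  note bo = rep_operator[OF ST(1)] rep_operator[OF ST(2)]
  show "Q (\<lambda>f. rep (S f + T f)) \<le> Q (\<lambda>f. rep (S f)) + Q (\<lambda>f. rep (T f))"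
    using Q_add[OF bo] by (simp add: rep_plus plus_fun_def)
  have "Q (\<lambda>f. rep (S (T f))) = Q (\<lambda>f. rep (S (rep (T f))))"
  proof (rule Q_cong[OF rep_operator[OF sem.bm_comp[OF ST]] bo_comp[OF bo]])
    fix f assume "f \<in> L"
    have "rep (T f - rep (T f)) = 0" by (simp add: rep_diff)
    then have "N (rep (S (T f - rep (T f)))) = 0"
      by (intro sem.bm_null[OF ST(1)]) (simp add: zero_fun_def)
    moreover have "rep (S (T f - rep (T f))) = (\<lambda>x. rep (S (T f)) x - rep (S (rep (T f))) x)"
      unfolding sem.bm_diff[OF ST(1)] rep_diff by (simp add: fun_diff_def)
    ultimately show "AE x in \<mu>. rep (S (T f)) x = rep (S (rep (T f))) x"
      using norm_diff_eq_0[of "rep (S (T f))" "rep (S (rep (T f)))"] by simp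
  qed
  then show "Q (\<lambda>f. rep (S (T f))) \<le> Q (\<lambda>f. rep (S f)) * Q (\<lambda>f. rep (T f))"
    using Q_comp[OF bo] by simp
next
  fix T c assume T: "T \<in> sem.bounded_maps"
  show "Q (\<lambda>f. rep (\<lambda>x. c * T f x)) = cmod c * Q (\<lambda>f. rep (T f))"
    using Q_scale[OF rep_operator[OF T], of c] by (simp add: rep_scale)
qed

text \<open>Everything rests on |z|^m \<le> Q(A^m) for spectral values z, the contrapositive of
  \<open>small_not_spectrum\<close>; the inserted 0 makes the supremum nonnegative when the spectrum
  is empty.\<close>

lemma radius_nonneg_bdd:
  assumes "A \<in> BO"
  shows "bdd_above (insert 0 (cmod ` spectrum_mod \<mu> L N J A))" "radius A \<ge> 0"
    "m \<ge> 1 \<Longrightarrow> radius A ^ m \<le> Q (A ^^ m)"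
proof -
  have le: "cmod z ^ m \<le> Q (A ^^ m)" if "m \<ge> 1" "z \<in> spectrum_mod \<mu> L N J A" for z m
    using small_not_spectrum[OF assms that(1), of z] that(2) by force
  show bdd: "bdd_above (insert 0 (cmod ` spectrum_mod \<mu> L N J A))"
    using le[of 1] by (intro bdd_aboveI[of _ "Q A"]) (auto simp: Q_nonneg assms)
  show "radius A \<ge> 0"
    unfolding radius_def by (rule cSup_upper[OF _ bdd]) simp
  assume m: "m \<ge> 1"
  have nn: "Q (A ^^ m) \<ge> 0" by (rule Q_nonneg[OF bo_pow[OF assms]])
  have "radius A \<le> root m (Q (A ^^ m))"
    unfolding radius_def
  proof (rule cSup_least)
    fix t assume t: "t \<in> insert 0 (cmod ` spectrum_mod \<mu> L N J A)"
    then have "t \<ge> 0" by auto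
    moreover have "t ^ m \<le> Q (A ^^ m)" using t le[OF m] nn m by (auto simp: power_0_left)
    ultimately show "t \<le> root m (Q (A ^^ m))"
      using m real_root_le_mono[of m "t ^ m" "Q (A ^^ m)"] by (simp add: real_root_power_cancel)
  qed simp
  then have "radius A ^ m \<le> root m (Q (A ^^ m)) ^ m"
    using \<open>radius A \<ge> 0\<close> by (intro power_mono)
  then show "radius A ^ m \<le> Q (A ^^ m)" using m nn by simp
qed

text \<open>The hard half of the spectral radius formula. Beyond \<open>radius A\<close> there are
  inverses modulo \<open>J\<close>, on which \<open>Q\<close> vanishes, so the abstract bound
  applies to the lift of A. It asks for inverses on a closed exterior region, hence a radius R
  strictly between \<open>radius A\<close> and r.\<close>

lemma radius_limit:
  assumes A: "A \<in> BO" and r: "radius A < r"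
  shows "(\<lambda>k. Q (A ^^ k) / r ^ k) \<longlonglongrightarrow> 0"
proof -
  define R where "R = (radius A + r) / 2"
  have rad: "radius A \<ge> 0" by (rule radius_nonneg_bdd[OF A])
  have R: "R > radius A" "R > 0" "R < r" using r rad by (auto simp: R_def)
  have bm: "lift A \<in> sem.bounded_maps" by (rule lift_bounded_map[OF A])
  have "(\<lambda>k. Q (\<lambda>f. rep ((lift A ^^ k) f)) / r ^ k) \<longlonglongrightarrow> 0"
  proof (rule gauge.gelfand_bound[OF bm R(2,3)])
    fix z assume z: "R \<le> cmod z"
    have "z \<notin> spectrum_mod \<mu> L N J A"
    proof
      assume "z \<in> spectrum_mod \<mu> L N J A"
      then have "cmod z \<le> radius A"
        unfolding radius_def by (intro cSup_upper radius_nonneg_bdd[OF A]) auto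
      then show False using z R by simp
    qed
    then obtain B where B: "B \<in> BO" "(\<lambda>f x. B (\<lambda>y. z * f y - A f y) x - f x) \<in> J"
      "(\<lambda>f x. z * B f x - A (B f) x - f x) \<in> J"
      by (auto simp: spectrum_mod_def)
    note bmB = lift_bounded_map[OF B(1)]
    define K1 where "K1 = (\<lambda>f. lift B ((\<lambda>x. z * f x) - lift A f) - f)"
    define K2 where "K2 = (\<lambda>f. (\<lambda>x. z * lift B f x) - lift A (lift B f) - f)"
    have bmK: "K1 \<in> sem.bounded_maps" "K2 \<in> sem.bounded_maps"
      using sem.bm_minus[OF sem.bm_comp[OF bmB sem.bm_minus[OF sem.bm_scaled[OF sem.bm_id, of z] bm]] sem.bm_id]
        sem.bm_minus[OF sem.bm_minus[OF sem.bm_scaled[OF bmB, of z] sem.bm_comp[OF bm bmB]] sem.bm_id]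
      by (simp_all add: K1_def K2_def)
    have liftL: "lift A f \<in> L" "lift B f \<in> L" for f by (auto simp: lift_def)
    have "Q (\<lambda>f. rep (K1 f)) = Q (\<lambda>f x. B (\<lambda>y. z * f y - A f y) x - f x)"
    proof (rule Q_cong[OF rep_operator[OF bmK(1)]])
      show "(\<lambda>f x. B (\<lambda>y. z * f y - A f y) x - f x) \<in> BO" using B J_BO by auto
      fix f assume f: "f \<in> L"
      define g where "g = (\<lambda>x. z * f x - lift A f x)"
      have g: "g \<in> L" unfolding g_def by (intro diff_closed scale_closed f liftL)
      have g': "(\<lambda>y. z * f y - A f y) \<in> L" by (intro diff_closed scale_closed f bo_L[OF A])
      have "K1 f \<in> L" unfolding K1_def fun_diff_def using diff_closed[OF liftL(2) f] by simp
      from rep_AE[OF this] have "AE x in \<mu>. rep (K1 f) x = lift B g x - f x"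
        by (simp add: K1_def fun_diff_def g_def)
      moreover have "AE x in \<mu>. lift B g x = B g x" by (rule lift_AE[OF B(1) g])
      moreover have "AE x in \<mu>. B g x = B (\<lambda>y. z * f y - A f y) x"
        using lift_AE[OF A f] by (intro bo_cong[OF B(1) g g']) (auto simp: g_def)
      ultimately show "AE x in \<mu>. rep (K1 f) x = B (\<lambda>y. z * f y - A f y) x - f x"
        by eventually_elim simp
    qed
    then have 1: "Q (\<lambda>f. rep (K1 f)) = 0" using Q_ideal[OF B(2)] by simp
    have "Q (\<lambda>f. rep (K2 f)) = Q (\<lambda>f x. z * B f x - A (B f) x - f x)"
    proof (rule Q_cong[OF rep_operator[OF bmK(2)]])
      show "(\<lambda>f x. z * B f x - A (B f) x - f x) \<in> BO" using B J_BO by auto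
      fix f assume f: "f \<in> L"
      have "K2 f \<in> L" unfolding K2_def fun_diff_def
        using diff_closed[OF diff_closed[OF scale_closed[OF liftL(2)] liftL(1)] f] by simp
      from rep_AE[OF this] have "AE x in \<mu>. rep (K2 f) x = z * lift B f x - lift A (lift B f) x - f x"
        by (simp add: K2_def fun_diff_def)
      moreover have "AE x in \<mu>. lift B f x = B f x" by (rule lift_AE[OF B(1) f])
      moreover have "AE x in \<mu>. lift A (lift B f) x = A (lift B f) x" by (rule lift_AE[OF A liftL(2)])
      moreover have "AE x in \<mu>. A (lift B f) x = A (B f) x"
        by (rule bo_cong[OF A liftL(2) bo_L[OF B(1) f] lift_AE[OF B(1) f]])
      ultimately show "AE x in \<mu>. rep (K2 f) x = z * B f x - A (B f) x - f x"
        by eventually_elim simp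
    qed
    then have 2: "Q (\<lambda>f. rep (K2 f)) = 0" using Q_ideal[OF B(3)] by simp
    show "\<exists>B\<in>sem.bounded_maps.
        Q (\<lambda>f. rep (B ((\<lambda>x. z * f x) - lift A f) - f)) = 0 \<and>
        Q (\<lambda>f. rep ((\<lambda>x. z * B f x) - lift A (B f) - f)) = 0"
      using 1 2 bmB unfolding K1_def K2_def by blast
  qed
  moreover have "Q (\<lambda>f. rep ((lift A ^^ k) f)) = Q (A ^^ k)" for k
  proof (rule Q_cong[OF rep_operator[OF sem.bm_funpow[OF bm]] bo_pow[OF A]])
    fix f assume f: "f \<in> L"
    have "AE x in \<mu>. rep ((A ^^ k) (rep f)) x = (A ^^ k) (rep f) x"
      by (rule rep_AE[OF bo_L[OF bo_pow[OF A]]]) simp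
    moreover have "AE x in \<mu>. (A ^^ k) (rep f) x = (A ^^ k) f x"
      by (rule bo_cong[OF bo_pow[OF A] rep_L f rep_AE[OF f]])
    ultimately show "AE x in \<mu>. rep ((lift A ^^ k) f) x = (A ^^ k) f x"
      unfolding lift_pow[OF A] by eventually_elim simp
  qed
  ultimately show ?thesis by simp
qed

end

section \<open>The operator norm and the measure of noncompactness\<close>

context banach_function_space
begin

lemma unit_ball_0: "(\<lambda>_. 0) \<in> unit_ball L N"
  by (simp add: unit_ball_def zero_closed)

lemma operator_norm_upper:
  assumes "A \<in> BO" "f \<in> unit_ball L N"
  shows "N (A f) \<le> operator_norm L N A"
proof -
  obtain C where C: "C > 0" "\<And>f. f \<in> L \<Longrightarrow> N (A f) \<le> C * N f" using bo_bound[OF assms(1)] by metis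
  have "N (A f) \<le> C" if "f \<in> unit_ball L N" for f
    using that order_trans[OF C(2)[of f] mult_left_mono[of "N f" 1 C]] C(1) by (auto simp: unit_ball_def)
  then show ?thesis
    unfolding operator_norm_def by (intro cSUP_upper assms(2) bdd_aboveI2)
qed

lemma operator_norm_least: "(\<And>f. f \<in> unit_ball L N \<Longrightarrow> N (A f) \<le> c) \<Longrightarrow> operator_norm L N A \<le> c"
  unfolding operator_norm_def using unit_ball_0 by (intro cSUP_least) auto

lemma operator_norm_nonneg: "A \<in> BO \<Longrightarrow> operator_norm L N A \<ge> 0"
  using operator_norm_upper[OF _ unit_ball_0] norm_nonneg[OF bo_L[OF _ zero_closed]] by force

lemma operator_norm_bound:
  assumes A: "A \<in> BO" and f: "f \<in> L"
  shows "N (A f) \<le> operator_norm L N A * N f"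
proof (cases "N f = 0")
  case True
  obtain C where "N (A f) \<le> C * N f" using bo_bound[OF A] f by metis
  then show ?thesis using True by simp
next
  case False
  then have pos: "N f > 0" using norm_nonneg[OF f] by simp
  define c where "c = complex_of_real (1 / N f)"
  have c: "cmod c = 1 / N f" using pos by (simp add: c_def norm_divide)
  have "(\<lambda>x. c * f x) \<in> unit_ball L N"
    using pos c by (simp add: unit_ball_def scale_closed f norm_scale)
  from operator_norm_upper[OF A this]
  have "N (A (\<lambda>x. c * f x)) \<le> operator_norm L N A" .
  moreover have "N (A (\<lambda>x. c * f x)) = N (\<lambda>x. c * A f x)"
    by (rule norm_cong[OF bo_L[OF A scale_closed[OF f]] scale_closed[OF bo_L[OF A f]] bo_scale[OF A f]])
  ultimately show ?thesis
    using pos c norm_scale[OF bo_L[OF A f], of c] by (simp add: field_simps)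
qed

text \<open>The condition inside the infimum of \<open>noncompactness\<close>, but with \<delta> = 0
  allowed, so that it holds for the operator norm also when this is 0.\<close>

definition net :: "'x operator \<Rightarrow> real \<Rightarrow> bool" where
  "net A \<delta> \<longleftrightarrow> (\<exists>M. finite M \<and> M \<subseteq> L \<and> (\<forall>f\<in>unit_ball L N. \<exists>g\<in>M. N (\<lambda>x. A f x - g x) \<le> \<delta>))"

lemma noncompactness_net: "noncompactness L N A = Inf {\<delta>. \<delta> > 0 \<and> net A \<delta>}"
  by (simp add: noncompactness_def net_def)

lemma net_mono: "net A \<delta> \<Longrightarrow> \<delta> \<le> \<delta>' \<Longrightarrow> net A \<delta>'"
  unfolding net_def by (meson order_trans)

lemma net_operator_norm: "A \<in> BO \<Longrightarrow> net A (operator_norm L N A)"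
  unfolding net_def using operator_norm_upper[of A] zero_closed
  by (intro exI[of _ "{\<lambda>_. 0}"]) auto

lemma noncompactness_le:
  assumes "net A \<delta>" "\<delta> \<ge> 0"
  shows "noncompactness L N A \<le> \<delta>"
proof (rule field_le_epsilon)
  fix e :: real assume "e > 0"
  then show "noncompactness L N A \<le> \<delta> + e"
    unfolding noncompactness_net using assms net_mono[OF assms(1), of "\<delta> + e"]
    by (intro cInf_lower bdd_belowI[of _ 0]) auto
qed

lemma noncompactness_nonneg:
  assumes "A \<in> BO"
  shows "noncompactness L N A \<ge> 0"
  unfolding noncompactness_net
proof (rule cInf_greatest)
  show "{\<delta>. \<delta> > 0 \<and> net A \<delta>} \<noteq> {}"
    using net_mono[OF net_operator_norm[OF assms], of "operator_norm L N A + 1"] operator_norm_nonneg[OF assms]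
    by (auto intro!: exI[of _ "operator_norm L N A + 1"])
qed auto

lemma noncompactness_less:
  assumes "A \<in> BO" "noncompactness L N A < \<delta>"
  shows "net A \<delta>" "\<delta> > 0"
proof -
  have "{\<delta>. \<delta> > 0 \<and> net A \<delta>} \<noteq> {}"
    using net_mono[OF net_operator_norm[OF assms(1)], of "operator_norm L N A + 1"] operator_norm_nonneg[OF assms(1)]
    by (auto intro!: exI[of _ "operator_norm L N A + 1"])
  then obtain d where "d > 0" "net A d" "d < \<delta>"
    using cInf_lessD[of "{\<delta>. \<delta> > 0 \<and> net A \<delta>}" \<delta>] assms(2) by (auto simp: noncompactness_net)
  then show "net A \<delta>" "\<delta> > 0" using net_mono[of A d \<delta>] by auto
qed

lemma noncompactness_le_norm: "A \<in> BO \<Longrightarrow> noncompactness L N A \<le> operator_norm L N A"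
  by (intro noncompactness_le net_operator_norm operator_norm_nonneg)

lemma noncompactness_cong:
  assumes "A \<in> BO" "B \<in> BO" "\<And>f. f \<in> L \<Longrightarrow> AE x in \<mu>. A f x = B f x"
  shows "noncompactness L N A = noncompactness L N B"
proof -
  have "N (\<lambda>x. A f x - g x) = N (\<lambda>x. B f x - g x)" if "f \<in> L" "g \<in> L" for f g
    by (rule norm_cong[OF diff_closed diff_closed eventually_mono[OF assms(3)[OF that(1)]]])
      (use that bo_L[OF assms(1)] bo_L[OF assms(2)] in auto)
  then have "net A \<delta> \<longleftrightarrow> net B \<delta>" for \<delta>
    unfolding net_def unit_ball_def by (smt (verit) mem_Collect_eq subset_iff)
  then show ?thesis by (simp add: noncompactness_net)
qed

lemma net_add:
  assumes "A \<in> BO" "B \<in> BO" "net A \<delta>" "net B \<epsilon>"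
  shows "net (\<lambda>f x. A f x + B f x) (\<delta> + \<epsilon>)"
proof -
  obtain M M' where M: "finite M" "M \<subseteq> L" "\<And>f. f \<in> unit_ball L N \<Longrightarrow> \<exists>g\<in>M. N (\<lambda>x. A f x - g x) \<le> \<delta>"
    and M': "finite M'" "M' \<subseteq> L" "\<And>f. f \<in> unit_ball L N \<Longrightarrow> \<exists>g\<in>M'. N (\<lambda>x. B f x - g x) \<le> \<epsilon>"
    using assms(3,4) by (auto simp: net_def)
  show ?thesis
    unfolding net_def
  proof (intro exI[of _ "(\<lambda>(g, h) x. g x + h x) ` (M \<times> M')"] conjI ballI)
    fix f assume f: "f \<in> unit_ball L N"
    then have fL: "f \<in> L" by (simp add: unit_ball_def)
    obtain g h where gh: "g \<in> M" "N (\<lambda>x. A f x - g x) \<le> \<delta>" "h \<in> M'" "N (\<lambda>x. B f x - h x) \<le> \<epsilon>"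
      using M(3)[OF f] M'(3)[OF f] by blast
    have "N (\<lambda>x. (A f x - g x) + (B f x - h x)) \<le> \<delta> + \<epsilon>"
      by (rule order_trans[OF norm_triangle add_mono])
        (use gh M(2) M'(2) fL in \<open>auto intro!: diff_closed bo_L[OF assms(1)] bo_L[OF assms(2)]\<close>)
    then have "N (\<lambda>x. A f x + B f x - (g x + h x)) \<le> \<delta> + \<epsilon>" by (simp add: algebra_simps)
    then show "\<exists>k\<in>(\<lambda>(g, h) x. g x + h x) ` (M \<times> M'). N (\<lambda>x. A f x + B f x - k x) \<le> \<delta> + \<epsilon>"
      using gh by (intro bexI[of _ "\<lambda>x. g x + h x"]) force+
  qed (use M M' add_closed in \<open>auto simp: subset_iff\<close>)
qed

lemma noncompactness_add:
  assumes "A \<in> BO" "B \<in> BO"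
  shows "noncompactness L N (\<lambda>f x. A f x + B f x) \<le> noncompactness L N A + noncompactness L N B"
proof (rule field_le_epsilon)
  fix e :: real assume e: "e > 0"
  have "net (\<lambda>f x. A f x + B f x) ((noncompactness L N A + e / 2) + (noncompactness L N B + e / 2))"
    using e by (intro net_add assms noncompactness_less) auto
  then have "noncompactness L N (\<lambda>f x. A f x + B f x) \<le> (noncompactness L N A + e / 2) + (noncompactness L N B + e / 2)"
    by (rule noncompactness_le) (use e noncompactness_nonneg[OF assms(1)] noncompactness_nonneg[OF assms(2)] in simp)
  then show "noncompactness L N (\<lambda>f x. A f x + B f x) \<le> noncompactness L N A + noncompactness L N B + e" by simp
qed

lemma net_scale:
  assumes "A \<in> BO" "net A \<delta>"
  shows "net (\<lambda>f x. c * A f x) (cmod c * \<delta>)"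
proof -
  obtain M where M: "finite M" "M \<subseteq> L" "\<And>f. f \<in> unit_ball L N \<Longrightarrow> \<exists>g\<in>M. N (\<lambda>x. A f x - g x) \<le> \<delta>"
    using assms(2) by (auto simp: net_def)
  show ?thesis
    unfolding net_def
  proof (intro exI[of _ "(\<lambda>g x. c * g x) ` M"] conjI ballI)
    fix f assume f: "f \<in> unit_ball L N"
    then have fL: "f \<in> L" by (simp add: unit_ball_def)
    obtain g where g: "g \<in> M" "N (\<lambda>x. A f x - g x) \<le> \<delta>" using M(3)[OF f] by blast
    have "N (\<lambda>x. c * (A f x - g x)) \<le> cmod c * \<delta>"
      using g M(2) fL by (subst norm_scale) (auto intro!: diff_closed bo_L[OF assms(1)] mult_left_mono)
    then show "\<exists>k\<in>(\<lambda>g x. c * g x) ` M. N (\<lambda>x. c * A f x - k x) \<le> cmod c * \<delta>"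
      using g(1) by (auto simp: algebra_simps)
  qed (use M scale_closed in auto)
qed

lemma noncompactness_scale_le:
  assumes "A \<in> BO"
  shows "noncompactness L N (\<lambda>f x. c * A f x) \<le> cmod c * noncompactness L N A"
proof (rule LIMSEQ_le_const)
  show "(\<lambda>i. cmod c * (noncompactness L N A + 1 / real (Suc i))) \<longlonglongrightarrow> cmod c * noncompactness L N A"
    using tendsto_mult_left[OF tendsto_add[OF tendsto_const LIMSEQ_inverse_real_of_nat]]
    by (simp add: inverse_eq_divide)
  show "\<exists>n0. \<forall>i\<ge>n0. noncompactness L N (\<lambda>f x. c * A f x) \<le> cmod c * (noncompactness L N A + 1 / real (Suc i))"
    using noncompactness_nonneg[OF assms]
    by (intro exI[of _ 0] allI impI noncompactness_le net_scale noncompactness_less assms mult_nonneg_nonneg) auto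
qed

lemma noncompactness_scale:
  assumes "A \<in> BO"
  shows "noncompactness L N (\<lambda>f x. c * A f x) = cmod c * noncompactness L N A"
proof (cases "c = 0")
  case True
  then show ?thesis
    using noncompactness_scale_le[OF assms, of 0] noncompactness_nonneg[OF bo_scaled[OF assms, of 0]] by simp
next
  case False
  have "noncompactness L N A \<le> cmod (1 / c) * noncompactness L N (\<lambda>f x. c * A f x)"
    using noncompactness_scale_le[OF bo_scaled[OF assms, of c], of "1 / c"] False by simp
  then show ?thesis
    using noncompactness_scale_le[OF assms, of c] False by (simp add: norm_divide field_simps)
qed

text \<open>If h is a centre near B f, then (B f - h) / \<epsilon> lies in the unit ball, where the
  net of A applies with some centre g; the composite therefore has the centres A h + \<epsilon>
  g.\<close>

lemma net_comp:
  assumes "A \<in> BO" "B \<in> BO" "net A \<delta>" "net B \<epsilon>" "\<epsilon> > 0"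
  shows "net (\<lambda>f. A (B f)) (\<delta> * \<epsilon>)"
proof -
  obtain M M' where M: "finite M" "M \<subseteq> L" "\<And>f. f \<in> unit_ball L N \<Longrightarrow> \<exists>g\<in>M. N (\<lambda>x. A f x - g x) \<le> \<delta>"
    and M': "finite M'" "M' \<subseteq> L" "\<And>f. f \<in> unit_ball L N \<Longrightarrow> \<exists>g\<in>M'. N (\<lambda>x. B f x - g x) \<le> \<epsilon>"
    using assms(3,4) by (auto simp: net_def)
  define c where "c = complex_of_real \<epsilon>"
  have c: "c \<noteq> 0" "cmod c = \<epsilon>" using assms(5) by (auto simp: c_def)
  show ?thesis
    unfolding net_def
  proof (intro exI[of _ "(\<lambda>(g, h) x. A h x + c * g x) ` (M \<times> M')"] conjI ballI)
    fix f assume f: "f \<in> unit_ball L N"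
    then have fL: "f \<in> L" by (simp add: unit_ball_def)
    obtain h where h: "h \<in> M'" "N (\<lambda>x. B f x - h x) \<le> \<epsilon>" using M'(3)[OF f] by blast
    have hL: "h \<in> L" using h M'(2) by auto
    note BfL = bo_L[OF assms(2) fL]
    define k where "k = (\<lambda>x. 1 / c * (B f x - h x))"
    have kL: "k \<in> L" unfolding k_def by (intro scale_closed diff_closed BfL hL)
    have "N k \<le> 1"
      using h(2) assms(5) c norm_scale[OF diff_closed[OF BfL hL], of "1 / c"]
      by (simp add: k_def norm_divide)
    then obtain g where g: "g \<in> M" "N (\<lambda>x. A k x - g x) \<le> \<delta>" using M(3)[of k] kL by (auto simp: unit_ball_def)
    have gL: "g \<in> L" using g M(2) by auto
    have eq: "B f = (\<lambda>x. h x + c * k x)" using c by (auto simp: k_def fun_eq_iff)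
    have "AE x in \<mu>. A (B f) x - (A h x + c * g x) = c * (A k x - g x)"
      using bo_add[OF assms(1) hL scale_closed[OF kL, of c]] bo_scale[OF assms(1) kL, of c]
      unfolding eq by eventually_elim (simp add: algebra_simps)
    then have "N (\<lambda>x. A (B f) x - (A h x + c * g x)) = N (\<lambda>x. c * (A k x - g x))"
      by (intro norm_cong diff_closed scale_closed add_closed bo_L[OF assms(1)] BfL hL gL kL fL)
    also have "\<dots> \<le> \<delta> * \<epsilon>"
      using g(2) c assms(5) norm_scale[OF diff_closed[OF bo_L[OF assms(1) kL] gL], of c]
      by (simp add: mult.commute mult_left_mono)
    finally show "\<exists>r\<in>(\<lambda>(g, h) x. A h x + c * g x) ` (M \<times> M'). N (\<lambda>x. A (B f) x - r x) \<le> \<delta> * \<epsilon>"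
      using g(1) h(1) by (intro bexI[of _ "\<lambda>x. A h x + c * g x"]) force+
  qed (use M(1,2) M'(1,2) in \<open>auto intro!: add_closed scale_closed bo_L[OF assms(1)]\<close>)
qed

lemma noncompactness_comp:
  assumes "A \<in> BO" "B \<in> BO"
  shows "noncompactness L N (\<lambda>f. A (B f)) \<le> noncompactness L N A * noncompactness L N B"
proof (rule LIMSEQ_le_const)
  let ?e = "\<lambda>i. 1 / real (Suc i)"
  show "(\<lambda>i. (noncompactness L N A + ?e i) * (noncompactness L N B + ?e i)) \<longlonglongrightarrow> noncompactness L N A * noncompactness L N B"
    using tendsto_mult[OF tendsto_add[OF tendsto_const LIMSEQ_inverse_real_of_nat] tendsto_add[OF tendsto_const LIMSEQ_inverse_real_of_nat]]
    by (simp add: inverse_eq_divide)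
  show "\<exists>n0. \<forall>i\<ge>n0. noncompactness L N (\<lambda>f. A (B f)) \<le> (noncompactness L N A + ?e i) * (noncompactness L N B + ?e i)"
    using noncompactness_nonneg[OF assms(1)] noncompactness_nonneg[OF assms(2)]
    by (intro exI[of _ 0] allI impI noncompactness_le net_comp[OF assms] noncompactness_less[OF assms(1)]
        noncompactness_less[OF assms(2)] mult_nonneg_nonneg) auto
qed

text \<open>Without a finite net of radius e, points of the unit ball with images more than e apart
  could be chosen inductively, and no subsequence of the images would converge.\<close>

lemma noncompactness_compact:
  assumes "K \<in> compact_operators \<mu> L N"
  shows "noncompactness L N K = 0"
proof -
  have K: "K \<in> BO" and comp: "\<forall>s. (\<forall>i. s i \<in> unit_ball L N) \<longrightarrow>
      (\<exists>\<phi>::nat \<Rightarrow> nat. strict_mono \<phi> \<and> (\<exists>g\<in>L. (\<lambda>i. N (\<lambda>x. K (s (\<phi> i)) x - g x)) \<longlonglongrightarrow> 0))"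
    using assms by (simp_all add: compact_operators_def)
  have "net K e" if e: "e > 0" for e
  proof (rule ccontr)
    assume no: "\<not> net K e"
    define P where "P s i f \<longleftrightarrow> f \<in> unit_ball L N \<and> (\<forall>j<i. N (\<lambda>x. K f x - K (s j) x) > e)"
      for s and i :: nat and f
    have "\<exists>s. \<forall>i. P s i (s i)"
    proof (rule dependent_wellorder_choice[of P])
      show "P s i f = P s' i f" if "\<And>j. j < i \<Longrightarrow> s j = s' j" for f s s' i
        using that by (simp add: P_def)
      fix s and i :: nat
      assume IH: "\<And>j. j < i \<Longrightarrow> P s j (s j)"
      have "s j \<in> L" if "j < i" for j using IH[OF that] by (simp add: unit_ball_def P_def)
      then have "(\<lambda>j. K (s j)) ` {..<i} \<subseteq> L" by (auto intro: bo_L[OF K])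
      then have "\<not> (\<forall>f\<in>unit_ball L N. \<exists>g\<in>(\<lambda>j. K (s j)) ` {..<i}. N (\<lambda>x. K f x - g x) \<le> e)"
        using no finite_imageI[OF finite_lessThan] unfolding net_def by blast
      then show "\<exists>f. P s i f"
        by (auto simp: not_le P_def)
    qed
    then obtain s where "\<forall>i. P s i (s i)" by (elim exE)
    then have s: "\<And>i. s i \<in> unit_ball L N" "\<And>i j. j < i \<Longrightarrow> N (\<lambda>x. K (s i) x - K (s j) x) > e"
      by (simp_all add: P_def)
    obtain \<phi> g where \<phi>: "strict_mono (\<phi> :: nat \<Rightarrow> nat)" "g \<in> L" "(\<lambda>i. N (\<lambda>x. K (s (\<phi> i)) x - g x)) \<longlonglongrightarrow> 0"
      using comp[rule_format, of s, OF s(1)] by (elim exE conjE bexE)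
    obtain i where i: "\<And>j. j \<ge> i \<Longrightarrow> N (\<lambda>x. K (s (\<phi> j)) x - g x) < e / 2"
      using order_tendstoD(2)[OF \<phi>(3), of "e / 2"] e unfolding eventually_sequentially by force
    have KL: "K (s j) \<in> L" for j using s(1)[of j] by (intro bo_L[OF K]) (simp add: unit_ball_def)
    have "N (\<lambda>x. K (s (\<phi> (Suc i))) x - K (s (\<phi> i)) x)
        = N (\<lambda>x. (K (s (\<phi> (Suc i))) x - g x) - (K (s (\<phi> i)) x - g x))" by simp
    also have "\<dots> \<le> N (\<lambda>x. K (s (\<phi> (Suc i))) x - g x) + N (\<lambda>x. K (s (\<phi> i)) x - g x)"
      by (intro norm_triangle_diff diff_closed KL \<phi>(2))
    also have "\<dots> < e" using i[of i] i[of "Suc i"] by simp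
    finally show False using s(2)[of "\<phi> i" "\<phi> (Suc i)"] \<phi>(1) by (simp add: strict_mono_Suc_iff)
  qed
  then have "noncompactness L N K \<le> 0 + e" if "e > 0" for e
    using that noncompactness_le[of K e] by simp
  then have "noncompactness L N K \<le> 0" by (rule field_le_epsilon)
  then show ?thesis using noncompactness_nonneg[OF K] by simp
qed

lemma noncompactness_pow:
  assumes "A \<in> BO" "k \<ge> 1"
  shows "noncompactness L N (A ^^ k) \<le> noncompactness L N A ^ k"
  using assms(2)
proof (induction k rule: dec_induct)
  case (step k)
  have "noncompactness L N (A ^^ Suc k) \<le> noncompactness L N A * noncompactness L N (A ^^ k)"
    using noncompactness_comp[OF assms(1) bo_pow[OF assms(1), of k]] by (simp add: comp_def)
  then show ?case
    using mult_left_mono[OF step.IH noncompactness_nonneg[OF assms(1)]] by (simp add: comp_def)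
qed simp

text \<open>Everything needed about \<open>z - A\<close>, for \<open>z\<close> outside the disc given by the measure of noncompactness:
  \<open>U\<close> is \<open>1 - A / z\<close>, up to a.e. equality.\<close>

lemma fredholm_resolvent:
  assumes A: "A \<in> BO" and m: "m \<ge> 1" and z: "noncompactness L N (A ^^ m) < cmod z ^ m"
  defines "U \<equiv> (\<lambda>f. f - (\<lambda>x. 1 / z * lift A f x))"
  obtains B p where "B \<in> BO"
    "\<And>f. f \<in> L \<Longrightarrow> N (rep ((U ^^ p) (\<lambda>x. B (\<lambda>y. z * f y - A f y) x - f x))) = 0"
    "\<And>f. f \<in> L \<Longrightarrow> N (rep ((U ^^ p) (\<lambda>x. z * B f x - A (B f) x - f x))) = 0"
    "\<And>s C. \<lbrakk>\<And>i. s i \<in> L; \<And>i. N (s i) \<le> C; \<And>i. N (rep ((U ^^ p) (s i))) = 0\<rbrakk> \<Longrightarrow>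
      \<exists>\<phi>::nat \<Rightarrow> nat. strict_mono \<phi> \<and> (\<exists>g\<in>L. (\<lambda>i. N (\<lambda>x. s (\<phi> i) x - g x)) \<longlonglongrightarrow> 0)"
proof -
  have nn: "noncompactness L N (A ^^ m) \<ge> 0" by (rule noncompactness_nonneg[OF bo_pow[OF A]])
  have z0: "z \<noteq> 0" using z nn m by (auto simp: power_0_left)
  define T where "T = (\<lambda>f x. 1 / z * lift A f x)"
  have lA: "lift A \<in> sem.bounded_maps" by (rule lift_bounded_map[OF A])
  have T: "T \<in> sem.bounded_maps" unfolding T_def by (rule sem.bm_scaled[OF lA])
  have T_pow: "(T ^^ k) f = (\<lambda>x. (1 / z) ^ k * (lift A ^^ k) f x)" for k f
  proof (induction k)
    case (Suc k)
    then show ?case using sem.bm_scale[OF lA, of "(1 / z) ^ k" "(lift A ^^ k) f"] by (simp add: T_def)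
  qed simp
  \<comment> \<open>The noncompactness of (A / z)^m is t < 1; a further power k with t^k < 1/4
    reaches the constant of the condensing theory.\<close>
  define t where "t = noncompactness L N (A ^^ m) / cmod z ^ m"
  have t: "0 \<le> t" "t < 1" using nn z z0 by (auto simp: t_def)
  have "(\<lambda>k. t ^ k) \<longlonglongrightarrow> 0" using t by (intro LIMSEQ_power_zero) simp
  then have "\<forall>\<^sub>F k in sequentially. t ^ k < 1 / 4" by (rule order_tendstoD) simp
  then have "\<forall>\<^sub>F k in sequentially. t ^ k < 1 / 4 \<and> k \<ge> 1" using eventually_ge_at_top[of 1] by (rule eventually_conj)
  then obtain k where k: "t ^ k < 1 / 4" "k \<ge> 1" by (auto simp: eventually_sequentially)
  define M where "M = m * k"
  have "noncompactness L N (A ^^ M) \<le> noncompactness L N (A ^^ m) ^ k"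
    using noncompactness_pow[OF bo_pow[OF A, of m] k(2)] by (simp add: M_def funpow_mult)
  also have "\<dots> = t ^ k * cmod z ^ M" using z0 by (simp add: t_def M_def power_divide power_mult)
  also have "\<dots> < cmod z ^ M / 4" using k(1) z0 by simp
  finally have "net (A ^^ M) (cmod z ^ M / 4)" by (rule noncompactness_less[OF bo_pow[OF A]])
  then obtain G where G: "finite G" "G \<subseteq> L"
    "\<And>f. f \<in> unit_ball L N \<Longrightarrow> \<exists>g\<in>G. N (\<lambda>x. (A ^^ M) f x - g x) \<le> cmod z ^ M / 4"
    by (auto simp: net_def)
  have "sem.covered (T ^^ M) (1/4)"
    unfolding sem.covered_def
  proof (intro exI[of _ "(\<lambda>g x. (1 / z) ^ M * g x) ` G"] conjI allI impI)
    fix f assume f: "N (rep f) \<le> 1"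
    then obtain g where g: "g \<in> G" "N (\<lambda>x. (A ^^ M) (rep f) x - g x) \<le> cmod z ^ M / 4"
      using G(3)[of "rep f"] by (auto simp: unit_ball_def)
    have gL: "g \<in> L" using g(1) G(2) by auto
    have AL: "(A ^^ M) (rep f) \<in> L" by (rule bo_L[OF bo_pow[OF A] rep_L])
    have "(T ^^ M) f - (\<lambda>x. (1 / z) ^ M * g x) = (\<lambda>x. (1 / z) ^ M * ((lift A ^^ M) f x - g x))"
      by (simp add: T_pow fun_eq_iff algebra_simps)
    then have "N (rep ((T ^^ M) f - (\<lambda>x. (1 / z) ^ M * g x)))
        = cmod ((1 / z) ^ M) * N (\<lambda>x. rep ((lift A ^^ M) f) x - rep g x)"
      using norm_scale[OF diff_closed[OF rep_L rep_L]] by (simp add: rep_scale rep_minus)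
    also have "N (\<lambda>x. rep ((lift A ^^ M) f) x - rep g x) = N (\<lambda>x. (A ^^ M) (rep f) x - g x)"
      unfolding lift_pow[OF A] rep_minus[symmetric] by (rule norm_rep[OF diff_closed[OF AL gL]])
    also have "cmod ((1 / z) ^ M) * \<dots> \<le> cmod ((1 / z) ^ M) * (cmod z ^ M / 4)"
      by (intro mult_left_mono g(2)) simp
    also have "\<dots> = 1/4" using z0 by (simp add: norm_power norm_divide power_divide)
    finally show "\<exists>h\<in>(\<lambda>g x. (1 / z) ^ M * g x) ` G. N (rep ((T ^^ M) f - h)) \<le> 1/4"
      using g(1) by blast
  qed (use G in auto)
  then interpret c: condensing_map "\<lambda>c f (x::'x). c * f x" "\<lambda>f. N (rep f)" T M
    by unfold_locales (rule T)
  have U: "c.U = U" by (rule ext) (subst c.U_def, simp only: U_def T_def)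
  obtain B p C where B: "\<And>f. N (rep (B f)) \<le> C * N (rep f)"
    "\<And>f g. N (rep (B (f + g) - (B f + B g))) = 0"
    "\<And>c f. N (rep (B (\<lambda>x. c * f x) - (\<lambda>x. c * B f x))) = 0"
    "\<And>f. N (rep ((U ^^ p) (U (B f) - f))) = 0"
    "\<And>f. N (rep ((U ^^ p) (B (U f) - f))) = 0"
    by (rule c.fredholm_inverse[unfolded U]) blast
  have rep0: "rep f = rep g" if "N (rep (f - g)) = 0" for f g
  proof -
    have "AE x in \<mu>. rep f x = rep g x"
      using that norm_diff_eq_0[of "rep f" "rep g"] by (simp add: rep_minus fun_diff_def)
    then have "rep (rep f) = rep (rep g)" by (intro rep_cong) auto
    then show ?thesis by simp
  qed
  \<comment> \<open>B is additive and bounded only up to null functions, which is just enough for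
    the class of B f to depend on the class of f alone.\<close>
  have Bc: "rep (B f) = rep (B g)" if "rep f = rep g" for f g
  proof -
    have "rep (B ((f - g) + g)) = rep (B (f - g)) + rep (B g)"
      using rep0[OF B(2)] by (simp only: rep_add)
    moreover have "N (rep (B (f - g))) \<le> C * N 0" using B(1)[of "f - g"] that by (simp add: rep_diff)
    then have "rep (rep (B (f - g))) = 0"
      using norm_nonneg[OF rep_L, of "B (f - g)"] norm_eq_0[OF rep_L, of "B (f - g)"]
      by (intro rep_null) (auto simp: zero_fun_def)
    ultimately show ?thesis by simp
  qed
  \<comment> \<open>Up to null functions z - A is z U, so the inverse of U is divided by z.\<close>
  define B0 where "B0 = (\<lambda>f x. 1 / z * rep (B f) x)"
  have B0: "B0 \<in> BO"
    unfolding B0_def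
  proof (rule bo_scaled, rule BO_I[where C = C])
    fix f g assume fg: "f \<in> L" "g \<in> L"
    show "AE x in \<mu>. rep (B (\<lambda>y. f y + g y)) x = rep (B f) x + rep (B g) x"
      using rep0[OF B(2)[of f g]] by (simp add: rep_plus plus_fun_def)
    assume "AE x in \<mu>. f x = g x"
    then show "AE x in \<mu>. rep (B f) x = rep (B g) x" using Bc[OF rep_cong[OF fg]] by simp
  next
    fix f c assume f: "f \<in> L"
    show "AE x in \<mu>. rep (B (\<lambda>y. c * f y)) x = c * rep (B f) x"
      using rep0[OF B(3)[of c f]] by (simp add: rep_scale)
    show "N (rep (B f)) \<le> C * N f" using B(1)[of f] by (simp add: norm_rep f)
  qed simp
  have Uc: "N (rep ((U ^^ p) f)) = N (rep ((U ^^ p) g))" if "rep f = rep g" for f g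
  proof -
    have "N (rep (f - g)) = 0" using that by (simp add: rep_diff zero_fun_def)
    then have "N (rep ((U ^^ p) (f - g))) = 0"
      unfolding U[symmetric] by (rule sem.bm_null[OF c.Uk])
    then show ?thesis
      using rep0[of "(U ^^ p) f" "(U ^^ p) g"] sem.bm_diff[OF c.Uk, of p f g] by (simp add: U)
  qed
  have rU: "rep (\<lambda>x. z * U f x) = rep (\<lambda>x. z * f x - A f x)" if f: "f \<in> L" for f
  proof (rule rep_cong)
    have "(\<lambda>x. z * U f x) = (\<lambda>x. z * f x - lift A f x)" using z0 by (auto simp: U_def fun_eq_iff algebra_simps)
    moreover have "lift A f \<in> L" by (simp add: lift_def)
    ultimately show "(\<lambda>x. z * U f x) \<in> L" by (simp add: diff_closed scale_closed f)
    show "(\<lambda>x. z * f x - A f x) \<in> L" by (intro diff_closed scale_closed f bo_L[OF A])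
    show "AE x in \<mu>. z * U f x = z * f x - A f x"
      using lift_AE[OF A f] by eventually_elim (use z0 in \<open>simp add: U_def algebra_simps\<close>)
  qed
  show thesis
  proof (rule that[OF B0, of p])
    fix f assume f: "f \<in> L"
    have "rep (B (\<lambda>y. z * f y - A f y)) = rep (B (\<lambda>x. z * U f x))" by (rule Bc) (simp add: rU[OF f])
    also have "\<dots> = rep (\<lambda>x. z * B (U f) x)" by (rule rep0[OF B(3)])
    finally have "B0 (\<lambda>y. z * f y - A f y) = rep (B (U f))"
      using z0 by (simp add: B0_def rep_scale)
    then have "rep (\<lambda>x. B0 (\<lambda>y. z * f y - A f y) x - f x) = rep (B (U f) - f)"
      by (simp add: rep_minus fun_diff_def)
    then show "N (rep ((U ^^ p) (\<lambda>x. B0 (\<lambda>y. z * f y - A f y) x - f x))) = 0"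
      using B(5)[of f] Uc by metis
    have B0L: "B0 f \<in> L" by (rule bo_L[OF B0 f])
    have e1: "rep (\<lambda>x. z * B0 f x - A (B0 f) x) = rep (\<lambda>x. z * U (B0 f) x)" by (simp add: rU[OF B0L])
    have e2: "(\<lambda>x. z * U (B0 f) x) = U (\<lambda>x. z * B0 f x)"
      using sem.bm_scale[OF c.U, of z "B0 f"] by (simp add: U)
    have e3: "(\<lambda>x. z * B0 f x) = rep (B f)" using z0 by (simp add: B0_def)
    have e4: "rep (U (rep (B f))) = rep (U (B f))"
      using rep_add[of "rep (B f)"] by (simp add: U_def lift_def rep_diff)
    have E: "rep (\<lambda>x. z * B0 f x - A (B0 f) x) = rep (U (B f))"
      by (rule trans[OF e1]) (simp only: e2 e3 e4)
    have "rep (\<lambda>x. z * B0 f x - A (B0 f) x - f x) = (\<lambda>x. rep (\<lambda>x. z * B0 f x - A (B0 f) x) x - rep f x)"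
      by (rule rep_minus)
    also have "\<dots> = rep (U (B f) - f)" unfolding E rep_diff by (simp only: fun_diff_def)
    finally show "N (rep ((U ^^ p) (\<lambda>x. z * B0 f x - A (B0 f) x - f x))) = 0"
      using B(4)[of f] Uc by metis
  next
    fix s D assume s: "\<And>i. s i \<in> L" "\<And>i. N (s i) \<le> D" "\<And>i::nat. N (rep ((U ^^ p) (s i))) = 0"
    have "sem.n_tendsto (\<lambda>i. (c.U ^^ p) (s i)) 0" using s(3) by (simp add: sem.n_tendsto_zero U)
    then obtain \<phi> g where \<phi>: "strict_mono (\<phi> :: nat \<Rightarrow> nat)" "sem.n_tendsto (\<lambda>i. s (\<phi> i)) g"
      using c.proper_power[of s D p 0] s(1,2) by (auto simp: norm_rep)
    have "N (rep (s (\<phi> i) - g)) = N (\<lambda>x. s (\<phi> i) x - rep g x)" for i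
      unfolding rep_minus fun_diff_def
      by (rule norm_cong[OF diff_closed diff_closed eventually_mono[OF rep_AE[OF s(1)]]]) (use s(1) in auto)
    then show "\<exists>\<phi>::nat \<Rightarrow> nat. strict_mono \<phi> \<and> (\<exists>g\<in>L. (\<lambda>i. N (\<lambda>x. s (\<phi> i) x - g x)) \<longlonglongrightarrow> 0)"
      using \<phi> unfolding sem.n_tendsto_def by (intro exI[of _ \<phi>]) auto
  qed
qed

text \<open>The errors of the Fredholm inverse take values annihilated by a power of 1 - A / z.
  Bounded sequences of such functions have convergent subsequences, so the errors are
  compact.\<close>

lemma ess_not_spectrum:
  assumes A: "A \<in> BO" and m: "m \<ge> 1" and z: "noncompactness L N (A ^^ m) < cmod z ^ m"
  shows "z \<notin> spectrum_mod \<mu> L N (compact_operators \<mu> L N) A"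
proof -
  define U where "U = (\<lambda>f. f - (\<lambda>x. 1 / z * lift A f x))"
  obtain B p where B: "B \<in> BO"
    "\<And>f. f \<in> L \<Longrightarrow> N (rep ((U ^^ p) (\<lambda>x. B (\<lambda>y. z * f y - A f y) x - f x))) = 0"
    "\<And>f. f \<in> L \<Longrightarrow> N (rep ((U ^^ p) (\<lambda>x. z * B f x - A (B f) x - f x))) = 0"
    and seq: "\<And>s C. \<lbrakk>\<And>i. s i \<in> L; \<And>i. N (s i) \<le> C; \<And>i. N (rep ((U ^^ p) (s i))) = 0\<rbrakk> \<Longrightarrow>
      \<exists>\<phi>::nat \<Rightarrow> nat. strict_mono \<phi> \<and> (\<exists>g\<in>L. (\<lambda>i. N (\<lambda>x. s (\<phi> i) x - g x)) \<longlonglongrightarrow> 0)"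
    by (rule fredholm_resolvent[OF A m z, folded U_def]) blast
  have compact: "K \<in> compact_operators \<mu> L N"
    if "K \<in> BO" "\<And>f. f \<in> L \<Longrightarrow> N (rep ((U ^^ p) (K f))) = 0" for K
    unfolding compact_operators_def mem_Collect_eq
  proof (intro conjI allI impI that(1))
    fix s :: "nat \<Rightarrow> 'x \<Rightarrow> complex" assume s: "\<forall>i. s i \<in> unit_ball L N"
    then have sL: "s i \<in> L" for i by (auto simp: unit_ball_def)
    have "N (K (s i)) \<le> operator_norm L N K" for i
      using operator_norm_upper[OF that(1)] s by blast
    then show "\<exists>\<phi>::nat \<Rightarrow> nat. strict_mono \<phi> \<and> (\<exists>g\<in>L. (\<lambda>i. N (\<lambda>x. K (s (\<phi> i)) x - g x)) \<longlonglongrightarrow> 0)"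
      by (intro seq[of "\<lambda>i. K (s i)"] that(2) bo_L[OF that(1)] sL)
  qed
  have "(\<lambda>f x. B (\<lambda>y. z * f y - A f y) x - f x) \<in> compact_operators \<mu> L N"
    by (rule compact[OF bo_minus[OF bo_comp[OF B(1) bo_resolvent[OF A]] bo_id(2)] B(2)])
  moreover have "(\<lambda>f x. z * B f x - A (B f) x - f x) \<in> compact_operators \<mu> L N"
    by (rule compact[OF bo_minus[OF bo_minus[OF bo_scaled[OF B(1)] bo_comp[OF A B(1)]] bo_id(2)] B(3)])
  ultimately show ?thesis using B(1) by (auto simp: spectrum_mod_def)
qed

text \<open>Noncompactness is below the norm, so the Fredholm inverse is available again, with
  errors in the kernel of a power of 1 - A / z. Under the stronger bound this kernel is null: A f =
  z f gives |z|^m N f \<le> ||A^m|| N f. Hence the inverse is genuine, and no Neumann series is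
  summed.\<close>

lemma norm_not_spectrum:
  assumes A: "A \<in> BO" and m: "m \<ge> 1" and z: "operator_norm L N (A ^^ m) < cmod z ^ m"
  shows "z \<notin> spectrum_mod \<mu> L N (null_operators \<mu> L N) A"
proof -
  have Am: "A ^^ m \<in> BO" by (rule bo_pow[OF A])
  have z0: "z \<noteq> 0" using z operator_norm_nonneg[OF Am] m by (auto simp: power_0_left)
  define U where "U = (\<lambda>f. f - (\<lambda>x. 1 / z * lift A f x))"
  obtain B p where B: "B \<in> BO"
    "\<And>f. f \<in> L \<Longrightarrow> N (rep ((U ^^ p) (\<lambda>x. B (\<lambda>y. z * f y - A f y) x - f x))) = 0"
    "\<And>f. f \<in> L \<Longrightarrow> N (rep ((U ^^ p) (\<lambda>x. z * B f x - A (B f) x - f x))) = 0"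
    by (rule fredholm_resolvent[OF A m le_less_trans[OF noncompactness_le_norm[OF Am] z], folded U_def]) blast
  have fixpoint: "N (rep f) = 0" if Uf: "N (rep (U f)) = 0" for f
  proof -
    have "AE x in \<mu>. rep (U f) x = 0" using Uf norm_eq_0[OF rep_L] by blast
    then have "rep (rep (U f)) = 0" by (intro rep_null) auto
    then have "rep (U f) = 0" by (simp only: rep_rep)
    moreover have "rep (U f) = rep f - (\<lambda>x. 1 / z * rep (lift A f) x)"
      unfolding U_def rep_diff rep_scale ..
    ultimately have "rep f - (\<lambda>x. 1 / z * rep (lift A f) x) = 0" by (simp only:)
    then have r1: "rep f = (\<lambda>x. 1 / z * rep (lift A f) x)" by (simp only: right_minus_eq)
    have r2: "rep (A (rep f)) = (\<lambda>x. z * rep f x)"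
    proof
      fix x
      have e: "rep f x = 1 / z * rep (A (rep f)) x"
        using fun_cong[OF r1, of x] by (simp only: lift_def rep_rep)
      show "rep (A (rep f)) x = z * rep f x" by (subst e) (use z0 in simp)
    qed
    have step: "rep (A (\<lambda>x. c * rep f x)) = (\<lambda>x. c * z * rep f x)" for c
    proof -
      have "rep (A (\<lambda>x. c * rep f x)) = rep (\<lambda>x. c * A (rep f) x)"
        by (rule rep_cong[OF bo_L[OF A scale_closed[OF rep_L]] scale_closed[OF bo_L[OF A rep_L]]
              bo_scale[OF A rep_L]])
      also have "\<dots> = (\<lambda>x. c * rep (A (rep f)) x)" by (rule rep_scale)
      finally show ?thesis by (simp only: r2 mult.assoc)
    qed
    have pow: "rep ((A ^^ k) (rep f)) = (\<lambda>x. z ^ k * rep f x)" for k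
    proof (induction k)
      case (Suc k)
      have AL: "(A ^^ k) (rep f) \<in> L" by (rule bo_L[OF bo_pow[OF A] rep_L])
      have "rep (A ((A ^^ k) (rep f))) = rep (A (rep ((A ^^ k) (rep f))))"
        using rep_AE[OF AL] by (intro rep_cong bo_L[OF A] bo_cong[OF A] AL rep_L) auto
      then show ?case using step[of "z ^ k"] Suc by (simp add: mult.commute)
    qed simp
    have "cmod z ^ m * N (rep f) = N (rep ((A ^^ m) (rep f)))"
      using norm_scale[OF rep_L, of "z ^ m" f] by (simp add: pow norm_power)
    also have "\<dots> \<le> operator_norm L N (A ^^ m) * N (rep f)"
      using operator_norm_bound[OF Am rep_L] norm_rep[OF bo_L[OF Am rep_L]] by simp
    finally have le: "cmod z ^ m * N (rep f) \<le> operator_norm L N (A ^^ m) * N (rep f)" .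
    have "\<not> 0 < N (rep f)" using mult_strict_right_mono[OF z, of "N (rep f)"] le by linarith
    then show ?thesis using norm_nonneg[OF rep_L, of f] by linarith
  qed
  have pow0: "N (rep f) = 0" if "N (rep ((U ^^ k) f)) = 0" for k f
    using that
  proof (induction k)
    case (Suc k)
    then show ?case using fixpoint[of "(U ^^ k) f"] by simp
  qed simp
  have null: "K \<in> null_operators \<mu> L N"
    if "K \<in> BO" "\<And>f. f \<in> L \<Longrightarrow> N (rep ((U ^^ p) (K f))) = 0" for K
    unfolding null_operators_def mem_Collect_eq
  proof (intro conjI ballI that(1))
    fix f assume f: "f \<in> L"
    then have "N (K f) = 0" using pow0[OF that(2)[OF f]] norm_rep[OF bo_L[OF that(1) f]] by simp
    then show "AE x in \<mu>. K f x = 0" using norm_eq_0[OF bo_L[OF that(1) f]] by simp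
  qed
  have "(\<lambda>f x. B (\<lambda>y. z * f y - A f y) x - f x) \<in> null_operators \<mu> L N"
    by (rule null[OF bo_minus[OF bo_comp[OF B(1) bo_resolvent[OF A]] bo_id(2)] B(2)])
  moreover have "(\<lambda>f x. z * B f x - A (B f) x - f x) \<in> null_operators \<mu> L N"
    by (rule null[OF bo_minus[OF bo_minus[OF bo_scaled[OF B(1)] bo_comp[OF A B(1)]] bo_id(2)] B(3)])
  ultimately show ?thesis using B(1) by (auto simp: spectrum_mod_def)
qed

lemma operator_norm_gauge: "operator_gauge \<mu> L N (operator_norm L N) (null_operators \<mu> L N)"
proof
  fix A B assume A: "A \<in> BO" and B: "B \<in> BO"
  show "operator_norm L N (\<lambda>f x. A f x + B f x) \<le> operator_norm L N A + operator_norm L N B"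
  proof (rule operator_norm_least)
    fix f assume f: "f \<in> unit_ball L N"
    then have "f \<in> L" by (simp add: unit_ball_def)
    then show "N (\<lambda>x. A f x + B f x) \<le> operator_norm L N A + operator_norm L N B"
      using norm_triangle[OF bo_L[OF A] bo_L[OF B]] operator_norm_upper[OF A f] operator_norm_upper[OF B f] by force
  qed
  show "operator_norm L N (\<lambda>f. A (B f)) \<le> operator_norm L N A * operator_norm L N B"
  proof (rule operator_norm_least)
    fix f assume f: "f \<in> unit_ball L N"
    then have "B f \<in> L" by (simp add: unit_ball_def bo_L[OF B])
    then show "N (A (B f)) \<le> operator_norm L N A * operator_norm L N B"
      using operator_norm_bound[OF A] mult_left_mono[OF operator_norm_upper[OF B f] operator_norm_nonneg[OF A]]
      by (meson order_trans)
  qed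
  assume eq: "\<And>f. f \<in> L \<Longrightarrow> AE x in \<mu>. A f x = B f x"
  have "N (A f) = N (B f)" if "f \<in> L" for f
    by (rule norm_cong[OF bo_L[OF A that] bo_L[OF B that] eq[OF that]])
  then show "operator_norm L N A = operator_norm L N B"
    unfolding operator_norm_def by (intro SUP_cong) (auto simp: unit_ball_def)
next
  fix A and c :: complex assume A: "A \<in> BO"
  have "N (\<lambda>x. c * A f x) = cmod c * N (A f)" if "f \<in> L" for f
    by (rule norm_scale[OF bo_L[OF A that]])
  then have le: "operator_norm L N (\<lambda>f x. c * A f x) \<le> cmod c * operator_norm L N A"
    using operator_norm_upper[OF A]
    by (intro operator_norm_least) (auto simp: unit_ball_def intro!: mult_left_mono)
  have ge: "cmod c * operator_norm L N A \<le> operator_norm L N (\<lambda>f x. c * A f x)" if "c \<noteq> 0"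
  proof -
    have "operator_norm L N A \<le> operator_norm L N (\<lambda>f x. c * A f x) / cmod c"
    proof (rule operator_norm_least)
      fix f assume f: "f \<in> unit_ball L N"
      then have "cmod c * N (A f) \<le> operator_norm L N (\<lambda>f x. c * A f x)"
        using operator_norm_upper[OF bo_scaled[OF A, of c] f] norm_scale[OF bo_L[OF A], of f c]
        by (simp add: unit_ball_def)
      then show "N (A f) \<le> operator_norm L N (\<lambda>f x. c * A f x) / cmod c"
        using that by (simp add: field_simps)
    qed
    then show ?thesis using that by (simp add: field_simps)
  qed
  show "operator_norm L N (\<lambda>f x. c * A f x) = cmod c * operator_norm L N A"
    using le ge operator_norm_nonneg[OF bo_scaled[OF A, of 0]] by (cases "c = 0") auto
next
  fix K assume K: "K \<in> null_operators \<mu> L N"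
  then have KB: "K \<in> BO" by (simp add: null_operators_def)
  have "operator_norm L N K \<le> 0"
  proof (rule operator_norm_least)
    fix f assume "f \<in> unit_ball L N"
    then have f: "f \<in> L" by (simp add: unit_ball_def)
    then have "AE x in \<mu>. K f x = 0" using K by (simp add: null_operators_def)
    then show "N (K f) \<le> 0" using norm_eq_0[OF bo_L[OF KB f]] by simp
  qed
  then show "operator_norm L N K = 0" using operator_norm_nonneg[OF KB] by simp
next
  show "null_operators \<mu> L N \<subseteq> BO" by (auto simp: null_operators_def)
qed (fact operator_norm_nonneg norm_not_spectrum)+

lemma noncompactness_gauge: "operator_gauge \<mu> L N (noncompactness L N) (compact_operators \<mu> L N)"
proof
  show "compact_operators \<mu> L N \<subseteq> BO" by (auto simp: compact_operators_def)
qed (fact noncompactness_add noncompactness_scale noncompactness_comp noncompactness_cong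
    noncompactness_nonneg noncompactness_compact ess_not_spectrum)+

end

section \<open>Kernels\<close>

context sigma_finite_measure
begin

text \<open>Sets whose vertical sections take countably many values: an algebra that contains the rectangles,
  so that sets in the product can be approximated by them.\<close>

definition section_sets :: "('a \<times> 'a) set set" where
  "section_sets = {{z \<in> space (M \<Otimes>\<^sub>M M). snd z \<in> F (p (fst z))} | p (F :: nat \<Rightarrow> 'a set).
    p \<in> M \<rightarrow>\<^sub>M count_space UNIV \<and> range F \<subseteq> sets M}"

lemma section_setsE:
  assumes "U \<in> section_sets"
  obtains p and F :: "nat \<Rightarrow> 'a set" where "p \<in> M \<rightarrow>\<^sub>M count_space UNIV" "range F \<subseteq> sets M"
    "U = {z \<in> space (M \<Otimes>\<^sub>M M). snd z \<in> F (p (fst z))}"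
  using assms unfolding section_sets_def by blast

lemma section_setsI:
  fixes F :: "nat \<Rightarrow> 'a set"
  shows "p \<in> M \<rightarrow>\<^sub>M count_space UNIV \<Longrightarrow> range F \<subseteq> sets M \<Longrightarrow>
    U = {z \<in> space (M \<Otimes>\<^sub>M M). snd z \<in> F (p (fst z))} \<Longrightarrow> U \<in> section_sets"
  unfolding section_sets_def by blast

lemma section_sets_measurable: "section_sets \<subseteq> sets (M \<Otimes>\<^sub>M M)"
proof
  fix U assume "U \<in> section_sets"
  then obtain p and F :: "nat \<Rightarrow> 'a set" where [measurable]: "p \<in> M \<rightarrow>\<^sub>M count_space UNIV" and F: "range F \<subseteq> sets M"
    and U: "U = {z \<in> space (M \<Otimes>\<^sub>M M). snd z \<in> F (p (fst z))}"
    by (rule section_setsE)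
  have [measurable]: "F i \<in> sets M" for i using F by auto
  have "U = (\<Union>i. {z \<in> space (M \<Otimes>\<^sub>M M). p (fst z) = i \<and> snd z \<in> F i})" by (auto simp: U)
  also have "\<dots> \<in> sets (M \<Otimes>\<^sub>M M)" by measurable
  finally show "U \<in> sets (M \<Otimes>\<^sub>M M)" .
qed

lemma section_sets_rectangle:
  assumes [measurable]: "A \<in> sets M" "B \<in> sets M"
  shows "A \<times> B \<in> section_sets"
proof (rule section_setsI)
  show "(\<lambda>x. if x \<in> A then 1 else 0 :: nat) \<in> M \<rightarrow>\<^sub>M count_space UNIV" by measurable
  show "range (\<lambda>i::nat. if i = 1 then B else {}) \<subseteq> sets M" by auto
  show "A \<times> B = {z \<in> space (M \<Otimes>\<^sub>M M). snd z \<in> (if (if fst z \<in> A then 1 else 0 :: nat) = 1 then B else {})}"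
    using sets.sets_into_space[OF assms(1)] sets.sets_into_space[OF assms(2)]
    by (auto simp: space_pair_measure)
qed

lemma section_sets_compl:
  assumes "U \<in> section_sets"
  shows "space (M \<Otimes>\<^sub>M M) - U \<in> section_sets"
proof -
  obtain p and F :: "nat \<Rightarrow> 'a set" where p: "p \<in> M \<rightarrow>\<^sub>M count_space UNIV" and F: "range F \<subseteq> sets M"
    and U: "U = {z \<in> space (M \<Otimes>\<^sub>M M). snd z \<in> F (p (fst z))}"
    using assms by (rule section_setsE)
  show ?thesis
    by (rule section_setsI[OF p, of "\<lambda>i. space M - F i"]) (use F in \<open>auto simp: U space_pair_measure\<close>)
qed

lemma section_sets_Un:
  assumes "U \<in> section_sets" "V \<in> section_sets"
  shows "U \<union> V \<in> section_sets"
proof -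
  obtain p and F :: "nat \<Rightarrow> 'a set" where [measurable]: "p \<in> M \<rightarrow>\<^sub>M count_space UNIV" and F: "range F \<subseteq> sets M"
    and U: "U = {z \<in> space (M \<Otimes>\<^sub>M M). snd z \<in> F (p (fst z))}"
    using assms(1) by (rule section_setsE)
  obtain q and G :: "nat \<Rightarrow> 'a set" where [measurable]: "q \<in> M \<rightarrow>\<^sub>M count_space UNIV" and G: "range G \<subseteq> sets M"
    and V: "V = {z \<in> space (M \<Otimes>\<^sub>M M). snd z \<in> G (q (fst z))}"
    using assms(2) by (rule section_setsE)
  show ?thesis
  proof (rule section_setsI)
    show "(\<lambda>x. prod_encode (p x, q x)) \<in> M \<rightarrow>\<^sub>M count_space UNIV" by measurable
    show "range (\<lambda>i. F (fst (prod_decode i)) \<union> G (snd (prod_decode i))) \<subseteq> sets M"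
      using F G by (auto intro!: sets.Un)
  qed (auto simp: U V)
qed

text \<open>Induction from rectangles through complements and disjoint unions. A countable union is
  cut off at n members with a loss below e / 2, and these members are approximated with a total
  error of at most e / 2.\<close>

lemma section_sets_approx:
  assumes "finite_measure \<nu>" and sets: "sets \<nu> = sets (M \<Otimes>\<^sub>M M)" and G: "G \<in> sets (M \<Otimes>\<^sub>M M)"
    and "\<epsilon> > 0"
  shows "\<exists>U\<in>section_sets. measure \<nu> ((G - U) \<union> (U - G)) < \<epsilon>"
proof -
  interpret \<nu>: finite_measure \<nu> by fact
  have ms: "U \<in> section_sets \<Longrightarrow> U \<in> sets \<nu>" for U using section_sets_measurable sets by auto
  have G': "G \<in> sigma_sets (space M \<times> space M) {A \<times> B |A B. A \<in> sets M \<and> B \<in> sets M}"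
    using G by (simp add: sets_pair_measure)
  have in_sets: "A \<in> sets \<nu>"
    if "A \<in> sigma_sets (space M \<times> space M) {A \<times> B |A B. A \<in> sets M \<and> B \<in> sets M}" for A
    using that by (simp add: sets_pair_measure sets)
  have stable: "Int_stable {A \<times> B |A B. A \<in> sets M \<and> B \<in> sets M}" by (rule Int_stable_pair_measure_generator)
  have sub: "{A \<times> B |A B. A \<in> sets M \<and> B \<in> sets M} \<subseteq> Pow (space M \<times> space M)"
    by (rule pair_measure_closed)
  have "\<forall>\<epsilon>>0. \<exists>U\<in>section_sets. measure \<nu> ((G - U) \<union> (U - G)) < \<epsilon>"
    using stable sub G'
  proof (induction G rule: sigma_sets_induct_disjoint)
    case (basic A)
    then have "A \<in> section_sets" using section_sets_rectangle by auto
    then show ?case by (intro allI impI bexI[of _ A]) auto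
  next
    case empty
    have "{} \<times> {} \<in> section_sets" by (rule section_sets_rectangle) auto
    then show ?case by (intro allI impI bexI[of _ "{}"]) auto
  next
    case (compl A)
    show ?case
    proof (intro allI impI)
      fix e :: real assume "e > 0"
      then obtain U where U: "U \<in> section_sets" "measure \<nu> ((A - U) \<union> (U - A)) < e" using compl(2) by blast
      have "A \<subseteq> space M \<times> space M" using sigma_sets_into_sp[OF sub compl(1)] .
      moreover have "U \<subseteq> space M \<times> space M"
        using sets.sets_into_space[of U "M \<Otimes>\<^sub>M M"] U(1) section_sets_measurable by (auto simp: space_pair_measure)
      ultimately have "(space M \<times> space M - A - (space (M \<Otimes>\<^sub>M M) - U)) \<union> ((space (M \<Otimes>\<^sub>M M) - U) - (space M \<times> space M - A))
          = (A - U) \<union> (U - A)" by (auto simp: space_pair_measure)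
      then show "\<exists>U\<in>section_sets. measure \<nu> ((space M \<times> space M - A - U) \<union> (U - (space M \<times> space M - A))) < e"
        using U section_sets_compl[OF U(1)] by (intro bexI[of _ "space (M \<Otimes>\<^sub>M M) - U"]) auto
    qed
  next
    case (union A)
    have A: "A i \<in> sets \<nu>" for i using union(2) by (intro in_sets) auto
    show ?case
    proof (intro allI impI)
      fix e :: real assume e: "e > 0"
      have "(\<lambda>n. measure \<nu> (\<Union>i<n. A i)) \<longlonglongrightarrow> measure \<nu> (\<Union>n. \<Union>i<n. A i)"
        using A by (intro \<nu>.finite_Lim_measure_incseq) (auto simp: incseq_def intro: less_le_trans)
      also have "(\<Union>n. \<Union>i<n. A i) = (\<Union>i. A i)" by auto
      finally have "\<forall>\<^sub>F n in sequentially. measure \<nu> (\<Union>i<n. A i) > measure \<nu> (\<Union>i. A i) - e / 2"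
        using e by (intro order_tendstoD(1)) auto
      then obtain n where n: "measure \<nu> (\<Union>i<n. A i) > measure \<nu> (\<Union>i. A i) - e / 2"
        by (auto simp: eventually_sequentially)
      have "\<exists>U\<in>section_sets. measure \<nu> ((A i - U) \<union> (U - A i)) < e / (2 * real (Suc n))" for i
        using union(3)[of i] e by simp
      then obtain U where U: "\<And>i. U i \<in> section_sets"
        "\<And>i. measure \<nu> ((A i - U i) \<union> (U i - A i)) < e / (2 * real (Suc n))" by metis
      have Un: "(\<Union>i<k. U i) \<in> section_sets" for k
      proof (induction k)
        case 0
        have "{} \<times> {} \<in> section_sets" by (rule section_sets_rectangle) auto
        then show ?case by simp
      next
        case (Suc k)
        then show ?case using section_sets_Un[OF U(1)[of k] Suc] by (simp add: lessThan_Suc)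
      qed
      have "measure \<nu> (((\<Union>i. A i) - (\<Union>i<n. U i)) \<union> ((\<Union>i<n. U i) - (\<Union>i. A i)))
          \<le> measure \<nu> (((\<Union>i. A i) - (\<Union>i<n. A i)) \<union> (\<Union>i<n. (A i - U i) \<union> (U i - A i)))"
        using A ms[OF U(1)] by (intro \<nu>.finite_measure_mono) auto
      also have "\<dots> \<le> measure \<nu> ((\<Union>i. A i) - (\<Union>i<n. A i)) + measure \<nu> (\<Union>i<n. (A i - U i) \<union> (U i - A i))"
        using A ms[OF U(1)] by (intro measure_Un_le) auto
      also have "measure \<nu> ((\<Union>i. A i) - (\<Union>i<n. A i)) = measure \<nu> (\<Union>i. A i) - measure \<nu> (\<Union>i<n. A i)"
        using A by (intro \<nu>.finite_measure_Diff) auto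
      also have "measure \<nu> (\<Union>i<n. (A i - U i) \<union> (U i - A i)) \<le> (\<Sum>i<n. measure \<nu> ((A i - U i) \<union> (U i - A i)))"
        using A ms[OF U(1)] by (intro \<nu>.finite_measure_subadditive_finite) auto
      also have "(\<Sum>i<n. measure \<nu> ((A i - U i) \<union> (U i - A i))) \<le> real n * (e / (2 * real (Suc n)))"
        using sum_bounded_above[of "{..<n}" "\<lambda>i. measure \<nu> ((A i - U i) \<union> (U i - A i))" "e / (2 * real (Suc n))"]
          U(2) by (simp add: less_imp_le)
      also have "real n * (e / (2 * real (Suc n))) \<le> e / 2" using e by (simp add: field_simps)
      finally have "measure \<nu> (((\<Union>i. A i) - (\<Union>i<n. U i)) \<union> ((\<Union>i<n. U i) - (\<Union>i. A i))) < e"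
        using n by simp
      then show "\<exists>U\<in>section_sets. measure \<nu> (((\<Union>i. A i) - U) \<union> (U - (\<Union>i. A i))) < e"
        using Un[of n] by blast
    qed
  qed
  then show ?thesis using \<open>\<epsilon> > 0\<close> by blast
qed

lemma positive_integrable:
  "\<exists>H :: 'a \<Rightarrow> real. integrable M H \<and> (\<forall>x\<in>space M. H x > 0) \<and> (\<forall>x. H x \<ge> 0)"
proof -
  obtain h where h[measurable]: "h \<in> borel_measurable M" and h_fin: "integral\<^sup>N M h \<noteq> \<infinity>"
    and h_pos: "\<And>x. x \<in> space M \<Longrightarrow> 0 < h x \<and> h x < \<infinity>"
    using Ex_finite_integrable_function by auto
  have "(\<integral>\<^sup>+x. ennreal (enn2real (h x)) \<partial>M) = integral\<^sup>N M h"
    using h_pos by (intro nn_integral_cong) (auto simp: less_top)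
  then have 1: "integrable M (\<lambda>x. enn2real (h x))"
    using h_fin by (intro integrableI_bounded) (auto simp: less_top)
  have 2: "0 < enn2real (h x)" if "x \<in> space M" for x
    using h_pos[OF that] by (simp add: enn2real_positive_iff)
  show ?thesis using 1 2 enn2real_nonneg by blast
qed

text \<open>The exceptional null set depends on F, and there may be uncountably many F, so the
  sections of {m < 0} cannot serve as test sets directly. A member of \<open>section_sets\<close>
  uses only countably many F, hence one null set. Such members approximate {m < 0} in the finite
  measure with density |\<kappa>|, where \<kappa> is m times a positive weight that makes it
  integrable.\<close>

lemma AE_nonneg_of_section_integrals:
  fixes m :: "'a \<times> 'a \<Rightarrow> real"
  assumes [measurable]: "m \<in> borel_measurable (M \<Otimes>\<^sub>M M)"
    and int: "AE x in M. integrable M (\<lambda>y. m (x, y))"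
    and pos: "\<And>F. F \<in> sets M \<Longrightarrow> AE x in M. (LINT y|M. indicator F y * m (x, y)) \<ge> 0"
  shows "AE z in M \<Otimes>\<^sub>M M. m z \<ge> 0"
proof -
  interpret P: pair_sigma_finite M M by unfold_locales
  obtain H :: "'a \<Rightarrow> real" where "integrable M H \<and> (\<forall>x\<in>space M. H x > 0) \<and> (\<forall>x. H x \<ge> 0)"
    using positive_integrable ..
  then have H_int: "integrable M H" and H_pos: "\<And>x. x \<in> space M \<Longrightarrow> H x > 0" by simp_all
  have H[measurable]: "H \<in> borel_measurable M" using H_int by auto
  define J where "J x = (LINT y|M. \<bar>m (x, y)\<bar>)" for x
  have J[measurable]: "J \<in> borel_measurable M" unfolding J_def by measurable
  have J_nn: "J x \<ge> 0" for x unfolding J_def by simp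
  \<comment> \<open>The divisor 1 + J gives \<phi> J \<le> H, hence integrability of the weighted
    kernel. Where the inner integral diverges, J is 0 by default and \<phi> stays positive.\<close>
  define \<phi> where "\<phi> x = H x / (1 + J x)" for x
  have \<phi>[measurable]: "\<phi> \<in> borel_measurable M" unfolding \<phi>_def by measurable
  have \<phi>_pos: "\<phi> x > 0" if "x \<in> space M" for x
    using H_pos[OF that] J_nn[of x] by (simp add: \<phi>_def add_pos_nonneg)
  define \<kappa> where "\<kappa> z = \<phi> (fst z) * m z" for z
  have \<kappa>[measurable]: "\<kappa> \<in> borel_measurable (M \<Otimes>\<^sub>M M)" unfolding \<kappa>_def by measurable
  have \<kappa>_int: "integrable (M \<Otimes>\<^sub>M M) \<kappa>"
  proof (rule P.Fubini_integrable[OF \<kappa>])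
    have eq: "(LINT y|M. norm (\<kappa> (x, y))) = \<phi> x * J x" if "x \<in> space M" for x
      using \<phi>_pos[OF that] by (simp add: \<kappa>_def J_def abs_mult)
    have "integrable M (\<lambda>x. \<phi> x * J x)"
    proof (rule Bochner_Integration.integrable_bound[OF H_int])
      have "\<bar>\<phi> x * J x\<bar> \<le> \<bar>H x\<bar>" if "x \<in> space M" for x
        using H_pos[OF that] J_nn[of x] by (simp add: \<phi>_def divide_simps)
      then show "AE x in M. norm (\<phi> x * J x) \<le> norm (H x)" by auto
    qed measurable
    then show "integrable M (\<lambda>x. LINT y|M. norm (\<kappa> (x, y)))"
      by (subst Bochner_Integration.integrable_cong[OF refl eq]) auto
    show "AE x in M. integrable M (\<lambda>y. \<kappa> (x, y))"
      using int by eventually_elim (simp add: \<kappa>_def)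
  qed
  define \<nu> where "\<nu> = density (M \<Otimes>\<^sub>M M) (\<lambda>z. ennreal \<bar>\<kappa> z\<bar>)"
  have sets\<nu>: "sets \<nu> = sets (M \<Otimes>\<^sub>M M)" by (simp add: \<nu>_def)
  have em: "emeasure \<nu> S = ennreal (LINT z|(M \<Otimes>\<^sub>M M). indicator S z * \<bar>\<kappa> z\<bar>)" if [measurable]: "S \<in> sets (M \<Otimes>\<^sub>M M)" for S
  proof -
    have "emeasure \<nu> S = (\<integral>\<^sup>+z. ennreal (indicator S z * \<bar>\<kappa> z\<bar>) \<partial>(M \<Otimes>\<^sub>M M))"
      unfolding \<nu>_def by (subst emeasure_density) (auto intro!: nn_integral_cong split: split_indicator)
    also have "\<dots> = ennreal (LINT z|(M \<Otimes>\<^sub>M M). indicator S z * \<bar>\<kappa> z\<bar>)"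
      using integrable_real_mult_indicator[OF that integrable_abs[OF \<kappa>_int]]
      by (intro nn_integral_eq_integral) (auto simp: mult.commute)
    finally show ?thesis .
  qed
  have fin: "finite_measure \<nu>"
    using em[OF sets.top] by (intro finite_measureI) (simp add: \<nu>_def)
  interpret \<nu>: finite_measure \<nu> by (rule fin)
  have meas: "measure \<nu> S = (LINT z|(M \<Otimes>\<^sub>M M). indicator S z * \<bar>\<kappa> z\<bar>)" if "S \<in> sets (M \<Otimes>\<^sub>M M)" for S
    unfolding measure_def em[OF that] by (intro enn2real_ennreal integral_nonneg_AE) auto
  have int_ind: "integrable (M \<Otimes>\<^sub>M M) (\<lambda>z. indicator S z * \<bar>\<kappa> z\<bar>)" "integrable (M \<Otimes>\<^sub>M M) (\<lambda>z. indicator S z * \<kappa> z)"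
    if "S \<in> sets (M \<Otimes>\<^sub>M M)" for S
    using integrable_real_mult_indicator[OF that integrable_abs[OF \<kappa>_int]] integrable_real_mult_indicator[OF that \<kappa>_int]
    by (auto simp: mult.commute)
  have sec: "(LINT z|(M \<Otimes>\<^sub>M M). indicator U z * \<kappa> z) \<ge> 0" if Us: "U \<in> section_sets" for U
  proof -
    obtain p and F :: "nat \<Rightarrow> 'a set" where p: "p \<in> M \<rightarrow>\<^sub>M count_space UNIV" and F: "range F \<subseteq> sets M"
      and U: "U = {z \<in> space (M \<Otimes>\<^sub>M M). snd z \<in> F (p (fst z))}"
      using Us by (rule section_setsE)
    have Um: "U \<in> sets (M \<Otimes>\<^sub>M M)" using Us section_sets_measurable by auto
    have "AE x in M. \<forall>i. (LINT y|M. indicator (F i) y * m (x, y)) \<ge> 0"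
      unfolding AE_all_countable using pos F by auto
    then have "AE x in M. (LINT y|M. indicator U (x, y) * \<kappa> (x, y)) \<ge> 0"
    proof (rule AE_mp, intro AE_I2 impI)
      fix x assume x: "x \<in> space M" and *: "\<forall>i. (LINT y|M. indicator (F i) y * m (x, y)) \<ge> 0"
      have "(LINT y|M. indicator U (x, y) * \<kappa> (x, y)) = (LINT y|M. \<phi> x * (indicator (F (p x)) y * m (x, y)))"
        using x by (intro Bochner_Integration.integral_cong)
          (auto simp: U \<kappa>_def space_pair_measure split: split_indicator)
      also have "\<dots> = \<phi> x * (LINT y|M. indicator (F (p x)) y * m (x, y))" by simp
      also have "\<dots> \<ge> 0" using * \<phi>_pos[OF x] by simp
      finally show "(LINT y|M. indicator U (x, y) * \<kappa> (x, y)) \<ge> 0" .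
    qed
    then have "(LINT x|M. LINT y|M. indicator U (x, y) * \<kappa> (x, y)) \<ge> 0" by (rule integral_nonneg_AE)
    then show ?thesis using P.integral_fst'[OF int_ind(2)[OF Um]] by simp
  qed
  define G where "G = {z \<in> space (M \<Otimes>\<^sub>M M). m z < 0}"
  have G: "G \<in> sets (M \<Otimes>\<^sub>M M)" unfolding G_def by measurable
  have "measure \<nu> G \<le> 0 + e" if e: "e > 0" for e
  proof -
    obtain U where U: "U \<in> section_sets" "measure \<nu> ((G - U) \<union> (U - G)) < e / 2"
      using section_sets_approx[OF fin sets\<nu> G, of "e / 2"] e by auto
    have Um: "U \<in> sets (M \<Otimes>\<^sub>M M)" using U section_sets_measurable by auto
    have "0 \<le> (LINT z|(M \<Otimes>\<^sub>M M). indicator U z * \<kappa> z)" by (rule sec[OF U(1)])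
    \<comment> \<open>\<kappa> is at most |\<kappa>| off G and equals -|\<kappa>| on G. The
      nonnegative integral over U thus bounds the part of U inside G by the part outside, which is
      small.\<close>
    also have "\<dots> \<le> (LINT z|(M \<Otimes>\<^sub>M M). indicator (U - G) z * \<bar>\<kappa> z\<bar> - indicator (U \<inter> G) z * \<bar>\<kappa> z\<bar>)"
    proof (rule integral_mono)
      fix z assume "z \<in> space (M \<Otimes>\<^sub>M M)"
      then have "\<kappa> z < 0" if "z \<in> G"
        using that \<phi>_pos[of "fst z"] by (auto simp: \<kappa>_def G_def mult_pos_neg space_pair_measure)
      then show "indicator U z * \<kappa> z \<le> indicator (U - G) z * \<bar>\<kappa> z\<bar> - indicator (U \<inter> G) z * \<bar>\<kappa> z\<bar>"
        by (auto split: split_indicator)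
    qed (use int_ind Um G in auto)
    also have "\<dots> = measure \<nu> (U - G) - measure \<nu> (U \<inter> G)"
      using Um G int_ind by (simp add: meas)
    finally have "measure \<nu> (U \<inter> G) \<le> measure \<nu> (U - G)" by simp
    moreover have "measure \<nu> (U - G) \<le> measure \<nu> ((G - U) \<union> (U - G))" "measure \<nu> (G - U) \<le> measure \<nu> ((G - U) \<union> (U - G))"
      using Um G sets\<nu> by (auto intro!: \<nu>.finite_measure_mono)
    moreover have "measure \<nu> G \<le> measure \<nu> (U \<inter> G) + measure \<nu> (G - U)"
    proof -
      have "G = (U \<inter> G) \<union> (G - U)" by auto
      then show ?thesis using measure_Un_le[of "U \<inter> G" \<nu> "G - U"] Um G sets\<nu> by auto
    qed
    ultimately show ?thesis using U(2) by simp
  qed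
  then have "measure \<nu> G \<le> 0" by (rule field_le_epsilon)
  then have "emeasure \<nu> G = 0" by (simp add: \<nu>.emeasure_eq_measure measure_le_0_iff)
  then have "AE z in \<nu>. z \<notin> G" using G by (intro AE_not_in) (auto simp: null_sets_def sets\<nu>)
  then have "AE z in M \<Otimes>\<^sub>M M. 0 < ennreal \<bar>\<kappa> z\<bar> \<longrightarrow> z \<notin> G"
    unfolding \<nu>_def by (subst (asm) AE_density) auto
  then show ?thesis
  proof (rule AE_mp, intro AE_I2 impI)
    fix z assume z: "z \<in> space (M \<Otimes>\<^sub>M M)" and imp: "0 < ennreal \<bar>\<kappa> z\<bar> \<longrightarrow> z \<notin> G"
    show "m z \<ge> 0"
    proof (rule ccontr)
      assume "\<not> m z \<ge> 0"
      moreover have "\<phi> (fst z) > 0" using \<phi>_pos z by (auto simp: space_pair_measure)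
      ultimately have "\<kappa> z < 0" "z \<in> G" using z by (auto simp: \<kappa>_def G_def mult_pos_neg)
      then show False using imp by simp
    qed
  qed
qed

end

text \<open>The right-hand side is minimal at t = sqrt (b / a). The hypothesis is confined to
  rational t because it will hold almost everywhere for each t separately, and countably many null
  sets can be united. Adding e to a and b avoids dividing by 0.\<close>

lemma square_le_of_amgm:
  fixes a b c :: real
  assumes "0 \<le> a" "0 \<le> b" "0 \<le> c" and le: "\<And>t. t > 0 \<Longrightarrow> t \<in> \<rat> \<Longrightarrow> 2 * c \<le> t * a + b / t"
  shows "c\<^sup>2 \<le> a * b"
proof -
  have all: "2 * c \<le> t * a + b / t" if t: "t > 0" for t
  proof -
    have "\<exists>u. u \<in> \<rat> \<and> t < u \<and> u < t + 1 / real (Suc i)" for i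
      using Rats_dense_in_real[of t "t + 1 / real (Suc i)"] by auto
    then have "\<forall>i. \<exists>u. u \<in> \<rat> \<and> t < u \<and> u < t + 1 / real (Suc i)" by blast
    from choice[OF this] obtain s where "\<forall>i. s i \<in> \<rat> \<and> t < s i \<and> s i < t + 1 / real (Suc i)" ..
    then have s: "\<And>i. s i \<in> \<rat>" "\<And>i. t < s i" "\<And>i. s i < t + 1 / real (Suc i)" by simp_all
    have "(\<lambda>i. 1 / real (Suc i)) \<longlonglongrightarrow> 0"
      using LIMSEQ_inverse_real_of_nat by (simp add: inverse_eq_divide)
    then have h: "(\<lambda>i. t + 1 / real (Suc i)) \<longlonglongrightarrow> t + 0" by (intro tendsto_add tendsto_const)
    have "s \<longlonglongrightarrow> t"
    proof (rule real_tendsto_sandwich)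
      show "\<forall>\<^sub>F i in sequentially. t \<le> s i" using s(2) by (simp add: less_imp_le)
      show "\<forall>\<^sub>F i in sequentially. s i \<le> t + 1 / real (Suc i)" using s(3) by (simp add: less_imp_le)
      show "(\<lambda>i. t + 1 / real (Suc i)) \<longlonglongrightarrow> t" using h by simp
    qed (rule tendsto_const)
    then have "(\<lambda>i. s i * a + b / s i) \<longlonglongrightarrow> t * a + b / t"
      using t by (intro tendsto_intros) auto
    moreover have "2 * c \<le> s i * a + b / s i" for i using le[of "s i"] s(1,2)[of i] t by linarith
    ultimately show ?thesis by (intro LIMSEQ_le_const) auto
  qed
  have "(c * c) \<le> (a + e) * (b + e)" if e: "e > 0" for e
  proof -
    define t where "t = sqrt ((b + e) / (a + e))"
    have pos: "a + e > 0" "b + e > 0" using e assms by auto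
    then have t: "t > 0" by (simp add: t_def)
    have t2: "t * t = (b + e) / (a + e)" using pos by (simp add: t_def)
    have "2 * c \<le> t * (a + e) + (b + e) / t"
      using all[OF t] t e mult_left_mono[of a "a + e" t] divide_right_mono[of b "b + e" t] by linarith
    also have "(b + e) / t = t * (a + e)" using t2 t pos by (simp add: field_simps)
    finally have "c \<le> t * (a + e)" by simp
    then have "c * c \<le> (t * (a + e)) * (t * (a + e))" using assms by (intro mult_mono) auto
    also have "\<dots> = (t * t) * (a + e) * (a + e)" by simp
    also have "\<dots> = (a + e) * (b + e)" using pos unfolding t2 by simp
    finally show ?thesis .
  qed
  then have "c * c \<le> (a + 1 / real (Suc i)) * (b + 1 / real (Suc i))" for i by simp
  moreover have "(\<lambda>i. (a + 1 / real (Suc i)) * (b + 1 / real (Suc i))) \<longlonglongrightarrow> (a + 0) * (b + 0)"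
    using LIMSEQ_inverse_real_of_nat by (intro tendsto_intros) (simp_all add: inverse_eq_divide)
  ultimately have "c * c \<le> (a + 0) * (b + 0)" by (intro LIMSEQ_le_const) auto
  then show ?thesis by (simp add: power2_eq_square)
qed

lemma sqrt_mult_le_amgm:
  fixes a b t :: real
  assumes "0 \<le> a" "0 \<le> b" "t > 0"
  shows "2 * sqrt (a * b) \<le> t * a + b / t"
  using arith_geo_mean_sqrt[of "t * a" "b / t"] assms by simp

section \<open>Kernels of positive operators and their geometric means\<close>

context banach_function_space
begin

definition modulus :: "('x \<Rightarrow> complex) \<Rightarrow> ('x \<Rightarrow> complex)" where
  "modulus f = (\<lambda>x. complex_of_real (cmod (f x)))"

lemma cmod_modulus [simp]: "cmod (modulus f x) = cmod (f x)"
  by (simp add: modulus_def)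

lemma modulus_L: "f \<in> L \<Longrightarrow> modulus f \<in> L"
  using ideal[of f "modulus f"] L_measurable[of f] by (simp add: modulus_def)

lemma norm_modulus: "f \<in> L \<Longrightarrow> N (modulus f) = N f"
  using norm_mono[of f "modulus f"] norm_mono[of "modulus f" f] modulus_L[of f] L_measurable[of f] L_measurable[of "modulus f"]
  by (intro antisym) auto

lemma nonneg_modulus: "nonneg_fun \<mu> (modulus f)"
  by (simp add: nonneg_fun_def modulus_def)

lemma nonneg_modulus_eq: "nonneg_fun \<mu> f \<Longrightarrow> AE x in \<mu>. modulus f x = f x"
  unfolding nonneg_fun_def modulus_def
  by (erule eventually_mono) (auto elim!: nonneg_Reals_cases)

sublocale P: pair_sigma_finite \<mu> \<mu> by unfold_locales

abbreviation PK :: "'x operator set" where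
  "PK \<equiv> positive_kernel_operators \<mu> L \<inter> BO"

text \<open>A kernel is determined almost everywhere because \<open>X\<close> is the carrier of \<open>L\<close>.\<close>

lemma AE_kernel_of_carrier:
  assumes Q: "{z \<in> space (\<mu> \<Otimes>\<^sub>M \<mu>). Q z} \<in> sets (\<mu> \<Otimes>\<^sub>M \<mu>)"
    and AE: "\<And>f. f \<in> L \<Longrightarrow> AE z in \<mu> \<Otimes>\<^sub>M \<mu>. f (snd z) \<noteq> 0 \<longrightarrow> Q z"
  shows "AE z in \<mu> \<Otimes>\<^sub>M \<mu>. Q z"
proof -
  define G where "G = {z \<in> space (\<mu> \<Otimes>\<^sub>M \<mu>). \<not> Q z}"
  have "G = space (\<mu> \<Otimes>\<^sub>M \<mu>) - {z \<in> space (\<mu> \<Otimes>\<^sub>M \<mu>). Q z}" by (auto simp: G_def)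
  then have G[measurable]: "G \<in> sets (\<mu> \<Otimes>\<^sub>M \<mu>)" using Q by (metis sets.compl_sets)
  \<comment> \<open>The points y whose section of the bad set is not null. By Fubini every f in L
    vanishes a.e. on Y, so the carrier condition makes Y null.\<close>
  define Y where "Y = {y \<in> space \<mu>. \<not> (AE x in \<mu>. (x, y) \<notin> G)}"
  have "Y = {y \<in> space \<mu>. emeasure \<mu> ((\<lambda>x. (x, y)) -` G) \<noteq> 0}"
  proof -
    have "(AE x in \<mu>. (x, y) \<notin> G) \<longleftrightarrow> emeasure \<mu> ((\<lambda>x. (x, y)) -` G) = 0" for y
    proof -
      have "{x \<in> space \<mu>. \<not> (x, y) \<notin> G} = (\<lambda>x. (x, y)) -` G" by (auto simp: G_def space_pair_measure)
      moreover have "(\<lambda>x. (x, y)) -` G \<in> sets \<mu>" by (rule sets_Pair2[OF G])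
      ultimately show ?thesis using AE_iff_null[of \<mu> "\<lambda>x. (x, y) \<notin> G"] by (simp add: null_sets_def)
    qed
    then show ?thesis by (auto simp: Y_def)
  qed
  also have "\<dots> \<in> sets \<mu>" using P.measurable_emeasure_Pair2[OF G] by measurable
  finally have Y: "Y \<in> sets \<mu>" .
  have f0: "AE y in \<mu>. y \<in> Y \<longrightarrow> f y = 0" if f: "f \<in> L" for f
  proof -
    have [measurable]: "f \<in> borel_measurable \<mu>" by (rule L_measurable[OF f])
    have "AE x in \<mu>. AE y in \<mu>. 0 < cmod (f y) \<longrightarrow> (x, y) \<notin> G"
      using P.AE_pair[OF AE[OF f]] by (rule eventually_mono) (auto simp: G_def elim: eventually_mono)
    then have "AE y in \<mu>. AE x in \<mu>. 0 < cmod (f y) \<longrightarrow> (x, y) \<notin> G"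
      by (subst (asm) P.AE_commute) auto
    then show ?thesis
      by (rule eventually_mono) (auto simp: Y_def)
  qed
  have "\<not> emeasure \<mu> Y > 0" using carrier[OF Y] f0 by blast
  then have "Y \<in> null_sets \<mu>" using Y by (auto simp: null_sets_def)
  then have "AE y in \<mu>. y \<notin> Y" by (rule AE_not_in)
  then have "AE y in \<mu>. AE x in \<mu>. (x, y) \<notin> G"
    by (rule AE_mp) (auto simp: Y_def)
  then have "AE x in \<mu>. AE y in \<mu>. (x, y) \<notin> G"
    by (subst P.AE_commute) auto
  then have "AE z in \<mu> \<Otimes>\<^sub>M \<mu>. z \<notin> G"
    by (intro P.AE_pair_measure) auto
  then show ?thesis
    by (rule AE_mp) (auto simp: G_def)
qed

text \<open>Only functions of L are available as tests. For a fixed f in L, the kernel k(x,y) |f(y)|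
  has nonnegative integrals over all sets F, because |f| restricted to F is again in L. So k is
  nonnegative wherever f(y) is not 0, and the carrier condition removes this restriction.\<close>

lemma AE_nonneg_kernel:
  fixes k :: "'x \<times> 'x \<Rightarrow> real"
  assumes k[measurable]: "k \<in> borel_measurable (\<mu> \<Otimes>\<^sub>M \<mu>)"
    and pos: "\<And>g. (\<And>y. g y \<ge> 0) \<Longrightarrow> (\<lambda>y. complex_of_real (g y)) \<in> L \<Longrightarrow>
      AE x in \<mu>. integrable \<mu> (\<lambda>y. k (x, y) * g y) \<and> (LINT y|\<mu>. k (x, y) * g y) \<ge> 0"
  shows "AE z in \<mu> \<Otimes>\<^sub>M \<mu>. k z \<ge> 0"
proof (rule AE_kernel_of_carrier)
  show "{z \<in> space (\<mu> \<Otimes>\<^sub>M \<mu>). k z \<ge> 0} \<in> sets (\<mu> \<Otimes>\<^sub>M \<mu>)" by measurable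
  fix f assume f: "f \<in> L"
  have [measurable]: "f \<in> borel_measurable \<mu>" by (rule L_measurable[OF f])
  have "AE z in \<mu> \<Otimes>\<^sub>M \<mu>. k z * cmod (f (snd z)) \<ge> 0"
  proof (rule AE_nonneg_of_section_integrals)
    show "AE x in \<mu>. integrable \<mu> (\<lambda>y. k (x, y) * cmod (f (snd (x, y))))"
      using pos[of "\<lambda>y. cmod (f y)"] modulus_L[OF f] by (auto simp: modulus_def)
    fix F assume F[measurable]: "F \<in> sets \<mu>"
    have "(\<lambda>y. complex_of_real (indicator F y * cmod (f y))) \<in> L"
      using ideal[OF f, of "\<lambda>y. complex_of_real (indicator F y * cmod (f y))"]
      by (auto simp: norm_mult split: split_indicator)
    from pos[OF _ this] have "AE x in \<mu>. (LINT y|\<mu>. k (x, y) * (indicator F y * cmod (f y))) \<ge> 0" by auto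
    then show "AE x in \<mu>. (LINT y|\<mu>. indicator F y * (k (x, y) * cmod (f (snd (x, y))))) \<ge> 0"
      by (simp add: mult_ac)
  qed measurable
  then show "AE z in \<mu> \<Otimes>\<^sub>M \<mu>. f (snd z) \<noteq> 0 \<longrightarrow> k z \<ge> 0"
    by (rule eventually_mono) (auto simp: zero_le_mult_iff)
qed

definition pk :: "'x operator \<Rightarrow> 'x \<times> 'x \<Rightarrow> real" where
  "pk A z = cmod (kernel \<mu> L A z)"

lemma pk_nonneg [simp]: "pk A z \<ge> 0"
  by (simp add: pk_def)

lemma has_kernel_kernel: "A \<in> positive_kernel_operators \<mu> L \<Longrightarrow> has_kernel \<mu> L A (kernel \<mu> L A)"
  unfolding kernel_def positive_kernel_operators_def using someI_ex[of "has_kernel \<mu> L A"] by blast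

lemma pk_measurable [measurable]: "A \<in> positive_kernel_operators \<mu> L \<Longrightarrow> pk A \<in> borel_measurable (\<mu> \<Otimes>\<^sub>M \<mu>)"
  using has_kernel_kernel[of A] unfolding has_kernel_def pk_def[abs_def] by auto

text \<open>Positivity of the operator makes Re a, Im a and - Im a pass the test for nonnegative
  kernels.\<close>

lemma pk_AE:
  assumes A: "A \<in> positive_kernel_operators \<mu> L"
  shows "AE z in \<mu> \<Otimes>\<^sub>M \<mu>. kernel \<mu> L A z = of_real (pk A z)"
proof -
  let ?k = "kernel \<mu> L A"
  have k[measurable]: "?k \<in> borel_measurable (\<mu> \<Otimes>\<^sub>M \<mu>)"
    and hk: "\<And>f. f \<in> L \<Longrightarrow> AE x in \<mu>. integrable \<mu> (\<lambda>y. ?k (x, y) * f y) \<and> A f x = (LINT y|\<mu>. ?k (x, y) * f y)"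
    using has_kernel_kernel[OF A] by (auto simp: has_kernel_def)
  have base: "AE x in \<mu>. integrable \<mu> (\<lambda>y. Re (?k (x, y)) * g y) \<and> integrable \<mu> (\<lambda>y. Im (?k (x, y)) * g y) \<and>
      (LINT y|\<mu>. Re (?k (x, y)) * g y) \<ge> 0 \<and> (LINT y|\<mu>. Im (?k (x, y)) * g y) = 0"
    if g: "\<And>y. g y \<ge> 0" "(\<lambda>y. complex_of_real (g y)) \<in> L" for g
  proof -
    have "nonneg_fun \<mu> (\<lambda>y. complex_of_real (g y))" using g by (simp add: nonneg_fun_def)
    then have "AE x in \<mu>. A (\<lambda>y. complex_of_real (g y)) x \<in> \<real>\<^sub>\<ge>\<^sub>0"
      using A g by (auto simp: positive_kernel_operators_def positive_operator_def nonneg_fun_def)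
    with hk[OF g(2)] show ?thesis
    proof eventually_elim
      case (elim x)
      then have i: "integrable \<mu> (\<lambda>y. ?k (x, y) * complex_of_real (g y))"
        and e: "A (\<lambda>y. complex_of_real (g y)) x = (LINT y|\<mu>. ?k (x, y) * complex_of_real (g y))"
        and p: "A (\<lambda>y. complex_of_real (g y)) x \<in> \<real>\<^sub>\<ge>\<^sub>0" by auto
      show ?case
        using integrable_Re[OF i] integrable_Im[OF i] integral_Re[OF i] integral_Im[OF i] p[unfolded e]
        by (auto simp: complex_nonneg_Reals_iff)
    qed
  qed
  have "AE z in \<mu> \<Otimes>\<^sub>M \<mu>. Re (?k z) \<ge> 0"
    by (rule AE_nonneg_kernel, measurable, rule eventually_mono[OF base]) auto
  moreover have "AE z in \<mu> \<Otimes>\<^sub>M \<mu>. Im (?k z) \<ge> 0"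
    by (rule AE_nonneg_kernel, measurable, rule eventually_mono[OF base]) auto
  moreover have "AE z in \<mu> \<Otimes>\<^sub>M \<mu>. - Im (?k z) \<ge> 0"
    by (rule AE_nonneg_kernel, measurable, rule eventually_mono[OF base]) auto
  ultimately show ?thesis
    by eventually_elim (auto simp: pk_def complex_eq_iff cmod_eq_Re)
qed

lemma pk_section:
  assumes A: "A \<in> positive_kernel_operators \<mu> L" and f: "f \<in> L"
  shows "AE x in \<mu>. integrable \<mu> (\<lambda>y. complex_of_real (pk A (x, y)) * f y) \<and>
    A f x = (LINT y|\<mu>. complex_of_real (pk A (x, y)) * f y)"
proof -
  have [measurable]: "f \<in> borel_measurable \<mu>" "pk A \<in> borel_measurable (\<mu> \<Otimes>\<^sub>M \<mu>)"
    "kernel \<mu> L A \<in> borel_measurable (\<mu> \<Otimes>\<^sub>M \<mu>)"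
    using L_measurable[OF f] pk_measurable[OF A] has_kernel_kernel[OF A] by (auto simp: has_kernel_def)
  have "AE x in \<mu>. integrable \<mu> (\<lambda>y. kernel \<mu> L A (x, y) * f y) \<and> A f x = (LINT y|\<mu>. kernel \<mu> L A (x, y) * f y)"
    using has_kernel_kernel[OF A] f by (auto simp: has_kernel_def)
  with P.AE_pair[OF pk_AE[OF A]] AE_space show ?thesis
  proof eventually_elim
    case (elim x)
    have m: "(\<lambda>y. kernel \<mu> L A (x, y) * f y) \<in> borel_measurable \<mu>"
      "(\<lambda>y. complex_of_real (pk A (x, y)) * f y) \<in> borel_measurable \<mu>"
      using elim(2) by measurable
    have ae: "AE y in \<mu>. kernel \<mu> L A (x, y) * f y = complex_of_real (pk A (x, y)) * f y"
      using elim(1) by eventually_elim simp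
    show ?case
      using elim(3) integrable_cong_AE[OF m ae] integral_cong_AE[OF m ae] by simp
  qed
qed

lemma pk_section_abs:
  assumes A: "A \<in> positive_kernel_operators \<mu> L" and f: "f \<in> L"
  shows "AE x in \<mu>. integrable \<mu> (\<lambda>y. pk A (x, y) * cmod (f y)) \<and>
    A (modulus f) x = complex_of_real (LINT y|\<mu>. pk A (x, y) * cmod (f y))"
  using pk_section[OF A modulus_L[OF f]]
proof eventually_elim
  case (elim x)
  then have "integrable \<mu> (\<lambda>y. complex_of_real (pk A (x, y) * cmod (f y)))"
    by (simp add: modulus_def)
  then have "integrable \<mu> (\<lambda>y. pk A (x, y) * cmod (f y))"
    by (simp only: complex_of_real_integrable_eq)
  then show ?case using elim
    by (auto simp: modulus_def simp flip: of_real_mult)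
qed

lemma pk_abs_le:
  assumes A: "A \<in> positive_kernel_operators \<mu> L" and f: "f \<in> L"
  shows "AE x in \<mu>. cmod (A f x) \<le> cmod (A (modulus f) x)"
  using pk_section[OF A f] pk_section_abs[OF A f]
proof eventually_elim
  case (elim x)
  have "cmod (A f x) \<le> (LINT y|\<mu>. norm (complex_of_real (pk A (x, y)) * f y))"
    using elim by (simp add: integral_norm_bound)
  also have "\<dots> = (LINT y|\<mu>. pk A (x, y) * cmod (f y))" by (simp add: norm_mult)
  also have "\<dots> \<le> cmod (A (modulus f) x)" using elim by simp
  finally show ?case .
qed

lemma PK_modulus:
  assumes A: "A \<in> positive_kernel_operators \<mu> L" and f: "f \<in> L"
  shows "AE x in \<mu>. modulus (A (modulus f)) x = A (modulus f) x"
  using A f modulus_L[OF f] nonneg_modulus[of f]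
  by (intro nonneg_modulus_eq) (auto simp: positive_kernel_operators_def positive_operator_def)

lemma PK_intro:
  fixes a :: "'x \<times> 'x \<Rightarrow> real"
  assumes A: "A \<in> BO" and [measurable]: "a \<in> borel_measurable (\<mu> \<Otimes>\<^sub>M \<mu>)" and nn: "\<And>z. a z \<ge> 0"
    and sec: "\<And>f. f \<in> L \<Longrightarrow> AE x in \<mu>. integrable \<mu> (\<lambda>y. complex_of_real (a (x, y)) * f y) \<and>
      A f x = (LINT y|\<mu>. complex_of_real (a (x, y)) * f y)"
  shows "A \<in> PK"
proof -
  have "has_kernel \<mu> L A (\<lambda>z. complex_of_real (a z))"
    using sec by (simp add: has_kernel_def)
  moreover have "positive_operator \<mu> L A"
    unfolding positive_operator_def
  proof (intro conjI ballI impI)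
    show "linear_operator \<mu> L A" using A by (simp add: bounded_operators_def)
    fix f assume f: "f \<in> L" and p: "nonneg_fun \<mu> f"
    have [measurable]: "f \<in> borel_measurable \<mu>" by (rule L_measurable[OF f])
    have pm: "AE y in \<mu>. modulus f y = f y" by (rule nonneg_modulus_eq[OF p])
    show "nonneg_fun \<mu> (A f)"
      unfolding nonneg_fun_def using sec[OF f] AE_space
    proof eventually_elim
      case (elim x)
      have "(LINT y|\<mu>. complex_of_real (a (x, y)) * f y) = (LINT y|\<mu>. complex_of_real (a (x, y) * cmod (f y)))"
        using elim(2) pm by (intro integral_cong_AE) (auto simp: modulus_def elim!: eventually_mono)
      also have "\<dots> = complex_of_real (LINT y|\<mu>. a (x, y) * cmod (f y))" by (rule integral_complex_of_real)
      also have "\<dots> \<in> \<real>\<^sub>\<ge>\<^sub>0" using nn by (simp add: complex_nonneg_Reals_iff integral_nonneg_AE)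
      finally show ?case using elim by simp
    qed
  qed
  ultimately show ?thesis using A by (auto simp: positive_kernel_operators_def)
qed

text \<open>Fubini, at almost every x, for the kernel that integrates a(x,z) b(z,y) over z. Absolute
  convergence is the finiteness of A (B |f|) at x.\<close>

lemma PK_comp:
  assumes A: "A \<in> PK" and B: "B \<in> PK"
  shows "A \<circ> B \<in> PK"
proof (rule PK_intro)
  have Ak: "A \<in> positive_kernel_operators \<mu> L" and Bk: "B \<in> positive_kernel_operators \<mu> L" and
    Ab: "A \<in> BO" and Bb: "B \<in> BO" using A B by auto
  have [measurable]: "pk A \<in> borel_measurable (\<mu> \<Otimes>\<^sub>M \<mu>)" "pk B \<in> borel_measurable (\<mu> \<Otimes>\<^sub>M \<mu>)"
    using pk_measurable[OF Ak] pk_measurable[OF Bk] by auto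
  define c where "c p = (LINT z|\<mu>. pk A (fst p, z) * pk B (z, snd p))" for p
  show "A \<circ> B \<in> BO" by (rule bo_o[OF Ab Bb])
  show "c \<in> borel_measurable (\<mu> \<Otimes>\<^sub>M \<mu>)" unfolding c_def by measurable
  show "c p \<ge> 0" for p unfolding c_def by (intro integral_nonneg_AE) auto
  fix f assume f: "f \<in> L"
  have [measurable]: "f \<in> borel_measurable \<mu>" by (rule L_measurable[OF f])
  have BL: "B f \<in> L" "B (modulus f) \<in> L" using bo_L[OF Bb] f modulus_L[OF f] by auto
  have [measurable]: "B f \<in> borel_measurable \<mu>" "B (modulus f) \<in> borel_measurable \<mu>"
    using BL L_measurable by auto
  show "AE x in \<mu>. integrable \<mu> (\<lambda>y. complex_of_real (c (x, y)) * f y) \<and>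
      (A \<circ> B) f x = (LINT y|\<mu>. complex_of_real (c (x, y)) * f y)"
    using pk_section[OF Ak BL(1)] pk_section[OF Ak BL(2)] AE_space
  proof eventually_elim
    case (elim x)
    \<comment> \<open>x is fixed here; the two variables of H are the intermediate point z and the
      argument y of f.\<close>
    define H where "H p = complex_of_real (pk A (x, fst p) * pk B p) * f (snd p)" for p
    have H[measurable]: "H \<in> borel_measurable (\<mu> \<Otimes>\<^sub>M \<mu>)" unfolding H_def using elim(3) by measurable
    have B1: "AE z in \<mu>. integrable \<mu> (\<lambda>y. H (z, y)) \<and> (LINT y|\<mu>. H (z, y)) = complex_of_real (pk A (x, z)) * B f z"
      using pk_section[OF Bk f]
    proof eventually_elim
      case (elim z)
      have "(\<lambda>y. H (z, y)) = (\<lambda>y. complex_of_real (pk A (x, z)) * (complex_of_real (pk B (z, y)) * f y))"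
        by (auto simp: H_def)
      then show ?case using elim by simp
    qed
    have B2: "AE z in \<mu>. (LINT y|\<mu>. norm (H (z, y))) = norm (complex_of_real (pk A (x, z)) * B (modulus f) z)"
      using pk_section_abs[OF Bk f]
    proof eventually_elim
      case (elim z)
      have "(\<lambda>y. norm (H (z, y))) = (\<lambda>y. pk A (x, z) * (pk B (z, y) * cmod (f y)))"
        by (auto simp: H_def norm_mult)
      then show ?case using elim by (simp add: norm_mult integral_nonneg_AE)
    qed
    have "integrable \<mu> (\<lambda>z. LINT y|\<mu>. norm (H (z, y)))"
    proof (subst integrable_cong_AE[OF _ _ B2])
      show "integrable \<mu> (\<lambda>z. norm (complex_of_real (pk A (x, z)) * B (modulus f) z))"
        using elim(2) by (intro integrable_norm) auto
    qed (use elim(3) in measurable)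
    then have Hi: "integrable (\<mu> \<Otimes>\<^sub>M \<mu>) H"
      by (intro P.Fubini_integrable[OF H]) (use B1 in \<open>auto elim!: eventually_mono\<close>)
    have cf: "(LINT z|\<mu>. H (z, y)) = complex_of_real (c (x, y)) * f y" for y
    proof -
      have "(LINT z|\<mu>. H (z, y)) = (LINT z|\<mu>. complex_of_real (pk A (x, z) * pk B (z, y)) * f y)"
        by (simp add: H_def)
      also have "\<dots> = (LINT z|\<mu>. complex_of_real (pk A (x, z) * pk B (z, y))) * f y" by (rule integral_mult_left_zero)
      also have "\<dots> = complex_of_real (c (x, y)) * f y" unfolding c_def by (simp only: integral_complex_of_real fst_conv snd_conv)
      finally show ?thesis .
    qed
    have "integrable \<mu> (\<lambda>y. LINT z|\<mu>. H (z, y))"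
      using P.integrable_snd[of "\<lambda>z y. H (z, y)"] Hi by simp
    then have 1: "integrable \<mu> (\<lambda>y. complex_of_real (c (x, y)) * f y)" by (simp only: cf)
    have "A (B f) x = (LINT z|\<mu>. LINT y|\<mu>. H (z, y))"
    proof -
      have "(LINT z|\<mu>. complex_of_real (pk A (x, z)) * B f z) = (LINT z|\<mu>. LINT y|\<mu>. H (z, y))"
      proof (rule integral_cong_AE)
        show "AE z in \<mu>. complex_of_real (pk A (x, z)) * B f z = (LINT y|\<mu>. H (z, y))"
          using B1 by eventually_elim simp
      qed (use elim(3) in measurable)
      then show ?thesis using elim(1) by simp
    qed
    also have "\<dots> = (LINT y|\<mu>. LINT z|\<mu>. H (z, y))"
      using P.Fubini_integral[of "\<lambda>z y. H (z, y)"] Hi by simp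
    also have "\<dots> = (LINT y|\<mu>. complex_of_real (c (x, y)) * f y)" by (simp only: cf)
    finally show ?case using 1 by simp
  qed
qed


text \<open>Positivity, phrased as A |f| being equal to its modulus. The class contains the
  identity, which is the zeroth power of every set of operators but in general has no
  kernel.\<close>

definition pos_ops :: "'x operator set" where
  "pos_ops = {A \<in> BO. \<forall>f\<in>L. AE x in \<mu>. modulus (A (modulus f)) x = A (modulus f) x}"

lemma pos_opsD:
  assumes "A \<in> pos_ops"
  shows "A \<in> BO" "f \<in> L \<Longrightarrow> AE x in \<mu>. modulus (A (modulus f)) x = A (modulus f) x"
  using assms by (auto simp: pos_ops_def)

lemma PK_pos_ops: "PK \<subseteq> pos_ops"
  using PK_modulus by (auto simp: pos_ops_def)

lemma id_pos_ops: "id \<in> pos_ops"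
  by (simp add: pos_ops_def bo_id modulus_def)

lemma pos_ops_comp:
  assumes A: "A \<in> pos_ops" and B: "B \<in> pos_ops"
  shows "A \<circ> B \<in> pos_ops"
  unfolding pos_ops_def
proof (intro CollectI conjI ballI)
  show "A \<circ> B \<in> BO" by (rule bo_o[OF pos_opsD(1)[OF A] pos_opsD(1)[OF B]])
  fix f assume f: "f \<in> L"
  let ?g = "B (modulus f)"
  have g: "?g \<in> L" by (rule bo_L[OF pos_opsD(1)[OF B] modulus_L[OF f]])
  have "AE x in \<mu>. A (modulus ?g) x = A ?g x"
    by (rule bo_cong[OF pos_opsD(1)[OF A] modulus_L[OF g] g pos_opsD(2)[OF B f]])
  with pos_opsD(2)[OF A g] show "AE x in \<mu>. modulus ((A \<circ> B) (modulus f)) x = (A \<circ> B) (modulus f) x"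
    by eventually_elim (simp add: modulus_def)
qed

text \<open>A symmetric form of \<open>C \<le> A\<^sup>(\<^sup>1\<^sup>/\<^sup>2\<^sup>) \<circ> B\<^sup>(\<^sup>1\<^sup>/\<^sup>2\<^sup>)\<close>, which is evidently multiplicative.\<close>

definition mean_dom :: "'x operator \<Rightarrow> 'x operator \<Rightarrow> 'x operator \<Rightarrow> bool" where
  "mean_dom C A B \<longleftrightarrow> (\<forall>g\<in>L. \<forall>h\<in>L. \<forall>k\<in>L.
    (AE x in \<mu>. (cmod (g x))\<^sup>2 \<le> cmod (h x) * cmod (k x)) \<longrightarrow>
    (AE x in \<mu>. (cmod (C g x))\<^sup>2 \<le> cmod (A (modulus h) x) * cmod (B (modulus k) x)))"

lemma mean_domD:
  "\<lbrakk>mean_dom C A B; g \<in> L; h \<in> L; k \<in> L; AE x in \<mu>. (cmod (g x))\<^sup>2 \<le> cmod (h x) * cmod (k x)\<rbrakk> \<Longrightarrow>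
    AE x in \<mu>. (cmod (C g x))\<^sup>2 \<le> cmod (A (modulus h) x) * cmod (B (modulus k) x)"
  unfolding mean_dom_def by blast

lemma mean_dom_id: "mean_dom id id id"
  by (simp add: mean_dom_def)

text \<open>A2 |h| and B2 |k| take over the roles of h and k for the function C2 g. Since A2 and B2
  are positive, the moduli that the outer relation puts around them change nothing.\<close>

lemma mean_dom_comp:
  assumes 1: "mean_dom C1 A1 B1" and 2: "mean_dom C2 A2 B2" and C2: "C2 \<in> BO"
    and A1: "A1 \<in> BO" and B1: "B1 \<in> BO" and A2: "A2 \<in> pos_ops" and B2: "B2 \<in> pos_ops"
  shows "mean_dom (C1 \<circ> C2) (A1 \<circ> A2) (B1 \<circ> B2)"
  unfolding mean_dom_def
proof (intro ballI impI)
  fix g h k assume L: "g \<in> L" "h \<in> L" "k \<in> L" and le: "AE x in \<mu>. (cmod (g x))\<^sup>2 \<le> cmod (h x) * cmod (k x)"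
  let ?h = "A2 (modulus h)" and ?k = "B2 (modulus k)"
  have L': "C2 g \<in> L" "?h \<in> L" "?k \<in> L"
    using bo_L[OF C2 L(1)] bo_L[OF pos_opsD(1)[OF A2] modulus_L[OF L(2)]]
      bo_L[OF pos_opsD(1)[OF B2] modulus_L[OF L(3)]] by auto
  have "AE x in \<mu>. A1 (modulus ?h) x = A1 ?h x"
    by (rule bo_cong[OF A1 modulus_L[OF L'(2)] L'(2) pos_opsD(2)[OF A2 L(2)]])
  moreover have "AE x in \<mu>. B1 (modulus ?k) x = B1 ?k x"
    by (rule bo_cong[OF B1 modulus_L[OF L'(3)] L'(3) pos_opsD(2)[OF B2 L(3)]])
  moreover have "AE x in \<mu>. (cmod (C1 (C2 g) x))\<^sup>2 \<le> cmod (A1 (modulus ?h) x) * cmod (B1 (modulus ?k) x)"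
    by (rule mean_domD[OF 1 L' mean_domD[OF 2 L le]])
  ultimately show "AE x in \<mu>. (cmod ((C1 \<circ> C2) g x))\<^sup>2 \<le> cmod ((A1 \<circ> A2) (modulus h) x) * cmod ((B1 \<circ> B2) (modulus k) x)"
    by eventually_elim simp
qed

lemma mean_dom_amgm:
  assumes "mean_dom C A B" "f \<in> L"
  shows "AE x in \<mu>. 2 * cmod (C f x) \<le> cmod (A (modulus f) x) + cmod (B (modulus f) x)"
proof -
  have "AE x in \<mu>. (cmod (C f x))\<^sup>2 \<le> cmod (A (modulus f) x) * cmod (B (modulus f) x)"
    by (rule mean_domD[OF assms(1,2,2,2)]) (simp add: power2_eq_square)
  then show ?thesis
  proof eventually_elim
    case (elim x)
    then have "cmod (C f x) \<le> sqrt (cmod (A (modulus f) x) * cmod (B (modulus f) x))" by (rule real_le_rsqrt)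
    then show ?case using sqrt_mult_le_amgm[of "cmod (A (modulus f) x)" "cmod (B (modulus f) x)" 1] by simp
  qed
qed

abbreviation gmean :: "'x operator \<Rightarrow> 'x operator \<Rightarrow> 'x operator" where
  "gmean A B \<equiv> hadamard_mean \<mu> L (1/2) A (1/2) B"

lemma gmean_eq: "gmean A B f x = (LINT y|\<mu>. complex_of_real (sqrt (pk A (x, y) * pk B (x, y))) * f y)"
  by (simp add: hadamard_mean_def kernel_operator_def pk_def powr_half_sqrt real_sqrt_mult)

lemma gmean_section:
  assumes A: "A \<in> PK" and B: "B \<in> PK" and f: "f \<in> L"
  shows "AE x in \<mu>. integrable \<mu> (\<lambda>y. sqrt (pk A (x, y) * pk B (x, y)) * cmod (f y)) \<and>
    integrable \<mu> (\<lambda>y. complex_of_real (sqrt (pk A (x, y) * pk B (x, y))) * f y) \<and>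
    cmod (gmean A B f x) \<le> (LINT y|\<mu>. sqrt (pk A (x, y) * pk B (x, y)) * cmod (f y))"
proof -
  have Ak: "A \<in> positive_kernel_operators \<mu> L" and Bk: "B \<in> positive_kernel_operators \<mu> L" using A B by auto
  have [measurable]: "pk A \<in> borel_measurable (\<mu> \<Otimes>\<^sub>M \<mu>)" "pk B \<in> borel_measurable (\<mu> \<Otimes>\<^sub>M \<mu>)" "f \<in> borel_measurable \<mu>"
    using pk_measurable[OF Ak] pk_measurable[OF Bk] L_measurable[OF f] by auto
  show ?thesis
    using pk_section_abs[OF Ak f] pk_section_abs[OF Bk f] AE_space
  proof eventually_elim
    case (elim x)
    have i: "integrable \<mu> (\<lambda>y. sqrt (pk A (x, y) * pk B (x, y)) * cmod (f y))"
    proof (rule Bochner_Integration.integrable_bound)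
      show "integrable \<mu> (\<lambda>y. pk A (x, y) * cmod (f y) + pk B (x, y) * cmod (f y))" using elim by auto
      show "(\<lambda>y. sqrt (pk A (x, y) * pk B (x, y)) * cmod (f y)) \<in> borel_measurable \<mu>" using elim(3) by measurable
      have "sqrt (pk A (x, y) * pk B (x, y)) * cmod (f y) \<le> (pk A (x, y) + pk B (x, y)) * cmod (f y)" for y
      proof (rule mult_right_mono)
        show "sqrt (pk A (x, y) * pk B (x, y)) \<le> pk A (x, y) + pk B (x, y)"
          using sqrt_mult_le_amgm[of "pk A (x, y)" "pk B (x, y)" 1] pk_nonneg[of A "(x, y)"] pk_nonneg[of B "(x, y)"]
            real_sqrt_ge_zero[OF mult_nonneg_nonneg[OF pk_nonneg pk_nonneg], of A "(x, y)" B "(x, y)"]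
          by linarith
      qed simp
      then show "AE y in \<mu>. norm (sqrt (pk A (x, y) * pk B (x, y)) * cmod (f y))
          \<le> norm (pk A (x, y) * cmod (f y) + pk B (x, y) * cmod (f y))"
        by (intro always_eventually allI) (simp add: distrib_right)
    qed
    have n: "norm (complex_of_real (sqrt (pk A (x, y) * pk B (x, y))) * f y) = sqrt (pk A (x, y) * pk B (x, y)) * cmod (f y)" for y
      by (simp add: norm_mult)
    have "integrable \<mu> (\<lambda>y. complex_of_real (sqrt (pk A (x, y) * pk B (x, y))) * f y)"
      by (rule Bochner_Integration.integrable_bound[OF i]) (use elim(3) in \<open>measurable, simp add: norm_mult\<close>)
    moreover have "cmod (gmean A B f x) \<le> (LINT y|\<mu>. norm (complex_of_real (sqrt (pk A (x, y) * pk B (x, y))) * f y))"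
      unfolding gmean_eq by (rule integral_norm_bound)
    ultimately show ?case using i by (simp only: n)
  qed
qed

text \<open>Cauchy-Schwarz, obtained by integrating 2 sqrt (a b) |g| \<le> t a |h| + b |k| / t and
  then optimising t. Separate functions h and k are what allows the inequality to be
  iterated.\<close>

lemma gmean_square:
  assumes A: "A \<in> PK" and B: "B \<in> PK" and L: "g \<in> L" "h \<in> L" "k \<in> L"
    and le: "AE x in \<mu>. (cmod (g x))\<^sup>2 \<le> cmod (h x) * cmod (k x)"
  shows "AE x in \<mu>. (cmod (gmean A B g x))\<^sup>2 \<le> cmod (A (modulus h) x) * cmod (B (modulus k) x)"
proof -
  have Ak: "A \<in> positive_kernel_operators \<mu> L" and Bk: "B \<in> positive_kernel_operators \<mu> L" using A B by auto
  show ?thesis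
    using gmean_section[OF A B L(1)] pk_section_abs[OF Ak L(2)] pk_section_abs[OF Bk L(3)]
  proof eventually_elim
    case (elim x)
    define \<alpha> where "\<alpha> = (LINT y|\<mu>. pk A (x, y) * cmod (h y))"
    define \<beta> where "\<beta> = (LINT y|\<mu>. pk B (x, y) * cmod (k y))"
    have nn: "\<alpha> \<ge> 0" "\<beta> \<ge> 0" unfolding \<alpha>_def \<beta>_def by (auto intro!: integral_nonneg_AE)
    have "(cmod (gmean A B g x))\<^sup>2 \<le> \<alpha> * \<beta>"
    proof (rule square_le_of_amgm[OF nn])
      fix t :: real assume t: "t > 0"
      have "(LINT y|\<mu>. 2 * (sqrt (pk A (x, y) * pk B (x, y)) * cmod (g y)))
          \<le> (LINT y|\<mu>. t * (pk A (x, y) * cmod (h y)) + pk B (x, y) * cmod (k y) / t)"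
      proof (rule integral_mono_AE)
        show "AE y in \<mu>. 2 * (sqrt (pk A (x, y) * pk B (x, y)) * cmod (g y))
            \<le> t * (pk A (x, y) * cmod (h y)) + pk B (x, y) * cmod (k y) / t"
          using le
        proof eventually_elim
          case (elim y)
          have "cmod (g y) \<le> sqrt (cmod (h y) * cmod (k y))" using elim by (rule real_le_rsqrt)
          then have "sqrt (pk A (x, y) * pk B (x, y)) * cmod (g y)
              \<le> sqrt (pk A (x, y) * pk B (x, y)) * sqrt (cmod (h y) * cmod (k y))"
            by (intro mult_left_mono) auto
          also have "\<dots> = sqrt ((pk A (x, y) * cmod (h y)) * (pk B (x, y) * cmod (k y)))"
            by (simp add: real_sqrt_mult[symmetric] mult_ac)
          finally show ?case
            using sqrt_mult_le_amgm[of "pk A (x, y) * cmod (h y)" "pk B (x, y) * cmod (k y)" t] t by simp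
        qed
      qed (use elim t in auto)
      also have "\<dots> = t * \<alpha> + \<beta> / t" using elim by (simp add: \<alpha>_def \<beta>_def)
      finally have "2 * (LINT y|\<mu>. sqrt (pk A (x, y) * pk B (x, y)) * cmod (g y)) \<le> t * \<alpha> + \<beta> / t" by simp
      then show "2 * cmod (gmean A B g x) \<le> t * \<alpha> + \<beta> / t" using elim by linarith
    qed simp
    then show ?case using elim nn by (simp add: \<alpha>_def \<beta>_def)
  qed
qed

lemma mean_dom_gmean: "A \<in> PK \<Longrightarrow> B \<in> PK \<Longrightarrow> mean_dom (gmean A B) A B"
  unfolding mean_dom_def using gmean_square[of A B] by blast

text \<open>The values have modulus at most (A |f| + B |f|) / 2, so the ideal property puts them
  into L, and a common bound of A and B is inherited.\<close>

lemma gmean_BO: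
  assumes A: "A \<in> PK" and B: "B \<in> PK"
  shows "gmean A B \<in> BO"
    and "(\<And>f. f \<in> L \<Longrightarrow> N (A f) \<le> C * N f) \<Longrightarrow> (\<And>f. f \<in> L \<Longrightarrow> N (B f) \<le> C * N f) \<Longrightarrow> f \<in> L \<Longrightarrow> N (gmean A B f) \<le> C * N f"
proof -
  have Ak: "A \<in> positive_kernel_operators \<mu> L" and Bk: "B \<in> positive_kernel_operators \<mu> L"
    and Ab: "A \<in> BO" and Bb: "B \<in> BO" using A B by auto
  have [measurable]: "pk A \<in> borel_measurable (\<mu> \<Otimes>\<^sub>M \<mu>)" "pk B \<in> borel_measurable (\<mu> \<Otimes>\<^sub>M \<mu>)"
    using pk_measurable[OF Ak] pk_measurable[OF Bk] by auto
  have meas: "gmean A B f \<in> borel_measurable \<mu>" if "f \<in> L" for f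
  proof -
    have [measurable]: "f \<in> borel_measurable \<mu>" by (rule L_measurable[OF that])
    have "gmean A B f = (\<lambda>x. LINT y|\<mu>. complex_of_real (sqrt (pk A (x, y) * pk B (x, y))) * f y)"
      by (rule ext) (rule gmean_eq)
    then show ?thesis by simp
  qed
  have bound: "gmean A B f \<in> L \<and> N (gmean A B f) \<le> (N (A (modulus f)) + N (B (modulus f))) / 2" if f: "f \<in> L" for f
  proof -
    define G where "G = (\<lambda>x. (1/2::complex) * (modulus (A (modulus f)) x + modulus (B (modulus f)) x))"
    have AL: "A (modulus f) \<in> L" "B (modulus f) \<in> L"
      using bo_L[OF Ab modulus_L[OF f]] bo_L[OF Bb modulus_L[OF f]] by auto
    have G: "G \<in> L" unfolding G_def by (intro scale_closed add_closed modulus_L AL)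
    have "AE x in \<mu>. cmod (gmean A B f x) \<le> cmod (G x)"
      using mean_dom_amgm[OF mean_dom_gmean[OF A B] f]
    proof eventually_elim
      case (elim x)
      have "G x = complex_of_real ((cmod (A (modulus f) x) + cmod (B (modulus f) x)) / 2)"
        by (simp add: G_def modulus_def)
      then have "cmod (G x) = (cmod (A (modulus f) x) + cmod (B (modulus f) x)) / 2"
        by (simp only: norm_of_real) simp
      then show ?case using elim by simp
    qed
    then have "gmean A B f \<in> L \<and> N (gmean A B f) \<le> N G" by (rule ideal[OF G meas[OF f]])
    moreover have "N G \<le> (N (A (modulus f)) + N (B (modulus f))) / 2"
      using norm_triangle[OF modulus_L[OF AL(1)] modulus_L[OF AL(2)]] norm_modulus[OF AL(1)] norm_modulus[OF AL(2)]
        norm_scale[OF add_closed[OF modulus_L[OF AL(1)] modulus_L[OF AL(2)]], of "1/2"]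
      by (simp add: G_def)
    ultimately show ?thesis by linarith
  qed
  obtain D where D: "\<And>f. f \<in> L \<Longrightarrow> N (A f) \<le> D * N f" using bo_bound[OF Ab] by metis
  obtain E where E: "\<And>f. f \<in> L \<Longrightarrow> N (B f) \<le> E * N f" using bo_bound[OF Bb] by metis
  show "gmean A B \<in> BO"
  proof (rule BO_I[where C = "(D + E) / 2"])
    fix f assume f: "f \<in> L"
    show "gmean A B f \<in> L" using bound[OF f] by simp
    show "N (gmean A B f) \<le> (D + E) / 2 * N f"
      using bound[OF f] D[OF modulus_L[OF f]] E[OF modulus_L[OF f]] norm_modulus[OF f] by (simp add: field_simps)
  next
    fix f g assume f: "f \<in> L" and g: "g \<in> L"
    have [measurable]: "f \<in> borel_measurable \<mu>" "g \<in> borel_measurable \<mu>" using L_measurable f g by auto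
    show "AE x in \<mu>. gmean A B (\<lambda>y. f y + g y) x = gmean A B f x + gmean A B g x"
      using gmean_section[OF A B f] gmean_section[OF A B g]
      by eventually_elim (simp add: gmean_eq distrib_left)
    assume eq: "AE x in \<mu>. f x = g x"
    show "AE x in \<mu>. gmean A B f x = gmean A B g x"
    proof (rule AE_I2)
      fix x assume [measurable]: "x \<in> space \<mu>"
      show "gmean A B f x = gmean A B g x"
        unfolding gmean_eq
        by (rule integral_cong_AE) (measurable, rule eventually_mono[OF eq], simp)
    qed
  next
    fix c f assume f: "f \<in> L"
    show "AE x in \<mu>. gmean A B (\<lambda>y. c * f y) x = c * gmean A B f x"
    proof (rule AE_I2)
      fix x
      have "gmean A B (\<lambda>y. c * f y) x = (LINT y|\<mu>. c * (complex_of_real (sqrt (pk A (x, y) * pk B (x, y))) * f y))"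
        unfolding gmean_eq by (simp add: mult_ac)
      then show "gmean A B (\<lambda>y. c * f y) x = c * gmean A B f x" unfolding gmean_eq by simp
    qed
  qed
  assume CA: "\<And>f. f \<in> L \<Longrightarrow> N (A f) \<le> C * N f" and CB: "\<And>f. f \<in> L \<Longrightarrow> N (B f) \<le> C * N f" and f: "f \<in> L"
  show "N (gmean A B f) \<le> C * N f"
    using bound[OF f] CA[OF modulus_L[OF f]] CB[OF modulus_L[OF f]] norm_modulus[OF f] by simp
qed

lemma gmean_PK:
  assumes A: "A \<in> PK" and B: "B \<in> PK"
  shows "gmean A B \<in> PK"
proof (rule PK_intro[where a = "\<lambda>z. sqrt (pk A z * pk B z)"])
  show "gmean A B \<in> BO" by (rule gmean_BO(1)[OF A B])
  have "pk A \<in> borel_measurable (\<mu> \<Otimes>\<^sub>M \<mu>)" "pk B \<in> borel_measurable (\<mu> \<Otimes>\<^sub>M \<mu>)"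
    using pk_measurable A B by auto
  then show "(\<lambda>z. sqrt (pk A z * pk B z)) \<in> borel_measurable (\<mu> \<Otimes>\<^sub>M \<mu>)" by measurable
  fix f assume "f \<in> L"
  from gmean_section[OF A B this]
  show "AE x in \<mu>. integrable \<mu> (\<lambda>y. complex_of_real (sqrt (pk A (x, y) * pk B (x, y))) * f y) \<and>
      gmean A B f x = (LINT y|\<mu>. complex_of_real (sqrt (pk A (x, y) * pk B (x, y))) * f y)"
    by eventually_elim (simp add: gmean_eq)
qed simp

text \<open>The way back from \<open>mean_dom\<close> to kernels. Testing with nonnegative functions
  of L gives t a + b / t - 2 c \<ge> 0 almost everywhere for each t > 0, and for all rational t
  simultaneously this means c \<le> sqrt (a b). A product of means is thereby bounded by the mean of
  the products.\<close>

lemma gmean_dominates: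
  assumes A: "A \<in> PK" and B: "B \<in> PK" and C: "C \<in> PK" and mean_dom: "mean_dom C A B" and f: "f \<in> L"
  shows "AE x in \<mu>. cmod (C f x) \<le> cmod (gmean A B (modulus f) x)"
proof -
  have Ak: "A \<in> positive_kernel_operators \<mu> L" and Bk: "B \<in> positive_kernel_operators \<mu> L"
    and Ck: "C \<in> positive_kernel_operators \<mu> L" using A B C by auto
  have [measurable]: "pk A \<in> borel_measurable (\<mu> \<Otimes>\<^sub>M \<mu>)" "pk B \<in> borel_measurable (\<mu> \<Otimes>\<^sub>M \<mu>)"
    "pk C \<in> borel_measurable (\<mu> \<Otimes>\<^sub>M \<mu>)"
    using pk_measurable Ak Bk Ck by auto
  have amgm: "AE z in \<mu> \<Otimes>\<^sub>M \<mu>. t * pk A z + pk B z / t - 2 * pk C z \<ge> 0" if t: "t > 0" for t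
  proof (rule AE_nonneg_kernel)
    fix g :: "'x \<Rightarrow> real" assume g: "\<And>y. g y \<ge> 0" and gL: "(\<lambda>y. complex_of_real (g y)) \<in> L"
    define G where "G = (\<lambda>y. complex_of_real (g y))"
    have G: "G \<in> L" "modulus G = G" "\<And>y. cmod (G y) = g y" using g gL by (auto simp: G_def modulus_def)
    have "AE x in \<mu>. (cmod (C G x))\<^sup>2 \<le> cmod (A (modulus G) x) * cmod (B (modulus G) x)"
      by (rule mean_domD[OF mean_dom G(1) G(1) G(1)]) (simp add: power2_eq_square)
    then show "AE x in \<mu>. integrable \<mu> (\<lambda>y. (t * pk A (x, y) + pk B (x, y) / t - 2 * pk C (x, y)) * g y) \<and>
        0 \<le> (LINT y|\<mu>. (t * pk A (x, y) + pk B (x, y) / t - 2 * pk C (x, y)) * g y)"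
      using pk_section_abs[OF Ak G(1)] pk_section_abs[OF Bk G(1)] pk_section_abs[OF Ck G(1)]
    proof eventually_elim
      case (elim x)
      define \<alpha> where "\<alpha> = (LINT y|\<mu>. pk A (x, y) * g y)"
      define \<beta> where "\<beta> = (LINT y|\<mu>. pk B (x, y) * g y)"
      define \<gamma> where "\<gamma> = (LINT y|\<mu>. pk C (x, y) * g y)"
      have i: "integrable \<mu> (\<lambda>y. pk A (x, y) * g y)" "integrable \<mu> (\<lambda>y. pk B (x, y) * g y)" "integrable \<mu> (\<lambda>y. pk C (x, y) * g y)"
        and v: "A G x = \<alpha>" "B G x = \<beta>" "C G x = \<gamma>"
        using elim by (auto simp: G \<alpha>_def \<beta>_def \<gamma>_def)
      have nn: "\<alpha> \<ge> 0" "\<beta> \<ge> 0" "\<gamma> \<ge> 0" unfolding \<alpha>_def \<beta>_def \<gamma>_def using g by (auto intro!: integral_nonneg_AE)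
      have "\<gamma>\<^sup>2 \<le> \<alpha> * \<beta>" using elim(1) nn by (simp add: G v)
      then have "\<gamma> \<le> sqrt (\<alpha> * \<beta>)" by (rule real_le_rsqrt)
      then have "2 * \<gamma> \<le> t * \<alpha> + \<beta> / t" using sqrt_mult_le_amgm[OF nn(1,2) t] by simp
      moreover have eq: "(\<lambda>y. (t * pk A (x, y) + pk B (x, y) / t - 2 * pk C (x, y)) * g y)
          = (\<lambda>y. t * (pk A (x, y) * g y) + pk B (x, y) * g y / t - 2 * (pk C (x, y) * g y))"
        by (auto simp: algebra_simps)
      have "(LINT y|\<mu>. t * (pk A (x, y) * g y) + pk B (x, y) * g y / t - 2 * (pk C (x, y) * g y)) = t * \<alpha> + \<beta> / t - 2 * \<gamma>"
        using i by (simp add: \<alpha>_def \<beta>_def \<gamma>_def)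
      moreover have "integrable \<mu> (\<lambda>y. t * (pk A (x, y) * g y) + pk B (x, y) * g y / t - 2 * (pk C (x, y) * g y))"
        using i by simp
      ultimately show ?case unfolding eq by simp
    qed
  qed measurable
  have "AE z in \<mu> \<Otimes>\<^sub>M \<mu>. \<forall>t\<in>\<rat>. t > 0 \<longrightarrow> t * pk A z + pk B z / t - 2 * pk C z \<ge> 0"
    by (subst AE_ball_countable[OF countable_rat]) (use amgm in auto)
  then have "AE z in \<mu> \<Otimes>\<^sub>M \<mu>. pk C z \<le> sqrt (pk A z * pk B z)"
  proof eventually_elim
    case (elim z)
    have "(pk C z)\<^sup>2 \<le> pk A z * pk B z"
      by (rule square_le_of_amgm) (use elim in \<open>auto simp: algebra_simps\<close>)
    then show ?case by (rule real_le_rsqrt)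
  qed
  from P.AE_pair[OF this] show ?thesis
    using pk_section_abs[OF Ck f] pk_abs_le[OF Ck f] gmean_section[OF A B f]
  proof eventually_elim
    case (elim x)
    have "cmod (C f x) \<le> (LINT y|\<mu>. pk C (x, y) * cmod (f y))"
      using elim(2,3) by (simp add: integral_nonneg_AE)
    also have "\<dots> \<le> (LINT y|\<mu>. sqrt (pk A (x, y) * pk B (x, y)) * cmod (f y))"
      by (rule integral_mono_AE) (use elim in \<open>auto elim!: eventually_mono intro!: mult_right_mono\<close>)
    also have "\<dots> = cmod (complex_of_real (LINT y|\<mu>. sqrt (pk A (x, y) * pk B (x, y)) * cmod (f y)))"
      by (subst norm_of_real) (simp add: integral_nonneg_AE)
    also have "\<dots> = cmod (gmean A B (modulus f) x)"
      unfolding gmean_eq modulus_def of_real_mult[symmetric] integral_complex_of_real ..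
    finally show ?case .
  qed
qed


section \<open>Precompact images of order intervals\<close>

lemma order_continuous_real:
  fixes e :: "nat \<Rightarrow> 'x \<Rightarrow> real"
  assumes oc: "order_continuous_norm L N (nonneg_fun \<mu>)"
    and meas: "\<And>n. e n \<in> borel_measurable \<mu>"
    and dec: "AE x in \<mu>. \<forall>n. 0 \<le> e n x \<and> e (Suc n) x \<le> e n x"
    and lim: "AE x in \<mu>. (\<lambda>n. e n x) \<longlonglongrightarrow> 0"
    and L: "(\<lambda>x. complex_of_real (e 0 x)) \<in> L"
  shows "(\<lambda>n. N (\<lambda>x. complex_of_real (e n x))) \<longlonglongrightarrow> 0"
proof -
  define f where "f n = (\<lambda>x. complex_of_real (e n x))" for n
  have fL: "f n \<in> L" for n
  proof -
    have "AE x in \<mu>. cmod (complex_of_real (e n x)) \<le> cmod (complex_of_real (e 0 x))"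
      using dec
    proof eventually_elim
      case (elim x)
      then have "decseq (\<lambda>n. e n x)" by (simp add: decseq_Suc_iff)
      then have "e n x \<le> e 0 x" by (rule decseqD) simp
      then show ?case using elim by (simp add: abs_of_nonneg)
    qed
    then show ?thesis using ideal[OF L, of "f n"] meas[of n] by (auto simp: f_def)
  qed
  \<comment> \<open>Order continuity speaks of infima in L. A lower bound of the sequence is at most
    0 at almost every point of convergence, so pointwise decrease to 0 yields the infimum 0.\<close>
  have "\<forall>g\<in>L. (\<forall>n. nonneg_fun \<mu> (\<lambda>x. f n x - g x)) \<longrightarrow> nonneg_fun \<mu> (\<lambda>x. - g x)"
  proof (intro ballI impI)
    fix g assume "\<forall>n. nonneg_fun \<mu> (\<lambda>x. f n x - g x)"
    then have "AE x in \<mu>. \<forall>n. f n x - g x \<in> \<real>\<^sub>\<ge>\<^sub>0" by (simp add: nonneg_fun_def AE_all_countable)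
    with lim show "nonneg_fun \<mu> (\<lambda>x. - g x)"
      unfolding nonneg_fun_def
    proof eventually_elim
      case (elim x)
      then have "Re (g x) \<le> e n x" "Im (g x) = 0" for n
        by (auto simp: f_def complex_nonneg_Reals_iff)
      moreover have "Re (g x) \<le> 0"
        by (rule LIMSEQ_le_const[OF elim(1)]) (use calculation(1) in auto)
      ultimately show ?case by (simp add: complex_nonneg_Reals_iff)
    qed
  qed
  moreover have "\<forall>n. nonneg_fun \<mu> (\<lambda>x. f n x - f (Suc n) x)"
    unfolding nonneg_fun_def f_def
    by (intro allI eventually_mono[OF dec]) (simp add: complex_nonneg_Reals_iff)
  moreover have "\<forall>n. f n \<in> L \<and> nonneg_fun \<mu> (f n)"
    unfolding nonneg_fun_def
    by (intro allI conjI fL eventually_mono[OF dec]) (simp add: complex_nonneg_Reals_iff f_def)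
  ultimately show ?thesis
    using oc[unfolded order_continuous_norm_def, rule_format, of f] by (simp add: f_def)
qed

text \<open>Kernels that send bounded functions into L: the image of the constant 1 belongs to L and
  dominates the images of all of \<open>unit_funs\<close>.\<close>

definition admissible :: "('x \<times> 'x \<Rightarrow> real) \<Rightarrow> bool" where
  "admissible g \<longleftrightarrow> g \<in> borel_measurable (\<mu> \<Otimes>\<^sub>M \<mu>) \<and> (\<forall>z. g z \<ge> 0) \<and> (AE x in \<mu>. integrable \<mu> (\<lambda>y. g (x, y))) \<and>
    (\<lambda>x. complex_of_real (LINT y|\<mu>. g (x, y))) \<in> L"

text \<open>Acts on bounded functions, which need not belong to \<open>L\<close>.\<close>

definition kmap :: "('x \<times> 'x \<Rightarrow> real) \<Rightarrow> ('x \<Rightarrow> complex) \<Rightarrow> ('x \<Rightarrow> complex)" where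
  "kmap g h = (\<lambda>x. LINT y|\<mu>. complex_of_real (g (x, y)) * h y)"

definition unit_funs :: "('x \<Rightarrow> complex) set" where
  "unit_funs = {h \<in> borel_measurable \<mu>. \<forall>y. cmod (h y) \<le> 1}"

definition compact_kernel :: "('x \<times> 'x \<Rightarrow> real) \<Rightarrow> bool" where
  "compact_kernel g \<longleftrightarrow> (\<forall>\<epsilon>>0. \<exists>M. finite M \<and> M \<subseteq> L \<and> (\<forall>h\<in>unit_funs. \<exists>k\<in>M. N (\<lambda>x. kmap g h x - k x) \<le> \<epsilon>))"

lemma admissibleD:
  assumes "admissible g"
  shows "g \<in> borel_measurable (\<mu> \<Otimes>\<^sub>M \<mu>)" "g z \<ge> 0" "AE x in \<mu>. integrable \<mu> (\<lambda>y. g (x, y))"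
    "(\<lambda>x. complex_of_real (LINT y|\<mu>. g (x, y))) \<in> L"
  using assms unfolding admissible_def by blast+

lemma unit_funsD: "h \<in> unit_funs \<Longrightarrow> h \<in> borel_measurable \<mu>" "h \<in> unit_funs \<Longrightarrow> cmod (h y) \<le> 1"
  by (auto simp: unit_funs_def)

lemma admissible_section:
  assumes g: "admissible g" and h: "h \<in> unit_funs"
  shows "AE x in \<mu>. integrable \<mu> (\<lambda>y. complex_of_real (g (x, y)) * h y)"
proof -
  have [measurable]: "g \<in> borel_measurable (\<mu> \<Otimes>\<^sub>M \<mu>)" "h \<in> borel_measurable \<mu>"
    using admissibleD[OF g] unit_funsD[OF h] by auto
  show ?thesis
    using admissibleD(3)[OF g] AE_space
  proof eventually_elim
    case (elim x)
    show ?case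
    proof (rule Bochner_Integration.integrable_bound[OF elim(1)])
      show "(\<lambda>y. complex_of_real (g (x, y)) * h y) \<in> borel_measurable \<mu>" using elim(2) by measurable
      have "g (x, y) * cmod (h y) \<le> g (x, y) * 1" for y
        by (intro mult_left_mono unit_funsD(2)[OF h] admissibleD(2)[OF g])
      then show "AE y in \<mu>. norm (complex_of_real (g (x, y)) * h y) \<le> norm (g (x, y))"
        using admissibleD(2)[OF g] by (simp add: norm_mult)
    qed
  qed
qed

lemma kmap_L:
  assumes g: "admissible g" and h: "h \<in> unit_funs"
  shows "kmap g h \<in> L" "N (kmap g h) \<le> N (\<lambda>x. complex_of_real (LINT y|\<mu>. g (x, y)))"
proof -
  have [measurable]: "g \<in> borel_measurable (\<mu> \<Otimes>\<^sub>M \<mu>)" "h \<in> borel_measurable \<mu>"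
    using admissibleD[OF g] unit_funsD[OF h] by auto
  have "kmap g h \<in> borel_measurable \<mu>" unfolding kmap_def by measurable
  moreover have "AE x in \<mu>. cmod (kmap g h x) \<le> cmod (complex_of_real (LINT y|\<mu>. g (x, y)))"
    using admissibleD(3)[OF g] admissible_section[OF g h]
  proof eventually_elim
    case (elim x)
    have "cmod (kmap g h x) \<le> (LINT y|\<mu>. norm (complex_of_real (g (x, y)) * h y))"
      unfolding kmap_def by (rule integral_norm_bound)
    also have "\<dots> \<le> (LINT y|\<mu>. g (x, y))"
    proof (rule integral_mono[OF integrable_norm[OF elim(2)] elim(1)])
      show "norm (complex_of_real (g (x, y)) * h y) \<le> g (x, y)" for y
        using mult_left_mono[OF unit_funsD(2)[OF h, of y] admissibleD(2)[OF g, of "(x, y)"]] admissibleD(2)[OF g, of "(x, y)"]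
        by (simp add: norm_mult)
    qed
    also have "\<dots> \<le> cmod (complex_of_real (LINT y|\<mu>. g (x, y)))" by simp
    finally show ?case .
  qed
  ultimately show "kmap g h \<in> L" "N (kmap g h) \<le> N (\<lambda>x. complex_of_real (LINT y|\<mu>. g (x, y)))"
    using ideal[OF admissibleD(4)[OF g]] by blast+
qed

lemma admissible_mono:
  assumes g: "admissible g" and g': "g' \<in> borel_measurable (\<mu> \<Otimes>\<^sub>M \<mu>)" "\<And>z. 0 \<le> g' z" "\<And>z. g' z \<le> g z"
  shows "admissible g'"
proof -
  note [measurable] = admissibleD(1)[OF g] g'(1)
  have int: "AE x in \<mu>. integrable \<mu> (\<lambda>y. g' (x, y))"
    using admissibleD(3)[OF g] AE_space
    by eventually_elim (rule Bochner_Integration.integrable_bound, assumption, measurable, use g' admissibleD(2)[OF g] in auto)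
  have "AE x in \<mu>. cmod (complex_of_real (LINT y|\<mu>. g' (x, y))) \<le> cmod (complex_of_real (LINT y|\<mu>. g (x, y)))"
    using admissibleD(3)[OF g] int
  proof eventually_elim
    case (elim x)
    have "0 \<le> (LINT y|\<mu>. g' (x, y))" using g'(2) by (intro integral_nonneg_AE) auto
    moreover have "(LINT y|\<mu>. g' (x, y)) \<le> (LINT y|\<mu>. g (x, y))" using elim g'(3) by (intro integral_mono) auto
    ultimately show ?case by simp
  qed
  then have "(\<lambda>x. complex_of_real (LINT y|\<mu>. g' (x, y))) \<in> L"
    using ideal[OF admissibleD(4)[OF g], of "\<lambda>x. complex_of_real (LINT y|\<mu>. g' (x, y))"] by auto
  then show ?thesis using int g' by (simp add: admissible_def)
qed

lemma admissible_add:
  assumes g: "admissible g" and g': "admissible g'"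
  shows "admissible (\<lambda>z. g z + g' z)"
proof -
  note [measurable] = admissibleD(1)[OF g] admissibleD(1)[OF g']
  have "AE x in \<mu>. complex_of_real (LINT y|\<mu>. g (x, y)) + complex_of_real (LINT y|\<mu>. g' (x, y))
      = complex_of_real (LINT y|\<mu>. g (x, y) + g' (x, y))"
    using admissibleD(3)[OF g] admissibleD(3)[OF g'] by eventually_elim simp
  then have "AE x in \<mu>. cmod (complex_of_real (LINT y|\<mu>. g (x, y) + g' (x, y)))
      \<le> cmod (complex_of_real (LINT y|\<mu>. g (x, y)) + complex_of_real (LINT y|\<mu>. g' (x, y)))"
    by eventually_elim (simp only: order_refl)
  then have "(\<lambda>x. complex_of_real (LINT y|\<mu>. g (x, y) + g' (x, y))) \<in> L"
    using ideal[OF add_closed[OF admissibleD(4)[OF g] admissibleD(4)[OF g']], of "\<lambda>x. complex_of_real (LINT y|\<mu>. g (x, y) + g' (x, y))"]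
    by auto
  moreover have "AE x in \<mu>. integrable \<mu> (\<lambda>y. g (x, y) + g' (x, y))"
    using admissibleD(3)[OF g] admissibleD(3)[OF g'] by eventually_elim simp
  ultimately show ?thesis using admissibleD(2)[OF g] admissibleD(2)[OF g'] by (simp add: admissible_def)
qed

lemma admissible_zero: "admissible (\<lambda>z. 0)"
  using zero_closed by (simp add: admissible_def)

lemma kmap_add:
  assumes g: "admissible g" and g': "admissible g'" and h: "h \<in> unit_funs"
  shows "AE x in \<mu>. kmap (\<lambda>z. g z + g' z) h x = kmap g h x + kmap g' h x"
  using admissible_section[OF g h] admissible_section[OF g' h]
  by eventually_elim (simp add: kmap_def distrib_right)

text \<open>One net argument for sums, multiples and differences. Differences arise from complements
  of sets, and the complex coefficients a and b cover the sign although kernels are kept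
  nonnegative.\<close>

lemma compact_kernel_combine:
  assumes g: "compact_kernel g1" "compact_kernel g2"
    and eq: "\<And>h. h \<in> unit_funs \<Longrightarrow> AE x in \<mu>. kmap g h x = a * kmap g1 h x + b * kmap g2 h x"
    and admissible: "admissible g1" "admissible g2" "admissible g"
  shows "compact_kernel g"
  unfolding compact_kernel_def
proof (intro allI impI)
  fix \<epsilon> :: real assume \<epsilon>: "\<epsilon> > 0"
  define c where "c = cmod a + cmod b + 1"
  have c: "c > 0" by (simp add: c_def add_nonneg_pos)
  then have e: "\<epsilon> / c > 0" using \<epsilon> by simp
  obtain M1 where M1: "finite M1" "M1 \<subseteq> L" "\<forall>h\<in>unit_funs. \<exists>k\<in>M1. N (\<lambda>x. kmap g1 h x - k x) \<le> \<epsilon> / c"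
    using g(1)[unfolded compact_kernel_def, rule_format, OF e] by blast
  obtain M2 where M2: "finite M2" "M2 \<subseteq> L" "\<forall>h\<in>unit_funs. \<exists>k\<in>M2. N (\<lambda>x. kmap g2 h x - k x) \<le> \<epsilon> / c"
    using g(2)[unfolded compact_kernel_def, rule_format, OF e] by blast
  show "\<exists>M. finite M \<and> M \<subseteq> L \<and> (\<forall>h\<in>unit_funs. \<exists>k\<in>M. N (\<lambda>x. kmap g h x - k x) \<le> \<epsilon>)"
  proof (intro exI[of _ "(\<lambda>(k, l) x. a * k x + b * l x) ` (M1 \<times> M2)"] conjI ballI)
    fix h assume h: "h \<in> unit_funs"
    obtain k where k: "k \<in> M1" "N (\<lambda>x. kmap g1 h x - k x) \<le> \<epsilon> / c" using bspec[OF M1(3) h] by blast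
    obtain l where l: "l \<in> M2" "N (\<lambda>x. kmap g2 h x - l x) \<le> \<epsilon> / c" using bspec[OF M2(3) h] by blast
    have kl: "k \<in> L" "l \<in> L" using k l M1 M2 by auto
    have KL: "kmap g1 h \<in> L" "kmap g2 h \<in> L" "kmap g h \<in> L" using kmap_L(1) admissible h by auto
    have d: "(\<lambda>x. kmap g1 h x - k x) \<in> L" "(\<lambda>x. kmap g2 h x - l x) \<in> L" by (intro diff_closed KL kl)+
    have "N (\<lambda>x. kmap g h x - (a * k x + b * l x)) = N (\<lambda>x. a * (kmap g1 h x - k x) + b * (kmap g2 h x - l x))"
    proof (rule norm_cong)
      show "AE x in \<mu>. kmap g h x - (a * k x + b * l x) = a * (kmap g1 h x - k x) + b * (kmap g2 h x - l x)"
        using eq[OF h] by eventually_elim (simp add: algebra_simps)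
    qed (intro diff_closed add_closed scale_closed KL kl d)+
    also have "\<dots> \<le> N (\<lambda>x. a * (kmap g1 h x - k x)) + N (\<lambda>x. b * (kmap g2 h x - l x))"
      by (rule norm_triangle[OF scale_closed[OF d(1)] scale_closed[OF d(2)]])
    also have "\<dots> = cmod a * N (\<lambda>x. kmap g1 h x - k x) + cmod b * N (\<lambda>x. kmap g2 h x - l x)"
      by (simp only: norm_scale[OF d(1)] norm_scale[OF d(2)])
    also have "\<dots> \<le> cmod a * (\<epsilon> / c) + cmod b * (\<epsilon> / c)"
      by (intro add_mono mult_left_mono k(2) l(2)) auto
    also have "\<dots> \<le> c * (\<epsilon> / c)" using e unfolding distrib_right[symmetric] by (intro mult_right_mono) (auto simp: c_def)
    also have "\<dots> = \<epsilon>" using c by simp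
    finally show "\<exists>m\<in>(\<lambda>(k, l) x. a * k x + b * l x) ` (M1 \<times> M2). N (\<lambda>x. kmap g h x - m x) \<le> \<epsilon>"
      using k(1) l(1) by (intro bexI[of _ "\<lambda>x. a * k x + b * l x"]) force+
  qed (use M1 M2 in \<open>auto intro!: add_closed scale_closed\<close>)
qed

lemma compact_kernel_add:
  assumes "compact_kernel g1" "compact_kernel g2" "admissible g1" "admissible g2"
  shows "compact_kernel (\<lambda>z. g1 z + g2 z)"
proof (rule compact_kernel_combine[OF assms(1,2) _ assms(3,4) admissible_add[OF assms(3,4)]])
  fix h assume "h \<in> unit_funs"
  from kmap_add[OF assms(3,4) this] show "AE x in \<mu>. kmap (\<lambda>z. g1 z + g2 z) h x = 1 * kmap g1 h x + 1 * kmap g2 h x"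
    by simp
qed

lemma compact_kernel_diff:
  assumes "compact_kernel g1" "compact_kernel g2" "admissible g1" "admissible g2" "admissible (\<lambda>z. g1 z - g2 z)"
  shows "compact_kernel (\<lambda>z. g1 z - g2 z)"
proof (rule compact_kernel_combine[OF assms(1,2) _ assms(3,4,5)])
  fix h assume "h \<in> unit_funs"
  from kmap_add[OF assms(5,4) this] show "AE x in \<mu>. kmap (\<lambda>z. g1 z - g2 z) h x = 1 * kmap g1 h x + - 1 * kmap g2 h x"
    by eventually_elim simp
qed

lemma compact_kernel_scale:
  assumes "compact_kernel g" "admissible g" "admissible (\<lambda>z. c * g z)"
  shows "compact_kernel (\<lambda>z. c * g z)"
proof (rule compact_kernel_combine[OF assms(1,1) _ assms(2,2,3)])
  fix h
  show "AE x in \<mu>. kmap (\<lambda>z. c * g z) h x = complex_of_real c * kmap g h x + 0 * kmap g h x"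
    by (simp add: kmap_def mult.assoc)
qed

lemma compact_kernel_zero: "compact_kernel (\<lambda>z. 0)"
  unfolding compact_kernel_def using zero_closed by (intro allI impI exI[of _ "{\<lambda>x. 0}"]) (auto simp: kmap_def)

text \<open>By dominated convergence the row integrals of g - s_n decrease to 0 at almost every x.
  Order continuity then makes their norms small, and these norms bound the images of all h in
  \<open>unit_funs\<close> at once.\<close>

lemma compact_kernel_limit:
  fixes s :: "nat \<Rightarrow> 'x \<times> 'x \<Rightarrow> real"
  assumes oc: "order_continuous_norm L N (nonneg_fun \<mu>)"
    and g: "admissible g" and s: "\<And>n. s n \<in> borel_measurable (\<mu> \<Otimes>\<^sub>M \<mu>)" "\<And>n z. 0 \<le> s n z"
      "\<And>n z. s n z \<le> s (Suc n) z" "\<And>n z. s n z \<le> g z"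
    and lim: "\<And>z. z \<in> space (\<mu> \<Otimes>\<^sub>M \<mu>) \<Longrightarrow> (\<lambda>n. s n z) \<longlonglongrightarrow> g z"
    and compact_kernel: "\<And>n. compact_kernel (s n)"
  shows "compact_kernel g"
  unfolding compact_kernel_def
proof (intro allI impI)
  fix \<epsilon> :: real assume \<epsilon>: "\<epsilon> > 0"
  note [measurable] = admissibleD(1)[OF g] s(1)
  define r where "r n z = g z - s n z" for n z
  have r[measurable]: "r n \<in> borel_measurable (\<mu> \<Otimes>\<^sub>M \<mu>)" for n unfolding r_def by measurable
  have admissible_s: "admissible (s n)" for n by (rule admissible_mono[OF g s(1,2,4)])
  have admissible_r: "admissible (r n)" for n by (rule admissible_mono[OF g r]) (use s(2,4) in \<open>auto simp: r_def\<close>)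
  define e where "e n x = (LINT y|\<mu>. r n (x, y))" for n x
  have ae_int: "AE x in \<mu>. \<forall>n. integrable \<mu> (\<lambda>y. r n (x, y))"
    unfolding AE_all_countable using admissibleD(3)[OF admissible_r] by auto
  have "(\<lambda>n. N (\<lambda>x. complex_of_real (e n x))) \<longlonglongrightarrow> 0"
  proof (rule order_continuous_real[OF oc])
    show "e n \<in> borel_measurable \<mu>" for n unfolding e_def by measurable
    show "AE x in \<mu>. \<forall>n. 0 \<le> e n x \<and> e (Suc n) x \<le> e n x"
      using ae_int
      by eventually_elim
        (use admissibleD(2)[OF admissible_r] s(3) in \<open>auto simp: e_def r_def intro!: integral_nonneg_AE integral_mono\<close>)
    show "AE x in \<mu>. (\<lambda>n. e n x) \<longlonglongrightarrow> 0"
      using admissibleD(3)[OF g] AE_space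
    proof eventually_elim
      case (elim x)
      have "(\<lambda>n. LINT y|\<mu>. r n (x, y)) \<longlonglongrightarrow> (LINT y|\<mu>. 0)"
      proof (rule integral_dominated_convergence[OF _ _ elim(1)])
        show "AE y in \<mu>. (\<lambda>n. r n (x, y)) \<longlonglongrightarrow> 0"
        proof (rule AE_I2)
          fix y assume "y \<in> space \<mu>"
          then have "(\<lambda>n. g (x, y) - s n (x, y)) \<longlonglongrightarrow> g (x, y) - g (x, y)"
            using elim(2) by (intro tendsto_diff tendsto_const lim) (simp add: space_pair_measure)
          then show "(\<lambda>n. r n (x, y)) \<longlonglongrightarrow> 0" by (simp add: r_def)
        qed
        show "AE y in \<mu>. norm (r n (x, y)) \<le> g (x, y)" for n
          using s(2,4) admissibleD(2)[OF g] by (auto simp: r_def)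
      qed (use elim(2) in measurable)
      then show ?case by (simp add: e_def)
    qed
    show "(\<lambda>x. complex_of_real (e 0 x)) \<in> L" unfolding e_def by (rule admissibleD(4)[OF admissible_r])
  qed
  then have "\<forall>\<^sub>F n in sequentially. N (\<lambda>x. complex_of_real (e n x)) < \<epsilon> / 2"
    using \<epsilon> by (intro order_tendstoD) auto
  then obtain n where n: "N (\<lambda>x. complex_of_real (e n x)) < \<epsilon> / 2" by (auto simp: eventually_sequentially)
  obtain M where M: "finite M" "M \<subseteq> L" "\<forall>h\<in>unit_funs. \<exists>k\<in>M. N (\<lambda>x. kmap (s n) h x - k x) \<le> \<epsilon> / 2"
    using compact_kernel[unfolded compact_kernel_def, rule_format, OF half_gt_zero[OF \<epsilon>], of n] by blast
  show "\<exists>M. finite M \<and> M \<subseteq> L \<and> (\<forall>h\<in>unit_funs. \<exists>k\<in>M. N (\<lambda>x. kmap g h x - k x) \<le> \<epsilon>)"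
  proof (intro exI[of _ M] conjI ballI M(1,2))
    fix h assume h: "h \<in> unit_funs"
    obtain k where k: "k \<in> M" "N (\<lambda>x. kmap (s n) h x - k x) \<le> \<epsilon> / 2" using bspec[OF M(3) h] by blast
    have kL: "k \<in> L" using k M by auto
    have KL: "kmap g h \<in> L" "kmap (s n) h \<in> L" "kmap (r n) h \<in> L" using kmap_L(1) g admissible_s admissible_r h by auto
    have "(\<lambda>z. r n z + s n z) = g" by (simp add: r_def)
    then have "AE x in \<mu>. kmap g h x = kmap (r n) h x + kmap (s n) h x" using kmap_add[OF admissible_r admissible_s h, of n n] by simp
    then have "N (\<lambda>x. kmap g h x - k x) = N (\<lambda>x. kmap (r n) h x + (kmap (s n) h x - k x))"
      by (intro norm_cong diff_closed add_closed KL kL) (auto elim!: eventually_mono)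
    also have "\<dots> \<le> N (kmap (r n) h) + N (\<lambda>x. kmap (s n) h x - k x)" by (intro norm_triangle diff_closed KL kL)
    also have "\<dots> \<le> \<epsilon>" using kmap_L(2)[OF admissible_r h, of n] n k(2) unfolding e_def by linarith
    finally show "\<exists>k\<in>M. N (\<lambda>x. kmap g h x - k x) \<le> \<epsilon>" using k(1) by blast
  qed
qed

lemma admissible_product:
  assumes u: "(\<lambda>x. complex_of_real (u x)) \<in> L" "\<And>x. u x \<ge> 0" and v: "integrable \<mu> v" "\<And>y. v y \<ge> 0"
  shows "admissible (\<lambda>z. u (fst z) * v (snd z))"
proof -
  have "(\<lambda>x. Re (complex_of_real (u x))) \<in> borel_measurable \<mu>"
    using L_measurable[OF u(1)] by measurable
  then have [measurable]: "u \<in> borel_measurable \<mu>" by simp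
  have [measurable]: "v \<in> borel_measurable \<mu>" using v(1) by auto
  show ?thesis
    using u v scale_closed[OF u(1), of "complex_of_real (integral\<^sup>L \<mu> v)"]
    by (auto simp: admissible_def mult.commute)
qed

text \<open>Over a rectangle the kernel has rank one. The image of h is c w with a fixed w and a
  number c in the disc whose radius is the integral of v, and a finite net of the disc becomes a net
  of the images.\<close>

lemma compact_kernel_rectangle:
  assumes u: "(\<lambda>x. complex_of_real (u x)) \<in> L" "\<And>x. u x \<ge> 0" and v: "integrable \<mu> v" "\<And>y. v y \<ge> 0"
    and E[measurable]: "E \<in> sets \<mu>" and F[measurable]: "F \<in> sets \<mu>"
  shows "compact_kernel (\<lambda>z. u (fst z) * v (snd z) * indicator (E \<times> F) z)"
  unfolding compact_kernel_def
proof (intro allI impI)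
  fix \<epsilon> :: real assume \<epsilon>: "\<epsilon> > 0"
  define w where "w x = complex_of_real (indicator E x) * complex_of_real (u x)" for x
  have [measurable]: "(\<lambda>x. complex_of_real (u x)) \<in> borel_measurable \<mu>" by (rule L_measurable[OF u(1)])
  have w: "w \<in> L"
    using ideal[OF u(1), of w] by (auto simp: w_def[abs_def] norm_mult split: split_indicator)
  define V where "V = integral\<^sup>L \<mu> v"
  define d where "d = \<epsilon> / (N w + 1)"
  have d: "d > 0" using \<epsilon> norm_nonneg[OF w] by (simp add: d_def)
  have cov: "cball (0::complex) V \<subseteq> (\<Union>t\<in>cball 0 V. ball t d)" using d by auto
  obtain T where T: "T \<subseteq> cball 0 V" "finite T" "cball (0::complex) V \<subseteq> (\<Union>t\<in>T. ball t d)"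
    by (rule compactE_image[OF compact_cball _ cov]) auto
  show "\<exists>M. finite M \<and> M \<subseteq> L \<and> (\<forall>h\<in>unit_funs. \<exists>k\<in>M. N (\<lambda>x. kmap (\<lambda>z. u (fst z) * v (snd z) * indicator (E \<times> F) z) h x - k x) \<le> \<epsilon>)"
  proof (intro exI[of _ "(\<lambda>t x. t * w x) ` T"] conjI ballI)
    fix h assume h: "h \<in> unit_funs"
    note [measurable] = unit_funsD(1)[OF h]
    define c where "c = (LINT y|\<mu>. complex_of_real (v y) * (complex_of_real (indicator F y) * h y))"
    have "cmod c \<le> (LINT y|\<mu>. norm (complex_of_real (v y) * (complex_of_real (indicator F y) * h y)))"
      unfolding c_def by (rule integral_norm_bound)
    also have "\<dots> \<le> V"
    proof -
      have le: "norm (complex_of_real (v y) * (complex_of_real (indicator F y) * h y)) \<le> v y" for y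
        using mult_left_mono[OF unit_funsD(2)[OF h, of y] v(2)[of y]] v(2)[of y]
        by (auto simp: norm_mult split: split_indicator)
      have [measurable]: "v \<in> borel_measurable \<mu>" using v(1) by auto
      have "integrable \<mu> (\<lambda>y. norm (complex_of_real (v y) * (complex_of_real (indicator F y) * h y)))"
        by (rule Bochner_Integration.integrable_bound[OF v(1)]) (measurable, use le v(2) in auto)
      then show ?thesis unfolding V_def by (rule integral_mono[OF _ v(1) le])
    qed
    finally have "c \<in> cball 0 V" by simp
    then obtain t where t: "t \<in> T" "c \<in> ball t d" using T(3) by blast
    then have t: "t \<in> T" "cmod (c - t) < d" using Real_Vector_Spaces.norm_minus_commute[of c t] by (simp_all add: dist_norm)
    have Kc: "kmap (\<lambda>z. u (fst z) * v (snd z) * indicator (E \<times> F) z) h x = c * w x" for x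
    proof -
      have "kmap (\<lambda>z. u (fst z) * v (snd z) * indicator (E \<times> F) z) h x
          = (LINT y|\<mu>. w x * (complex_of_real (v y) * (complex_of_real (indicator F y) * h y)))"
        unfolding kmap_def by (intro Bochner_Integration.integral_cong) (auto simp: w_def split: split_indicator)
      then show ?thesis by (simp add: c_def mult.commute)
    qed
    have "N (\<lambda>x. c * w x - t * w x) = cmod (c - t) * N w"
      using norm_scale[OF w, of "c - t"] by (simp add: left_diff_distrib)
    also have "\<dots> \<le> d * (N w + 1)" using t d norm_nonneg[OF w] by (intro mult_mono) auto
    also have "\<dots> = \<epsilon>" using norm_nonneg[OF w] by (simp add: d_def)
    finally show "\<exists>k\<in>(\<lambda>t x. t * w x) ` T.
        N (\<lambda>x. kmap (\<lambda>z. u (fst z) * v (snd z) * indicator (E \<times> F) z) h x - k x) \<le> \<epsilon>"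
      unfolding Kc using t(1) by (intro bexI[of _ "\<lambda>x. t * w x"]) auto
  qed (use T(2) in \<open>auto intro!: scale_closed w\<close>)
qed

context
  fixes u v :: "'x \<Rightarrow> real"
  assumes oc: "order_continuous_norm L N (nonneg_fun \<mu>)"
    and u: "(\<lambda>x. complex_of_real (u x)) \<in> L" "\<And>x. u x \<ge> 0" and v: "integrable \<mu> v" "\<And>y. v y \<ge> 0"
begin

lemma admissible_product_set:
  assumes "G \<in> sets (\<mu> \<Otimes>\<^sub>M \<mu>)"
  shows "admissible (\<lambda>z. u (fst z) * v (snd z) * indicator G z)"
proof (rule admissible_mono[OF admissible_product[OF u v]])
  show "(\<lambda>z. u (fst z) * v (snd z) * indicator G z) \<in> borel_measurable (\<mu> \<Otimes>\<^sub>M \<mu>)"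
    by (rule borel_measurable_times[OF admissibleD(1)[OF admissible_product[OF u v]] borel_measurable_indicator[OF assms]])
  show "0 \<le> u (fst z) * v (snd z) * indicator G z" for z using u(2) v(2) by simp
  show "u (fst z) * v (snd z) * indicator G z \<le> u (fst z) * v (snd z)" for z
    using u(2)[of "fst z"] v(2)[of "snd z"] by (simp split: split_indicator)
qed

text \<open>Dynkin's argument: rectangles have rank one, complements are differences, and disjoint
  countable unions are increasing limits of finite sums.\<close>

lemma compact_kernel_product_set:
  assumes "G \<in> sets (\<mu> \<Otimes>\<^sub>M \<mu>)"
  shows "compact_kernel (\<lambda>z. u (fst z) * v (snd z) * indicator G z)"
proof -
  have G': "G \<in> sigma_sets (space \<mu> \<times> space \<mu>) {A \<times> B |A B. A \<in> sets \<mu> \<and> B \<in> sets \<mu>}"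
    using assms by (simp add: sets_pair_measure)
  have in_sets: "A \<in> sets (\<mu> \<Otimes>\<^sub>M \<mu>)"
    if "A \<in> sigma_sets (space \<mu> \<times> space \<mu>) {A \<times> B |A B. A \<in> sets \<mu> \<and> B \<in> sets \<mu>}" for A
    using that by (simp add: sets_pair_measure)
  show ?thesis
    using Int_stable_pair_measure_generator pair_measure_closed G'
  proof (induction G rule: sigma_sets_induct_disjoint)
    case (basic A)
    then show ?case using compact_kernel_rectangle[OF u v] by auto
  next
    case empty
    then show ?case using compact_kernel_zero by simp
  next
    case (compl A)
    have A: "A \<in> sets (\<mu> \<Otimes>\<^sub>M \<mu>)" by (rule in_sets[OF compl(1)])
    have S: "space \<mu> \<times> space \<mu> \<in> sets (\<mu> \<Otimes>\<^sub>M \<mu>)" by auto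
    have "A \<subseteq> space \<mu> \<times> space \<mu>" using sets.sets_into_space[OF A] by (simp add: space_pair_measure)
    then have eq: "(\<lambda>z. u (fst z) * v (snd z) * indicator (space \<mu> \<times> space \<mu> - A) z)
        = (\<lambda>z. u (fst z) * v (snd z) * indicator (space \<mu> \<times> space \<mu>) z - u (fst z) * v (snd z) * indicator A z)"
      by (auto simp: fun_eq_iff split: split_indicator)
    have "admissible (\<lambda>z. u (fst z) * v (snd z) * indicator (space \<mu> \<times> space \<mu> - A) z)"
      using A by (intro admissible_product_set sets.Diff S)
    then show ?case
      unfolding eq
      by (intro compact_kernel_diff compact_kernel_rectangle[OF u v] compl(2) admissible_product_set A S) auto
  next
    case (union A)
    have A: "A i \<in> sets (\<mu> \<Otimes>\<^sub>M \<mu>)" for i using union(2) by (intro in_sets) auto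
    define s where "s n z = u (fst z) * v (snd z) * indicator (\<Union>i<n. A i) z" for n z
    have sets: "(\<Union>i<n. A i) \<in> sets (\<mu> \<Otimes>\<^sub>M \<mu>)" for n :: nat using A by auto
    have compact_kernel_s: "compact_kernel (s n)" for n
    proof (induction n)
      case 0
      then show ?case using compact_kernel_zero by (simp add: s_def[abs_def])
    next
      case (Suc n)
      have "s (Suc n) z = s n z + u (fst z) * v (snd z) * indicator (A n) z" for z
      proof -
        have "A i \<inter> A n = {}" if "i < n" for i
          using disjoint_family_onD[OF union(1), of i n] that by simp
        then have "(\<Union>i<n. A i) \<inter> A n = {}" by auto
        then show ?thesis by (auto simp: s_def lessThan_Suc split: split_indicator)
      qed
      then have "s (Suc n) = (\<lambda>z. s n z + u (fst z) * v (snd z) * indicator (A n) z)" by auto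
      moreover have "admissible (s n)" unfolding s_def[abs_def] by (rule admissible_product_set[OF sets])
      ultimately show ?case
        using compact_kernel_add[OF Suc union(3)[of n] _ admissible_product_set[OF A]] by simp
    qed
    show ?case
    proof (rule compact_kernel_limit[OF oc, of _ s])
      show "admissible (\<lambda>z. u (fst z) * v (snd z) * indicator (\<Union>i. A i) z)"
        using A by (intro admissible_product_set) auto
      show "s n \<in> borel_measurable (\<mu> \<Otimes>\<^sub>M \<mu>)" for n
        unfolding s_def[abs_def] by (rule admissibleD(1)[OF admissible_product_set[OF sets]])
      show "0 \<le> s n z" "s n z \<le> s (Suc n) z" "s n z \<le> u (fst z) * v (snd z) * indicator (\<Union>i. A i) z" for n z
        using u(2)[of "fst z"] v(2)[of "snd z"] by (auto simp: s_def lessThan_Suc split: split_indicator)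
      show "(\<lambda>n. s n z) \<longlonglongrightarrow> u (fst z) * v (snd z) * indicator (\<Union>i. A i) z" for z
      proof -
        have "(\<lambda>n. indicator (\<Union>i<n. A i) z :: real) \<longlonglongrightarrow> indicator (\<Union>i. A i) z"
          by (rule LIMSEQ_indicator_UN)
        then show ?thesis unfolding s_def by (intro tendsto_mult_left)
      qed
      show "compact_kernel (s n)" for n by (rule compact_kernel_s)
    qed
  qed
qed

lemma compact_kernel_product_simple:
  assumes s: "simple_function (\<mu> \<Otimes>\<^sub>M \<mu>) (s :: _ \<Rightarrow> real)" "\<And>z. s z \<ge> 0"
  shows "compact_kernel (\<lambda>z. u (fst z) * v (snd z) * (s z * indicator (space (\<mu> \<Otimes>\<^sub>M \<mu>)) z))"
proof -
  let ?S = "\<lambda>c. s -` {c} \<inter> space (\<mu> \<Otimes>\<^sub>M \<mu>)"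
  have fin: "finite (s ` space (\<mu> \<Otimes>\<^sub>M \<mu>))" and S: "\<And>c. ?S c \<in> sets (\<mu> \<Otimes>\<^sub>M \<mu>)"
    using s(1) simple_functionD[OF s(1)] by auto
  define D where "D = {c \<in> s ` space (\<mu> \<Otimes>\<^sub>M \<mu>). c \<ge> 0}"
  have D: "finite D" "\<And>c. c \<in> D \<Longrightarrow> c \<ge> 0" using fin by (auto simp: D_def)
  have summand: "admissible (\<lambda>z. c * (u (fst z) * v (snd z) * indicator (?S c) z))
      \<and> compact_kernel (\<lambda>z. c * (u (fst z) * v (snd z) * indicator (?S c) z))" if "c \<ge> 0" for c
  proof -
    have "admissible (\<lambda>z. (c * u (fst z)) * v (snd z) * indicator (?S c) z)"
    proof -
      have m: "(\<lambda>z. (c * u (fst z)) * v (snd z) * indicator (?S c) z) \<in> borel_measurable (\<mu> \<Otimes>\<^sub>M \<mu>)"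
        using admissibleD(1)[OF admissible_product_set[OF S[of c]]] borel_measurable_times[OF borel_measurable_const[of c]]
        by (simp add: mult.assoc)
      have "(\<lambda>x. complex_of_real (c * u x)) \<in> L" using scale_closed[OF u(1), of "complex_of_real c"] by simp
      from admissible_product[OF this _ v] have g: "admissible (\<lambda>z. (c * u (fst z)) * v (snd z))" using that u(2) by simp
      show ?thesis
        by (rule admissible_mono[OF g m]) (use that u(2) v(2) in \<open>auto split: split_indicator\<close>)
    qed
    then have "admissible (\<lambda>z. c * (u (fst z) * v (snd z) * indicator (?S c) z))" by (simp add: mult.assoc)
    then show ?thesis using compact_kernel_scale[OF compact_kernel_product_set[OF S] admissible_product_set[OF S]] by blast
  qed
  have sum: "admissible (\<lambda>z. \<Sum>c\<in>D'. c * (u (fst z) * v (snd z) * indicator (?S c) z))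
      \<and> compact_kernel (\<lambda>z. \<Sum>c\<in>D'. c * (u (fst z) * v (snd z) * indicator (?S c) z))" if "D' \<subseteq> D" for D'
    using finite_subset[OF that D(1)] that
  proof (induction D' rule: finite_induct)
    case empty
    then show ?case using compact_kernel_zero admissible_zero by simp
  next
    case (insert c D')
    have c: "c \<ge> 0" using insert.prems D(2) by auto
    have IH: "admissible (\<lambda>z. \<Sum>c\<in>D'. c * (u (fst z) * v (snd z) * indicator (?S c) z))"
      "compact_kernel (\<lambda>z. \<Sum>c\<in>D'. c * (u (fst z) * v (snd z) * indicator (?S c) z))" using insert by auto
    show ?case
      using admissible_add[OF summand[OF c, THEN conjunct1] IH(1)]
        compact_kernel_add[OF summand[OF c, THEN conjunct2] IH(2) summand[OF c, THEN conjunct1] IH(1)] insert.hyps by simp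
  qed
  have "u (fst z) * v (snd z) * (s z * indicator (space (\<mu> \<Otimes>\<^sub>M \<mu>)) z)
      = (\<Sum>c\<in>D. c * (u (fst z) * v (snd z) * indicator (?S c) z))" for z
  proof (cases "z \<in> space (\<mu> \<Otimes>\<^sub>M \<mu>)")
    case True
    then have "(\<Sum>c\<in>D. c * (u (fst z) * v (snd z) * indicator (?S c) z))
        = (\<Sum>c\<in>D. if c = s z then s z * (u (fst z) * v (snd z)) else 0)"
      by (intro sum.cong) (auto split: split_indicator)
    also have "\<dots> = s z * (u (fst z) * v (snd z))" using True s(2) D(1) by (simp add: D_def)
    finally show ?thesis using True by simp
  qed simp
  then show ?thesis using sum[of D] by simp
qed

end


text \<open>Every f in the order interval of w is |w| h with |h| \<le> 1, so A acts there as the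
  kernel a(x,y) |w(y)| on bounded functions. This kernel is written as u(x) v(y) g(x,y) with u = A
  |w| in L and v integrable and positive. Simple functions increasing to g then reduce the claim to
  measurable sets, with order continuity controlling the limit.\<close>

theorem kernel_operator_order_interval:
  assumes oc: "order_continuous_norm L N (nonneg_fun \<mu>)"
    and A: "A \<in> PK" and w: "w \<in> L" and "\<epsilon> > 0"
  shows "\<exists>M. finite M \<and> M \<subseteq> L \<and> (\<forall>f\<in>L. (AE x in \<mu>. cmod (f x) \<le> cmod (w x)) \<longrightarrow>
    (\<exists>k\<in>M. N (\<lambda>x. A f x - k x) \<le> \<epsilon>))"
proof -
  have Ak: "A \<in> positive_kernel_operators \<mu> L" and Ab: "A \<in> BO" using A by auto
  note [measurable] = pk_measurable[OF Ak] L_measurable[OF w]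
  obtain v :: "'x \<Rightarrow> real" where "integrable \<mu> v \<and> (\<forall>x\<in>space \<mu>. v x > 0) \<and> (\<forall>x. v x \<ge> 0)"
    using positive_integrable ..
  then have v: "integrable \<mu> v" "\<And>x. x \<in> space \<mu> \<Longrightarrow> v x > 0" "\<And>x. v x \<ge> 0" by simp_all
  have [measurable]: "v \<in> borel_measurable \<mu>" using v(1) by auto
  define u where "u x = (LINT y|\<mu>. pk A (x, y) * cmod (w y))" for x
  have [measurable]: "u \<in> borel_measurable \<mu>" unfolding u_def by measurable
  have u0: "u x \<ge> 0" for x unfolding u_def by (intro integral_nonneg_AE) auto
  have uA: "AE x in \<mu>. A (modulus w) x = complex_of_real (u x)"
    using pk_section_abs[OF Ak w] by eventually_elim (simp add: u_def)
  have uL: "(\<lambda>x. complex_of_real (u x)) \<in> L"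
  proof -
    have "AE x in \<mu>. cmod (complex_of_real (u x)) \<le> cmod (A (modulus w) x)"
      using uA by eventually_elim simp
    then show ?thesis
      using ideal[OF bo_L[OF Ab modulus_L[OF w]], of "\<lambda>x. complex_of_real (u x)"] by auto
  qed
  have admissible: "admissible (\<lambda>z. pk A z * cmod (w (snd z)))"
    using pk_section_abs[OF Ak w] uL by (auto simp: admissible_def u_def elim!: eventually_mono)
  \<comment> \<open>Where u vanishes, the row of the kernel a(x,y) |w(y)| is 0 almost everywhere;
    cutting it off there permits division by u.\<close>
  define D where "D z \<longleftrightarrow> z \<in> space (\<mu> \<Otimes>\<^sub>M \<mu>) \<and> 0 < u (fst z)" for z
  define c where "c z = (if D z then pk A z * cmod (w (snd z)) else 0)" for z
  define g where "g z = (if D z then pk A z * cmod (w (snd z)) / (u (fst z) * v (snd z)) else 0)" for z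
  have m: "c \<in> borel_measurable (\<mu> \<Otimes>\<^sub>M \<mu>)" "g \<in> borel_measurable (\<mu> \<Otimes>\<^sub>M \<mu>)"
    unfolding c_def g_def D_def by measurable
  have c: "admissible c"
    by (rule admissible_mono[OF admissible m(1)]) (auto simp: c_def)
  have g0: "g z \<ge> 0" for z using u0 v(3) by (auto simp: g_def)
  have cg: "c z = u (fst z) * v (snd z) * g z" for z
    using v(2)[of "snd z"] by (auto simp: c_def g_def D_def space_pair_measure)
  obtain s where s: "\<And>i::nat. simple_function (\<mu> \<Otimes>\<^sub>M \<mu>) (s i)" "incseq s"
    "\<And>z. bdd_above (range (\<lambda>i. s i z))" "\<And>i z. 0 \<le> s i z" "g = (SUP i. s i)"
    using borel_measurable_implies_simple_function_sequence_real[OF m(2) g0] by blast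
  have gz: "g z = (SUP i. s i z)" for z by (simp add: s(5) image_comp)
  have s_le: "s i z \<le> g z" for i z unfolding gz by (rule cSUP_upper[OF UNIV_I s(3)])
  have s_lim: "(\<lambda>i. s i z) \<longlonglongrightarrow> g z" for z
    unfolding gz by (rule LIMSEQ_incseq_SUP[OF s(3)]) (rule incseq_SucI, rule le_funD[OF incseq_SucD[OF s(2)]])
  define t where "t i z = u (fst z) * v (snd z) * (s i z * indicator (space (\<mu> \<Otimes>\<^sub>M \<mu>)) z)" for i z
  have "compact_kernel c"
  proof (rule compact_kernel_limit[OF oc c, of t])
    show "t i \<in> borel_measurable (\<mu> \<Otimes>\<^sub>M \<mu>)" for i
      using borel_measurable_simple_function[OF s(1)[of i]] unfolding t_def by measurable
    show "0 \<le> t i z" for i z using u0 v(3) s(4) by (simp add: t_def)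
    show "t i z \<le> t (Suc i) z" for i z
      unfolding t_def
      by (intro mult_left_mono mult_right_mono mult_nonneg_nonneg u0 v(3) le_funD[OF incseq_SucD[OF s(2)]]) simp
    show "t i z \<le> c z" for i z
    proof -
      have "s i z * indicator (space (\<mu> \<Otimes>\<^sub>M \<mu>)) z \<le> g z"
        using s_le[of i z] g0[of z] by (auto split: split_indicator)
      then show ?thesis unfolding t_def cg using u0 v(3) by (intro mult_left_mono) auto
    qed
    show "(\<lambda>i. t i z) \<longlonglongrightarrow> c z" if "z \<in> space (\<mu> \<Otimes>\<^sub>M \<mu>)" for z
      using that unfolding t_def cg by (intro tendsto_mult_left) (simp add: s_lim)
    show "compact_kernel (t i)" for i
      unfolding t_def[abs_def] by (rule compact_kernel_product_simple[OF oc uL u0 v(1,3) s(1,4)])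
  qed
  then obtain M where M: "finite M" "M \<subseteq> L" "\<forall>h\<in>unit_funs. \<exists>k\<in>M. N (\<lambda>x. kmap c h x - k x) \<le> \<epsilon>"
    using \<open>\<epsilon> > 0\<close> unfolding compact_kernel_def by auto
  show ?thesis
  proof (intro exI[of _ M] conjI ballI impI M(1,2))
    fix f assume f: "f \<in> L" and fw: "AE x in \<mu>. cmod (f x) \<le> cmod (w x)"
    note [measurable] = L_measurable[OF f]
    \<comment> \<open>|f| \<le> |w| holds only almost everywhere. Building it into the definition
      gives |h| \<le> 1 at every point.\<close>
    define h where "h y = (if 0 < cmod (w y) \<and> cmod (f y) \<le> cmod (w y) then f y / complex_of_real (cmod (w y)) else 0)" for y
    have "h \<in> borel_measurable \<mu>" unfolding h_def by measurable
    then have h: "h \<in> unit_funs" by (auto simp: unit_funs_def h_def norm_divide divide_simps)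
    have fh: "AE y in \<mu>. f y = complex_of_real (cmod (w y)) * h y"
      using fw by eventually_elim (auto simp: h_def)
    have "AE x in \<mu>. A f x = kmap c h x"
      using pk_section[OF Ak f] pk_section_abs[OF Ak w] AE_space
    proof eventually_elim
      case (elim x)
      show ?case
      proof (cases "0 < u x")
        case True
        have "(LINT y|\<mu>. complex_of_real (pk A (x, y)) * f y) = (LINT y|\<mu>. complex_of_real (c (x, y)) * h y)"
        proof (rule integral_cong_AE)
          show "(\<lambda>y. complex_of_real (pk A (x, y)) * f y) \<in> borel_measurable \<mu>" using elim(3) by measurable
          show "(\<lambda>y. complex_of_real (c (x, y)) * h y) \<in> borel_measurable \<mu>"
            using elim(3) m(1) \<open>h \<in> borel_measurable \<mu>\<close> by measurable
          show "AE y in \<mu>. complex_of_real (pk A (x, y)) * f y = complex_of_real (c (x, y)) * h y"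
            using fh AE_space
          proof eventually_elim
            case (elim y)
            then show ?case using True \<open>x \<in> space \<mu>\<close> by (simp add: c_def D_def space_pair_measure mult.assoc)
          qed
        qed
        then show ?thesis using elim(1) by (simp add: kmap_def)
      next
        case False
        then have "u x = 0" using u0[of x] by linarith
        then have "(LINT y|\<mu>. pk A (x, y) * cmod (w y)) = 0" by (simp only: u_def)
        then have "AE y in \<mu>. pk A (x, y) * cmod (w y) = 0"
          using elim(2) by (subst (asm) integral_nonneg_eq_0_iff_AE) auto
        then have "AE y in \<mu>. complex_of_real (pk A (x, y)) * f y = 0"
          using fh by eventually_elim auto
        then have "(LINT y|\<mu>. complex_of_real (pk A (x, y)) * f y) = 0" by (rule integral_eq_zero_AE)
        then show ?thesis using elim(1) False by (simp add: kmap_def c_def D_def)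
      qed
    qed
    then have ae: "AE x in \<mu>. A f x - k x = kmap c h x - k x" for k by (rule eventually_mono) simp
    obtain k where k: "k \<in> M" "N (\<lambda>x. kmap c h x - k x) \<le> \<epsilon>" using bspec[OF M(3) h] by blast
    have kL: "k \<in> L" using k M by auto
    have "N (\<lambda>x. A f x - k x) = N (\<lambda>x. kmap c h x - k x)"
      by (rule norm_cong[OF diff_closed[OF bo_L[OF Ab f] kL] diff_closed[OF kmap_L(1)[OF c h] kL] ae])
    then show "\<exists>k\<in>M. N (\<lambda>x. A f x - k x) \<le> \<epsilon>" using k by (intro bexI[of _ k]) simp_all
  qed
qed

lemma sum_cmod_L: "finite M \<Longrightarrow> M \<subseteq> L \<Longrightarrow> (\<lambda>x. complex_of_real (\<Sum>g\<in>M. cmod (g x))) \<in> L"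
proof (induction M rule: finite_induct)
  case empty
  then show ?case using zero_closed by simp
next
  case (insert g M)
  then show ?case using add_closed[OF modulus_L[of g], of "\<lambda>x. complex_of_real (\<Sum>g\<in>M. cmod (g x))"]
    by (simp add: modulus_def)
qed

text \<open>A dominated operator maps the unit ball into an order interval plus a small ball, and \<open>X\<close> is
  compact on order intervals. Composing with \<open>X\<close> is harmless for radii, and avoids any assumption
  on the dual space.\<close>

lemma net_dominated:
  assumes oc: "order_continuous_norm L N (nonneg_fun \<mu>)"
    and X: "X \<in> PK" and BO: "C \<in> BO" "A \<in> BO" "B \<in> BO"
    and mean_dom: "\<And>f. f \<in> L \<Longrightarrow> AE x in \<mu>. 2 * cmod (C f x) \<le> cmod (A (modulus f) x) + cmod (B (modulus f) x)"
    and net: "net A \<delta>" "net B \<eta>" and \<epsilon>: "\<epsilon> > 0"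
  shows "net (X \<circ> C) (\<epsilon> + operator_norm L N X * ((\<delta> + \<eta>) / 2))"
proof -
  have Xb: "X \<in> BO" using X by auto
  obtain MA where MA: "finite MA" "MA \<subseteq> L" "\<forall>f\<in>unit_ball L N. \<exists>g\<in>MA. N (\<lambda>x. A f x - g x) \<le> \<delta>"
    using net(1) unfolding net_def by blast
  obtain MB where MB: "finite MB" "MB \<subseteq> L" "\<forall>f\<in>unit_ball L N. \<exists>g\<in>MB. N (\<lambda>x. B f x - g x) \<le> \<eta>"
    using net(2) unfolding net_def by blast
  \<comment> \<open>The sum of the moduli of all centres dominates each of them, so that a single
    order interval serves the whole unit ball.\<close>
  define w where "w x = complex_of_real (\<Sum>g\<in>MA. cmod (g x)) + complex_of_real (\<Sum>g\<in>MB. cmod (g x))" for x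
  have w: "w \<in> L" unfolding w_def by (intro add_closed sum_cmod_L MA MB)
  have cw: "cmod (w x) = (\<Sum>g\<in>MA. cmod (g x)) + (\<Sum>g\<in>MB. cmod (g x))" for x
    unfolding w_def of_real_add[symmetric] norm_of_real by (intro abs_of_nonneg add_nonneg_nonneg sum_nonneg) auto
  obtain M where M: "finite M" "M \<subseteq> L" "\<forall>f\<in>L. (AE x in \<mu>. cmod (f x) \<le> cmod (w x)) \<longrightarrow> (\<exists>k\<in>M. N (\<lambda>x. X f x - k x) \<le> \<epsilon>)"
    using kernel_operator_order_interval[OF oc X w \<epsilon>] by blast
  show ?thesis
    unfolding net_def
  proof (intro exI[of _ M] conjI ballI M(1,2))
    fix f assume f: "f \<in> unit_ball L N"
    then have fL: "f \<in> L" and "modulus f \<in> unit_ball L N"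
      by (auto simp: unit_ball_def modulus_L norm_modulus)
    obtain a where a: "a \<in> MA" "N (\<lambda>x. A (modulus f) x - a x) \<le> \<delta>"
      using bspec[OF MA(3) \<open>modulus f \<in> unit_ball L N\<close>] by blast
    obtain b where b: "b \<in> MB" "N (\<lambda>x. B (modulus f) x - b x) \<le> \<eta>"
      using bspec[OF MB(3) \<open>modulus f \<in> unit_ball L N\<close>] by blast
    have d: "(\<lambda>x. A (modulus f) x - a x) \<in> L" "(\<lambda>x. B (modulus f) x - b x) \<in> L"
      using a(1) b(1) MA(2) MB(2) diff_closed[OF bo_L[OF BO(2) modulus_L[OF fL]], of a]
        diff_closed[OF bo_L[OF BO(3) modulus_L[OF fL]], of b] by auto
    define E where "E x = (1/2 :: complex) * (modulus (\<lambda>x. A (modulus f) x - a x) x + modulus (\<lambda>x. B (modulus f) x - b x) x)" for x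
    have E: "E \<in> L" unfolding E_def by (intro scale_closed add_closed modulus_L d)
    have cE: "cmod (E x) = (cmod (A (modulus f) x - a x) + cmod (B (modulus f) x - b x)) / 2" for x
    proof -
      have "E x = complex_of_real ((cmod (A (modulus f) x - a x) + cmod (B (modulus f) x - b x)) / 2)"
        by (simp add: E_def modulus_def)
      then show ?thesis by (simp only: norm_of_real) simp
    qed
    have NE: "N E \<le> (\<delta> + \<eta>) / 2"
      using norm_scale[OF add_closed[OF modulus_L[OF d(1)] modulus_L[OF d(2)]], of "1/2"]
        norm_triangle[OF modulus_L[OF d(1)] modulus_L[OF d(2)]] norm_modulus[OF d(1)] norm_modulus[OF d(2)] a(2) b(2)
      by (simp add: E_def[abs_def])
    have CfL: "C f \<in> L" by (rule bo_L[OF BO(1) fL])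
    note [measurable] = L_measurable[OF CfL] L_measurable[OF w]
    have le: "AE x in \<mu>. cmod (C f x) \<le> cmod (w x) + cmod (E x)"
      using mean_dom[OF fL]
    proof eventually_elim
      case (elim x)
      have "cmod (a x) \<le> (\<Sum>g\<in>MA. cmod (g x))" "cmod (b x) \<le> (\<Sum>g\<in>MB. cmod (g x))"
        using a(1) b(1) MA(1) MB(1) by (auto intro!: member_le_sum)
      moreover have "cmod (A (modulus f) x) \<le> cmod (A (modulus f) x - a x) + cmod (a x)"
        "cmod (B (modulus f) x) \<le> cmod (B (modulus f) x - b x) + cmod (b x)"
        using norm_triangle_ineq[of "A (modulus f) x - a x" "a x"] norm_triangle_ineq[of "B (modulus f) x - b x" "b x"] by auto
      moreover have "0 \<le> cmod (a x)" "0 \<le> cmod (b x)" by auto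
      ultimately show ?case using elim unfolding cw cE by argo
    qed
    \<comment> \<open>Truncation of C f at height |w|. The remaining part g1 has modulus at most
      |w|, and the excess g2 is bounded by the average E of the two net errors.\<close>
    define g2 where "g2 x = (if cmod (C f x) \<le> cmod (w x) then 0 else C f x * complex_of_real (1 - cmod (w x) / cmod (C f x)))" for x
    have cg2: "cmod (g2 x) = (if cmod (C f x) \<le> cmod (w x) then 0 else cmod (C f x) - cmod (w x))" for x
    proof -
      have "cmod (C f x) * \<bar>1 - cmod (w x) / cmod (C f x)\<bar> = cmod (C f x) - cmod (w x)" if "\<not> cmod (C f x) \<le> cmod (w x)"
      proof -
        have "cmod (C f x) > 0" using that norm_ge_zero[of "w x"] by linarith
        then show ?thesis using that by (simp add: abs_of_nonneg field_simps)
      qed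
      then show ?thesis unfolding g2_def by (simp only: if_distrib[of cmod] norm_mult norm_of_real norm_zero) simp
    qed
    have "g2 \<in> borel_measurable \<mu>" unfolding g2_def by measurable
    moreover have "AE x in \<mu>. cmod (g2 x) \<le> cmod (E x)"
      using le by eventually_elim (simp add: cg2)
    ultimately have g2: "g2 \<in> L" "N g2 \<le> N E" using ideal[OF E] by blast+
    define g1 where "g1 x = C f x - g2 x" for x
    have g1: "g1 \<in> L" unfolding g1_def by (intro diff_closed CfL g2)
    have "cmod (g1 x) \<le> cmod (w x)" for x
    proof (cases "cmod (C f x) \<le> cmod (w x)")
      case False
      then have pos: "cmod (C f x) > 0" using norm_ge_zero[of "w x"] by linarith
      have "g1 x = C f x * complex_of_real (cmod (w x) / cmod (C f x))"
        using False by (simp add: g1_def g2_def algebra_simps)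
      then have "cmod (g1 x) = cmod (C f x) * \<bar>cmod (w x) / cmod (C f x)\<bar>" by (simp only: norm_mult norm_of_real)
      then show ?thesis using pos by simp
    qed (simp add: g1_def g2_def)
    then obtain k where k: "k \<in> M" "N (\<lambda>x. X g1 x - k x) \<le> \<epsilon>" using M(3) g1 by blast
    have kL: "k \<in> L" using k M by auto
    have XL: "X g1 \<in> L" "X g2 \<in> L" "X (C f) \<in> L" using bo_L[OF Xb] g1 g2 CfL by auto
    have "C f = (\<lambda>x. g1 x + g2 x)" by (auto simp: g1_def)
    then have "AE x in \<mu>. X (C f) x = X g1 x + X g2 x" using bo_add[OF Xb g1 g2(1)] by simp
    then have "AE x in \<mu>. X (C f) x - k x = (X g1 x - k x) + X g2 x" by (rule eventually_mono) simp
    then have "N (\<lambda>x. X (C f) x - k x) = N (\<lambda>x. (X g1 x - k x) + X g2 x)"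
      by (rule norm_cong[OF diff_closed[OF XL(3) kL] add_closed[OF diff_closed[OF XL(1) kL] XL(2)]])
    also have "\<dots> \<le> N (\<lambda>x. X g1 x - k x) + N (X g2)" by (rule norm_triangle[OF diff_closed[OF XL(1) kL] XL(2)])
    also have "N (X g2) \<le> operator_norm L N X * ((\<delta> + \<eta>) / 2)"
      using operator_norm_bound[OF Xb g2(1)] mult_left_mono[OF order_trans[OF g2(2) NE] operator_norm_nonneg[OF Xb]] by linarith
    finally show "\<exists>k\<in>M. N (\<lambda>x. (X \<circ> C) f x - k x) \<le> \<epsilon> + operator_norm L N X * ((\<delta> + \<eta>) / 2)"
      using k by (intro bexI[of _ k]) auto
  qed
qed

lemma noncompactness_dominated:
  assumes oc: "order_continuous_norm L N (nonneg_fun \<mu>)"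
    and X: "X \<in> PK" and BO: "C \<in> BO" "A \<in> BO" "B \<in> BO"
    and mean_dom: "\<And>f. f \<in> L \<Longrightarrow> AE x in \<mu>. 2 * cmod (C f x) \<le> cmod (A (modulus f) x) + cmod (B (modulus f) x)"
  shows "noncompactness L N (X \<circ> C) \<le> operator_norm L N X * ((noncompactness L N A + noncompactness L N B) / 2)"
proof (rule LIMSEQ_le_const)
  let ?a = "noncompactness L N A" and ?b = "noncompactness L N B" and ?e = "\<lambda>i. 1 / real (Suc i)"
  have Xb: "X \<in> BO" using X by auto
  have nn: "?a \<ge> 0" "?b \<ge> 0" "operator_norm L N X \<ge> 0"
    using noncompactness_nonneg BO operator_norm_nonneg[OF Xb] by auto
  have e: "?e \<longlonglongrightarrow> 0" using LIMSEQ_inverse_real_of_nat by (simp add: inverse_eq_divide)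
  have "(\<lambda>i. ?e i + operator_norm L N X * (((?a + ?e i) + (?b + ?e i)) * (1/2))) \<longlonglongrightarrow>
      0 + operator_norm L N X * (((?a + 0) + (?b + 0)) * (1/2))"
    by (intro tendsto_add tendsto_mult tendsto_const e)
  then show "(\<lambda>i. ?e i + operator_norm L N X * (((?a + ?e i) + (?b + ?e i)) / 2)) \<longlonglongrightarrow>
      operator_norm L N X * ((?a + ?b) / 2)" by simp
  show "\<exists>n0. \<forall>i\<ge>n0. noncompactness L N (X \<circ> C) \<le> ?e i + operator_norm L N X * (((?a + ?e i) + (?b + ?e i)) / 2)"
  proof (intro exI[of _ 0] allI impI)
    fix i
    have pos: "?e i > 0" by simp
    have "net (X \<circ> C) (?e i + operator_norm L N X * (((?a + ?e i) + (?b + ?e i)) / 2))"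
      by (rule net_dominated[OF oc X BO mean_dom]) (use noncompactness_less(1) BO pos in auto)
    then show "noncompactness L N (X \<circ> C) \<le> ?e i + operator_norm L N X * (((?a + ?e i) + (?b + ?e i)) / 2)"
      by (rule noncompactness_le) (use nn in simp)
  qed
qed

end

section \<open>Growth rates\<close>

text \<open>\<open>rate a x\<close> says that \<open>x = lim a\<^sub>m\<^sup>1\<^sup>/\<^sup>m\<close>, approached from above.\<close>

definition rate :: "(nat \<Rightarrow> real) \<Rightarrow> real \<Rightarrow> bool" where
  "rate a x \<longleftrightarrow> 0 \<le> x \<and> (\<forall>m\<ge>1. x ^ m \<le> a m) \<and> (\<forall>r>x. \<forall>\<^sub>F m in sequentially. a m \<le> r ^ m)"

lemma rateD:
  assumes "rate a x"
  shows "0 \<le> x" "m \<ge> 1 \<Longrightarrow> x ^ m \<le> a m" "r > x \<Longrightarrow> \<forall>\<^sub>F m in sequentially. a m \<le> r ^ m"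
  using assms by (auto simp: rate_def)

text \<open>If x^p exceeded some r > y, the powers (x^p / r)^m would remain below C / x, which is
  absurd. The additional 1 in p m + 1 makes room for one extra operator, whose norm enters only the
  constant.\<close>

lemma rate_compare:
  assumes a: "rate a x" and b: "rate b y" and p: "p \<ge> 1"
    and le: "\<And>m. m \<ge> 1 \<Longrightarrow> a (p * m + 1) \<le> C * b m" and C: "C \<ge> 0"
  shows "x ^ p \<le> y"
proof (rule ccontr)
  assume "\<not> x ^ p \<le> y"
  then obtain r where r: "y < r" "r < x ^ p" using dense[of y "x ^ p"] by auto
  have r0: "r > 0" using r rateD(1)[OF b] by linarith
  have x: "x > 0" using r r0 p rateD(1)[OF a] by (cases "x = 0") (auto simp: power_0_left)
  define t where "t = x ^ p / r"
  have t: "t > 1" using r r0 by (simp add: t_def)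
  have ev: "\<forall>\<^sub>F m in sequentially. t ^ m \<le> C / x"
    using rateD(3)[OF b r(1)] eventually_ge_at_top[of 1]
  proof eventually_elim
    case (elim m)
    have "x ^ (p * m + 1) \<le> a (p * m + 1)" by (rule rateD(2)[OF a]) simp
    also have "\<dots> \<le> C * r ^ m" using order_trans[OF le[OF elim(2)] mult_left_mono[OF elim(1) C]] .
    finally have "x * (x ^ p) ^ m \<le> C * r ^ m" by (simp add: power_mult)
    then show ?case using x r0 by (simp add: t_def power_divide field_simps)
  qed
  obtain n where n: "t ^ n > C / x" using real_arch_pow[OF t] by blast
  obtain m where "m \<ge> n" "t ^ m \<le> C / x" using ev by (auto simp: eventually_sequentially) (meson le_cases)
  then show False using n power_increasing[of n m t] t by linarith
qed

lemma rate_unique: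
  assumes a: "rate a x" and b: "rate a y"
  shows "x = y"
proof -
  have le: "x \<le> y" if a: "rate a x" and b: "rate a y" for x y
  proof (rule dense_ge)
    fix r assume r: "y < r"
    have r0: "r > 0" using r rateD(1)[OF b] by linarith
    obtain n where n: "\<And>m. m \<ge> n \<Longrightarrow> a m \<le> r ^ m"
      using rateD(3)[OF b r] unfolding eventually_sequentially by blast
    have "x ^ Suc n \<le> r ^ Suc n" using order_trans[OF rateD(2)[OF a] n, of "Suc n"] by simp
    then show "x \<le> r" using r0 by (rule power_le_imp_le_base[OF _ less_imp_le])
  qed
  show ?thesis using le[OF a b] le[OF b a] by simp
qed

lemma rate_max:
  assumes a: "rate a x" and b: "rate b y"
  shows "rate (\<lambda>m. max (a m) (b m)) (max x y)"
  unfolding rate_def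
proof (intro conjI allI impI)
  show "0 \<le> max x y" using rateD(1)[OF a] by simp
  show "max x y ^ m \<le> max (a m) (b m)" if "m \<ge> 1" for m
    using rateD(2)[OF a that] rateD(2)[OF b that] by (simp add: max_def)
  show "\<forall>\<^sub>F m in sequentially. max (a m) (b m) \<le> r ^ m" if "r > max x y" for r
    using rateD(3)[OF a, of r] rateD(3)[OF b, of r] that by (simp add: eventually_conj_iff)
qed

lemma rate_power:
  assumes a: "rate a x" and k: "k \<ge> 1"
  shows "rate (\<lambda>m. a (k * m)) (x ^ k)"
  unfolding rate_def
proof (intro conjI allI impI)
  show "0 \<le> x ^ k" using rateD(1)[OF a] by simp
  show "(x ^ k) ^ m \<le> a (k * m)" if "m \<ge> 1" for m
    using rateD(2)[OF a, of "k * m"] that k by (simp add: power_mult)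
  fix r assume r: "r > x ^ k"
  have r0: "r \<ge> 0" using r rateD(1)[OF a] zero_le_power[of x k] by linarith
  have "root k r > x"
    using real_root_less_mono[of k "x ^ k" r] r k rateD(1)[OF a] by (simp add: real_root_power_cancel)
  from rateD(3)[OF a this] have "\<forall>\<^sub>F n in sequentially. a n \<le> root k r ^ n" .
  then obtain n0 where n0: "\<And>n. n \<ge> n0 \<Longrightarrow> a n \<le> root k r ^ n" unfolding eventually_sequentially by blast
  have "a (k * m) \<le> r ^ m" if "m \<ge> n0" for m
  proof -
    have "m \<le> k * m" using k by simp
    then have "a (k * m) \<le> root k r ^ (k * m)" using that by (intro n0) linarith
    also have "\<dots> = r ^ m" using k r0 by (simp add: power_mult)
    finally show ?thesis .
  qed
  then show "\<forall>\<^sub>F m in sequentially. a (k * m) \<le> r ^ m" unfolding eventually_sequentially by blast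
qed

lemma rate_root_limit:
  assumes a: "rate a x"
  shows "(\<lambda>m. root m (a m)) \<longlonglongrightarrow> x"
proof (rule order_tendstoI)
  have lower: "x \<le> root m (a m)" if "m \<ge> 1" for m
    using real_root_le_mono[of m "x ^ m" "a m"] rateD(2)[OF a that] that rateD(1)[OF a]
    by (simp add: real_root_power_cancel)
  show "\<forall>\<^sub>F m in sequentially. y < root m (a m)" if "y < x" for y
    using eventually_ge_at_top[of 1] by eventually_elim (use lower that in force)
  show "\<forall>\<^sub>F m in sequentially. root m (a m) < y" if "x < y" for y
  proof -
    obtain r where r: "x < r" "r < y" using dense[OF \<open>x < y\<close>] by blast
    show ?thesis
      using rateD(3)[OF a r(1)] eventually_ge_at_top[of 1]
    proof eventually_elim
      case (elim m)
      have "root m (a m) \<le> r"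
        using real_root_le_mono[of m "a m" "r ^ m"] elim r rateD(1)[OF a] by (simp add: real_root_power_cancel)
      then show ?case using r(2) by simp
    qed
  qed
qed

text \<open>Fekete's lemma. As x is the infimum of the m-th roots, the lower estimate is immediate.
  For r > x, one m with a root below s < r controls all indices n = m j + i, the remainders i < m
  contributing only the constant D.\<close>

lemma rate_submultiplicative:
  assumes nn: "\<And>m. a m \<ge> 0" and sub: "\<And>m n. a (m + n) \<le> a m * a n"
  shows "\<exists>x. rate a x"
proof -
  define x where "x = Inf ((\<lambda>m. root m (a m)) ` {1..})"
  have bdd: "bdd_below ((\<lambda>m. root m (a m)) ` {1..})" by (rule bdd_belowI[of _ 0]) (auto simp: nn)
  have x0: "x \<ge> 0" unfolding x_def by (rule cInf_greatest) (auto simp: nn)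
  have "rate a x"
    unfolding rate_def
  proof (intro conjI allI impI x0)
    fix m :: nat assume m: "m \<ge> 1"
    have "x \<le> root m (a m)" unfolding x_def by (rule cInf_lower[OF _ bdd]) (use m in auto)
    then have "x ^ m \<le> root m (a m) ^ m" using x0 by (intro power_mono)
    then show "x ^ m \<le> a m" using m nn by simp
  next
    fix r assume "r > x"
    then obtain m where m: "m \<ge> 1" "root m (a m) < r"
      using cInf_lessD[of "(\<lambda>m. root m (a m)) ` {1..}" r] by (auto simp: x_def)
    obtain s where s: "root m (a m) < s" "s < r" using dense[OF m(2)] by blast
    have root0: "root m (a m) \<ge> 0" by (rule real_root_ge_zero[OF nn])
    then have s0: "s > 0" using s by linarith
    have "a m = root m (a m) ^ m" using m nn by simp
    also have "\<dots> \<le> s ^ m" using s root0 by (intro power_mono) auto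
    finally have am: "a m \<le> s ^ m" .
    define D where "D = (\<Sum>i<m. a i / s ^ i)"
    have D: "a i \<le> D * s ^ i" if "i < m" for i
    proof -
      have "a i / s ^ i \<le> D" unfolding D_def by (rule member_le_sum) (use that nn s0 in auto)
      then show ?thesis using s0 by (simp add: field_simps)
    qed
    have bound: "a (m * j + i) \<le> D * s ^ (m * j + i)" if "i < m" for j i
    proof (induction j)
      case 0
      then show ?case using D[OF that] by simp
    next
      case (Suc j)
      have "a (m * Suc j + i) = a (m + (m * j + i))" by (simp add: algebra_simps)
      also have "\<dots> \<le> a m * a (m * j + i)" by (rule sub)
      also have "\<dots> \<le> s ^ m * (D * s ^ (m * j + i))" using am Suc nn s0 by (intro mult_mono) auto
      also have "\<dots> = D * s ^ (m * Suc j + i)" by (simp add: power_add algebra_simps)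
      finally show ?case .
    qed
    have all: "a n \<le> D * s ^ n" for n
      using bound[of "n mod m" "n div m"] m by (simp add: mult.commute)
    have D0: "D \<ge> 0" unfolding D_def using nn s0 by (intro sum_nonneg) auto
    have "(\<lambda>n. D * (s / r) ^ n) \<longlonglongrightarrow> 0"
      using s s0 by (intro tendsto_mult_right_zero LIMSEQ_power_zero) simp
    then have "\<forall>\<^sub>F n in sequentially. D * (s / r) ^ n < 1" by (rule order_tendstoD) simp
    then show "\<forall>\<^sub>F n in sequentially. a n \<le> r ^ n"
    proof eventually_elim
      case (elim n)
      have "D * s ^ n \<le> r ^ n" using elim s s0 by (simp add: power_divide field_simps)
      then show ?case using all[of n] by simp
    qed
  qed
  then show ?thesis by blast
qed

text \<open>The bounds on u keep the extended real limsup finite, so that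
  \<open>real_of_ereal\<close> returns its true value.\<close>

lemma real_limsup:
  fixes u :: "nat \<Rightarrow> real"
  assumes u: "\<And>n. 0 \<le> u n" "\<And>n. u n \<le> c"
  defines "x \<equiv> real_of_ereal (limsup (\<lambda>n. ereal (u n)))"
  shows "0 \<le> x" "r > x \<Longrightarrow> \<forall>\<^sub>F n in sequentially. u n \<le> r"
    "(\<And>r. r > y \<Longrightarrow> \<forall>\<^sub>F n in sequentially. u n \<le> r) \<Longrightarrow> x \<le> y"
proof -
  have up: "limsup (\<lambda>n. ereal (u n)) \<le> ereal r" if "\<forall>\<^sub>F n in sequentially. u n \<le> r" for r
    using that by (intro Limsup_bounded) simp
  have "0 \<le> liminf (\<lambda>n. ereal (u n))" by (intro Liminf_bounded) (simp add: u zero_ereal_def)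
  also have "\<dots> \<le> limsup (\<lambda>n. ereal (u n))" by (rule Liminf_le_Limsup) simp
  finally have lo: "0 \<le> limsup (\<lambda>n. ereal (u n))" .
  have "limsup (\<lambda>n. ereal (u n)) \<le> ereal c" by (rule up) (simp add: u)
  then have fin: "\<bar>limsup (\<lambda>n. ereal (u n))\<bar> \<noteq> \<infinity>" using lo by auto
  then have x: "ereal x = limsup (\<lambda>n. ereal (u n))" unfolding x_def by (rule ereal_real')
  show "0 \<le> x" using lo x by (metis ereal_less_eq(3) zero_ereal_def)
  show "\<forall>\<^sub>F n in sequentially. u n \<le> r" if "r > x"
  proof -
    have "limsup (\<lambda>n. ereal (u n)) < ereal r" using that x by (metis ereal_less(2) less_ereal.simps(1))
    then have "\<forall>\<^sub>F n in sequentially. ereal (u n) < ereal r" by (rule Limsup_lessD)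
    then show ?thesis by (rule eventually_mono) simp
  qed
  show "x \<le> y" if *: "\<And>r. r > y \<Longrightarrow> \<forall>\<^sub>F n in sequentially. u n \<le> r"
  proof (rule dense_ge)
    fix r assume "y < r"
    from up[OF *[OF this]] show "x \<le> r" unfolding x[symmetric] by simp
  qed
qed

section \<open>Powers of sets of operators\<close>

lemma operator_set_multI: "A \<in> \<Phi> \<Longrightarrow> B \<in> \<Theta> \<Longrightarrow> A \<circ> B \<in> operator_set_mult \<Phi> \<Theta>"
  unfolding operator_set_mult_def by blast

lemma operator_set_multE:
  assumes "C \<in> operator_set_mult \<Phi> \<Theta>"
  obtains A B where "C = A \<circ> B" "A \<in> \<Phi>" "B \<in> \<Theta>"
  using assms unfolding operator_set_mult_def by blast

lemma operator_set_mult_assoc: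
  "operator_set_mult (operator_set_mult \<Phi> \<Theta>) \<Omega> = operator_set_mult \<Phi> (operator_set_mult \<Theta> \<Omega>)"
proof (intro set_eqI iffI)
  fix C assume "C \<in> operator_set_mult (operator_set_mult \<Phi> \<Theta>) \<Omega>"
  then obtain X Z where X: "C = X \<circ> Z" "X \<in> operator_set_mult \<Phi> \<Theta>" "Z \<in> \<Omega>" by (rule operator_set_multE)
  then obtain U V where U: "X = U \<circ> V" "U \<in> \<Phi>" "V \<in> \<Theta>" by (elim operator_set_multE)
  show "C \<in> operator_set_mult \<Phi> (operator_set_mult \<Theta> \<Omega>)"
    unfolding X(1) U(1) o_assoc[symmetric] using U X by (intro operator_set_multI)
next
  fix C assume "C \<in> operator_set_mult \<Phi> (operator_set_mult \<Theta> \<Omega>)"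
  then obtain U X where X: "C = U \<circ> X" "U \<in> \<Phi>" "X \<in> operator_set_mult \<Theta> \<Omega>" by (rule operator_set_multE)
  then obtain V Z where V: "X = V \<circ> Z" "V \<in> \<Theta>" "Z \<in> \<Omega>" by (elim operator_set_multE)
  show "C \<in> operator_set_mult (operator_set_mult \<Phi> \<Theta>) \<Omega>"
    unfolding X(1) V(1) o_assoc using V X by (intro operator_set_multI)
qed

lemma operator_set_mult_id: "operator_set_mult {id} \<Phi> = \<Phi>" "operator_set_mult \<Phi> {id} = \<Phi>"
  unfolding operator_set_mult_def by auto

lemma operator_set_power_add:
  "operator_set_power \<Phi> (m + n) = operator_set_mult (operator_set_power \<Phi> m) (operator_set_power \<Phi> n)"
  by (induction m) (simp_all add: operator_set_mult_id operator_set_mult_assoc)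

lemma operator_set_power_mult: "operator_set_power (operator_set_power \<Phi> k) m = operator_set_power \<Phi> (k * m)"
  by (induction m) (simp_all add: operator_set_power_add)

lemma operator_set_power_1 [simp]: "operator_set_power \<Phi> (Suc 0) = \<Phi>"
  by (simp add: operator_set_mult_id)

lemma funpow_operator_set_power: "A \<in> \<Phi> \<Longrightarrow> A ^^ m \<in> operator_set_power \<Phi> m"
  by (induction m) (auto intro: operator_set_multI)

text \<open>A cyclic regrouping of the letters, through which growth for \<Sigma>\<Psi> is estimated
  by growth for \<Psi>\<Sigma>.\<close>

lemma operator_set_power_swap:
  "operator_set_power (operator_set_mult \<Sigma> \<Psi>) (Suc m) =
    operator_set_mult \<Sigma> (operator_set_mult (operator_set_power (operator_set_mult \<Psi> \<Sigma>) m) \<Psi>)"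
  by (induction m) (simp_all add: operator_set_mult_id operator_set_mult_assoc)

context banach_function_space
begin

text \<open>A bound of at least 1 keeps all products and powers of bounds nonnegative, also when the
  set is empty.\<close>

definition bounded_PK :: "'x operator set \<Rightarrow> bool" where
  "bounded_PK \<Phi> \<longleftrightarrow> \<Phi> \<subseteq> PK \<and> (\<exists>c\<ge>1. \<forall>A\<in>\<Phi>. operator_norm L N A \<le> c)"

lemma bounded_PKE:
  assumes "bounded_PK \<Phi>"
  obtains c where "\<Phi> \<subseteq> PK" "c \<ge> 1" "\<And>A. A \<in> \<Phi> \<Longrightarrow> operator_norm L N A \<le> c"
  using assms by (auto simp: bounded_PK_def)

lemma bounded_PK_subset: "bounded_PK \<Phi> \<Longrightarrow> \<Phi> \<subseteq> PK"
  by (simp add: bounded_PK_def)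

lemma operator_norm_o: "A \<in> BO \<Longrightarrow> B \<in> BO \<Longrightarrow> operator_norm L N (A \<circ> B) \<le> operator_norm L N A * operator_norm L N B"
  using operator_gauge.Q_o[OF operator_norm_gauge] by blast

lemma operator_norm_id: "operator_norm L N id \<le> 1"
  by (rule operator_norm_least) (simp add: unit_ball_def)

lemma bounded_PK_mult:
  assumes \<Phi>: "bounded_PK \<Phi>" and \<Theta>: "bounded_PK \<Theta>"
  shows "bounded_PK (operator_set_mult \<Phi> \<Theta>)"
proof -
  obtain c where c: "\<Phi> \<subseteq> PK" "c \<ge> 1" "\<And>A. A \<in> \<Phi> \<Longrightarrow> operator_norm L N A \<le> c" using \<Phi> by (rule bounded_PKE) blast
  obtain d where d: "\<Theta> \<subseteq> PK" "d \<ge> 1" "\<And>A. A \<in> \<Theta> \<Longrightarrow> operator_norm L N A \<le> d" using \<Theta> by (rule bounded_PKE) blast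
  have "operator_set_mult \<Phi> \<Theta> \<subseteq> PK"
    using c(1) d(1) PK_comp unfolding operator_set_mult_def by blast
  moreover have "operator_norm L N C \<le> c * d" if C: "C \<in> operator_set_mult \<Phi> \<Theta>" for C
  proof -
    obtain A B where AB: "C = A \<circ> B" "A \<in> \<Phi>" "B \<in> \<Theta>" using C by (rule operator_set_multE)
    have bo: "A \<in> BO" "B \<in> BO" using AB c(1) d(1) by auto
    have "operator_norm L N A * operator_norm L N B \<le> c * d"
      using c(2,3) d(3) AB operator_norm_nonneg[OF bo(2)] by (intro mult_mono) auto
    then show ?thesis using operator_norm_o[OF bo] AB(1) by simp
  qed
  moreover have "c * d \<ge> 1" using mult_mono[of 1 c 1 d] c d by simp
  ultimately show ?thesis unfolding bounded_PK_def by blast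
qed

lemma bounded_PK_power:
  assumes "bounded_PK \<Phi>" "k \<ge> 1"
  shows "bounded_PK (operator_set_power \<Phi> k)"
  using assms(2)
proof (induction k rule: dec_induct)
  case (step k)
  then show ?case using bounded_PK_mult[OF assms(1)] by simp
qed (simp add: assms operator_set_mult_id)

text \<open>The zeroth power is {id}, hence \<open>pos_ops\<close> where one would expect
  \<open>PK\<close>, and c^0 = 1 as its bound.\<close>

lemma power_bounds:
  assumes "bounded_PK \<Phi>"
  obtains c where "c \<ge> 1" "\<And>m A. A \<in> operator_set_power \<Phi> m \<Longrightarrow> A \<in> pos_ops \<and> operator_norm L N A \<le> c ^ m"
proof -
  obtain c where c: "\<Phi> \<subseteq> PK" "c \<ge> 1" "\<And>A. A \<in> \<Phi> \<Longrightarrow> operator_norm L N A \<le> c" using assms by (rule bounded_PKE) blast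
  have "A \<in> pos_ops \<and> operator_norm L N A \<le> c ^ m" if "A \<in> operator_set_power \<Phi> m" for m A
    using that
  proof (induction m arbitrary: A)
    case 0
    then have "A = id" by simp
    show ?case unfolding \<open>A = id\<close> power_0 by (intro conjI id_pos_ops operator_norm_id)
  next
    case (Suc m)
    then have "A \<in> operator_set_mult \<Phi> (operator_set_power \<Phi> m)" by simp
    then obtain B C where BC: "A = B \<circ> C" "B \<in> \<Phi>" "C \<in> operator_set_power \<Phi> m" by (rule operator_set_multE)
    note IH = Suc.IH[OF BC(3)]
    have B: "B \<in> PK" using BC(2) c(1) by auto
    then have bo: "B \<in> BO" "C \<in> BO" using IH pos_opsD(1) by auto
    have "operator_norm L N B * operator_norm L N C \<le> c * c ^ m"
      using c(2,3) BC(2) IH operator_norm_nonneg[OF bo(2)] by (intro mult_mono) auto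
    then have "operator_norm L N (B \<circ> C) \<le> c ^ Suc m" using operator_norm_o[OF bo] unfolding power_Suc by linarith
    moreover have "B \<circ> C \<in> pos_ops" by (rule pos_ops_comp) (use B PK_pos_ops IH in auto)
    ultimately show ?case unfolding BC(1) by (intro conjI)
  qed
  then show thesis using that[of c] c(2) by blast
qed

lemma power_pos_ops: "bounded_PK \<Phi> \<Longrightarrow> operator_set_power \<Phi> m \<subseteq> pos_ops"
  by (rule power_bounds[of \<Phi>]) auto

lemma power_BO: "bounded_PK \<Phi> \<Longrightarrow> operator_set_power \<Phi> m \<subseteq> BO"
  using power_pos_ops[of \<Phi> m] by (auto simp: pos_ops_def)

lemma half_meanE:
  assumes "C \<in> half_mean \<mu> L \<Phi>"
  obtains A B where "C = gmean A B" "A \<in> \<Phi>" "B \<in> \<Phi>"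
  using assms unfolding hadamard_mean_set_def by blast

lemma half_meanI: "A \<in> \<Phi> \<Longrightarrow> B \<in> \<Phi> \<Longrightarrow> gmean A B \<in> half_mean \<mu> L \<Phi>"
  unfolding hadamard_mean_set_def by blast

lemma bounded_PK_half_mean:
  assumes "bounded_PK \<Phi>"
  shows "bounded_PK (half_mean \<mu> L \<Phi>)"
proof -
  obtain c where c: "\<Phi> \<subseteq> PK" "c \<ge> 1" "\<And>A. A \<in> \<Phi> \<Longrightarrow> operator_norm L N A \<le> c" using assms by (rule bounded_PKE) blast
  have "C \<in> PK \<and> operator_norm L N C \<le> c" if C: "C \<in> half_mean \<mu> L \<Phi>" for C
  proof -
    obtain A B where AB: "C = gmean A B" "A \<in> \<Phi>" "B \<in> \<Phi>" using C by (rule half_meanE)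
    have PK: "A \<in> PK" "B \<in> PK" using AB c(1) by auto
    have "N (D f) \<le> c * N f" if D: "D \<in> \<Phi>" and f: "f \<in> L" for D f
    proof -
      have "D \<in> BO" using D c(1) by auto
      then show ?thesis
        using operator_norm_bound[OF _ f] mult_right_mono[OF c(3)[OF D] norm_nonneg[OF f]] by fastforce
    qed
    then have bound: "N (gmean A B f) \<le> c * N f" if "f \<in> L" for f
      using AB that by (intro gmean_BO(2)[OF PK]) auto
    have "operator_norm L N (gmean A B) \<le> c"
    proof (rule operator_norm_least)
      fix f assume "f \<in> unit_ball L N"
      then have f: "f \<in> L" "N f \<le> 1" by (auto simp: unit_ball_def)
      show "N (gmean A B f) \<le> c" using order_trans[OF bound[OF f(1)] mult_left_mono[OF f(2), of c]] c(2) by simp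
    qed
    then show ?thesis using AB(1) gmean_PK[OF PK] by simp
  qed
  then show ?thesis using c(2) unfolding bounded_PK_def by blast
qed

text \<open>Hoelder's inequality for products of means.\<close>

lemma half_mean_power_dom:
  assumes \<Phi>: "bounded_PK \<Phi>" and C: "C \<in> operator_set_power (half_mean \<mu> L \<Phi>) m"
  shows "\<exists>A\<in>operator_set_power \<Phi> m. \<exists>B\<in>operator_set_power \<Phi> m. mean_dom C A B"
  using C
proof (induction m arbitrary: C)
  case 0
  then have "C = id" by simp
  show ?case unfolding \<open>C = id\<close> operator_set_power.simps by (intro bexI[of _ id] mean_dom_id singletonI)
next
  case (Suc m)
  then have "C \<in> operator_set_mult (half_mean \<mu> L \<Phi>) (operator_set_power (half_mean \<mu> L \<Phi>) m)" by simp
  then obtain C1 C2 where C: "C = C1 \<circ> C2" "C1 \<in> half_mean \<mu> L \<Phi>" "C2 \<in> operator_set_power (half_mean \<mu> L \<Phi>) m"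
    by (rule operator_set_multE)
  obtain A1 B1 where 1: "C1 = gmean A1 B1" "A1 \<in> \<Phi>" "B1 \<in> \<Phi>" using C(2) by (rule half_meanE)
  obtain A2 B2 where 2: "A2 \<in> operator_set_power \<Phi> m" "B2 \<in> operator_set_power \<Phi> m" "mean_dom C2 A2 B2"
    using Suc.IH[OF C(3)] by blast
  have PK: "A1 \<in> PK" "B1 \<in> PK" using 1 bounded_PK_subset[OF \<Phi>] by auto
  have pos: "A2 \<in> pos_ops" "B2 \<in> pos_ops" using 2 power_pos_ops[OF \<Phi>, of m] by auto
  have "C2 \<in> BO" using C(3) power_BO[OF bounded_PK_half_mean[OF \<Phi>], of m] by auto
  then have "mean_dom (C1 \<circ> C2) (A1 \<circ> A2) (B1 \<circ> B2)"
    using mean_dom_comp[OF mean_dom_gmean[OF PK] 2(3)] PK pos 1(1) by auto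
  then show ?case unfolding C(1) operator_set_power.simps
    using operator_set_multI[OF 1(2) 2(1)] operator_set_multI[OF 1(3) 2(2)] by blast
qed

definition dominated :: "'x operator \<Rightarrow> 'x operator \<Rightarrow> bool" where
  "dominated C D \<longleftrightarrow> (\<forall>f\<in>L. AE x in \<mu>. cmod (C f x) \<le> cmod (D (modulus f) x))"

lemma PK_mono:
  assumes D: "D \<in> PK" and f: "f \<in> L" and g: "g \<in> L" and le: "AE x in \<mu>. cmod (f x) \<le> cmod (g x)"
  shows "AE x in \<mu>. cmod (D (modulus f) x) \<le> cmod (D (modulus g) x)"
proof -
  have Dk: "D \<in> positive_kernel_operators \<mu> L" using D by auto
  show ?thesis
    using pk_section_abs[OF Dk f] pk_section_abs[OF Dk g]
  proof eventually_elim
    case (elim x)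
    have "(LINT y|\<mu>. pk D (x, y) * cmod (f y)) \<le> (LINT y|\<mu>. pk D (x, y) * cmod (g y))"
    proof (rule integral_mono_AE)
      show "AE y in \<mu>. pk D (x, y) * cmod (f y) \<le> pk D (x, y) * cmod (g y)"
        using le by eventually_elim (simp add: mult_left_mono)
    qed (use elim in auto)
    moreover have "0 \<le> (LINT y|\<mu>. pk D (x, y) * cmod (f y))" by (intro integral_nonneg_AE) auto
    ultimately show ?case using elim by simp
  qed
qed

lemma dominated_comp:
  assumes 1: "dominated C1 D1" and 2: "dominated C2 D2" and C2: "C2 \<in> BO" and D1: "D1 \<in> PK" and D2: "D2 \<in> pos_ops"
  shows "dominated (C1 \<circ> C2) (D1 \<circ> D2)"
  unfolding dominated_def
proof
  fix f assume f: "f \<in> L"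
  have L: "C2 f \<in> L" "D2 (modulus f) \<in> L"
    using bo_L[OF C2 f] bo_L[OF pos_opsD(1)[OF D2] modulus_L[OF f]] by auto
  have D1b: "D1 \<in> BO" using D1 by auto
  have "AE x in \<mu>. cmod (C1 (C2 f) x) \<le> cmod (D1 (modulus (C2 f)) x)" using 1 L(1) by (auto simp: dominated_def)
  moreover have "AE x in \<mu>. cmod (D1 (modulus (C2 f)) x) \<le> cmod (D1 (modulus (D2 (modulus f))) x)"
    by (rule PK_mono[OF D1 L]) (use 2 f in \<open>auto simp: dominated_def\<close>)
  moreover have "AE x in \<mu>. D1 (modulus (D2 (modulus f))) x = D1 (D2 (modulus f)) x"
    by (rule bo_cong[OF D1b modulus_L[OF L(2)] L(2) pos_opsD(2)[OF D2 f]])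
  ultimately show "AE x in \<mu>. cmod ((C1 \<circ> C2) f x) \<le> cmod ((D1 \<circ> D2) (modulus f) x)"
    by eventually_elim simp
qed

lemma dominated_id: "dominated id id"
  by (simp add: dominated_def)

text \<open>A word of length k m is cut into m blocks of length k. Each block is a kernel operator,
  since k \<ge> 1, and is related by \<open>mean_dom\<close> to two elements of \<Phi>^k; so it lies
  below their genuine mean.\<close>

lemma half_mean_power_dominated:
  assumes \<Phi>: "bounded_PK \<Phi>" and k: "k \<ge> 1" and C: "C \<in> operator_set_power (half_mean \<mu> L \<Phi>) (k * m)"
  shows "\<exists>D\<in>operator_set_power (half_mean \<mu> L (operator_set_power \<Phi> k)) m. dominated C D"
  using C
proof (induction m arbitrary: C)
  case 0
  then have "C = id" by simp
  show ?case unfolding \<open>C = id\<close> operator_set_power.simps by (intro bexI[of _ id] dominated_id singletonI)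
next
  case (Suc m)
  note H = bounded_PK_half_mean[OF \<Phi>] and \<Phi>k = bounded_PK_power[OF \<Phi> k]
  have "C \<in> operator_set_mult (operator_set_power (half_mean \<mu> L \<Phi>) k) (operator_set_power (half_mean \<mu> L \<Phi>) (k * m))"
    using Suc.prems by (simp flip: operator_set_power_add)
  then obtain C1 C2 where C: "C = C1 \<circ> C2" "C1 \<in> operator_set_power (half_mean \<mu> L \<Phi>) k"
    "C2 \<in> operator_set_power (half_mean \<mu> L \<Phi>) (k * m)" by (rule operator_set_multE)
  obtain D2 where D2: "D2 \<in> operator_set_power (half_mean \<mu> L (operator_set_power \<Phi> k)) m" "dominated C2 D2"
    using Suc.IH[OF C(3)] by blast
  obtain A B where AB: "A \<in> operator_set_power \<Phi> k" "B \<in> operator_set_power \<Phi> k" "mean_dom C1 A B"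
    using half_mean_power_dom[OF \<Phi> C(2)] by blast
  have PK: "A \<in> PK" "B \<in> PK" using AB bounded_PK_subset[OF \<Phi>k] by auto
  have C1: "C1 \<in> PK" using C(2) bounded_PK_subset[OF bounded_PK_power[OF H k]] by auto
  have "dominated C1 (gmean A B)" unfolding dominated_def using gmean_dominates[OF PK C1 AB(3)] by blast
  moreover have "C2 \<in> BO" using C(3) power_BO[OF H, of "k * m"] by auto
  moreover have "D2 \<in> pos_ops" using D2(1) power_pos_ops[OF bounded_PK_half_mean[OF \<Phi>k], of m] by auto
  ultimately have "dominated C (gmean A B \<circ> D2)"
    unfolding C(1) using dominated_comp D2(2) gmean_PK[OF PK] by blast
  moreover have "gmean A B \<circ> D2 \<in> operator_set_power (half_mean \<mu> L (operator_set_power \<Phi> k)) (Suc m)"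
    using operator_set_multI[OF half_meanI[OF AB(1,2)] D2(1)] by simp
  ultimately show ?case by blast
qed

end

section \<open>Joint and generalized radii\<close>

definition power_sup :: "('x operator \<Rightarrow> real) \<Rightarrow> 'x operator set \<Rightarrow> nat \<Rightarrow> real" where
  "power_sup q \<Phi> m = Sup (insert 0 (q ` operator_set_power \<Phi> m))"

lemma sup_root_power_sup: "sup_root q \<Phi> = (\<lambda>m. root m (power_sup q \<Phi> m))"
  by (rule ext) (simp add: sup_root_def power_sup_def)

lemma power_sup_power: "power_sup q (operator_set_power \<Phi> k) m = power_sup q \<Phi> (k * m)"
  by (simp add: power_sup_def operator_set_power_mult)

text \<open>\<open>upper_rate a x\<close> says that \<open>x = limsup a\<^sub>m\<^sup>1\<^sup>/\<^sup>m\<close>.\<close>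

definition upper_rate :: "(nat \<Rightarrow> real) \<Rightarrow> real \<Rightarrow> bool" where
  "upper_rate a x \<longleftrightarrow> 0 \<le> x \<and> (\<forall>r>x. \<forall>\<^sub>F m in sequentially. a m \<le> r ^ m) \<and>
    (\<forall>y\<ge>0. (\<forall>r>y. \<forall>\<^sub>F m in sequentially. a m \<le> r ^ m) \<longrightarrow> x \<le> y)"

lemma upper_rateD:
  assumes "upper_rate a x"
  shows "0 \<le> x" "r > x \<Longrightarrow> \<forall>\<^sub>F m in sequentially. a m \<le> r ^ m"
    "y \<ge> 0 \<Longrightarrow> (\<And>r. r > y \<Longrightarrow> \<forall>\<^sub>F m in sequentially. a m \<le> r ^ m) \<Longrightarrow> x \<le> y"
  using assms by (auto simp: upper_rate_def)

lemma upper_rate_limsup: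
  assumes a: "\<And>m. 0 \<le> a m" "\<And>m. a m \<le> c ^ m" and c: "c \<ge> 0"
  shows "upper_rate a (real_of_ereal (limsup (\<lambda>m. ereal (root m (a m)))))" (is "upper_rate a ?x")
proof -
  have root_le: "root m (a m) \<le> r" if "a m \<le> r ^ m" "r \<ge> 0" for m r
    using that real_root_le_mono[of m "a m" "r ^ m"] by (cases "m = 0") (simp_all add: real_root_power_cancel)
  have u: "0 \<le> root m (a m)" "root m (a m) \<le> c" for m
    using real_root_ge_zero[OF a(1)] root_le[OF a(2) c] by auto
  note lim = real_limsup[of "\<lambda>m. root m (a m)", OF u]
  show ?thesis
    unfolding upper_rate_def
  proof (intro conjI allI impI)
    show "0 \<le> ?x" by (rule lim(1))
    show "\<forall>\<^sub>F m in sequentially. a m \<le> r ^ m" if "r > ?x" for r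
      using lim(2)[OF that] eventually_ge_at_top[of 1]
    proof eventually_elim
      case (elim m)
      have "root m (a m) ^ m \<le> r ^ m" by (rule power_mono[OF elim(1) u(1)])
      then show ?case using elim(2) a(1) by simp
    qed
    fix y :: real assume y: "y \<ge> 0" "\<forall>r>y. \<forall>\<^sub>F m in sequentially. a m \<le> r ^ m"
    show "?x \<le> y"
    proof (rule lim(3))
      fix r assume "r > y"
      then have "\<forall>\<^sub>F m in sequentially. a m \<le> r ^ m" using y by blast
      then show "\<forall>\<^sub>F m in sequentially. root m (a m) \<le> r"
        by (rule eventually_mono) (use root_le y \<open>r > y\<close> in auto)
    qed
  qed
qed

lemma upper_rate_mono:
  assumes a: "upper_rate a x" and b: "upper_rate b y" and le: "\<And>m. m \<ge> 1 \<Longrightarrow> a m \<le> b m"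
  shows "x \<le> y"
proof (rule upper_rateD(3)[OF a upper_rateD(1)[OF b]])
  fix r assume "r > y"
  show "\<forall>\<^sub>F m in sequentially. a m \<le> r ^ m"
    using upper_rateD(2)[OF b \<open>r > y\<close>] eventually_ge_at_top[of 1]
    by eventually_elim (use le order_trans in blast)
qed

context banach_function_space
begin

text \<open>Guarantees that the suprema over powers of a bounded set are taken over bounded sets of
  numbers.\<close>

definition subordinate :: "('x operator \<Rightarrow> real) \<Rightarrow> bool" where
  "subordinate q \<longleftrightarrow> (\<forall>A\<in>BO. 0 \<le> q A \<and> q A \<le> operator_norm L N A)"

lemma power_sup_upper:
  assumes q: "subordinate q" and \<Phi>: "bounded_PK \<Phi>"
  shows "A \<in> operator_set_power \<Phi> m \<Longrightarrow> q A \<le> power_sup q \<Phi> m" "0 \<le> power_sup q \<Phi> m"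
proof -
  obtain c where c: "c \<ge> 1" "\<And>m A. A \<in> operator_set_power \<Phi> m \<Longrightarrow> A \<in> pos_ops \<and> operator_norm L N A \<le> c ^ m"
    using \<Phi> by (rule power_bounds) blast
  have "q A \<le> c ^ m" if "A \<in> operator_set_power \<Phi> m" for A
    using c(2)[OF that] q pos_opsD(1) unfolding subordinate_def by (meson order_trans)
  then have bdd: "bdd_above (insert 0 (q ` operator_set_power \<Phi> m))"
    using c(1) by (intro bdd_aboveI[of _ "c ^ m"]) auto
  show "0 \<le> power_sup q \<Phi> m" unfolding power_sup_def by (intro cSup_upper[OF _ bdd]) simp
  show "q A \<le> power_sup q \<Phi> m" if "A \<in> operator_set_power \<Phi> m"
    unfolding power_sup_def by (intro cSup_upper[OF _ bdd]) (use that in simp)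
qed

lemma power_sup_least:
  assumes "\<And>A. A \<in> operator_set_power \<Phi> m \<Longrightarrow> q A \<le> c" "0 \<le> c"
  shows "power_sup q \<Phi> m \<le> c"
  unfolding power_sup_def using assms by (intro cSup_least) auto

lemma upper_rate_power_sup:
  assumes q: "subordinate q" and \<Phi>: "bounded_PK \<Phi>"
  shows "upper_rate (power_sup q \<Phi>) (real_of_ereal (limsup (\<lambda>m. ereal (sup_root q \<Phi> m))))"
proof -
  obtain c where c: "c \<ge> 1" "\<And>m A. A \<in> operator_set_power \<Phi> m \<Longrightarrow> A \<in> pos_ops \<and> operator_norm L N A \<le> c ^ m"
    using \<Phi> by (rule power_bounds) blast
  have "power_sup q \<Phi> m \<le> c ^ m" for m
  proof (rule power_sup_least)
    fix A assume "A \<in> operator_set_power \<Phi> m"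
    then show "q A \<le> c ^ m"
      using c(2) q pos_opsD(1) unfolding subordinate_def by (meson order_trans)
  qed (use c(1) in simp)
  then show ?thesis
    unfolding sup_root_power_sup using c(1) power_sup_upper(2)[OF q \<Phi>]
    by (intro upper_rate_limsup[of _ c]) auto
qed

text \<open>The properties of a radius from which the inequality follows by arithmetic, so that the
  four radii are treated alike. Passing to powers is an inequality because a limsup along the
  multiples of k yields it at once.\<close>

definition mean_radius :: "('x operator set \<Rightarrow> real) \<Rightarrow> bool" where
  "mean_radius r \<longleftrightarrow> (\<forall>\<Phi>. bounded_PK \<Phi> \<longrightarrow> 0 \<le> r \<Phi> \<and> r (half_mean \<mu> L \<Phi>) \<le> r \<Phi> \<and>
      (\<forall>k\<ge>1. r (half_mean \<mu> L \<Phi>) ^ k \<le> r (half_mean \<mu> L (operator_set_power \<Phi> k)) \<and>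
        r (operator_set_power \<Phi> k) \<le> r \<Phi> ^ k)) \<and>
    (\<forall>\<Psi> \<Sigma>. bounded_PK \<Psi> \<and> bounded_PK \<Sigma> \<longrightarrow> r (operator_set_mult \<Sigma> \<Psi>) \<le> r (operator_set_mult \<Psi> \<Sigma>))"

end

text \<open>The factor X is there for the measure of noncompactness. For the operator norm the
  estimate of C by the average of A and B is elementary, and X enters through
  submultiplicativity.\<close>

locale dominated_gauge = operator_gauge \<mu> L N Q J
  for \<mu> :: "'x measure" and L N Q J +
  assumes Q_le_norm: "A \<in> BO \<Longrightarrow> Q A \<le> operator_norm L N A"
    and Q_dominated: "\<lbrakk>X \<in> PK; C \<in> BO; A \<in> BO; B \<in> BO;
      \<And>f. f \<in> L \<Longrightarrow> AE x in \<mu>. 2 * cmod (C f x) \<le> cmod (A (modulus f) x) + cmod (B (modulus f) x)\<rbrakk>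
      \<Longrightarrow> Q (X \<circ> C) \<le> operator_norm L N X * ((Q A + Q B) / 2)"
begin

lemma Q_subordinate: "subordinate Q"
  using Q_nonneg Q_le_norm by (simp add: subordinate_def)

lemma radius_subordinate: "subordinate radius"
  unfolding subordinate_def
proof (intro ballI conjI)
  fix A assume A: "A \<in> BO"
  show "0 \<le> radius A" by (rule radius_nonneg_bdd[OF A])
  have "radius A \<le> Q A" using radius_nonneg_bdd(3)[OF A, of 1] by simp
  then show "radius A \<le> operator_norm L N A" using Q_le_norm[OF A] by simp
qed

lemma Q_mean_dom: "\<lbrakk>X \<in> PK; C \<in> BO; A \<in> BO; B \<in> BO; mean_dom C A B\<rbrakk> \<Longrightarrow> Q (X \<circ> C) \<le> operator_norm L N X * ((Q A + Q B) / 2)"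
  using Q_dominated mean_dom_amgm by blast

lemma Q_pointwise_dominated: "\<lbrakk>X \<in> PK; C \<in> BO; D \<in> BO; dominated C D\<rbrakk> \<Longrightarrow> Q (X \<circ> C) \<le> operator_norm L N X * Q D"
  using Q_dominated[of X C D D] unfolding dominated_def by force

lemma Q_swap:
  assumes "S \<in> BO" "W \<in> BO" "P' \<in> BO"
  shows "Q (S \<circ> (W \<circ> P')) \<le> Q S * Q P' * Q W"
proof -
  have "Q (S \<circ> (W \<circ> P')) \<le> Q S * (Q W * Q P')"
    using order_trans[OF Q_o[OF assms(1) bo_o[OF assms(2,3)]] mult_left_mono[OF Q_o[OF assms(2,3)] Q_nonneg[OF assms(1)]]] .
  then show ?thesis by (simp add: mult_ac)
qed

definition joint_radius :: "'x operator set \<Rightarrow> real" where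
  "joint_radius \<Phi> = lim (sup_root Q \<Phi>)"

lemma joint_rate:
  assumes \<Phi>: "bounded_PK \<Phi>"
  shows "rate (power_sup Q \<Phi>) (joint_radius \<Phi>)"
proof -
  have "\<exists>x. rate (power_sup Q \<Phi>) x"
  proof (rule rate_submultiplicative)
    note up = power_sup_upper[OF Q_subordinate \<Phi>]
    show "power_sup Q \<Phi> m \<ge> 0" for m by (rule up)
    show "power_sup Q \<Phi> (m + n) \<le> power_sup Q \<Phi> m * power_sup Q \<Phi> n" for m n
    proof (rule power_sup_least)
      fix A assume "A \<in> operator_set_power \<Phi> (m + n)"
      then obtain B C where BC: "A = B \<circ> C" "B \<in> operator_set_power \<Phi> m" "C \<in> operator_set_power \<Phi> n"
        unfolding operator_set_power_add by (rule operator_set_multE)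
      have bo: "B \<in> BO" "C \<in> BO" using BC power_BO[OF \<Phi>] by blast+
      have "Q A \<le> Q B * Q C" unfolding BC(1) by (rule Q_o[OF bo])
      also have "\<dots> \<le> power_sup Q \<Phi> m * power_sup Q \<Phi> n"
        by (intro mult_mono up(1)[OF BC(2)] up(1)[OF BC(3)] up(2) Q_nonneg[OF bo(2)])
      finally show "Q A \<le> power_sup Q \<Phi> m * power_sup Q \<Phi> n" .
    qed (intro mult_nonneg_nonneg up)
  qed
  then obtain x where x: "rate (power_sup Q \<Phi>) x" ..
  have "joint_radius \<Phi> = x"
    unfolding joint_radius_def sup_root_power_sup by (rule limI[OF rate_root_limit[OF x]])
  then show ?thesis using x by simp
qed

text \<open>Common form of the comparisons of joint radii: words of length p m + 1 against words of
  length m. The number b stands for the supremum over the latter.\<close>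

lemma joint_compare:
  assumes \<Phi>: "bounded_PK \<Phi>" and \<Theta>: "bounded_PK \<Theta>" and p: "p \<ge> 1" and c: "c \<ge> 0"
    and le: "\<And>m C b. \<lbrakk>m \<ge> 1; C \<in> operator_set_power \<Phi> (Suc (p * m));
      \<And>A. A \<in> operator_set_power \<Theta> m \<Longrightarrow> Q A \<le> b; b \<ge> 0\<rbrakk> \<Longrightarrow> Q C \<le> c * b"
  shows "joint_radius \<Phi> ^ p \<le> joint_radius \<Theta>"
proof (rule rate_compare[OF joint_rate[OF \<Phi>] joint_rate[OF \<Theta>] p _ c])
  fix m :: nat assume m: "m \<ge> 1"
  note up = power_sup_upper[OF Q_subordinate \<Theta>]
  show "power_sup Q \<Phi> (p * m + 1) \<le> c * power_sup Q \<Theta> m"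
    by (rule power_sup_least) (use le[OF m _ up] mult_nonneg_nonneg[OF c up(2)] in auto)
qed

lemma norm_scaled_mono: "\<lbrakk>operator_norm L N X \<le> c; a \<le> b; 0 \<le> b; 0 \<le> c; X \<in> BO\<rbrakk> \<Longrightarrow> operator_norm L N X * a \<le> c * b"
  by (meson mult_left_mono mult_right_mono order_trans operator_norm_nonneg)

text \<open>The first letter of a word of means serves as the factor X, and the remaining word is
  related to two words in \<Phi> of the same length.\<close>

lemma joint_half_mean:
  assumes \<Phi>: "bounded_PK \<Phi>"
  shows "joint_radius (half_mean \<mu> L \<Phi>) \<le> joint_radius \<Phi>"
proof -
  note H = bounded_PK_half_mean[OF \<Phi>]
  obtain c where c: "half_mean \<mu> L \<Phi> \<subseteq> PK" "c \<ge> 1" "\<And>X. X \<in> half_mean \<mu> L \<Phi> \<Longrightarrow> operator_norm L N X \<le> c"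
    using H by (rule bounded_PKE) blast
  have "joint_radius (half_mean \<mu> L \<Phi>) ^ 1 \<le> joint_radius \<Phi>"
  proof (rule joint_compare[OF H \<Phi>])
    fix m C b assume C: "C \<in> operator_set_power (half_mean \<mu> L \<Phi>) (Suc (1 * m))"
      and b: "\<And>A. A \<in> operator_set_power \<Phi> m \<Longrightarrow> Q A \<le> b" "b \<ge> 0"
    from C obtain X Y where XY: "C = X \<circ> Y" "X \<in> half_mean \<mu> L \<Phi>" "Y \<in> operator_set_power (half_mean \<mu> L \<Phi>) m"
      unfolding operator_set_power.simps mult_1 by (rule operator_set_multE)
    obtain A B where AB: "A \<in> operator_set_power \<Phi> m" "B \<in> operator_set_power \<Phi> m" "mean_dom Y A B"
      using half_mean_power_dom[OF \<Phi> XY(3)] by blast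
    have X: "X \<in> PK" using XY(2) c(1) by blast
    have bo: "Y \<in> BO" "A \<in> BO" "B \<in> BO" using AB XY(3) power_BO[OF \<Phi>] power_BO[OF H] by blast+
    have "Q C \<le> operator_norm L N X * ((Q A + Q B) / 2)" unfolding XY(1) by (rule Q_mean_dom[OF X bo AB(3)])
    also have "\<dots> \<le> c * b"
      by (rule norm_scaled_mono) (use c XY(2) X b(1)[OF AB(1)] b(1)[OF AB(2)] b(2) in auto)
    finally show "Q C \<le> c * b" .
  qed (use c(2) in auto)
  then show ?thesis by simp
qed

text \<open>Again the first letter serves as X; the other k m letters form m blocks, dominated by a
  word in the means of \<Phi>^k.\<close>

lemma joint_half_mean_power:
  assumes \<Phi>: "bounded_PK \<Phi>" and k: "k \<ge> 1"
  shows "joint_radius (half_mean \<mu> L \<Phi>) ^ k \<le> joint_radius (half_mean \<mu> L (operator_set_power \<Phi> k))"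
proof -
  note H = bounded_PK_half_mean[OF \<Phi>] and Hk = bounded_PK_half_mean[OF bounded_PK_power[OF \<Phi> k]]
  obtain c where c: "half_mean \<mu> L \<Phi> \<subseteq> PK" "c \<ge> 1" "\<And>X. X \<in> half_mean \<mu> L \<Phi> \<Longrightarrow> operator_norm L N X \<le> c"
    using H by (rule bounded_PKE) blast
  show ?thesis
  proof (rule joint_compare[OF H Hk k])
    fix m C b assume C: "C \<in> operator_set_power (half_mean \<mu> L \<Phi>) (Suc (k * m))"
      and b: "\<And>A. A \<in> operator_set_power (half_mean \<mu> L (operator_set_power \<Phi> k)) m \<Longrightarrow> Q A \<le> b" "b \<ge> 0"
    from C obtain X Y where XY: "C = X \<circ> Y" "X \<in> half_mean \<mu> L \<Phi>" "Y \<in> operator_set_power (half_mean \<mu> L \<Phi>) (k * m)"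
      unfolding operator_set_power.simps by (rule operator_set_multE)
    obtain D where D: "D \<in> operator_set_power (half_mean \<mu> L (operator_set_power \<Phi> k)) m" "dominated Y D"
      using half_mean_power_dominated[OF \<Phi> k XY(3)] by blast
    have X: "X \<in> PK" using XY(2) c(1) by blast
    have bo: "Y \<in> BO" "D \<in> BO" using D XY(3) power_BO[OF H] power_BO[OF Hk] by blast+
    have "Q C \<le> operator_norm L N X * Q D" unfolding XY(1) by (rule Q_pointwise_dominated[OF X bo D(2)])
    also have "\<dots> \<le> c * b"
      by (rule norm_scaled_mono) (use c XY(2) X b(1)[OF D(1)] b(2) in auto)
    finally show "Q C \<le> c * b" .
  qed (use c(2) in auto)
qed

lemma joint_power:
  assumes \<Phi>: "bounded_PK \<Phi>" and k: "k \<ge> 1"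
  shows "joint_radius (operator_set_power \<Phi> k) = joint_radius \<Phi> ^ k"
proof (rule rate_unique)
  show "rate (power_sup Q (operator_set_power \<Phi> k)) (joint_radius (operator_set_power \<Phi> k))"
    by (rule joint_rate[OF bounded_PK_power[OF \<Phi> k]])
  show "rate (power_sup Q (operator_set_power \<Phi> k)) (joint_radius \<Phi> ^ k)"
    using rate_power[OF joint_rate[OF \<Phi>] k] by (simp add: power_sup_power[abs_def])
qed

lemma operator_set_power_swapE:
  assumes "C \<in> operator_set_power (operator_set_mult \<Sigma> \<Psi>) (Suc m)"
  obtains S W P' where "C = S \<circ> (W \<circ> P')" "S \<in> \<Sigma>" "W \<in> operator_set_power (operator_set_mult \<Psi> \<Sigma>) m" "P' \<in> \<Psi>"
  using assms unfolding operator_set_power_swap by (elim operator_set_multE) blast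

lemma joint_swap:
  assumes \<Psi>: "bounded_PK \<Psi>" and \<Sigma>: "bounded_PK \<Sigma>"
  shows "joint_radius (operator_set_mult \<Sigma> \<Psi>) \<le> joint_radius (operator_set_mult \<Psi> \<Sigma>)"
proof -
  note \<Psi>\<Sigma> = bounded_PK_mult[OF \<Psi> \<Sigma>] and \<Sigma>\<Psi> = bounded_PK_mult[OF \<Sigma> \<Psi>]
  obtain c where c: "\<Sigma> \<subseteq> PK" "c \<ge> 1" "\<And>X. X \<in> \<Sigma> \<Longrightarrow> operator_norm L N X \<le> c"
    using \<Sigma> by (rule bounded_PKE) blast
  obtain d where d: "\<Psi> \<subseteq> PK" "d \<ge> 1" "\<And>X. X \<in> \<Psi> \<Longrightarrow> operator_norm L N X \<le> d"
    using \<Psi> by (rule bounded_PKE) blast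
  have "joint_radius (operator_set_mult \<Sigma> \<Psi>) ^ 1 \<le> joint_radius (operator_set_mult \<Psi> \<Sigma>)"
  proof (rule joint_compare[OF \<Sigma>\<Psi> \<Psi>\<Sigma>])
    fix m C b assume C: "C \<in> operator_set_power (operator_set_mult \<Sigma> \<Psi>) (Suc (1 * m))"
      and b: "\<And>A. A \<in> operator_set_power (operator_set_mult \<Psi> \<Sigma>) m \<Longrightarrow> Q A \<le> b" "b \<ge> 0"
    obtain S W P' where SWP: "C = S \<circ> (W \<circ> P')" "S \<in> \<Sigma>" "W \<in> operator_set_power (operator_set_mult \<Psi> \<Sigma>) m" "P' \<in> \<Psi>"
      using C unfolding mult_1 by (rule operator_set_power_swapE)
    have bo: "S \<in> BO" "W \<in> BO" "P' \<in> BO" using SWP c(1) d(1) power_BO[OF \<Psi>\<Sigma>] by blast+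
    have "Q C \<le> Q S * Q P' * Q W" unfolding SWP(1) by (rule Q_swap[OF bo])
    also have "\<dots> \<le> c * d * b"
    proof (intro mult_mono)
      show "Q S \<le> c" using Q_le_norm[OF bo(1)] c(3)[OF SWP(2)] by simp
      show "Q P' \<le> d" using Q_le_norm[OF bo(3)] d(3)[OF SWP(4)] by simp
      show "Q W \<le> b" by (rule b(1)[OF SWP(3)])
    qed (use c(2) d(2) Q_nonneg bo in auto)
    finally show "Q C \<le> c * d * b" .
  qed (use c(2) d(2) in auto)
  then show ?thesis by simp
qed

theorem mean_radius_joint: "mean_radius joint_radius"
  unfolding mean_radius_def
  using rateD(1)[OF joint_rate] joint_half_mean joint_half_mean_power joint_power joint_swap by force

section \<open>Spectral radii of single operators and generalized radii\<close>

lemma radius_rate: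
  assumes A: "A \<in> BO"
  shows "rate (\<lambda>m. Q (A ^^ m)) (radius A)"
  unfolding rate_def
proof (intro conjI allI impI)
  show "0 \<le> radius A" by (rule radius_nonneg_bdd(2)[OF A])
  show "radius A ^ m \<le> Q (A ^^ m)" if "m \<ge> 1" for m by (rule radius_nonneg_bdd(3)[OF A that])
  fix r assume r: "r > radius A"
  then have r0: "r > 0" using radius_nonneg_bdd(2)[OF A] by linarith
  have "\<forall>\<^sub>F m in sequentially. Q (A ^^ m) / r ^ m < 1"
    by (rule order_tendstoD(2)[OF radius_limit[OF A r]]) simp
  then show "\<forall>\<^sub>F m in sequentially. Q (A ^^ m) \<le> r ^ m"
    by (rule eventually_mono) (use r0 in \<open>simp add: divide_simps\<close>)
qed

text \<open>Both sides are the growth rate of the sequence Q(A^(k m)) in m.\<close>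

lemma radius_power:
  assumes A: "A \<in> BO" and k: "k \<ge> 1"
  shows "radius (A ^^ k) = radius A ^ k"
proof (rule rate_unique)
  show "rate (\<lambda>m. Q ((A ^^ k) ^^ m)) (radius (A ^^ k))" by (rule radius_rate[OF bo_pow[OF A]])
  show "rate (\<lambda>m. Q ((A ^^ k) ^^ m)) (radius A ^ k)"
    using rate_power[OF radius_rate[OF A] k] by (simp add: funpow_mult mult.commute)
qed

lemma pos_ops_funpow: "A \<in> pos_ops \<Longrightarrow> A ^^ n \<in> pos_ops"
  by (induction n) (simp_all add: id_pos_ops pos_ops_comp)

lemma mean_dom_funpow:
  assumes "mean_dom C A B" "C \<in> BO" "A \<in> pos_ops" "B \<in> pos_ops"
  shows "mean_dom (C ^^ n) (A ^^ n) (B ^^ n)"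
proof (induction n)
  case 0
  then show ?case unfolding funpow.simps(1) by (rule mean_dom_id)
next
  case (Suc n)
  show ?case unfolding funpow.simps(2)
    by (rule mean_dom_comp[OF assms(1) Suc bo_pow[OF assms(2)] pos_opsD(1)[OF assms(3)] pos_opsD(1)[OF assms(4)]
      pos_ops_funpow[OF assms(3)] pos_ops_funpow[OF assms(4)]])
qed

lemma dominated_funpow:
  assumes "dominated C D" "C \<in> BO" "D \<in> PK"
  shows "dominated (C ^^ n) (D ^^ n)"
proof (induction n)
  case 0
  then show ?case unfolding funpow.simps(1) by (rule dominated_id)
next
  case (Suc n)
  have "D \<in> pos_ops" using assms(3) PK_pos_ops by blast
  then show ?case unfolding funpow.simps(2)
    by (rule dominated_comp[OF assms(1) Suc bo_pow[OF assms(2)] assms(3) pos_ops_funpow])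
qed

text \<open>The factor X is C itself, as C^(m+1) is C after C^m, and \<open>mean_dom\<close> passes
  to m-th powers. The average of Q(A^m) and Q(B^m) is at most their maximum.\<close>

lemma radius_mean_dom:
  assumes C: "C \<in> PK" and A: "A \<in> PK" and B: "B \<in> PK" and mean_dom: "mean_dom C A B"
  shows "radius C \<le> max (radius A) (radius B)"
proof -
  have bo: "C \<in> BO" "A \<in> BO" "B \<in> BO" using A B C by auto
  have pos: "A \<in> pos_ops" "B \<in> pos_ops" using A B PK_pos_ops by auto
  have "radius C ^ 1 \<le> max (radius A) (radius B)"
  proof (rule rate_compare[OF radius_rate[OF bo(1)] rate_max[OF radius_rate[OF bo(2)] radius_rate[OF bo(3)]]])
    fix m :: nat
    have "Q (C \<circ> C ^^ m) \<le> operator_norm L N C * ((Q (A ^^ m) + Q (B ^^ m)) / 2)"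
      by (rule Q_mean_dom[OF C bo_pow[OF bo(1)] bo_pow[OF bo(2)] bo_pow[OF bo(3)] mean_dom_funpow[OF mean_dom bo(1) pos]])
    also have "\<dots> \<le> operator_norm L N C * max (Q (A ^^ m)) (Q (B ^^ m))"
      by (intro mult_left_mono operator_norm_nonneg[OF bo(1)]) (simp add: max_def)
    finally show "Q (C ^^ (1 * m + 1)) \<le> operator_norm L N C * max (Q (A ^^ m)) (Q (B ^^ m))" by simp
  qed (simp_all add: operator_norm_nonneg bo)
  then show ?thesis by simp
qed

lemma radius_dominated:
  assumes C: "C \<in> PK" and D: "D \<in> PK" and dominated: "dominated C D"
  shows "radius C \<le> radius D"
proof -
  have bo: "C \<in> BO" "D \<in> BO" using C D by auto
  have "radius C ^ 1 \<le> radius D"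
  proof (rule rate_compare[OF radius_rate[OF bo(1)] radius_rate[OF bo(2)]])
    fix m :: nat
    show "Q (C ^^ (1 * m + 1)) \<le> operator_norm L N C * Q (D ^^ m)"
      using Q_pointwise_dominated[OF C bo_pow[OF bo(1), of m] bo_pow[OF bo(2), of m] dominated_funpow[OF dominated bo(1) D]] by simp
  qed (simp_all add: operator_norm_nonneg bo)
  then show ?thesis by simp
qed

lemma funpow_swap: "(X \<circ> Y) ^^ Suc n = X \<circ> ((Y \<circ> X) ^^ n \<circ> Y)"
  by (induction n) (simp_all add: fun_eq_iff)

text \<open>(X Y)^(m+1) = X (Y X)^m Y, and the outer factors cost only a constant.\<close>

lemma radius_swap:
  assumes X: "X \<in> BO" and Y: "Y \<in> BO"
  shows "radius (X \<circ> Y) \<le> radius (Y \<circ> X)"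
proof -
  note bo = bo_o[OF X Y] bo_o[OF Y X]
  have "radius (X \<circ> Y) ^ 1 \<le> radius (Y \<circ> X)"
  proof (rule rate_compare[OF radius_rate[OF bo(1)] radius_rate[OF bo(2)]])
    fix m :: nat
    show "Q ((X \<circ> Y) ^^ (1 * m + 1)) \<le> Q X * Q Y * Q ((Y \<circ> X) ^^ m)"
      using Q_swap[OF X bo_pow[OF bo(2)] Y] unfolding mult_1 Suc_eq_plus1[symmetric] funpow_swap .
  qed (simp_all add: Q_nonneg X Y)
  then show ?thesis by simp
qed

definition gen_radius :: "'x operator set \<Rightarrow> real" where
  "gen_radius \<Phi> = real_of_ereal (limsup (\<lambda>m. ereal (sup_root radius \<Phi> m)))"

lemma gen_rate: "bounded_PK \<Phi> \<Longrightarrow> upper_rate (power_sup radius \<Phi>) (gen_radius \<Phi>)"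
  unfolding gen_radius_def by (rule upper_rate_power_sup[OF radius_subordinate])

lemma gen_half_mean:
  assumes \<Phi>: "bounded_PK \<Phi>"
  shows "gen_radius (half_mean \<mu> L \<Phi>) \<le> gen_radius \<Phi>"
proof (rule upper_rate_mono[OF gen_rate[OF bounded_PK_half_mean[OF \<Phi>]] gen_rate[OF \<Phi>]])
  fix m :: nat assume m: "m \<ge> 1"
  note up = power_sup_upper[OF radius_subordinate \<Phi>]
  show "power_sup radius (half_mean \<mu> L \<Phi>) m \<le> power_sup radius \<Phi> m"
  proof (rule power_sup_least[OF _ up(2)])
    fix C assume C: "C \<in> operator_set_power (half_mean \<mu> L \<Phi>) m"
    obtain A B where AB: "A \<in> operator_set_power \<Phi> m" "B \<in> operator_set_power \<Phi> m" "mean_dom C A B"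
      using half_mean_power_dom[OF \<Phi> C] by blast
    have "C \<in> PK" "A \<in> PK" "B \<in> PK"
      using C AB bounded_PK_subset[OF bounded_PK_power[OF \<Phi> m]]
        bounded_PK_subset[OF bounded_PK_power[OF bounded_PK_half_mean[OF \<Phi>] m]] by blast+
    from radius_mean_dom[OF this AB(3)] show "radius C \<le> power_sup radius \<Phi> m"
      using up(1)[OF AB(1)] up(1)[OF AB(2)] by linarith
  qed
qed

text \<open>Comparing only words whose length is a multiple of k would control the limsup merely
  along a subsequence. Instead a word A of any length m is replaced by its k-th power, a word of
  length k m dominated by a word D of length m in the means of \<Phi>^k; multiplicativity of the
  radius on powers of A then gives (radius A)^k \<le> radius D.\<close>

lemma gen_half_mean_power:
  assumes \<Phi>: "bounded_PK \<Phi>" and k: "k \<ge> 1"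
  shows "gen_radius (half_mean \<mu> L \<Phi>) ^ k \<le> gen_radius (half_mean \<mu> L (operator_set_power \<Phi> k))" (is "_ \<le> ?z")
proof -
  note H = bounded_PK_half_mean[OF \<Phi>] and Hk = bounded_PK_half_mean[OF bounded_PK_power[OF \<Phi> k]]
  have z: "?z \<ge> 0" by (rule upper_rateD(1)[OF gen_rate[OF Hk]])
  have rz: "root k ?z \<ge> 0" by (rule real_root_ge_zero[OF z])
  have "gen_radius (half_mean \<mu> L \<Phi>) \<le> root k ?z"
  proof (rule upper_rateD(3)[OF gen_rate[OF H] rz])
    fix r assume r: "r > root k ?z"
    then have r0: "r \<ge> 0" using rz by linarith
    have "root k ?z ^ k < r ^ k" using r rz k by (intro power_strict_mono) auto
    then have "?z < r ^ k" using z k by simp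
    from upper_rateD(2)[OF gen_rate[OF Hk] this]
    show "\<forall>\<^sub>F m in sequentially. power_sup radius (half_mean \<mu> L \<Phi>) m \<le> r ^ m"
      using eventually_ge_at_top[of 1]
    proof eventually_elim
      case (elim m)
      show ?case
      proof (rule power_sup_least)
        fix A assume A: "A \<in> operator_set_power (half_mean \<mu> L \<Phi>) m"
        have Ab: "A \<in> BO" using A power_BO[OF H] by blast
        have Ak: "A ^^ k \<in> operator_set_power (half_mean \<mu> L \<Phi>) (k * m)"
          using funpow_operator_set_power[OF A, of k] by (simp add: operator_set_power_mult mult.commute)
        obtain D where D: "D \<in> operator_set_power (half_mean \<mu> L (operator_set_power \<Phi> k)) m" "dominated (A ^^ k) D"
          using half_mean_power_dominated[OF \<Phi> k Ak] by blast
        have km: "k * m \<ge> 1" using k elim(2) by simp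
        have "A ^^ k \<in> PK" "D \<in> PK"
          using Ak D(1) bounded_PK_subset[OF bounded_PK_power[OF H km]] bounded_PK_subset[OF bounded_PK_power[OF Hk elim(2)]]
          by blast+
        from radius_dominated[OF this D(2)] have "radius A ^ k \<le> radius D" by (simp add: radius_power[OF Ab k])
        also have "\<dots> \<le> power_sup radius (half_mean \<mu> L (operator_set_power \<Phi> k)) m"
          by (rule power_sup_upper(1)[OF radius_subordinate Hk D(1)])
        also have "\<dots> \<le> (r ^ m) ^ k" using elim(1) by (simp add: power_mult[symmetric] mult.commute)
        finally show "radius A \<le> r ^ m"
          using power_mono_iff[OF radius_nonneg_bdd(2)[OF Ab] zero_le_power[OF r0], of k m] k by simp
      qed (use r0 in simp)
    qed
  qed
  then have "gen_radius (half_mean \<mu> L \<Phi>) ^ k \<le> root k ?z ^ k"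
    by (intro power_mono upper_rateD(1)[OF gen_rate[OF H]])
  then show ?thesis using z k by simp
qed

text \<open>The left-hand side is governed by the multiples of k alone, and a limsup along a
  subsequence does not exceed the full one.\<close>

lemma gen_power:
  assumes \<Phi>: "bounded_PK \<Phi>" and k: "k \<ge> 1"
  shows "gen_radius (operator_set_power \<Phi> k) \<le> gen_radius \<Phi> ^ k"
proof (rule upper_rateD(3)[OF gen_rate[OF bounded_PK_power[OF \<Phi> k]]])
  note nn = upper_rateD(1)[OF gen_rate[OF \<Phi>]]
  show "gen_radius \<Phi> ^ k \<ge> 0" using nn by simp
  fix r assume r: "r > gen_radius \<Phi> ^ k"
  have r0: "r \<ge> 0" using r zero_le_power[OF nn, of k] by linarith
  have "root k r > gen_radius \<Phi>"
    using real_root_less_mono[of k "gen_radius \<Phi> ^ k" r] r k nn by (simp add: real_root_power_cancel)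
  from upper_rateD(2)[OF gen_rate[OF \<Phi>] this]
  obtain n0 where n0: "\<And>n. n \<ge> n0 \<Longrightarrow> power_sup radius \<Phi> n \<le> root k r ^ n" unfolding eventually_sequentially by blast
  have "power_sup radius (operator_set_power \<Phi> k) m \<le> r ^ m" if "m \<ge> n0" for m
  proof -
    have "m \<le> k * m" using k by simp
    then have "power_sup radius \<Phi> (k * m) \<le> root k r ^ (k * m)" using that by (intro n0) linarith
    also have "\<dots> = r ^ m" using k r0 by (simp add: power_mult)
    finally show ?thesis by (simp add: power_sup_power)
  qed
  then show "\<forall>\<^sub>F m in sequentially. power_sup radius (operator_set_power \<Phi> k) m \<le> r ^ m"
    unfolding eventually_sequentially by blast
qed

text \<open>Moving the leading \<Sigma>-factor of a word to its end gives a word of the same length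
  in \<Psi>\<Sigma>, and the radius of a single operator does not decrease under this
  rotation.\<close>

lemma gen_swap:
  assumes \<Psi>: "bounded_PK \<Psi>" and \<Sigma>: "bounded_PK \<Sigma>"
  shows "gen_radius (operator_set_mult \<Sigma> \<Psi>) \<le> gen_radius (operator_set_mult \<Psi> \<Sigma>)"
proof -
  note \<Psi>\<Sigma> = bounded_PK_mult[OF \<Psi> \<Sigma>] and \<Sigma>\<Psi> = bounded_PK_mult[OF \<Sigma> \<Psi>]
  note up = power_sup_upper[OF radius_subordinate \<Psi>\<Sigma>]
  show ?thesis
  proof (rule upper_rate_mono[OF gen_rate[OF \<Sigma>\<Psi>] gen_rate[OF \<Psi>\<Sigma>]])
    fix m :: nat assume "m \<ge> 1"
    then obtain n where n: "m = Suc n" by (cases m) auto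
    show "power_sup radius (operator_set_mult \<Sigma> \<Psi>) m \<le> power_sup radius (operator_set_mult \<Psi> \<Sigma>) m"
    proof (rule power_sup_least[OF _ up(2)])
      fix C assume C: "C \<in> operator_set_power (operator_set_mult \<Sigma> \<Psi>) m"
      obtain S W P' where SWP: "C = S \<circ> (W \<circ> P')" "S \<in> \<Sigma>" "W \<in> operator_set_power (operator_set_mult \<Psi> \<Sigma>) n" "P' \<in> \<Psi>"
        using C unfolding n by (rule operator_set_power_swapE)
      have bo: "S \<in> BO" "W \<in> BO" "P' \<in> BO"
        using SWP bounded_PK_subset[OF \<Sigma>] bounded_PK_subset[OF \<Psi>] power_BO[OF \<Psi>\<Sigma>] by blast+
      have "W \<circ> (P' \<circ> S) \<in> operator_set_power (operator_set_mult \<Psi> \<Sigma>) (n + 1)"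
        unfolding operator_set_power_add One_nat_def operator_set_power_1
        by (intro operator_set_multI SWP)
      then have "(W \<circ> P') \<circ> S \<in> operator_set_power (operator_set_mult \<Psi> \<Sigma>) m"
        by (simp only: n o_assoc Suc_eq_plus1)
      from up(1)[OF this] show "radius C \<le> power_sup radius (operator_set_mult \<Psi> \<Sigma>) m"
        using radius_swap[OF bo(1) bo_o[OF bo(2,3)]] unfolding SWP(1) by linarith
    qed
  qed
qed

theorem mean_radius_gen: "mean_radius gen_radius"
  unfolding mean_radius_def
  using upper_rateD(1)[OF gen_rate] gen_half_mean gen_half_mean_power gen_power gen_swap by blast

end

section \<open>The four radii as instances\<close>

context banach_function_space
begin

lemma operator_norm_dominated_gauge: "dominated_gauge \<mu> L N (operator_norm L N) (null_operators \<mu> L N)"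
proof (intro dominated_gauge.intro operator_norm_gauge dominated_gauge_axioms.intro order_refl)
  fix X C A B
  assume X: "X \<in> PK" and bo: "C \<in> BO" "A \<in> BO" "B \<in> BO"
    and mean_dom: "\<And>f. f \<in> L \<Longrightarrow> AE x in \<mu>. 2 * cmod (C f x) \<le> cmod (A (modulus f) x) + cmod (B (modulus f) x)"
  have Xb: "X \<in> BO" using X by auto
  have "operator_norm L N C \<le> (operator_norm L N A + operator_norm L N B) / 2"
  proof (rule operator_norm_least)
    fix f assume "f \<in> unit_ball L N"
    then have f: "f \<in> L" "modulus f \<in> unit_ball L N" by (auto simp: unit_ball_def modulus_L norm_modulus)
    have AL: "A (modulus f) \<in> L" "B (modulus f) \<in> L" "C f \<in> L"
      using bo_L[OF bo(2) modulus_L[OF f(1)]] bo_L[OF bo(3) modulus_L[OF f(1)]] bo_L[OF bo(1) f(1)] by auto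
    note sum = add_closed[OF modulus_L[OF AL(1)] modulus_L[OF AL(2)]]
    have "2 * N (C f) = N (\<lambda>x. 2 * C f x)" using norm_scale[OF AL(3), of 2] by simp
    also have "\<dots> \<le> N (\<lambda>x. modulus (A (modulus f)) x + modulus (B (modulus f)) x)"
    proof (rule ideal[OF sum, THEN conjunct2])
      show "(\<lambda>x. 2 * C f x) \<in> borel_measurable \<mu>" by (rule L_measurable[OF scale_closed[OF AL(3)]])
      show "AE x in \<mu>. cmod (2 * C f x) \<le> cmod (modulus (A (modulus f)) x + modulus (B (modulus f)) x)"
        using mean_dom[OF f(1)]
      proof eventually_elim
        case (elim x)
        have "cmod (modulus (A (modulus f)) x + modulus (B (modulus f)) x) = cmod (A (modulus f) x) + cmod (B (modulus f) x)"
          unfolding modulus_def of_real_add[symmetric] norm_of_real by simp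
        then show ?case using elim by (simp add: norm_mult)
      qed
    qed
    also have "\<dots> \<le> N (A (modulus f)) + N (B (modulus f))"
      using norm_triangle[OF modulus_L[OF AL(1)] modulus_L[OF AL(2)]] norm_modulus[OF AL(1)] norm_modulus[OF AL(2)] by simp
    finally show "N (C f) \<le> (operator_norm L N A + operator_norm L N B) / 2"
      using add_mono[OF operator_norm_upper[OF bo(2) f(2)] operator_norm_upper[OF bo(3) f(2)]] by argo
  qed
  from mult_left_mono[OF this operator_norm_nonneg[OF Xb]]
  show "operator_norm L N (X \<circ> C) \<le> operator_norm L N X * ((operator_norm L N A + operator_norm L N B) / 2)"
    using operator_norm_o[OF Xb bo(1)] by linarith
qed

lemma noncompactness_dominated_gauge:
  assumes "order_continuous_norm L N (nonneg_fun \<mu>)"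
  shows "dominated_gauge \<mu> L N (noncompactness L N) (compact_operators \<mu> L N)"
  by (intro dominated_gauge.intro noncompactness_gauge dominated_gauge_axioms.intro noncompactness_le_norm
    noncompactness_dominated[OF assms])

lemma mean_radius_spectral:
  "mean_radius (gen_spectral_radius \<mu> L N)" "mean_radius (joint_spectral_radius L N)"
proof -
  interpret dominated_gauge \<mu> L N "operator_norm L N" "null_operators \<mu> L N"
    by (rule operator_norm_dominated_gauge)
  have "spectral_radius \<mu> L N = radius" by (rule ext) (simp add: spectral_radius_def radius_def)
  then have "gen_spectral_radius \<mu> L N = gen_radius"
    by (intro ext) (simp add: gen_spectral_radius_def gen_radius_def)
  then show "mean_radius (gen_spectral_radius \<mu> L N)" using mean_radius_gen by simp
  have "joint_spectral_radius L N = joint_radius"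
    by (intro ext) (simp add: joint_spectral_radius_def joint_radius_def)
  then show "mean_radius (joint_spectral_radius L N)" using mean_radius_joint by simp
qed

lemma mean_radius_ess_spectral:
  assumes "order_continuous_norm L N (nonneg_fun \<mu>)"
  shows "mean_radius (gen_ess_spectral_radius \<mu> L N)" "mean_radius (joint_ess_spectral_radius L N)"
proof -
  interpret dominated_gauge \<mu> L N "noncompactness L N" "compact_operators \<mu> L N"
    by (rule noncompactness_dominated_gauge[OF assms])
  have "ess_spectral_radius \<mu> L N = radius" by (rule ext) (simp add: ess_spectral_radius_def radius_def)
  then have "gen_ess_spectral_radius \<mu> L N = gen_radius"
    by (intro ext) (simp add: gen_ess_spectral_radius_def gen_radius_def)
  then show "mean_radius (gen_ess_spectral_radius \<mu> L N)" using mean_radius_gen by simp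
  have "joint_ess_spectral_radius L N = joint_radius"
    by (intro ext) (simp add: joint_ess_spectral_radius_def joint_radius_def)
  then show "mean_radius (joint_ess_spectral_radius L N)" using mean_radius_joint by simp
qed

lemma bounded_PK_operator_set:
  assumes PK: "\<Phi> \<subseteq> positive_kernel_operators \<mu> L" and bd: "bounded_operator_set L N \<Phi>"
  shows "bounded_PK \<Phi>"
proof -
  obtain C where C: "\<And>A f. A \<in> \<Phi> \<Longrightarrow> f \<in> L \<Longrightarrow> N (A f) \<le> C * N f"
    using bd unfolding bounded_operator_set_def by blast
  have "\<Phi> \<subseteq> BO"
    using PK C unfolding bounded_operators_def positive_kernel_operators_def positive_operator_def by blast
  moreover have "operator_norm L N A \<le> max C 1" if A: "A \<in> \<Phi>" for A
  proof (rule operator_norm_least)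
    fix f assume "f \<in> unit_ball L N"
    then have f: "f \<in> L" "N f \<le> 1" by (auto simp: unit_ball_def)
    have "N (A f) \<le> C * N f" by (rule C[OF A f(1)])
    also have "\<dots> \<le> max C 1 * 1" using f norm_nonneg[OF f(1)] by (intro mult_mono) auto
    finally show "N (A f) \<le> max C 1" by simp
  qed
  ultimately show ?thesis using PK unfolding bounded_PK_def by (intro conjI exI[of _ "max C 1"]) auto
qed

end

section \<open>Weighted products of real powers and the final inequality\<close>

lemma rpow_mono: "0 \<le> x \<Longrightarrow> x \<le> y \<Longrightarrow> 0 \<le> e \<Longrightarrow> rpow x e \<le> rpow y e"
  by (auto simp: rpow_def intro: powr_mono2)

lemma rpow_nonneg: "0 \<le> rpow x e"
  by (simp add: rpow_def)

text \<open>This includes x = 0: both sides are 1 for e = 0, by the convention of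
  \<open>rpow\<close>, and 0 otherwise.\<close>

lemma rpow_power:
  assumes "0 \<le> x" "k \<ge> 1"
  shows "rpow (x ^ k) (e / (2 * real k)) = rpow x (e / 2)"
proof (cases "x = 0")
  case False
  then have "x ^ k = x powr real k" using assms by (simp add: powr_realpow)
  then show ?thesis using assms by (simp add: rpow_def powr_powr)
qed (use assms in \<open>simp add: rpow_def power_0_left\<close>)

text \<open>The exponents on a' and b' carry the factor 1 / k, which undoes the k-th powers in the
  hypotheses; the two exponents left on R add up to 1/2.\<close>

lemma rpow_interpolation:
  assumes "0 \<le> a" "0 \<le> b" "a ^ k \<le> a'" "b ^ k \<le> b'" "a' \<le> R ^ k" "b' \<le> R ^ k" "0 \<le> R" and k: "k \<ge> 1"
    and \<alpha>: "\<alpha> \<in> {0..1}"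
  shows "rpow a (\<alpha> / 2) * rpow b ((1 - \<alpha>) / 2) \<le> rpow a' (\<alpha> / (2 * real k)) * rpow b' ((1 - \<alpha>) / (2 * real k))"
    and "rpow a' (\<alpha> / (2 * real k)) * rpow b' ((1 - \<alpha>) / (2 * real k)) \<le> rpow R (1 / 2)"
proof -
  have nn: "0 \<le> a ^ k" "0 \<le> b ^ k" using assms by auto
  have e: "0 \<le> \<alpha> / (2 * real k)" "0 \<le> (1 - \<alpha>) / (2 * real k)" using \<alpha> by auto
  have "rpow (a ^ k) (\<alpha> / (2 * real k)) * rpow (b ^ k) ((1 - \<alpha>) / (2 * real k))
      \<le> rpow a' (\<alpha> / (2 * real k)) * rpow b' ((1 - \<alpha>) / (2 * real k))"
    by (intro mult_mono rpow_mono nn assms e rpow_nonneg)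
  then show "rpow a (\<alpha> / 2) * rpow b ((1 - \<alpha>) / 2) \<le> rpow a' (\<alpha> / (2 * real k)) * rpow b' ((1 - \<alpha>) / (2 * real k))"
    unfolding rpow_power[OF assms(1) k] rpow_power[OF assms(2) k] .
  have "rpow a' (\<alpha> / (2 * real k)) * rpow b' ((1 - \<alpha>) / (2 * real k))
      \<le> rpow (R ^ k) (\<alpha> / (2 * real k)) * rpow (R ^ k) ((1 - \<alpha>) / (2 * real k))"
    by (intro mult_mono rpow_mono order_trans[OF nn(1)] order_trans[OF nn(2)] assms e rpow_nonneg)
  also have "\<dots> = rpow R (\<alpha> / 2) * rpow R ((1 - \<alpha>) / 2)"
    unfolding rpow_power[OF assms(7) k] ..
  also have "\<dots> = rpow R (1 / 2)"
    by (simp add: rpow_def powr_add[symmetric] diff_divide_distrib)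
  finally show "rpow a' (\<alpha> / (2 * real k)) * rpow b' ((1 - \<alpha>) / (2 * real k)) \<le> rpow R (1 / 2)" .
qed

lemma (in banach_function_space) mean_radius_inequality:
  assumes r: "mean_radius r" and \<Psi>: "bounded_PK \<Psi>" and \<Sigma>: "bounded_PK \<Sigma>" and \<alpha>: "\<alpha> \<in> {0..1}" and k: "k \<ge> 1"
  shows "rpow (r (half_mean \<mu> L (operator_set_mult \<Psi> \<Sigma>))) (\<alpha> / 2) *
      rpow (r (half_mean \<mu> L (operator_set_mult \<Sigma> \<Psi>))) ((1 - \<alpha>) / 2)
      \<le> rpow (r (half_mean \<mu> L (operator_set_power (operator_set_mult \<Psi> \<Sigma>) k))) (\<alpha> / (2 * real k)) *
        rpow (r (half_mean \<mu> L (operator_set_power (operator_set_mult \<Sigma> \<Psi>) k))) ((1 - \<alpha>) / (2 * real k))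
    \<and> rpow (r (half_mean \<mu> L (operator_set_power (operator_set_mult \<Psi> \<Sigma>) k))) (\<alpha> / (2 * real k)) *
        rpow (r (half_mean \<mu> L (operator_set_power (operator_set_mult \<Sigma> \<Psi>) k))) ((1 - \<alpha>) / (2 * real k))
      \<le> rpow (r (operator_set_mult \<Psi> \<Sigma>)) (1 / 2)"
proof -
  have r1: "0 \<le> r \<Phi>" "r (half_mean \<mu> L \<Phi>) \<le> r \<Phi>"
    "r (half_mean \<mu> L \<Phi>) ^ k \<le> r (half_mean \<mu> L (operator_set_power \<Phi> k))"
    "r (operator_set_power \<Phi> k) \<le> r \<Phi> ^ k" if "bounded_PK \<Phi>" for \<Phi>
    using r k that unfolding mean_radius_def by blast+
  have swap: "r (operator_set_mult \<Sigma> \<Psi>) \<le> r (operator_set_mult \<Psi> \<Sigma>)"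
    using r \<Psi> \<Sigma> unfolding mean_radius_def by blast
  note \<Psi>\<Sigma> = bounded_PK_mult[OF \<Psi> \<Sigma>] and \<Sigma>\<Psi> = bounded_PK_mult[OF \<Sigma> \<Psi>]
  \<comment> \<open>For \<Psi>\<Sigma>, the radius of the means of the k-th power is at most that of
    the k-th power, and so at most the k-th power of the radius. For \<Sigma>\<Psi> the swap finally
    replaces its radius by that of \<Psi>\<Sigma>.\<close>
  note 1 = order_trans[OF r1(2)[OF bounded_PK_power[OF \<Psi>\<Sigma> k]] r1(4)[OF \<Psi>\<Sigma>]]
  note 2 = order_trans[OF order_trans[OF r1(2)[OF bounded_PK_power[OF \<Sigma>\<Psi> k]] r1(4)[OF \<Sigma>\<Psi>]]
      power_mono[OF swap r1(1)[OF \<Sigma>\<Psi>]]]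
  note interpolation = rpow_interpolation[OF r1(1)[OF bounded_PK_half_mean[OF \<Psi>\<Sigma>]] r1(1)[OF bounded_PK_half_mean[OF \<Sigma>\<Psi>]]
      r1(3)[OF \<Psi>\<Sigma>] r1(3)[OF \<Sigma>\<Psi>] 1 2 r1(1)[OF \<Psi>\<Sigma>] k \<alpha>]
  show ?thesis using interpolation by (intro conjI)
qed

theorem corollary3p11:
  fixes \<mu> :: "'x measure"
    and L :: "('x \<Rightarrow> complex) set"
    and N :: "('x \<Rightarrow> complex) \<Rightarrow> real"
    and \<Psi> \<Sigma> :: "'x operator set"
    and \<alpha> :: real
  assumes "banach_function_space \<mu> L N"
    and "\<Psi> \<subseteq> positive_kernel_operators \<mu> L" and "bounded_operator_set L N \<Psi>"
    and "\<Sigma> \<subseteq> positive_kernel_operators \<mu> L" and "bounded_operator_set L N \<Sigma>"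
    and "\<alpha> \<in> {0..1}"
  shows "(\<forall>r \<in> {gen_spectral_radius \<mu> L N, joint_spectral_radius L N}. \<forall>k::nat. k \<ge> 1 \<longrightarrow>
      rpow (r (half_mean \<mu> L (operator_set_mult \<Psi> \<Sigma>))) (\<alpha> / 2) *
      rpow (r (half_mean \<mu> L (operator_set_mult \<Sigma> \<Psi>))) ((1 - \<alpha>) / 2)
      \<le> rpow (r (half_mean \<mu> L (operator_set_power (operator_set_mult \<Psi> \<Sigma>) k))) (\<alpha> / (2 * real k)) *
        rpow (r (half_mean \<mu> L (operator_set_power (operator_set_mult \<Sigma> \<Psi>) k))) ((1 - \<alpha>) / (2 * real k))
    \<and> rpow (r (half_mean \<mu> L (operator_set_power (operator_set_mult \<Psi> \<Sigma>) k))) (\<alpha> / (2 * real k)) *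
        rpow (r (half_mean \<mu> L (operator_set_power (operator_set_mult \<Sigma> \<Psi>) k))) ((1 - \<alpha>) / (2 * real k))
      \<le> rpow (r (operator_set_mult \<Psi> \<Sigma>)) (1 / 2))
  \<and> (order_continuous_norm L N (nonneg_fun \<mu>) \<and>
     order_continuous_norm (dual L N) (dual_norm L N) (nonneg_functional \<mu> L) \<longrightarrow>
    (\<forall>r \<in> {gen_ess_spectral_radius \<mu> L N, joint_ess_spectral_radius L N}. \<forall>k::nat. k \<ge> 1 \<longrightarrow>
      rpow (r (half_mean \<mu> L (operator_set_mult \<Psi> \<Sigma>))) (\<alpha> / 2) *
      rpow (r (half_mean \<mu> L (operator_set_mult \<Sigma> \<Psi>))) ((1 - \<alpha>) / 2)
      \<le> rpow (r (half_mean \<mu> L (operator_set_power (operator_set_mult \<Psi> \<Sigma>) k))) (\<alpha> / (2 * real k)) *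
        rpow (r (half_mean \<mu> L (operator_set_power (operator_set_mult \<Sigma> \<Psi>) k))) ((1 - \<alpha>) / (2 * real k))
    \<and> rpow (r (half_mean \<mu> L (operator_set_power (operator_set_mult \<Psi> \<Sigma>) k))) (\<alpha> / (2 * real k)) *
        rpow (r (half_mean \<mu> L (operator_set_power (operator_set_mult \<Sigma> \<Psi>) k))) ((1 - \<alpha>) / (2 * real k))
      \<le> rpow (r (operator_set_mult \<Psi> \<Sigma>)) (1 / 2)))"
proof -
  interpret banach_function_space \<mu> L N by (rule assms(1))
  note \<Psi> = bounded_PK_operator_set[OF assms(2,3)] and \<Sigma> = bounded_PK_operator_set[OF assms(4,5)]
  note ineq = mean_radius_inequality[OF _ \<Psi> \<Sigma> assms(6)]
  show ?thesis
  proof (intro conjI[of "Ball _ _"] impI ballI allI)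
    fix r and k :: nat
    assume "r \<in> {gen_spectral_radius \<mu> L N, joint_spectral_radius L N}" and k: "k \<ge> 1"
    then have "mean_radius r" using mean_radius_spectral by blast
    from ineq[OF this k] show "rpow (r (half_mean \<mu> L (operator_set_mult \<Psi> \<Sigma>))) (\<alpha> / 2) *
      rpow (r (half_mean \<mu> L (operator_set_mult \<Sigma> \<Psi>))) ((1 - \<alpha>) / 2)
      \<le> rpow (r (half_mean \<mu> L (operator_set_power (operator_set_mult \<Psi> \<Sigma>) k))) (\<alpha> / (2 * real k)) *
        rpow (r (half_mean \<mu> L (operator_set_power (operator_set_mult \<Sigma> \<Psi>) k))) ((1 - \<alpha>) / (2 * real k))
    \<and> rpow (r (half_mean \<mu> L (operator_set_power (operator_set_mult \<Psi> \<Sigma>) k))) (\<alpha> / (2 * real k)) *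
        rpow (r (half_mean \<mu> L (operator_set_power (operator_set_mult \<Sigma> \<Psi>) k))) ((1 - \<alpha>) / (2 * real k))
      \<le> rpow (r (operator_set_mult \<Psi> \<Sigma>)) (1 / 2)" .
  next
    fix r and k :: nat
    assume oc: "order_continuous_norm L N (nonneg_fun \<mu>) \<and>
        order_continuous_norm (dual L N) (dual_norm L N) (nonneg_functional \<mu> L)"
      and "r \<in> {gen_ess_spectral_radius \<mu> L N, joint_ess_spectral_radius L N}" and k: "k \<ge> 1"
    then have "mean_radius r" using mean_radius_ess_spectral[OF conjunct1[OF oc]] by blast
    from ineq[OF this k] show "rpow (r (half_mean \<mu> L (operator_set_mult \<Psi> \<Sigma>))) (\<alpha> / 2) *
      rpow (r (half_mean \<mu> L (operator_set_mult \<Sigma> \<Psi>))) ((1 - \<alpha>) / 2)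
      \<le> rpow (r (half_mean \<mu> L (operator_set_power (operator_set_mult \<Psi> \<Sigma>) k))) (\<alpha> / (2 * real k)) *
        rpow (r (half_mean \<mu> L (operator_set_power (operator_set_mult \<Sigma> \<Psi>) k))) ((1 - \<alpha>) / (2 * real k))
    \<and> rpow (r (half_mean \<mu> L (operator_set_power (operator_set_mult \<Psi> \<Sigma>) k))) (\<alpha> / (2 * real k)) *
        rpow (r (half_mean \<mu> L (operator_set_power (operator_set_mult \<Sigma> \<Psi>) k))) ((1 - \<alpha>) / (2 * real k))
      \<le> rpow (r (operator_set_mult \<Psi> \<Sigma>)) (1 / 2)" .
  qed
qed

end
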